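(* Let $(X,* )$ be a pointed fibrant bisimplicial set. Then $\pi^{\mathrm{BC}}_{m,n}(\Omega X,* )$ is a group (under the composition-of-loops operation $\diamond$) for all $m\ge0$, $n\ge0$, and it is an abelian group (under $\diamond$, and likewise under the Bott-Chern product $\star$) for $m\ge1$, $n\ge1$.
   Context: **Notation.** A bisimplicial set $X$ has face and degeneracy maps $d_i,s_i$ in the first index and $\overline d_j,\overline s_j$ in the second. For simplicial sets $A,B$, $(A\boxtimes B)_{m,n}=A_m\times B_n$. $\Delta^{m,n}=\Delta^m\boxtimes\Delta^n$; elements of $X_{m,n}$ are identified with maps $\Delta^{m,n}\to X$, so faces and degeneracies of such maps make sense. $d_i\Delta^m$ is the $i$-th face of $\Delta^m$ and $\Lambda^m_k=\bigcup_{i\ne k}d_i\Delta^m$. Subobjects of $\Delta^{m,n}$: $\delta\Delta^{m,n}=\partial\Delta^m\boxtimes\Delta^n\cup\Delta^m\boxtimes\partial\Delta^n$; $\delta_{\mathrm A}\Delta^{m,n}=\Lambda^m_m\boxtimes\Delta^n\cup\Delta^m\boxtimes\Lambda^n_n\cup\partial\Delta^m\boxtimes\partial\Delta^n$. **Fibrancy.** Anodyne extensions are the monomorphisms in the saturated class generated by $\Lambda^m_k\boxtimes\Delta^n\cup\Delta^m\boxtimes\Lambda^n_l\to\Delta^m\boxtimes\Delta^n$ ($m,n\ge1$, $0\le k\le m$, $0\le l\le n$). Fibrations are the maps with the right lifting property against all anodyne extensions; $X$ is fibrant if $X\to\Delta^{0,0}$ is a fibration. A pointed bisimplicial set has a chosen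 vertex $*$; constant maps to it are also written $*$. **Homotopy.** For $h:K\times\Delta^{1,1}\to X$, operators in the $\Delta^{1,1}$-direction carry a hat. $h$ is a homotopy from $\alpha$ to $\beta$ if $\hat d_0h=\hat{\overline s}_0\alpha$, $\hat{\overline d}_0h=\hat s_0\alpha$ (i.e. $\alpha$ composed with the projection to $K$) and $\hat d_1\hat{\overline d}_1h=\beta$. A map $K\to X$ rel $L\subset K$ is one that is $*$ on $L$; a homotopy rel $L$ is one with $h|_{L\times\Delta^{1,1}}=*$. For fibrant $X$ this is an equivalence relation. $\pi^{\mathrm{BC}}_{m,n}(X)$ (resp. $\pi^{\mathrm A}_{m,n}(X)$) is the set of relative homotopy classes of maps $\Delta^{m,n}\to X$ rel $\delta\Delta^{m,n}$ (resp. rel $\delta_{\mathrm A}\Delta^{m,n}$). **Bott-Chern product** on $\pi^{\mathrm{BC}}_{m,n}(Y)$ for $Y$ pointed fibrant, $m,n\ge1$: for $\alpha,\beta:\Delta^{m,n}\to Y$ rel $\delta\Delta^{m,n}$ choose $\theta:\Delta^{m+1,n+1}\to Y$ with $d_i\theta=*$ ($i<m-1$), $\overline d_j\theta=*$ ($j<n-1$), $d_{m-1}\theta=\overline s_{n-1}\alpha$, $\overline d_{n-1}\theta=s_{m-1}\alpha$, $d_{m+1}\theta=\overline s_n\beta$, $\overline d_{n+1}\theta=s_m\beta$; then $[\alpha]\star[\beta]=[d_m\overline d_n\theta]$ (well defined). **Aeppli product** on $\pi^{\mathrm A}_{1,1}(Z)$, $Z$ pointed fibrant: for $\alpha,\beta:\Delta^{1,1}\to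 Z$ rel $\delta_{\mathrm A}\Delta^{1,1}$ choose $\theta:\Delta^{2,2}\to Z$ with $d_0\theta=\overline s_0\alpha$, $\overline d_0\theta=s_0\alpha$, $d_2\overline d_2\theta=\beta$; then $[\alpha]\diamond[\beta]=[d_1\overline d_1\theta]$ (well defined). **Loop space.** $\mathbf{Hom}(K,X)_{m,n}=\mathrm{Hom}(K\times\Delta^{m,n},X)$. $\Omega X$ is the fiber over the constant map of the restriction $\mathbf{Hom}(\Delta^{1,1},X)\to\mathbf{Hom}(\delta_{\mathrm A}\Delta^{1,1},X)$, pointed by the constant map; it is fibrant if $X$ is. **Composition of loops** on $\pi^{\mathrm{BC}}_{m,n}(\Omega X)$, $m,n\ge0$: maps $\Delta^{m,n}\to\Omega X$ rel $\delta\Delta^{m,n}$ correspond to maps $\Delta^{1,1}\to Z$ rel $\delta_{\mathrm A}\Delta^{1,1}$, where $Z=\mathbf{Hom}(\Delta^{m,n},X)\times_{\mathbf{Hom}(\delta\Delta^{m,n},X)}\mathbf{Hom}(\delta\Delta^{m,n},* )$, and $\diamond$ is the Aeppli product of $\pi^{\mathrm A}_{1,1}(Z)$ transported to $\pi^{\mathrm{BC}}_{m,n}(\Omega X)$. *)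

theory Defs
  imports "HOL-Algebra.Group" "HOL-Library.FuncSet" "HOL-Library.Infinite_Typeclass"
begin

section \<open>Simplicial operators\<close>

text \<open>A monotone map from \<open>{0..k}\<close> to \<open>{0..m}\<close> is the sorted list of its \<open>k + 1\<close> values.\<close>

definition ops :: "nat \<Rightarrow> nat \<Rightarrow> nat list set" where
  "ops k m = {\<theta>. length \<theta> = Suc k \<and> sorted \<theta> \<and> set \<theta> \<subseteq> {..m}}"

definition id_op :: "nat \<Rightarrow> nat list" where
  "id_op m = [0..<Suc m]"

definition comp_op :: "nat list \<Rightarrow> nat list \<Rightarrow> nat list" where
  "comp_op \<theta> \<psi> = map ((!) \<theta>) \<psi>"

text \<open>\<open>coface m i \<in> ops (m - 1) m\<close> omits the value \<open>i\<close> (for \<open>m \<ge> 1\<close>), and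
  \<open>codegen m i \<in> ops (m + 1) m\<close> repeats it.\<close>

definition coface :: "nat \<Rightarrow> nat \<Rightarrow> nat list" where
  "coface m i = [0..<i] @ [Suc i..<Suc m]"

definition codegen :: "nat \<Rightarrow> nat \<Rightarrow> nat list" where
  "codegen m i = [0..<Suc i] @ [i..<Suc m]"


section \<open>Simplicial sets\<close>

text \<open>\<open>sact A m \<theta> x\<close> is \<open>\<theta>\<^sup>* x\<close> for \<open>x\<close> of degree \<open>m\<close> and \<open>\<theta> \<in> ops k m\<close>.\<close>

record 'a sset =
  scells :: "nat \<Rightarrow> 'a set"
  sact :: "nat \<Rightarrow> nat list \<Rightarrow> 'a \<Rightarrow> 'a"

definition std :: "nat \<Rightarrow> nat list sset" where
  "std m = \<lparr>scells = (\<lambda>k. ops k m), sact = (\<lambda>k \<theta> x. comp_op x \<theta>)\<rparr>"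

text \<open>The \<open>i\<close>-th face consists of the simplices that avoid the vertex \<open>i\<close>; for \<open>m = 0\<close> it is empty.\<close>

definition std_face :: "nat \<Rightarrow> nat \<Rightarrow> nat list sset" where
  "std_face m i = (std m)\<lparr>scells := (\<lambda>k. {x \<in> ops k m. i \<notin> set x})\<rparr>"

definition boundary :: "nat \<Rightarrow> nat list sset" where
  "boundary m = (std m)\<lparr>scells := (\<lambda>k. \<Union>i\<in>{..m}. scells (std_face m i) k)\<rparr>"

definition horn :: "nat \<Rightarrow> nat \<Rightarrow> nat list sset" where
  "horn m k = (std m)\<lparr>scells := (\<lambda>p. \<Union>i\<in>{..m} - {k}. scells (std_face m i) p)\<rparr>"


section \<open>Bisimplicial sets\<close>

text \<open>\<open>act X m n \<theta> \<phi> x\<close> is \<open>(\<theta>, \<phi>)\<^sup>* x\<close> for \<open>x\<close> of bidegree \<open>(m, n)\<close>.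
  The bidegree is an argument because the sets of cells of different bidegrees may overlap.\<close>

record 'a bisset =
  cells :: "nat \<Rightarrow> nat \<Rightarrow> 'a set"
  act :: "nat \<Rightarrow> nat \<Rightarrow> nat list \<Rightarrow> nat list \<Rightarrow> 'a \<Rightarrow> 'a"

definition bisimplicial_set :: "'a bisset \<Rightarrow> bool" where
  "bisimplicial_set X \<longleftrightarrow>
     (\<forall>m n k l. \<forall>\<theta> \<in> ops k m. \<forall>\<phi> \<in> ops l n. \<forall>x \<in> cells X m n.
        act X m n \<theta> \<phi> x \<in> cells X k l) \<and>
     (\<forall>m n. \<forall>x \<in> cells X m n. act X m n (id_op m) (id_op n) x = x) \<and>
     (\<forall>m n k l p q. \<forall>\<theta> \<in> ops k m. \<forall>\<phi> \<in> ops l n. \<forall>\<theta>' \<in> ops p k. \<forall>\<phi>' \<in> ops q l.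
        \<forall>x \<in> cells X m n.
        act X k l \<theta>' \<phi>' (act X m n \<theta> \<phi> x) = act X m n (comp_op \<theta> \<theta>') (comp_op \<phi> \<phi>') x)"

text \<open>For \<open>x\<close> of bidegree \<open>(m, n)\<close>: \<open>face1 X m n i x\<close>, \<open>degen1 X m n i x\<close> are
  \<open>d\<^sub>i x\<close>, \<open>s\<^sub>i x\<close>, and \<open>face2\<close>, \<open>degen2\<close> are their counterparts in the second
  index, which are written with a bar on paper.\<close>

definition face1 :: "'a bisset \<Rightarrow> nat \<Rightarrow> nat \<Rightarrow> nat \<Rightarrow> 'a \<Rightarrow> 'a" where
  "face1 X m n i x = act X m n (coface m i) (id_op n) x"

definition face2 :: "'a bisset \<Rightarrow> nat \<Rightarrow> nat \<Rightarrow> nat \<Rightarrow> 'a \<Rightarrow> 'a" where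
  "face2 X m n j x = act X m n (id_op m) (coface n j) x"

definition degen1 :: "'a bisset \<Rightarrow> nat \<Rightarrow> nat \<Rightarrow> nat \<Rightarrow> 'a \<Rightarrow> 'a" where
  "degen1 X m n i x = act X m n (codegen m i) (id_op n) x"

definition degen2 :: "'a bisset \<Rightarrow> nat \<Rightarrow> nat \<Rightarrow> nat \<Rightarrow> 'a \<Rightarrow> 'a" where
  "degen2 X m n j x = act X m n (id_op m) (codegen n j) x"

definition box :: "'a sset \<Rightarrow> 'b sset \<Rightarrow> ('a \<times> 'b) bisset" where
  "box A B = \<lparr>cells = (\<lambda>m n. scells A m \<times> scells B n),
              act = (\<lambda>m n \<theta> \<phi> (a, b). (sact A m \<theta> a, sact B n \<phi> b))\<rparr>"

definition bprod :: "'a bisset \<Rightarrow> 'b bisset \<Rightarrow> ('a \<times> 'b) bisset" where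
  "bprod K L = \<lparr>cells = (\<lambda>m n. cells K m n \<times> cells L m n),
                act = (\<lambda>m n \<theta> \<phi> (x, y). (act K m n \<theta> \<phi> x, act L m n \<theta> \<phi> y))\<rparr>"

text \<open>The union of two subobjects of the same bisimplicial set.\<close>

definition bunion :: "'a bisset \<Rightarrow> 'a bisset \<Rightarrow> 'a bisset" where
  "bunion A B = A\<lparr>cells := (\<lambda>m n. cells A m n \<union> cells B m n)\<rparr>"

type_synonym bistd_cell = "nat list \<times> nat list"

definition bistd :: "nat \<Rightarrow> nat \<Rightarrow> bistd_cell bisset" where
  "bistd m n = box (std m) (std n)"

definition bd_BC :: "nat \<Rightarrow> nat \<Rightarrow> bistd_cell bisset" where
  "bd_BC m n = bunion (box (boundary m) (std n)) (box (std m) (boundary n))"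

definition bd_A :: "nat \<Rightarrow> nat \<Rightarrow> bistd_cell bisset" where
  "bd_A m n = bunion (bunion (box (horn m m) (std n)) (box (std m) (horn n n)))
                     (box (boundary m) (boundary n))"

definition bihorn :: "nat \<Rightarrow> nat \<Rightarrow> nat \<Rightarrow> nat \<Rightarrow> bistd_cell bisset" where
  "bihorn m n k l = bunion (box (horn m k) (std n)) (box (std m) (horn n l))"


section \<open>Maps\<close>

text \<open>Maps are extensional in each bidegree, so that equality of functions is equality of maps.\<close>

type_synonym ('a, 'b) bimap = "nat \<Rightarrow> nat \<Rightarrow> 'a \<Rightarrow> 'b"

definition is_bimap :: "'a bisset \<Rightarrow> 'b bisset \<Rightarrow> ('a, 'b) bimap \<Rightarrow> bool" where
  "is_bimap X Y f \<longleftrightarrow>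
     (\<forall>m n. f m n \<in> cells X m n \<rightarrow>\<^sub>E cells Y m n) \<and>
     (\<forall>m n k l. \<forall>\<theta> \<in> ops k m. \<forall>\<phi> \<in> ops l n. \<forall>x \<in> cells X m n.
        f k l (act X m n \<theta> \<phi> x) = act Y m n \<theta> \<phi> (f m n x))"

text \<open>\<open>comp_bimap X g f\<close> is the composite of \<open>f\<close>, with domain \<open>X\<close>, followed by \<open>g\<close>.\<close>

definition comp_bimap ::
    "'a bisset \<Rightarrow> ('b, 'c) bimap \<Rightarrow> ('a, 'b) bimap \<Rightarrow> ('a, 'c) bimap" where
  "comp_bimap X g f = (\<lambda>m n. \<lambda>x \<in> cells X m n. g m n (f m n x))"

definition id_bimap :: "'a bisset \<Rightarrow> ('a, 'a) bimap" where
  "id_bimap X = (\<lambda>m n. \<lambda>x \<in> cells X m n. x)"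

definition restr_bimap :: "'a bisset \<Rightarrow> ('a, 'b) bimap \<Rightarrow> ('a, 'b) bimap" where
  "restr_bimap L f = (\<lambda>m n. restrict (f m n) (cells L m n))"

definition is_mono :: "'a bisset \<Rightarrow> ('a, 'b) bimap \<Rightarrow> bool" where
  "is_mono X f \<longleftrightarrow> (\<forall>m n. inj_on (f m n) (cells X m n))"

definition is_iso :: "'a bisset \<Rightarrow> 'b bisset \<Rightarrow> ('a, 'b) bimap \<Rightarrow> bool" where
  "is_iso X Y f \<longleftrightarrow> is_bimap X Y f \<and> (\<forall>m n. bij_betw (f m n) (cells X m n) (cells Y m n))"

definition iso_arrows ::
    "'a bisset \<Rightarrow> 'b bisset \<Rightarrow> ('a, 'b) bimap \<Rightarrow>
     'c bisset \<Rightarrow> 'd bisset \<Rightarrow> ('c, 'd) bimap \<Rightarrow> bool" where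
  "iso_arrows A B i C D j \<longleftrightarrow>
     (\<exists>f g. is_iso A C f \<and> is_iso B D g \<and> comp_bimap A g i = comp_bimap A j f)"

text \<open>The degenerate cell of bidegree \<open>(m, n)\<close> on a vertex \<open>v\<close>, and the constant map.\<close>

definition base :: "'a bisset \<Rightarrow> 'a \<Rightarrow> nat \<Rightarrow> nat \<Rightarrow> 'a" where
  "base X v m n = act X 0 0 (replicate (Suc m) 0) (replicate (Suc n) 0) v"

definition const_bimap :: "'k bisset \<Rightarrow> 'a bisset \<Rightarrow> 'a \<Rightarrow> ('k, 'a) bimap" where
  "const_bimap K X v = (\<lambda>m n. \<lambda>x \<in> cells K m n. base X v m n)"

text \<open>The sub-bisimplicial set generated by a vertex.\<close>

definition point :: "'a bisset \<Rightarrow> 'a \<Rightarrow> 'a bisset" where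
  "point X v = X\<lparr>cells := (\<lambda>m n. {base X v m n})\<rparr>"


section \<open>Anodyne extensions and fibrations\<close>

text \<open>The following universal properties are those of the category of bisimplicial sets with cells
  in a fixed type \<open>'u\<close>. In the pushout square, \<open>g : A \<rightarrow> C\<close>, \<open>i : A \<rightarrow> B\<close>, \<open>j : B \<rightarrow> D\<close>, \<open>k : C \<rightarrow> D\<close>.\<close>

definition is_pushout ::
    "'u bisset \<Rightarrow> 'u bisset \<Rightarrow> 'u bisset \<Rightarrow> 'u bisset \<Rightarrow>
     ('u, 'u) bimap \<Rightarrow> ('u, 'u) bimap \<Rightarrow> ('u, 'u) bimap \<Rightarrow> ('u, 'u) bimap \<Rightarrow> bool" where
  "is_pushout A B C D i g j k \<longleftrightarrow>
     bisimplicial_set A \<and> bisimplicial_set B \<and> bisimplicial_set C \<and> bisimplicial_set D \<and>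
     is_bimap A B i \<and> is_bimap A C g \<and> is_bimap B D j \<and> is_bimap C D k \<and>
     comp_bimap A j i = comp_bimap A k g \<and>
     (\<forall>(T :: 'u bisset) u w.
        bisimplicial_set T \<and> is_bimap B T u \<and> is_bimap C T w \<and>
        comp_bimap A u i = comp_bimap A w g \<longrightarrow>
        (\<exists>!h. is_bimap D T h \<and> comp_bimap B h j = u \<and> comp_bimap C h k = w))"

definition is_coproduct ::
    "'i set \<Rightarrow> ('i \<Rightarrow> 'u bisset) \<Rightarrow> 'u bisset \<Rightarrow> ('i \<Rightarrow> ('u, 'u) bimap) \<Rightarrow> bool" where
  "is_coproduct I A C c \<longleftrightarrow>
     bisimplicial_set C \<and> (\<forall>i\<in>I. bisimplicial_set (A i) \<and> is_bimap (A i) C (c i)) \<and>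
     (\<forall>(T :: 'u bisset) u.
        bisimplicial_set T \<and> (\<forall>i\<in>I. is_bimap (A i) T (u i)) \<longrightarrow>
        (\<exists>!h. is_bimap C T h \<and> (\<forall>i\<in>I. comp_bimap (A i) h (c i) = u i)))"

definition is_seq_colimit ::
    "(nat \<Rightarrow> 'u bisset) \<Rightarrow> (nat \<Rightarrow> ('u, 'u) bimap) \<Rightarrow> 'u bisset \<Rightarrow> (nat \<Rightarrow> ('u, 'u) bimap) \<Rightarrow> bool"
  where
  "is_seq_colimit A f C c \<longleftrightarrow>
     bisimplicial_set C \<and>
     (\<forall>n. bisimplicial_set (A n) \<and> is_bimap (A n) (A (Suc n)) (f n) \<and> is_bimap (A n) C (c n) \<and>
          comp_bimap (A n) (c (Suc n)) (f n) = c n) \<and>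
     (\<forall>(T :: 'u bisset) u.
        bisimplicial_set T \<and>
        (\<forall>n. is_bimap (A n) T (u n) \<and> comp_bimap (A n) (u (Suc n)) (f n) = u n) \<longrightarrow>
        (\<exists>!h. is_bimap C T h \<and> (\<forall>n. comp_bimap (A n) h (c n) = u n)))"

text \<open>\<open>g : C \<rightarrow> D\<close> is a retract of \<open>f : A \<rightarrow> B\<close>.\<close>

definition is_retract ::
    "'u bisset \<Rightarrow> 'u bisset \<Rightarrow> ('u, 'u) bimap \<Rightarrow>
     'u bisset \<Rightarrow> 'u bisset \<Rightarrow> ('u, 'u) bimap \<Rightarrow> bool" where
  "is_retract C D g A B f \<longleftrightarrow>
     bisimplicial_set C \<and> bisimplicial_set D \<and> is_bimap C D g \<and>
     (\<exists>a r b q. is_bimap C A a \<and> is_bimap A C r \<and> is_bimap D B b \<and> is_bimap B D q \<and>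
        comp_bimap C r a = id_bimap C \<and> comp_bimap D q b = id_bimap D \<and>
        comp_bimap C f a = comp_bimap C b g \<and> comp_bimap A g r = comp_bimap A q f)"

inductive saturation ::
    "('u bisset \<Rightarrow> 'u bisset \<Rightarrow> ('u, 'u) bimap \<Rightarrow> bool) \<Rightarrow>
     'u bisset \<Rightarrow> 'u bisset \<Rightarrow> ('u, 'u) bimap \<Rightarrow> bool"
  for G where
  generator: "G A B f \<Longrightarrow> saturation G A B f"
| isomorphism: "bisimplicial_set A \<Longrightarrow> bisimplicial_set B \<Longrightarrow> is_iso A B f \<Longrightarrow> saturation G A B f"
| pushout: "saturation G A B i \<Longrightarrow> is_pushout A B C D i g j k \<Longrightarrow> saturation G C D k"
| retract: "saturation G A B f \<Longrightarrow> is_retract C D g A B f \<Longrightarrow> saturation G C D g"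
| coproduct: "(\<And>i. i \<in> (I :: 'u set) \<Longrightarrow> saturation G (A i) (B i) (f i)) \<Longrightarrow>
    is_coproduct I A C c \<Longrightarrow> is_coproduct I B D d \<Longrightarrow> is_bimap C D h \<Longrightarrow>
    (\<And>i. i \<in> I \<Longrightarrow> comp_bimap (A i) h (c i) = comp_bimap (A i) (d i) (f i)) \<Longrightarrow>
    saturation G C D h"
| composition: "(\<And>n. saturation G (A n) (A (Suc n)) (f n)) \<Longrightarrow>
    is_seq_colimit A f C c \<Longrightarrow> saturation G (A 0) C (c 0)"

text \<open>The generating inclusions have cells in \<open>nat list \<times> nat list\<close>; \<open>horn_generator\<close> holds of
  their isomorphic copies with cells in \<open>'u\<close>, which exist when \<open>'u\<close> is infinite.\<close>

definition horn_generator :: "'u bisset \<Rightarrow> 'u bisset \<Rightarrow> ('u, 'u) bimap \<Rightarrow> bool" where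
  "horn_generator A B i \<longleftrightarrow>
     bisimplicial_set A \<and> bisimplicial_set B \<and> is_bimap A B i \<and>
     (\<exists>m n k l. 1 \<le> m \<and> 1 \<le> n \<and> k \<le> m \<and> l \<le> n \<and>
        iso_arrows A B i (bihorn m n k l) (bistd m n) (id_bimap (bihorn m n k l)))"

definition anodyne :: "'u bisset \<Rightarrow> 'u bisset \<Rightarrow> ('u, 'u) bimap \<Rightarrow> bool" where
  "anodyne A B i \<longleftrightarrow> saturation horn_generator A B i \<and> is_mono A i"

definition has_rlp ::
    "'a bisset \<Rightarrow> 'b bisset \<Rightarrow> ('a, 'b) bimap \<Rightarrow> 'x bisset \<Rightarrow> 'y bisset \<Rightarrow> ('x, 'y) bimap \<Rightarrow> bool"
  where
  "has_rlp A B i X Y p \<longleftrightarrow>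
     (\<forall>u w. is_bimap A X u \<and> is_bimap B Y w \<and> comp_bimap A p u = comp_bimap A w i \<longrightarrow>
        (\<exists>h. is_bimap B X h \<and> comp_bimap A h i = u \<and> comp_bimap B p h = w))"

text \<open>A definition cannot quantify over types, so the anodyne extensions that are tested have their
  cells in a type \<open>'u\<close> that is passed as a parameter. Since \<open>'u\<close> is infinite, they include copies
  of all the generators; and as a lifting property against the generators passes to their
  saturation, the notion does not depend on \<open>'u\<close>.\<close>

definition fibration ::
    "('u :: infinite) itself \<Rightarrow> 'x bisset \<Rightarrow> 'y bisset \<Rightarrow> ('x, 'y) bimap \<Rightarrow> bool" where
  "fibration U X Y p \<longleftrightarrow>
     is_bimap X Y p \<and> (\<forall>(A :: 'u bisset) B i. anodyne A B i \<longrightarrow> has_rlp A B i X Y p)"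

definition fibrant :: "('u :: infinite) itself \<Rightarrow> 'x bisset \<Rightarrow> bool" where
  "fibrant U X \<longleftrightarrow>
     bisimplicial_set X \<and> fibration U X (bistd 0 0) (const_bimap X (bistd 0 0) ([0], [0]))"


section \<open>Function complexes and the loop space\<close>

definition Hom :: "'k bisset \<Rightarrow> 'a bisset \<Rightarrow> ('k \<times> bistd_cell, 'a) bimap bisset" where
  "Hom K X =
     \<lparr>cells = (\<lambda>m n. {f. is_bimap (bprod K (bistd m n)) X f}),
      act = (\<lambda>m n \<theta> \<phi> f i j.
        \<lambda>(x, a, b) \<in> cells (bprod K (bistd (length \<theta> - 1) (length \<phi> - 1))) i j.
          f i j (x, comp_op \<theta> a, comp_op \<phi> b))\<rparr>"

text \<open>Restriction \<open>Hom K X \<rightarrow> Hom L X\<close> along a subobject \<open>L\<close> of \<open>K\<close>.\<close>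

definition Hom_restr ::
    "'k bisset \<Rightarrow> 'k bisset \<Rightarrow> 'a bisset \<Rightarrow>
     (('k \<times> bistd_cell, 'a) bimap, ('k \<times> bistd_cell, 'a) bimap) bimap" where
  "Hom_restr K L X = (\<lambda>m n. \<lambda>f \<in> cells (Hom K X) m n. restr_bimap (bprod L (bistd m n)) f)"

text \<open>The vertex of \<open>Hom K X\<close> given by the constant map.\<close>

definition Hom_pt :: "'k bisset \<Rightarrow> 'a bisset \<Rightarrow> 'a \<Rightarrow> ('k \<times> bistd_cell, 'a) bimap" where
  "Hom_pt K X v = const_bimap (bprod K (bistd 0 0)) X v"

text \<open>The preimage under \<open>p\<close> of a subobject \<open>W\<close> of its codomain, that is, their fiber product.\<close>

definition preimage :: "'a bisset \<Rightarrow> ('a, 'b) bimap \<Rightarrow> 'b bisset \<Rightarrow> 'a bisset" where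
  "preimage X p W = X\<lparr>cells := (\<lambda>m n. {x \<in> cells X m n. p m n x \<in> cells W m n})\<rparr>"

type_synonym 'a loop = "(bistd_cell \<times> bistd_cell, 'a) bimap"

definition loops :: "'a bisset \<Rightarrow> 'a \<Rightarrow> 'a loop bisset" where
  "loops X v = preimage (Hom (bistd 1 1) X) (Hom_restr (bistd 1 1) (bd_A 1 1) X)
                        (point (Hom (bd_A 1 1) X) (Hom_pt (bd_A 1 1) X v))"

definition loops_pt :: "'a bisset \<Rightarrow> 'a \<Rightarrow> 'a loop" where
  "loops_pt X v = Hom_pt (bistd 1 1) X v"


section \<open>Homotopy\<close>

text \<open>A map \<open>K \<rightarrow> X\<close> as a vertex of \<open>Hom K X\<close>. A homotopy is an element of \<open>Hom K X\<close> of bidegree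
  \<open>(1, 1)\<close>, and the hatted operators are those of \<open>Hom K X\<close>.\<close>

definition vertex_of :: "'k bisset \<Rightarrow> ('k, 'a) bimap \<Rightarrow> ('k \<times> bistd_cell, 'a) bimap" where
  "vertex_of K f = (\<lambda>i j. \<lambda>(x, t) \<in> cells (bprod K (bistd 0 0)) i j. f i j x)"

definition is_homotopy ::
    "'k bisset \<Rightarrow> 'a bisset \<Rightarrow> ('k \<times> bistd_cell, 'a) bimap \<Rightarrow>
     ('k, 'a) bimap \<Rightarrow> ('k, 'a) bimap \<Rightarrow> bool" where
  "is_homotopy K X h f g \<longleftrightarrow>
     is_bimap (bprod K (bistd 1 1)) X h \<and>
     face1 (Hom K X) 1 1 0 h = degen2 (Hom K X) 0 0 0 (vertex_of K f) \<and>
     face2 (Hom K X) 1 1 0 h = degen1 (Hom K X) 0 0 0 (vertex_of K f) \<and>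
     face1 (Hom K X) 1 0 1 (face2 (Hom K X) 1 1 1 h) = vertex_of K g"

definition trivial_on :: "'k bisset \<Rightarrow> 'a bisset \<Rightarrow> 'a \<Rightarrow> ('k, 'a) bimap \<Rightarrow> bool" where
  "trivial_on L X v f \<longleftrightarrow> restr_bimap L f = const_bimap L X v"

definition homotopic_rel ::
    "'k bisset \<Rightarrow> 'k bisset \<Rightarrow> 'a bisset \<Rightarrow> 'a \<Rightarrow> ('k, 'a) bimap \<Rightarrow> ('k, 'a) bimap \<Rightarrow> bool" where
  "homotopic_rel K L X v f g \<longleftrightarrow>
     (\<exists>h. is_homotopy K X h f g \<and> trivial_on (bprod L (bistd 1 1)) X v h)"

text \<open>The map \<open>bistd m n \<rightarrow> X\<close> that corresponds to a cell \<open>x\<close> of bidegree \<open>(m, n)\<close>. The homotopy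
  sets below are formed from cells, identified with maps in this way.\<close>

definition cell_map :: "'a bisset \<Rightarrow> nat \<Rightarrow> nat \<Rightarrow> 'a \<Rightarrow> (bistd_cell, 'a) bimap" where
  "cell_map X m n x = (\<lambda>i j. \<lambda>(a, b) \<in> cells (bistd m n) i j. act X m n a b x)"

definition rel_cells :: "'a bisset \<Rightarrow> 'a \<Rightarrow> nat \<Rightarrow> nat \<Rightarrow> bistd_cell bisset \<Rightarrow> 'a set" where
  "rel_cells X v m n L = {x \<in> cells X m n. trivial_on L X v (cell_map X m n x)}"

definition homotopy_rel ::
    "'a bisset \<Rightarrow> 'a \<Rightarrow> nat \<Rightarrow> nat \<Rightarrow> bistd_cell bisset \<Rightarrow> ('a \<times> 'a) set" where
  "homotopy_rel X v m n L =
     {(x, y). x \<in> rel_cells X v m n L \<and> y \<in> rel_cells X v m n L \<and>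
        homotopic_rel (bistd m n) L X v (cell_map X m n x) (cell_map X m n y)}"

definition pi_BC :: "'a bisset \<Rightarrow> 'a \<Rightarrow> nat \<Rightarrow> nat \<Rightarrow> 'a set set" where
  "pi_BC X v m n = rel_cells X v m n (bd_BC m n) // homotopy_rel X v m n (bd_BC m n)"

definition class_BC :: "'a bisset \<Rightarrow> 'a \<Rightarrow> nat \<Rightarrow> nat \<Rightarrow> 'a \<Rightarrow> 'a set" where
  "class_BC X v m n x = homotopy_rel X v m n (bd_BC m n) `` {x}"

definition pi_A :: "'a bisset \<Rightarrow> 'a \<Rightarrow> nat \<Rightarrow> nat \<Rightarrow> 'a set set" where
  "pi_A X v m n = rel_cells X v m n (bd_A m n) // homotopy_rel X v m n (bd_A m n)"

definition class_A :: "'a bisset \<Rightarrow> 'a \<Rightarrow> nat \<Rightarrow> nat \<Rightarrow> 'a \<Rightarrow> 'a set" where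
  "class_A X v m n x = homotopy_rel X v m n (bd_A m n) `` {x}"


section \<open>Products\<close>

text \<open>The definite descriptions require the class to be the same for all choices of
  \<open>\<alpha>\<close>, \<open>\<beta>\<close> and \<open>\<theta>\<close>.\<close>

definition is_BC_filler ::
    "'a bisset \<Rightarrow> 'a \<Rightarrow> nat \<Rightarrow> nat \<Rightarrow> 'a \<Rightarrow> 'a \<Rightarrow> 'a \<Rightarrow> bool" where
  "is_BC_filler Y v m n \<alpha> \<beta> \<theta> \<longleftrightarrow>
     \<theta> \<in> cells Y (m + 1) (n + 1) \<and>
     (\<forall>i < m - 1. face1 Y (m + 1) (n + 1) i \<theta> = base Y v m (n + 1)) \<and>
     (\<forall>j < n - 1. face2 Y (m + 1) (n + 1) j \<theta> = base Y v (m + 1) n) \<and>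
     face1 Y (m + 1) (n + 1) (m - 1) \<theta> = degen2 Y m n (n - 1) \<alpha> \<and>
     face2 Y (m + 1) (n + 1) (n - 1) \<theta> = degen1 Y m n (m - 1) \<alpha> \<and>
     face1 Y (m + 1) (n + 1) (m + 1) \<theta> = degen2 Y m n n \<beta> \<and>
     face2 Y (m + 1) (n + 1) (n + 1) \<theta> = degen1 Y m n m \<beta>"

definition BC_mult ::
    "'a bisset \<Rightarrow> 'a \<Rightarrow> nat \<Rightarrow> nat \<Rightarrow> 'a set \<Rightarrow> 'a set \<Rightarrow> 'a set" where
  "BC_mult Y v m n P Q =
     (THE C. \<exists>\<alpha> \<in> P. \<exists>\<beta> \<in> Q. \<exists>\<theta>. is_BC_filler Y v m n \<alpha> \<beta> \<theta> \<and>
        C = class_BC Y v m n (face1 Y (m + 1) n m (face2 Y (m + 1) (n + 1) n \<theta>)))"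

definition is_A_filler :: "'a bisset \<Rightarrow> 'a \<Rightarrow> 'a \<Rightarrow> 'a \<Rightarrow> bool" where
  "is_A_filler Z \<alpha> \<beta> \<theta> \<longleftrightarrow>
     \<theta> \<in> cells Z 2 2 \<and>
     face1 Z 2 2 0 \<theta> = degen2 Z 1 1 0 \<alpha> \<and>
     face2 Z 2 2 0 \<theta> = degen1 Z 1 1 0 \<alpha> \<and>
     face1 Z 2 1 2 (face2 Z 2 2 2 \<theta>) = \<beta>"

definition A_mult :: "'a bisset \<Rightarrow> 'a \<Rightarrow> 'a set \<Rightarrow> 'a set \<Rightarrow> 'a set" where
  "A_mult Z v P Q =
     (THE C. \<exists>\<alpha> \<in> P. \<exists>\<beta> \<in> Q. \<exists>\<theta>. is_A_filler Z \<alpha> \<beta> \<theta> \<and>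
        C = class_A Z v 1 1 (face1 Z 2 1 1 (face2 Z 2 2 1 \<theta>)))"

text \<open>In the fiber product defining \<open>Z\<close>, \<open>Hom (bd_BC m n) (point X v)\<close> is a subobject of
  \<open>Hom (bd_BC m n) X\<close>.\<close>

definition loop_Z :: "'a bisset \<Rightarrow> 'a \<Rightarrow> nat \<Rightarrow> nat \<Rightarrow> 'a loop bisset" where
  "loop_Z X v m n = preimage (Hom (bistd m n) X) (Hom_restr (bistd m n) (bd_BC m n) X)
                             (Hom (bd_BC m n) (point X v))"

text \<open>The map \<open>L \<times> K \<rightarrow> X\<close> obtained from a map \<open>K \<times> L \<rightarrow> X\<close>. With \<open>K = bistd 1 1\<close> and
  \<open>L = bistd m n\<close> it turns a cell of bidegree \<open>(m, n)\<close> of the loop space into one of bidegree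
  \<open>(1, 1)\<close> of \<open>Z\<close>.\<close>

definition flip_map ::
    "'k bisset \<Rightarrow> 'l bisset \<Rightarrow> ('k \<times> 'l, 'a) bimap \<Rightarrow> ('l \<times> 'k, 'a) bimap" where
  "flip_map K L f = (\<lambda>i j. \<lambda>(y, x) \<in> cells (bprod L K) i j. f i j (x, y))"

definition loop_mult ::
    "'a bisset \<Rightarrow> 'a \<Rightarrow> nat \<Rightarrow> nat \<Rightarrow> 'a loop set \<Rightarrow> 'a loop set \<Rightarrow> 'a loop set" where
  "loop_mult X v m n P Q =
     flip_map (bistd m n) (bistd 1 1) `
       A_mult (loop_Z X v m n) (Hom_pt (bistd m n) X v)
         (flip_map (bistd 1 1) (bistd m n) ` P) (flip_map (bistd 1 1) (bistd m n) ` Q)"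

definition BC_group :: "'a bisset \<Rightarrow> 'a \<Rightarrow> nat \<Rightarrow> nat \<Rightarrow> 'a set monoid" where
  "BC_group Y v m n =
     \<lparr>carrier = pi_BC Y v m n, mult = BC_mult Y v m n,
      one = class_BC Y v m n (base Y v m n)\<rparr>"

definition loop_group :: "'a bisset \<Rightarrow> 'a \<Rightarrow> nat \<Rightarrow> nat \<Rightarrow> 'a loop set monoid" where
  "loop_group X v m n =
     \<lparr>carrier = pi_BC (loops X v) (loops_pt X v) m n, mult = loop_mult X v m n,
      one = class_BC (loops X v) (loops_pt X v) m n (base (loops X v) (loops_pt X v) m n)\<rparr>"

end

theory Submission
  imports Defs "HOL-Library.Product_Order" "HOL-Library.Countable"
begin

text \<open>The Aeppli product is composition of edges in a simplicial set: its \<open>n\<close>-simplices are the cells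
  of bidegree \<open>(n, n)\<close> that factor through a certain quotient of \<open>\<Delta>\<^bsup>n,n\<^esup>\<close>, and bihorn fillers of \<open>Z\<close> yield
  its horn fillers. So the usual argument with 2- and 3-simplices gives the group laws. A relative
  homotopy is a square of this simplicial set, that is, two of its triangles, which identifies the
  two notions of homotopy class. The complex \<open>Z\<close> is fibrant because the inclusions that occur in
  products with a bihorn are composites of horn fillings; these are found by matching the chains
  of a product of linear orders in pairs.

  For \<open>m, n \<ge> 1\<close> let \<open>\<theta>\<close> be a Bott-Chern filler of \<open>\<alpha>\<close> and \<open>\<beta>\<close>. The bihorn of \<open>\<Delta>\<^bsup>m+1,n+1\<^esup>\<close> without the faces
  \<open>d\<^sub>m\<close> in the first and \<open>d\<^sub>n\<close> in the second index is the union of a part on which \<open>\<theta>\<close> is a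
  degeneracy of \<open>\<alpha>\<close> while the corresponding degeneracy of \<open>\<beta>\<close> is constant, and a part where the roles
  are exchanged. On the bihorn \<open>\<theta>\<close> is therefore the composite of the two degeneracies, in either
  order, for trivial reasons; extending these compositions from the bihorn to \<open>\<Delta>\<^bsup>m+1,n+1\<^esup>\<close> and restricting
  them to the remaining face shows that the Bott-Chern product is both \<open>\<alpha> \<diamond> \<beta>\<close> and \<open>\<beta> \<diamond> \<alpha>\<close>.\<close>

section \<open>Operators and natural families\<close>

text \<open>Fibrancy fills bihorns but never a horn in one index alone (a box product of arbitrary
  simplicial sets is fibrant), so the classical argument applies in neither index by itself. The
  collapse is read off from the Aeppli product. Its filler prescribes both faces opposite to 0 as
  degeneracies of one loop, so the value on a cell one of whose lists avoids 0 depends only on the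
  two lists raised to at least 1. Asking for this at every \<open>s\<close> makes the condition pass
  to faces. The vertex 0 stays special: horns lacking the face opposite to 0 are left out, so
  inverses are first obtained on one side. For the Bott-Chern product the argument is of
  Eckmann-Hilton type, but the interchange law is replaced by a symmetry: \<alpha> and \<beta> enter
  the description of one filler on the bihorn in the same way, each being constant where the other
  prescribes the value. So \<star> inherits its laws from \<diamond>, and one filler makes both
  commutative.\<close>

lemma opsI: "length a = Suc k \<Longrightarrow> sorted a \<Longrightarrow> set a \<subseteq> {..m} \<Longrightarrow> a \<in> ops k m"
  by (simp add: ops_def)

lemma opsD:
  assumes "a \<in> ops k m"
  shows "length a = Suc k" "sorted a" "set a \<subseteq> {..m}"
  using assms by (auto simp: ops_def)

lemma ops_nonempty: "a \<in> ops k m \<Longrightarrow> set a \<noteq> {}"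
  by (auto simp: ops_def)

lemma ops_nth_le: "a \<in> ops k m \<Longrightarrow> i \<le> k \<Longrightarrow> a ! i \<le> m"
  by (auto simp: ops_def subset_iff less_Suc_eq_le)

text \<open>\<open>comp_op\<close> for lists over an arbitrary type. Simplices of a product of
  linear orders are lists of pairs, and operators act on them by the same selection of
  entries.\<close>

definition pick :: "'v list \<Rightarrow> nat list \<Rightarrow> 'v list" where
  "pick x \<theta> = map ((!) x) \<theta>"

lemma comp_op_pick: "comp_op = pick"
  by (intro ext) (simp add: comp_op_def pick_def)

lemma length_pick [simp]: "length (pick x \<theta>) = length \<theta>"
  by (simp add: pick_def)

lemma set_pick_subset: "\<theta> \<in> ops k m \<Longrightarrow> length x = Suc m \<Longrightarrow> set (pick x \<theta>) \<subseteq> set x"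
  by (auto simp: ops_def pick_def subset_iff)

lemma pick_pick:
  assumes "\<theta> \<in> ops k m" "\<theta>' \<in> ops p k"
  shows "pick (pick x \<theta>) \<theta>' = pick x (pick \<theta> \<theta>')"
  using assms by (auto simp: ops_def pick_def subset_iff)

lemma pick_id: "length x = Suc m \<Longrightarrow> pick x (id_op m) = x"
  by (metis id_op_def map_nth pick_def)

lemma id_pick:
  assumes "\<theta> \<in> ops k m"
  shows "pick (id_op m) \<theta> = \<theta>"
proof -
  have "map ((!) (id_op m)) \<theta> = map id \<theta>"
    using assms by (intro map_cong) (auto simp: ops_def id_op_def subset_iff less_Suc_eq_le simp del: upt_Suc)
  then show ?thesis by (simp add: pick_def)
qed

lemma map_pick:
  assumes "\<theta> \<in> ops k m" "length x = Suc m"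
  shows "map f (pick x \<theta>) = pick (map f x) \<theta>"
  using assms by (auto simp: ops_def pick_def subset_iff)

lemma sorted_wrt_pick:
  fixes x :: "'v::order list"
  assumes "\<theta> \<in> ops k m" "length x = Suc m" "sorted_wrt (\<le>) x"
  shows "sorted_wrt (\<le>) (pick x \<theta>)"
proof -
  have *: "x ! i \<le> x ! j" if "i \<le> j" "j \<le> m" for i j
    using assms(2,3) that by (cases "i = j") (auto simp: sorted_wrt_iff_nth_less)
  show ?thesis
    unfolding sorted_wrt_iff_nth_less
  proof (intro allI impI)
    fix i j assume ij: "i < j" "j < length (pick x \<theta>)"
    have "\<theta> ! i \<le> \<theta> ! j" using assms(1) ij by (auto simp: ops_def sorted_iff_nth_mono)
    moreover have "\<theta> ! j \<le> m" using assms(1) ij by (auto simp: ops_def subset_iff)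
    ultimately show "pick x \<theta> ! i \<le> pick x \<theta> ! j" using ij * by (simp add: pick_def)
  qed
qed

lemma pick_ops: "a \<in> ops m n \<Longrightarrow> \<theta> \<in> ops k m \<Longrightarrow> pick a \<theta> \<in> ops k n"
  using sorted_wrt_pick[of \<theta> k m a] set_pick_subset[of \<theta> k m a]
  by (auto simp: ops_def)

lemma id_op_ops: "id_op m \<in> ops m m"
  by (auto simp: ops_def id_op_def simp del: upt_Suc)

lemma replicate_ops: "i \<le> m \<Longrightarrow> replicate (Suc k) i \<in> ops k m"
  by (auto simp: ops_def sorted_replicate simp del: replicate_Suc)

lemma pick_replicate: "\<theta> \<in> ops k m \<Longrightarrow> pick (replicate (Suc m) i) \<theta> = replicate (Suc k) i"
proof -
  assume a: "\<theta> \<in> ops k m"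
  have "map ((!) (replicate (Suc m) i)) \<theta> = map (\<lambda>_. i) \<theta>"
    using a by (intro map_cong) (auto simp: ops_def subset_iff less_Suc_eq_le simp del: replicate_Suc)
  then show ?thesis using a by (simp add: pick_def ops_def map_replicate_const del: replicate_Suc)
qed

lemma map_mono_ops:
  assumes "a \<in> ops k m" "\<And>x y. x \<le> y \<Longrightarrow> y \<le> m \<Longrightarrow> f x \<le> f y" "\<And>x. x \<le> m \<Longrightarrow> f x \<le> n"
  shows "map f a \<in> ops k n"
  using assms
  by (auto simp: ops_def sorted_map subset_iff intro: sorted_wrt_mono_rel[of a "(\<le>)"])

lemma act_cells:
  "bisimplicial_set X \<Longrightarrow> x \<in> cells X m n \<Longrightarrow> \<theta> \<in> ops k m \<Longrightarrow> \<phi> \<in> ops l n \<Longrightarrow>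
     act X m n \<theta> \<phi> x \<in> cells X k l"
  unfolding bisimplicial_set_def by simp

lemma act_id: "bisimplicial_set X \<Longrightarrow> x \<in> cells X m n \<Longrightarrow> act X m n (id_op m) (id_op n) x = x"
  unfolding bisimplicial_set_def by simp

lemma act_act:
  "bisimplicial_set X \<Longrightarrow> x \<in> cells X m n \<Longrightarrow> \<theta> \<in> ops k m \<Longrightarrow> \<phi> \<in> ops l n \<Longrightarrow>
     \<theta>' \<in> ops p k \<Longrightarrow> \<phi>' \<in> ops q l \<Longrightarrow>
     act X k l \<theta>' \<phi>' (act X m n \<theta> \<phi> x) = act X m n (pick \<theta> \<theta>') (pick \<phi> \<phi>') x"
  unfolding bisimplicial_set_def comp_op_pick by simp

text \<open>A bimap up to values outside the cells of its domain.\<close>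

definition nat_on :: "'k bisset \<Rightarrow> 'a bisset \<Rightarrow> ('k, 'a) bimap \<Rightarrow> bool" where
  "nat_on K X f \<longleftrightarrow>
     (\<forall>m n. \<forall>x \<in> cells K m n. f m n x \<in> cells X m n) \<and>
     (\<forall>m n k l. \<forall>\<theta> \<in> ops k m. \<forall>\<phi> \<in> ops l n. \<forall>x \<in> cells K m n.
        f k l (act K m n \<theta> \<phi> x) = act X m n \<theta> \<phi> (f m n x))"

lemma nat_onI:
  assumes "\<And>m n x. x \<in> cells K m n \<Longrightarrow> f m n x \<in> cells X m n"
    and "\<And>m n k l \<theta> \<phi> x. \<theta> \<in> ops k m \<Longrightarrow> \<phi> \<in> ops l n \<Longrightarrow> x \<in> cells K m n \<Longrightarrow>
        f k l (act K m n \<theta> \<phi> x) = act X m n \<theta> \<phi> (f m n x)"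
  shows "nat_on K X f"
  using assms by (auto simp: nat_on_def)

lemma nat_onD:
  assumes "nat_on K X f" "x \<in> cells K m n"
  shows "f m n x \<in> cells X m n"
    and "\<theta> \<in> ops k m \<Longrightarrow> \<phi> \<in> ops l n \<Longrightarrow> f k l (act K m n \<theta> \<phi> x) = act X m n \<theta> \<phi> (f m n x)"
  using assms by (auto simp: nat_on_def)

lemma is_bimap_nat_on: "is_bimap K X f \<longleftrightarrow> nat_on K X f \<and> (\<forall>m n. f m n \<in> extensional (cells K m n))"
  by (auto simp: is_bimap_def nat_on_def PiE_def Pi_def extensional_def)

lemma restr_bimap_is_bimap:
  assumes "nat_on K X f"
    and "\<And>m n k l \<theta> \<phi> x. \<theta> \<in> ops k m \<Longrightarrow> \<phi> \<in> ops l n \<Longrightarrow> x \<in> cells K m n \<Longrightarrow> act K m n \<theta> \<phi> x \<in> cells K k l"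
  shows "is_bimap K X (restr_bimap K f)"
  using assms by (auto simp: is_bimap_def nat_on_def restr_bimap_def)

section \<open>The standard objects and their subobjects in terms of vertex sets\<close>

lemma cells_bistd [simp]: "cells (bistd m n) i j = ops i m \<times> ops j n"
  by (simp add: bistd_def box_def std_def)

lemma act_bistd: "act (bistd m n) i j \<theta> \<phi> (a, b) = (pick a \<theta>, pick b \<phi>)"
  by (simp add: bistd_def box_def std_def comp_op_pick)

text \<open>Faces, horns and boundaries see only the vertex set of a simplex, so each subobject
  becomes a condition on \<open>set a\<close> and \<open>set b\<close> that passes to smaller sets.
  All regions below are given in this form.\<close>

lemma cells_bihorn:
  "cells (bihorn m n k l) i j = {(a, b) \<in> ops i m \<times> ops j n.
     \<not> {..m} - {k} \<subseteq> set a \<or> \<not> {..n} - {l} \<subseteq> set b}"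
  by (auto simp: bihorn_def bunion_def box_def std_def std_face_def horn_def)

lemma act_bihorn: "act (bihorn m n k l) i j \<theta> \<phi> (a, b) = (pick a \<theta>, pick b \<phi>)"
  by (simp add: bihorn_def bunion_def box_def std_def horn_def comp_op_pick)

lemma cells_bd_BC:
  "cells (bd_BC m n) i j = {(a, b) \<in> ops i m \<times> ops j n. \<not> {..m} \<subseteq> set a \<or> \<not> {..n} \<subseteq> set b}"
  by (auto simp: bd_BC_def bunion_def box_def std_def std_face_def boundary_def)

lemma act_bd_BC: "act (bd_BC m n) i j \<theta> \<phi> (a, b) = (pick a \<theta>, pick b \<phi>)"
  by (simp add: bd_BC_def bunion_def box_def std_def boundary_def comp_op_pick)

text \<open>The horn \<open>horn 1 1\<close> is the face opposite to 0, that is, the vertex 1; this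
  is where 0 and 1 lose their symmetry.\<close>

lemma cells_bd_A:
  "cells (bd_A 1 1) i j = {(a, b) \<in> ops i 1 \<times> ops j 1. 0 \<notin> set a \<or> 0 \<notin> set b \<or>
     (\<not> {0,1} \<subseteq> set a \<and> \<not> {0,1} \<subseteq> set b)}"
  by (auto simp: bd_A_def bunion_def box_def std_def std_face_def boundary_def horn_def atMost_Suc)

lemma cells_bprod [simp]: "cells (bprod K L) i j = cells K i j \<times> cells L i j"
  by (simp add: bprod_def)

lemma act_bprod: "act (bprod K L) i j \<theta> \<phi> (x, y) = (act K i j \<theta> \<phi> x, act L i j \<theta> \<phi> y)"
  by (simp add: bprod_def)

section \<open>Horn fillers\<close>

text \<open>By the Yoneda correspondence a map out of \<open>bistd m n\<close> is a single cell, so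
  fillers of bihorns can be stated without the type parameter of \<open>fibrant\<close> and without
  extensionality. Fibrancy enters the proof through this property alone.\<close>

definition kan :: "'a bisset \<Rightarrow> bool" where
  "kan X \<longleftrightarrow> bisimplicial_set X \<and>
     (\<forall>m n k l f. 1 \<le> m \<longrightarrow> 1 \<le> n \<longrightarrow> k \<le> m \<longrightarrow> l \<le> n \<longrightarrow> nat_on (bihorn m n k l) X f \<longrightarrow>
        (\<exists>x \<in> cells X m n. \<forall>i j. \<forall>(a, b) \<in> cells (bihorn m n k l) i j. act X m n a b x = f i j (a, b)))"

lemma kan_bisimplicial: "kan X \<Longrightarrow> bisimplicial_set X"
  by (simp add: kan_def)

lemma kan_filler:
  assumes "kan X" "1 \<le> m" "1 \<le> n" "k \<le> m" "l \<le> n" "nat_on (bihorn m n k l) X f"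
  obtains x where "x \<in> cells X m n"
    and "\<And>i j a b. (a, b) \<in> cells (bihorn m n k l) i j \<Longrightarrow> act X m n a b x = f i j (a, b)"
  using assms unfolding kan_def by fast

text \<open>Fibrancy is tested on objects with cells in the type \<open>'u\<close> only; an
  injection \<open>e\<close> transports the generators into that type.\<close>

definition copy :: "('k \<Rightarrow> 'u) \<Rightarrow> 'k bisset \<Rightarrow> 'u bisset" where
  "copy e K = \<lparr>cells = (\<lambda>m n. e ` cells K m n),
               act = (\<lambda>m n \<theta> \<phi> y. e (act K m n \<theta> \<phi> (inv_into UNIV e y)))\<rparr>"

lemma bisimplicial_copy:
  assumes "inj e" "bisimplicial_set K"
  shows "bisimplicial_set (copy e K)"
  using assms unfolding bisimplicial_set_def copy_def by simp

lemma bisimplicial_bistd: "bisimplicial_set (bistd m n)"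
  unfolding bisimplicial_set_def comp_op_pick
  using pick_ops by (auto simp: act_bistd pick_pick ops_def intro!: pick_id)

lemma set_pick_ops: "a \<in> ops i m \<Longrightarrow> \<theta> \<in> ops k i \<Longrightarrow> set (pick a \<theta>) \<subseteq> set a"
  using set_pick_subset opsD(1) by metis

lemma bisimplicial_bihorn: "bisimplicial_set (bihorn m n k l)"
  unfolding bisimplicial_set_def comp_op_pick
proof (intro conjI allI ballI)
  fix i j p q \<theta> \<phi> x
  assume *: "\<theta> \<in> ops p i" "\<phi> \<in> ops q j" "x \<in> cells (bihorn m n k l) i j"
  obtain a b where x: "x = (a, b)" by (cases x)
  show "act (bihorn m n k l) i j \<theta> \<phi> x \<in> cells (bihorn m n k l) p q"
    using * set_pick_ops[of a i m \<theta> p] set_pick_ops[of b j n \<phi> q] pick_ops[of a i m \<theta> p]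
      pick_ops[of b j n \<phi> q]
    unfolding x by (auto simp: cells_bihorn act_bihorn)
qed (auto simp: cells_bihorn act_bihorn pick_pick ops_def intro!: pick_id)

lemma iso_copy:
  assumes "inj e" "bisimplicial_set K"
  shows "is_iso (copy e K) K (\<lambda>m n. \<lambda>x\<in>cells (copy e K) m n. inv_into UNIV e x)"
  unfolding is_iso_def is_bimap_def
proof (intro conjI allI ballI)
  fix i j p q \<theta> \<phi> y
  assume *: "\<theta> \<in> ops p i" "\<phi> \<in> ops q j" "y \<in> cells (copy e K) i j"
  then obtain x where x: "x \<in> cells K i j" "y = e x" by (auto simp: copy_def)
  show "(\<lambda>x\<in>cells (copy e K) p q. inv_into UNIV e x) (act (copy e K) i j \<theta> \<phi> y) =
    act K i j \<theta> \<phi> ((\<lambda>x\<in>cells (copy e K) i j. inv_into UNIV e x) y)"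
    using * x assms act_cells[OF assms(2) x(1) *(1,2)] by (simp add: copy_def)
next
  fix i j
  show "bij_betw (\<lambda>x\<in>cells (copy e K) i j. inv_into UNIV e x) (cells (copy e K) i j) (cells K i j)"
    by (rule bij_betwI[of _ _ _ e]) (use assms(1) in \<open>auto simp: copy_def\<close>)
qed (use assms(1) in \<open>auto simp: copy_def\<close>)

lemma iso_copy_arrows:
  assumes "inj e" "bisimplicial_set K" "bisimplicial_set L" "act K = act L"
    "\<And>i j. cells K i j \<subseteq> cells L i j"
  shows "iso_arrows (copy e K) (copy e L) (id_bimap (copy e K)) K L (id_bimap K)"
  unfolding iso_arrows_def
proof (intro exI conjI)
  show "is_iso (copy e K) K (\<lambda>m n. \<lambda>x\<in>cells (copy e K) m n. inv_into UNIV e x)"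
    by (rule iso_copy) fact+
  show "is_iso (copy e L) L (\<lambda>m n. \<lambda>x\<in>cells (copy e L) m n. inv_into UNIV e x)"
    by (rule iso_copy) fact+
  show "comp_bimap (copy e K) (\<lambda>m n. \<lambda>x\<in>cells (copy e L) m n. inv_into UNIV e x) (id_bimap (copy e K)) =
    comp_bimap (copy e K) (id_bimap K) (\<lambda>m n. \<lambda>x\<in>cells (copy e K) m n. inv_into UNIV e x)"
  proof (intro ext)
    fix i j y
    show "comp_bimap (copy e K) (\<lambda>m n. \<lambda>x\<in>cells (copy e L) m n. inv_into UNIV e x) (id_bimap (copy e K)) i j y =
      comp_bimap (copy e K) (id_bimap K) (\<lambda>m n. \<lambda>x\<in>cells (copy e K) m n. inv_into UNIV e x) i j y"
    proof (cases "y \<in> cells (copy e K) i j")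
      case True
      then obtain x where x: "x \<in> cells K i j" "y = e x" by (auto simp: copy_def)
      moreover have "x \<in> cells L i j" using x assms(5) by blast
      ultimately show ?thesis
        using assms(1) by (simp add: comp_bimap_def id_bimap_def copy_def)
    qed (simp add: comp_bimap_def)
  qed
qed

lemma act_bihorn_bistd: "act (bihorn m n k l) = act (bistd m n)"
  by (simp add: bihorn_def bistd_def bunion_def box_def std_def horn_def)

text \<open>Every square over the terminal object commutes, so lifting against the copied generator
  is extension from the bihorn. The filler is the image of the top cell under the lift.\<close>

lemma fibrant_imp_kan:
  fixes X :: "'a bisset"
  assumes "fibrant TYPE('u::infinite) X"
  shows "kan X"
proof -
  have bs: "bisimplicial_set X" using assms by (simp add: fibrant_def)
  \<comment> \<open>An infinite type contains a copy of the natural numbers, and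
    \<open>bistd_cell\<close> is countable.\<close>
  obtain e0 :: "nat \<Rightarrow> 'u" where e0: "inj e0"
    using infinite_countable_subset[OF infinite_UNIV] by auto
  define e :: "bistd_cell \<Rightarrow> 'u" where "e = e0 \<circ> to_nat"
  have e: "inj e" unfolding e_def using e0 by (intro inj_compose inj_to_nat)
  show ?thesis unfolding kan_def
  proof (intro conjI bs allI impI)
    fix m n k l :: nat and f
    assume mn: "1 \<le> m" "1 \<le> n" "k \<le> m" "l \<le> n" and f: "nat_on (bihorn m n k l) X f"
    let ?K = "bihorn m n k l" and ?L = "bistd m n"
    let ?A = "copy e ?K" and ?B = "copy e ?L" and ?P = "bistd 0 0"
    have sub: "cells ?K i j \<subseteq> cells ?L i j" for i j by (auto simp: cells_bihorn)
    have mono: "is_mono ?A (id_bimap ?A)"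
      by (auto simp: is_mono_def id_bimap_def inj_on_def)
    have "is_bimap ?A ?B (id_bimap ?A)"
      using sub bisimplicial_copy[OF e bisimplicial_bihorn[of m n k l]] 
      by (auto simp: is_bimap_def id_bimap_def copy_def act_bihorn_bistd bisimplicial_set_def)
    then have "horn_generator ?A ?B (id_bimap ?A)"
      unfolding horn_generator_def
      by (intro conjI exI[of _ m] exI[of _ n] exI[of _ k] exI[of _ l] mn
          bisimplicial_copy[OF e bisimplicial_bihorn] bisimplicial_copy[OF e bisimplicial_bistd]
          iso_copy_arrows[OF e bisimplicial_bihorn bisimplicial_bistd act_bihorn_bistd sub])
    then have "anodyne ?A ?B (id_bimap ?A)"
      unfolding anodyne_def by (intro conjI saturation.generator mono)
    then have rlp: "has_rlp ?A ?B (id_bimap ?A) X ?P (const_bimap X ?P ([0],[0]))"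
      using assms by (simp add: fibrant_def fibration_def)
    define u where "u = (\<lambda>i j. \<lambda>y\<in>cells ?A i j. f i j (inv_into UNIV e y))"
    define w where "w = const_bimap ?B ?P ([0],[0])"
    have u: "is_bimap ?A X u"
      using f e bisimplicial_bihorn[of m n k l]
      by (auto simp: is_bimap_def u_def copy_def nat_on_def bisimplicial_set_def)
    have bP: "base ?P ([0],[0]) i j = (replicate (Suc i) 0, replicate (Suc j) 0)" for i j
      by (auto simp: base_def act_bistd pick_def map_replicate_const nth_append simp del: replicate_Suc)
    have w: "is_bimap ?B ?P w"
      using bisimplicial_copy[OF e bisimplicial_bistd[of m n]]
      by (auto simp: is_bimap_def w_def const_bimap_def bP replicate_ops act_bistd pick_replicate
          bisimplicial_set_def simp del: replicate_Suc)
    have "cells ?A i j \<subseteq> cells ?B i j" for i j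
      using sub[of i j] by (simp add: copy_def image_mono del: cells_bistd)
    moreover have "y \<in> cells ?A i j \<Longrightarrow> u i j y \<in> cells X i j" for i j y
      using u by (auto simp: is_bimap_def)
    ultimately have "comp_bimap ?A (const_bimap X ?P ([0],[0])) u = comp_bimap ?A w (id_bimap ?A)"
      by (intro ext) (auto simp: comp_bimap_def w_def const_bimap_def id_bimap_def restrict_def
          subset_iff)
    then obtain h where h: "is_bimap ?B X h" "comp_bimap ?A h (id_bimap ?A) = u"
      using rlp u w unfolding has_rlp_def by blast
    let ?x = "h m n (e (id_op m, id_op n))"
    have "(id_op m, id_op n) \<in> cells ?L m n" by (simp add: id_op_ops)
    then have mem: "e (id_op m, id_op n) \<in> cells ?B m n" by (simp add: copy_def)
    show "\<exists>x\<in>cells X m n. \<forall>i j. \<forall>(a, b)\<in>cells ?K i j. act X m n a b x = f i j (a, b)"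
    proof (intro bexI[of _ ?x] allI ballI, clarify)
      show "?x \<in> cells X m n" using h(1) mem by (auto simp: is_bimap_def)
      fix i j a b assume ab: "(a, b) \<in> cells ?K i j"
      then have ops: "a \<in> ops i m" "b \<in> ops j n" by (auto simp: cells_bihorn)
      have "act X m n a b ?x = h i j (act ?B m n a b (e (id_op m, id_op n)))"
        using h(1) mem ops by (simp add: is_bimap_def)
      also have "act ?B m n a b (e (id_op m, id_op n)) = e (a, b)"
        using e ops by (simp add: copy_def act_bistd id_pick)
      also have "h i j (e (a, b)) = u i j (e (a, b))"
        using ab by (simp add: h(2)[symmetric] comp_bimap_def id_bimap_def copy_def)
      also have "\<dots> = f i j (a, b)" using ab e by (simp add: u_def copy_def)
      finally show "act X m n a b ?x = f i j (a, b)" .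
    qed
  qed
qed

section \<open>Extension along complexes\<close>

text \<open>A family of pairs of nonempty chains, closed under passing to subsets, describes a
  bisimplicial set whose cells are the pairs of weakly increasing lists of vertices.\<close>

definition cplx :: "('v::order set \<times> 'w::order set) set \<Rightarrow> ('v list \<times> 'w list) bisset" where
  "cplx \<K> = \<lparr>cells = (\<lambda>i j. {(u, w). length u = Suc i \<and> length w = Suc j \<and>
       sorted_wrt (\<le>) u \<and> sorted_wrt (\<le>) w \<and> (set u, set w) \<in> \<K>}),
     act = (\<lambda>m n \<theta> \<phi> (u, w). (pick u \<theta>, pick w \<phi>))\<rparr>"

definition down_closed :: "('v set \<times> 'w set) set \<Rightarrow> bool" where
  "down_closed \<K> \<longleftrightarrow> (\<forall>S T S' T'. (S, T) \<in> \<K> \<longrightarrow> S' \<subseteq> S \<longrightarrow> T' \<subseteq> T \<longrightarrow> S' \<noteq> {} \<longrightarrow> T' \<noteq> {} \<longrightarrow> (S', T') \<in> \<K>)"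

definition extends :: "'a bisset \<Rightarrow> ('v::order set \<times> 'w::order set) set \<Rightarrow> ('v set \<times> 'w set) set \<Rightarrow> bool" where
  "extends X \<A> \<B> \<longleftrightarrow> (\<forall>f. nat_on (cplx \<A>) X f \<longrightarrow>
     (\<exists>g. nat_on (cplx \<B>) X g \<and> (\<forall>i j. \<forall>c \<in> cells (cplx \<A>) i j. g i j c = f i j c)))"

lemma cells_cplx: "(u, w) \<in> cells (cplx \<K>) i j \<longleftrightarrow> length u = Suc i \<and> length w = Suc j \<and>
       sorted_wrt (\<le>) u \<and> sorted_wrt (\<le>) w \<and> (set u, set w) \<in> \<K>"
  by (simp add: cplx_def)

lemma act_cplx: "act (cplx \<K>) m n \<theta> \<phi> (u, w) = (pick u \<theta>, pick w \<phi>)"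
  by (simp add: cplx_def)

lemma act_cplx_cells:
  assumes "down_closed \<K>" "\<theta> \<in> ops k m" "\<phi> \<in> ops l n" "c \<in> cells (cplx \<K>) m n"
  shows "act (cplx \<K>) m n \<theta> \<phi> c \<in> cells (cplx \<K>) k l"
proof -
  obtain u w where c: "c = (u, w)" by (cases c)
  have *: "length u = Suc m" "length w = Suc n" "(set u, set w) \<in> \<K>"
    using assms(4) by (auto simp: c cells_cplx)
  have "set (pick u \<theta>) \<noteq> {}" "set (pick w \<phi>) \<noteq> {}"
    using assms(2,3) by (auto simp: pick_def ops_def)
  then have "(set (pick u \<theta>), set (pick w \<phi>)) \<in> \<K>"
    using assms(1) * set_pick_subset[OF assms(2) *(1)] set_pick_subset[OF assms(3) *(2)]
    unfolding down_closed_def by meson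
  then show ?thesis
    using assms sorted_wrt_pick[of \<theta> k m u] sorted_wrt_pick[of \<phi> l n w]
    by (auto simp: c cells_cplx act_cplx ops_def)
qed

lemma extends_refl: "extends X \<A> \<A>"
  unfolding extends_def by blast

lemma extends_trans:
  assumes "extends X \<A> \<B>" "extends X \<B> \<C>" "\<A> \<subseteq> \<B>"
  shows "extends X \<A> \<C>"
  unfolding extends_def
proof (intro allI impI)
  fix f assume "nat_on (cplx \<A>) X f"
  then obtain g where g: "nat_on (cplx \<B>) X g" "\<forall>i j. \<forall>c \<in> cells (cplx \<A>) i j. g i j c = f i j c"
    using assms(1) unfolding extends_def by meson
  then obtain h where h: "nat_on (cplx \<C>) X h" "\<forall>i j. \<forall>c \<in> cells (cplx \<B>) i j. h i j c = g i j c"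
    using assms(2) unfolding extends_def by meson
  show "\<exists>g. nat_on (cplx \<C>) X g \<and> (\<forall>i j. \<forall>c \<in> cells (cplx \<A>) i j. g i j c = f i j c)"
  proof (intro exI[of _ h] conjI allI ballI)
    show "nat_on (cplx \<C>) X h" by (rule h(1))
    fix i j c assume c: "c \<in> cells (cplx \<A>) i j"
    then have "c \<in> cells (cplx \<B>) i j" using assms(3) by (auto simp: cplx_def)
    then show "h i j c = f i j c" using g(2) h(2) c by simp
  qed
qed

text \<open>\<open>cplx (\<A> \<union> \<B>)\<close> is the pushout of \<open>cplx \<A>\<close> and
  \<open>cplx \<B>\<close> over \<open>cplx (\<A> \<inter> \<B>)\<close>: a cell belongs to one of
  the two according to its pair of vertex sets, and operators do not lead out of either.\<close>

lemma extends_glue: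
  fixes \<A> \<B> :: "('v::order set \<times> 'w::order set) set"
  assumes "down_closed \<A>" "down_closed \<B>" "extends X (\<A> \<inter> \<B>) \<B>"
  shows "extends X \<A> (\<A> \<union> \<B>)"
  unfolding extends_def
proof (intro allI impI)
  fix f assume f: "nat_on (cplx \<A>) X f"
  let ?I = "\<A> \<inter> \<B>"
  have I: "c \<in> cells (cplx ?I) i j \<longleftrightarrow> c \<in> cells (cplx \<A>) i j \<and> c \<in> cells (cplx \<B>) i j" for c i j
    by (auto simp: cplx_def)
  have U: "c \<in> cells (cplx (\<A> \<union> \<B>)) i j \<longleftrightarrow> c \<in> cells (cplx \<A>) i j \<or> c \<in> cells (cplx \<B>) i j" for c i j
    by (auto simp: cplx_def)
  have ac: "act (cplx \<K>) = act (cplx \<K>')" for \<K> \<K>' :: "('v set \<times> 'w set) set"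
    by (simp add: cplx_def)
  have "nat_on (cplx ?I) X f"
  proof (rule nat_onI)
    fix m n k l \<theta> \<phi> x
    assume "\<theta> \<in> ops k m" "\<phi> \<in> ops l n" "x \<in> cells (cplx ?I) m n"
    then show "f k l (act (cplx ?I) m n \<theta> \<phi> x) = act X m n \<theta> \<phi> (f m n x)"
      using nat_onD(2)[OF f] ac[of ?I \<A>] by (simp add: I)
  qed (use nat_onD(1)[OF f] in \<open>simp add: I\<close>)
  then obtain g where g: "nat_on (cplx \<B>) X g" "\<forall>i j. \<forall>c \<in> cells (cplx ?I) i j. g i j c = f i j c"
    using assms(3) unfolding extends_def by meson
  define h where "h = (\<lambda>i j c. if c \<in> cells (cplx \<A>) i j then f i j c else g i j c)"
  have hB: "h i j c = g i j c" if "c \<in> cells (cplx \<B>) i j" for i j c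
    using that g(2) by (auto simp: h_def I)
  have "nat_on (cplx (\<A> \<union> \<B>)) X h"
  proof (rule nat_onI)
    fix m n x assume "x \<in> cells (cplx (\<A> \<union> \<B>)) m n"
    then show "h m n x \<in> cells X m n"
      unfolding U using nat_onD(1)[OF f, of x m n] nat_onD(1)[OF g(1), of x m n] by (auto simp: h_def simp del: split_paired_All)
  next
    fix m n k l \<theta> \<phi> x
    assume *: "\<theta> \<in> ops k m" "\<phi> \<in> ops l n" "x \<in> cells (cplx (\<A> \<union> \<B>)) m n"
    show "h k l (act (cplx (\<A> \<union> \<B>)) m n \<theta> \<phi> x) = act X m n \<theta> \<phi> (h m n x)"
    proof (cases "x \<in> cells (cplx \<A>) m n")
      case True
      show ?thesis
        unfolding ac[of "\<A> \<union> \<B>" \<A>]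
        using act_cplx_cells[OF assms(1) *(1,2) True] nat_onD(2)[OF f True *(1,2)] True
        by (simp add: h_def)
    next
      case False
      then have x: "x \<in> cells (cplx \<B>) m n" using * U by blast
      show ?thesis
        unfolding ac[of "\<A> \<union> \<B>" \<B>]
        using act_cplx_cells[OF assms(2) *(1,2) x] nat_onD(2)[OF g(1) x *(1,2)] x
        by (simp add: hB)
    qed
  qed
  then show "\<exists>g. nat_on (cplx (\<A> \<union> \<B>)) X g \<and> (\<forall>i j. \<forall>c \<in> cells (cplx \<A>) i j. g i j c = f i j c)"
    by (intro exI[of _ h]) (simp add: h_def)
qed

section \<open>Bihorns spanned by two chains\<close>

definition is_chain :: "'v::order set \<Rightarrow> bool" where
  "is_chain S \<longleftrightarrow> finite S \<and> (\<forall>x\<in>S. \<forall>y\<in>S. x \<le> y \<or> y \<le> x)"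

lemma chain_list:
  assumes "is_chain S"
  shows "\<exists>e. set e = S \<and> sorted_wrt (<) e"
proof -
  have "finite S" using assms by (simp add: is_chain_def)
  then show ?thesis using assms
  proof (induction "card S" arbitrary: S)
    case 0
    then show ?case by (intro exI[of _ "[]"]) auto
  next
    case (Suc n)
    then have "S \<noteq> {}" by auto
    then obtain x where x: "x \<in> S" "\<forall>y\<in>S. x \<le> y \<longrightarrow> x = y"
      using finite_has_maximal[of S] Suc.prems(1) by blast
    have "is_chain (S - {x})" using Suc.prems(2) by (auto simp: is_chain_def)
    then obtain e where e: "set e = S - {x}" "sorted_wrt (<) e"
      using Suc.hyps(1)[of "S - {x}"] Suc.hyps(2) Suc.prems(1) x(1) by (metis card_Diff_singleton diff_Suc_1 finite_Diff)
    have "\<forall>y\<in>S - {x}. y < x" using x Suc.prems(2) by (auto simp: is_chain_def less_le)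
    then show ?case using e x(1) by (intro exI[of _ "e @ [x]"]) (auto simp: sorted_wrt_append)
  qed
qed

text \<open>\<open>ix\<close> inverts the enumeration \<open>e\<close>; it is monotone because
  \<open>e\<close> is strictly increasing.\<close>

lemma strict_list_index:
  fixes e :: "'v::order list"
  assumes "sorted_wrt (<) e" "length e = Suc m"
  obtains ix where "\<And>v. v \<in> set e \<Longrightarrow> ix v \<le> m \<and> e ! ix v = v"
    and "\<And>i. i \<le> m \<Longrightarrow> ix (e ! i) = i"
    and "\<And>v v'. v \<in> set e \<Longrightarrow> v' \<in> set e \<Longrightarrow> v \<le> v' \<Longrightarrow> ix v \<le> ix v'"
proof -
  define ix where "ix v = (SOME i. i \<le> m \<and> e ! i = v)" for v
  have *: "ix v \<le> m \<and> e ! ix v = v" if "v \<in> set e" for v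
  proof -
    have "\<exists>i. i \<le> m \<and> e ! i = v" using that assms(2) by (auto simp: in_set_conv_nth less_Suc_eq_le)
    then show ?thesis unfolding ix_def by (rule someI_ex)
  qed
  have lt: "e ! i < e ! j" if "i < j" "j \<le> m" for i j
    using assms that by (simp add: sorted_wrt_iff_nth_less)
  have inj: "i = j" if "e ! i = e ! j" "i \<le> m" "j \<le> m" for i j
    using lt[of i j] lt[of j i] that by (cases i j rule: linorder_cases) auto
  have "ix (e ! i) = i" if "i \<le> m" for i
    using *[of "e ! i"] that assms(2) inj by (auto simp: less_Suc_eq_le)
  moreover have "ix v \<le> ix v'" if "v \<in> set e" "v' \<in> set e" "v \<le> v'" for v v'
    using lt[of "ix v'" "ix v"] *[OF that(1)] *[OF that(2)] that(3) by (metis leD leI)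
  ultimately show thesis using * that by blast
qed

lemma sorted_map_ix:
  assumes "sorted_wrt (\<le>) u" "set u \<subseteq> S" "\<And>v v'. v \<in> S \<Longrightarrow> v' \<in> S \<Longrightarrow> v \<le> v' \<Longrightarrow> ix v \<le> (ix v' :: nat)"
  shows "sorted (map ix u)"
  unfolding sorted_map by (rule sorted_wrt_mono_rel[OF _ assms(1)]) (use assms in blast)

text \<open>The strictly increasing enumerations \<open>e1\<close> and \<open>e2\<close> identify
  the larger complex with \<open>bistd m n\<close> and the smaller one with the bihorn for
  \<open>k\<close> and \<open>l\<close>. So this is \<open>kan\<close>, transported along
  \<open>pick e1\<close> and \<open>pick e2\<close> and back along the position functions
  \<open>ix\<close> and \<open>iy\<close>.\<close>

lemma extends_bihorn_list:
  fixes e1 :: "'v::order list" and e2 :: "'w::order list"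
  assumes "kan X" "sorted_wrt (<) e1" "sorted_wrt (<) e2" "length e1 = Suc m" "length e2 = Suc n"
    and "1 \<le> m" "1 \<le> n" "k \<le> m" "l \<le> n"
  shows "extends X {(S, T). S \<noteq> {} \<and> T \<noteq> {} \<and> S \<subseteq> set e1 \<and> T \<subseteq> set e2 \<and>
            (\<not> set e1 - {e1 ! k} \<subseteq> S \<or> \<not> set e2 - {e2 ! l} \<subseteq> T)}
          {(S, T). S \<noteq> {} \<and> T \<noteq> {} \<and> S \<subseteq> set e1 \<and> T \<subseteq> set e2}" (is "extends X ?A ?B")
  unfolding extends_def
proof (intro allI impI)
  fix f assume f: "nat_on (cplx ?A) X f"
  have bs: "bisimplicial_set X" using assms(1) by (rule kan_bisimplicial)
  obtain ix where ix: "\<And>v. v \<in> set e1 \<Longrightarrow> ix v \<le> m \<and> e1 ! ix v = v" "\<And>i. i \<le> m \<Longrightarrow> ix (e1 ! i) = i"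
    "\<And>v v'. v \<in> set e1 \<Longrightarrow> v' \<in> set e1 \<Longrightarrow> v \<le> v' \<Longrightarrow> ix v \<le> ix v'"
    using strict_list_index[OF assms(2,4)] by metis
  obtain iy where iy: "\<And>v. v \<in> set e2 \<Longrightarrow> iy v \<le> n \<and> e2 ! iy v = v" "\<And>i. i \<le> n \<Longrightarrow> iy (e2 ! i) = i"
    "\<And>v v'. v \<in> set e2 \<Longrightarrow> v' \<in> set e2 \<Longrightarrow> v \<le> v' \<Longrightarrow> iy v \<le> iy v'"
    using strict_list_index[OF assms(3,5)] by metis
  have mem: "(pick e1 a, pick e2 b) \<in> cells (cplx ?A) i j"
    if ab: "(a, b) \<in> cells (bihorn m n k l) i j" for a b i j
  proof -
    have ops: "a \<in> ops i m" "b \<in> ops j n" and h: "\<not> {..m} - {k} \<subseteq> set a \<or> \<not> {..n} - {l} \<subseteq> set b"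
      using ab by (auto simp: cells_bihorn)
    have le: "sorted_wrt (\<le>) e1" "sorted_wrt (\<le>) e2"
      using assms(2,3) by (auto elim: sorted_wrt_mono_rel[rotated])
    have "e1 ! s \<notin> set (pick e1 a)" if "s \<le> m" "s \<notin> set a" for s
      using that ix(2) opsD(3)[OF ops(1)] by (auto simp: pick_def subset_iff) metis
    moreover have "e2 ! s \<notin> set (pick e2 b)" if "s \<le> n" "s \<notin> set b" for s
      using that iy(2) opsD(3)[OF ops(2)] by (auto simp: pick_def subset_iff) metis
    moreover have "e1 ! s \<in> set e1 - {e1 ! k}" if "s \<le> m" "s \<noteq> k" for s
      using that ix(2)[of s] ix(2)[of k] assms by auto
    moreover have "e2 ! s \<in> set e2 - {e2 ! l}" if "s \<le> n" "s \<noteq> l" for s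
      using that iy(2)[of s] iy(2)[of l] assms by auto
    ultimately have "\<not> set e1 - {e1 ! k} \<subseteq> set (pick e1 a) \<or> \<not> set e2 - {e2 ! l} \<subseteq> set (pick e2 b)"
      using h by (auto simp: subset_iff) metis+
    moreover have "set (pick e1 a) \<noteq> {}" "set (pick e2 b) \<noteq> {}"
      using ops by (auto simp: pick_def ops_def)
    ultimately show ?thesis
      using ops le set_pick_subset[of a i m e1] set_pick_subset[of b j n e2] assms(4,5)
        sorted_wrt_pick[of a i m e1] sorted_wrt_pick[of b j n e2]
      by (auto simp: cells_cplx ops_def)
  qed
  have "nat_on (bihorn m n k l) X (\<lambda>i j (a, b). f i j (pick e1 a, pick e2 b))"
  proof (rule nat_onI)
    fix i j p q \<theta> \<phi> x
    assume *: "\<theta> \<in> ops p i" "\<phi> \<in> ops q j" "x \<in> cells (bihorn m n k l) i j"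
    obtain a b where x: "x = (a, b)" by (cases x)
    have ops: "a \<in> ops i m" "b \<in> ops j n" using * x by (auto simp: cells_bihorn)
    show "(case act (bihorn m n k l) i j \<theta> \<phi> x of (a, b) \<Rightarrow> f p q (pick e1 a, pick e2 b)) =
      act X i j \<theta> \<phi> (case x of (a, b) \<Rightarrow> f i j (pick e1 a, pick e2 b))"
      using nat_onD(2)[OF f mem[of a b i j] *(1,2)] * ops
      by (simp add: x act_bihorn act_cplx pick_pick)
  qed (use nat_onD(1)[OF f mem] in auto)
  from kan_filler[OF assms(1,6-9) this] obtain x where x: "x \<in> cells X m n"
    and fx: "\<And>i j a b. (a, b) \<in> cells (bihorn m n k l) i j \<Longrightarrow> act X m n a b x = f i j (pick e1 a, pick e2 b)"
    by auto
  \<comment> \<open>The positions of the entries of \<open>u\<close> and \<open>w\<close> form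
    operators, and these are applied to the filler.\<close>
  define g where "g = (\<lambda>(i::nat) (j::nat) (u, w). act X m n (map ix u) (map iy w) x)"
  have ops1: "map ix u \<in> ops i m" if "length u = Suc i" "sorted_wrt (\<le>) u" "set u \<subseteq> set e1" for u i
    using that ix sorted_map_ix[of u "set e1" ix] by (auto simp: ops_def)
  have ops2: "map iy u \<in> ops i n" if "length u = Suc i" "sorted_wrt (\<le>) u" "set u \<subseteq> set e2" for u i
    using that iy sorted_map_ix[of u "set e2" iy] by (auto simp: ops_def)
  have "nat_on (cplx ?B) X g"
  proof (rule nat_onI)
    fix i j c assume "c \<in> cells (cplx ?B) i j"
    then show "g i j c \<in> cells X i j"
      using act_cells[OF bs x] ops1 ops2 by (cases c) (simp add: cells_cplx g_def)
  next
    fix i j p q \<theta> \<phi> c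
    assume *: "\<theta> \<in> ops p i" "\<phi> \<in> ops q j" "c \<in> cells (cplx ?B) i j"
    obtain u w where c: "c = (u, w)" by (cases c)
    have uw: "length u = Suc i" "sorted_wrt (\<le>) u" "set u \<subseteq> set e1" "length w = Suc j" "sorted_wrt (\<le>) w" "set w \<subseteq> set e2"
      using *(3) by (simp_all add: c cells_cplx)
    show "g p q (act (cplx ?B) i j \<theta> \<phi> c) = act X i j \<theta> \<phi> (g i j c)"
      using act_act[OF bs x ops1[OF uw(1-3)] ops2[OF uw(4-6)] *(1,2)] map_pick[OF *(1) uw(1), of ix]
        map_pick[OF *(2) uw(4), of iy]
      by (simp add: c g_def act_cplx)
  qed
  moreover have "g i j c = f i j c" if "c \<in> cells (cplx ?A) i j" for i j c
  proof -
    obtain u w where c: "c = (u, w)" by (cases c)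
    have uw: "length u = Suc i" "sorted_wrt (\<le>) u" "set u \<subseteq> set e1" "length w = Suc j" "sorted_wrt (\<le>) w" "set w \<subseteq> set e2"
      and h: "\<not> set e1 - {e1 ! k} \<subseteq> set u \<or> \<not> set e2 - {e2 ! l} \<subseteq> set w"
      using that unfolding c cells_cplx mem_Collect_eq case_prod_conv by blast+
    have 1: "\<not> {..m} - {k} \<subseteq> set (map ix u)" if "\<not> set e1 - {e1 ! k} \<subseteq> set u"
    proof -
      obtain v where v: "v \<in> set e1" "v \<noteq> e1 ! k" "v \<notin> set u" using \<open>\<not> set e1 - {e1 ! k} \<subseteq> set u\<close> by blast
      then have "ix v \<in> {..m} - {k}" using ix(1)[of v] by auto
      moreover have "ix v \<notin> set (map ix u)"
      proof
        assume "ix v \<in> set (map ix u)"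
        then obtain v' where "v' \<in> set u" "ix v' = ix v" by auto
        then show False using ix(1)[of v] ix(1)[of v'] v uw(3) by (metis subsetD)
      qed
      ultimately show ?thesis by blast
    qed
    have 2: "\<not> {..n} - {l} \<subseteq> set (map iy w)" if "\<not> set e2 - {e2 ! l} \<subseteq> set w"
    proof -
      obtain v where v: "v \<in> set e2" "v \<noteq> e2 ! l" "v \<notin> set w" using \<open>\<not> set e2 - {e2 ! l} \<subseteq> set w\<close> by blast
      then have "iy v \<in> {..n} - {l}" using iy(1)[of v] by auto
      moreover have "iy v \<notin> set (map iy w)"
      proof
        assume "iy v \<in> set (map iy w)"
        then obtain v' where "v' \<in> set w" "iy v' = iy v" by auto
        then show False using iy(1)[of v] iy(1)[of v'] v uw(6) by (metis subsetD)
      qed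
      ultimately show ?thesis by blast
    qed
    have "(map ix u, map iy w) \<in> cells (bihorn m n k l) i j"
      using h 1 2 ops1[OF uw(1-3)] ops2[OF uw(4-6)] by (auto simp: cells_bihorn)
    then have "g i j c = f i j (pick e1 (map ix u), pick e2 (map iy w))"
      using fx by (simp add: g_def c)
    moreover have "pick e1 (map ix u) = u" "pick e2 (map iy w) = w"
      using ix(1) iy(1) uw by (auto simp: pick_def subset_iff intro!: map_idI)
    ultimately show ?thesis by (simp add: c)
  qed
  ultimately show "\<exists>g. nat_on (cplx ?B) X g \<and> (\<forall>i j. \<forall>c \<in> cells (cplx ?A) i j. g i j c = f i j c)"
    by blast
qed

text \<open>A bisimplex on \<open>P\<close> and \<open>Q\<close> is glued along the bihorn that
  lacks the faces opposite to \<open>s\<close> and \<open>t\<close>; the last hypothesis says that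
  it meets \<open>\<A>\<close> in exactly this bihorn.\<close>

lemma extends_attach:
  fixes \<A> :: "('v::order set \<times> 'w::order set) set"
  assumes "kan X" "down_closed \<A>" "is_chain P" "is_chain Q" "s \<in> P" "t \<in> Q" "2 \<le> card P" "2 \<le> card Q"
    and mem: "\<And>S T. S \<noteq> {} \<Longrightarrow> T \<noteq> {} \<Longrightarrow> S \<subseteq> P \<Longrightarrow> T \<subseteq> Q \<Longrightarrow>
      (S, T) \<in> \<A> \<longleftrightarrow> \<not> P - {s} \<subseteq> S \<or> \<not> Q - {t} \<subseteq> T"
  shows "extends X \<A> (\<A> \<union> {(S, T). S \<noteq> {} \<and> T \<noteq> {} \<and> S \<subseteq> P \<and> T \<subseteq> Q})" (is "extends X \<A> (\<A> \<union> ?B)")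
proof (rule extends_glue[OF assms(2)])
  show "down_closed ?B" unfolding down_closed_def by auto
  obtain e1 where e1: "set e1 = P" "sorted_wrt (<) e1" using chain_list[OF assms(3)] by blast
  obtain e2 where e2: "set e2 = Q" "sorted_wrt (<) e2" using chain_list[OF assms(4)] by blast
  have d: "distinct e1" "distinct e2"
    using e1 e2 by (simp_all add: strict_sorted_iff distinct_conv_nth sorted_wrt_iff_nth_less)
      (metis nat_neq_iff order_less_irrefl)+
  have l: "length e1 = card P" "length e2 = card Q" using d e1 e2 by (metis distinct_card)+
  obtain k where k: "k < length e1" "e1 ! k = s" using assms(5) e1 by (metis in_set_conv_nth)
  obtain l where l': "l < length e2" "e2 ! l = t" using assms(6) e2 by (metis in_set_conv_nth)
  have "\<A> \<inter> ?B = {(S, T). S \<noteq> {} \<and> T \<noteq> {} \<and> S \<subseteq> P \<and> T \<subseteq> Q \<and> (\<not> P - {s} \<subseteq> S \<or> \<not> Q - {t} \<subseteq> T)}"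
    (is "_ = ?R")
  proof (rule Set.set_eqI)
    fix z :: "'v set \<times> 'w set"
    obtain S T where z: "z = (S, T)" by (cases z)
    show "z \<in> \<A> \<inter> ?B \<longleftrightarrow> z \<in> ?R" using mem[of S T] by (auto simp: z)
  qed
  then show "extends X (\<A> \<inter> ?B) ?B"
    using extends_bihorn_list[OF assms(1) e1(2) e2(2), of "card P - 1" "card Q - 1" k l] l l' k e1 e2 assms(7,8)
    by (simp add: less_Suc_eq_le[symmetric])
qed

section \<open>Products of horn fillings\<close>

definition complex :: "'v set set \<Rightarrow> bool" where
  "complex A \<longleftrightarrow> (\<forall>S\<in>A. S \<noteq> {}) \<and> (\<forall>S\<in>A. \<forall>S'\<subseteq>S. S' \<noteq> {} \<longrightarrow> S' \<in> A)"

lemma complexI: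
  assumes "\<And>S. S \<in> A \<Longrightarrow> S \<noteq> {}" "\<And>S S'. S \<in> A \<Longrightarrow> S' \<subseteq> S \<Longrightarrow> S' \<noteq> {} \<Longrightarrow> S' \<in> A"
  shows "complex A"
  unfolding complex_def
proof (intro conjI ballI allI impI)
  fix S S' assume "S \<in> A" "S' \<subseteq> S" "S' \<noteq> {}"
  then show "S' \<in> A" by (rule assms(2))
qed (rule assms(1))

lemma complexD: "complex A \<Longrightarrow> S \<in> A \<Longrightarrow> S' \<subseteq> S \<Longrightarrow> S' \<noteq> {} \<Longrightarrow> S' \<in> A"
  unfolding complex_def by (drule conjunct2, drule (1) bspec, drule spec, drule (1) mp, drule (1) mp)

lemma complex_nonempty: "complex A \<Longrightarrow> S \<in> A \<Longrightarrow> S \<noteq> {}"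
  unfolding complex_def by (elim conjE) (rule bspec)

text \<open>\<open>B\<close> arises from \<open>A\<close> by finitely many horn fillings, each of which adds a simplex \<open>P\<close> and its
  face \<open>P - {t}\<close>.\<close>

inductive anod :: "'v::order set set \<Rightarrow> 'v set set \<Rightarrow> bool" where
  refl: "anod B B"
| step: "is_chain P \<Longrightarrow> t \<in> P \<Longrightarrow> 2 \<le> card P \<Longrightarrow> P - {t} \<notin> A \<Longrightarrow>
    \<forall>s\<in>P - {t}. P - {s} \<in> A \<Longrightarrow> anod (A \<union> {P, P - {t}}) B \<Longrightarrow> anod A B"

lemma anod_subset: "anod A B \<Longrightarrow> A \<subseteq> B"
  by (induction rule: anod.induct) auto

lemma diff_singleton_nonempty: "2 \<le> card P \<Longrightarrow> P - {t} \<noteq> {}"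
proof
  assume *: "2 \<le> card P" "P - {t} = {}"
  then have "P \<subseteq> {t}" by auto
  then show False using *(1) card_mono[of "{t}" P] by simp
qed

text \<open>The two conditions on the faces of \<open>P\<close> say that \<open>A\<close> meets the
  simplex \<open>P\<close> in the horn that lacks the face opposite to \<open>t\<close>: a set that
  misses some \<open>s \<noteq> t\<close> lies in the face \<open>P - {s}\<close>, and any other set
  contains \<open>P - {t}\<close>.\<close>

lemma fill_mem:
  assumes "complex A" "t \<in> P" "2 \<le> card P" "P - {t} \<notin> A" "\<forall>s\<in>P - {t}. P - {s} \<in> A"
    and "S \<noteq> {}" "S \<subseteq> P"
  shows "S \<in> A \<longleftrightarrow> \<not> P - {t} \<subseteq> S"
proof
  assume "S \<in> A"
  show "\<not> P - {t} \<subseteq> S"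
  proof
    assume "P - {t} \<subseteq> S"
    moreover have "P - {t} \<noteq> {}" by (rule diff_singleton_nonempty[OF assms(3)])
    ultimately have "P - {t} \<in> A" using complexD[OF assms(1) \<open>S \<in> A\<close>] by simp
    then show False using assms(4) by blast
  qed
next
  assume "\<not> P - {t} \<subseteq> S"
  then obtain s where s: "s \<in> P - {t}" "s \<notin> S" by blast
  then have "S \<subseteq> P - {s}" using assms(7) by blast
  then show "S \<in> A" using complexD[OF assms(1) bspec[OF assms(5) s(1)] _ assms(6)] by simp
qed

lemma complex_fill:
  assumes "complex A" "t \<in> P" "2 \<le> card P" "P - {t} \<notin> A" "\<forall>s\<in>P - {t}. P - {s} \<in> A"
  shows "complex (A \<union> {P, P - {t}})"
proof (rule complexI)
  fix S assume "S \<in> A \<union> {P, P - {t}}"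
  then consider "S \<in> A" | "S = P" | "S = P - {t}" by auto
  then show "S \<noteq> {}"
  proof cases
    case 1
    then show ?thesis by (rule complex_nonempty[OF assms(1)])
  next
    case 2
    then show ?thesis using assms(2) by auto
  next
    case 3
    then show ?thesis using diff_singleton_nonempty[OF assms(3)] by simp
  qed
next
  fix S S' assume *: "S \<in> A \<union> {P, P - {t}}" "S' \<subseteq> S" "S' \<noteq> {}"
  show "S' \<in> A \<union> {P, P - {t}}"
  proof (cases "S \<in> A")
    case True
    then show ?thesis using complexD[OF assms(1) _ *(2,3)] by simp
  next
    case False
    then have "S' \<subseteq> P" using * by blast
    then have "S' \<in> A \<or> P - {t} \<subseteq> S'" using fill_mem[OF assms *(3)] by simp
    then show ?thesis using \<open>S' \<subseteq> P\<close> by blast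
  qed
qed

lemma complex_anod: "anod A B \<Longrightarrow> complex A \<Longrightarrow> complex B"
proof (induction rule: anod.induct)
  case (step P t A B)
  show ?case by (rule step.IH[OF complex_fill[OF step.prems step.hyps(2-5)]])
qed

lemma down_closed_Times: "complex A \<Longrightarrow> complex B \<Longrightarrow> down_closed (A \<times> B)"
  unfolding down_closed_def
proof (intro allI impI)
  fix S T S' T' assume "complex A" "complex B" "(S, T) \<in> A \<times> B" "S' \<subseteq> S" "T' \<subseteq> T" "S' \<noteq> {}" "T' \<noteq> {}"
  then show "(S', T') \<in> A \<times> B" using complexD[of A S S'] complexD[of B T T'] by blast
qed

lemma down_closed_Un: "down_closed A \<Longrightarrow> down_closed B \<Longrightarrow> down_closed (A \<union> B)"
  unfolding down_closed_def
proof (intro allI impI)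
  fix S T S' T'
  assume A: "\<forall>S T S' T'. (S, T) \<in> A \<longrightarrow> S' \<subseteq> S \<longrightarrow> T' \<subseteq> T \<longrightarrow> S' \<noteq> {} \<longrightarrow> T' \<noteq> {} \<longrightarrow> (S', T') \<in> A"
    and B: "\<forall>S T S' T'. (S, T) \<in> B \<longrightarrow> S' \<subseteq> S \<longrightarrow> T' \<subseteq> T \<longrightarrow> S' \<noteq> {} \<longrightarrow> T' \<noteq> {} \<longrightarrow> (S', T') \<in> B"
    and *: "(S, T) \<in> A \<union> B" "S' \<subseteq> S" "T' \<subseteq> T" "S' \<noteq> {}" "T' \<noteq> {}"
  show "(S', T') \<in> A \<union> B"
    using * A[rule_format, of S T S' T'] B[rule_format, of S T S' T'] by auto
qed

text \<open>The product of one horn filling with a composite of horn fillings. Each filling of some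
  \<open>Q\<close> in the second factor combines with that of \<open>P\<close> in the first to a
  single bihorn filling, since over \<open>A\<close> everything is present already.\<close>

lemma extends_product_step:
  fixes A :: "'v::order set set" and A2 :: "'w::order set set"
  assumes X: "kan X" and P: "is_chain P" "t \<in> P" "2 \<le> card P" "P - {t} \<notin> A"
      "\<forall>s\<in>P - {t}. P - {s} \<in> A"
    and A: "complex A" and "anod A2 B2" "complex A2"
  shows "extends X (A \<times> B2 \<union> (A \<union> {P, P - {t}}) \<times> A2) ((A \<union> {P, P - {t}}) \<times> B2)"
  using assms(8,9)
proof (induction rule: anod.induct)
  case (refl B)
  have "A \<times> B \<union> (A \<union> {P, P - {t}}) \<times> B = (A \<union> {P, P - {t}}) \<times> B" by auto
  then show ?case by (simp only: extends_refl)
next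
  case (step Q u A2 B2)
  let ?A = "A \<union> {P, P - {t}}" and ?A2 = "A2 \<union> {Q, Q - {u}}"
  have c: "complex ?A" using complex_fill[OF A P(2-5)] .
  have c2: "complex ?A2" using complex_fill[OF step.prems step.hyps(2-5)] .
  have B2: "complex B2" using complex_anod[OF step.hyps(6) c2] .
  have sub: "?A2 \<subseteq> B2" using anod_subset[OF step.hyps(6)] .
  have IH: "extends X (A \<times> B2 \<union> ?A \<times> ?A2) (?A \<times> B2)" using step.IH c2 by blast
  have dc: "down_closed (A \<times> B2 \<union> ?A \<times> A2)"
    by (intro down_closed_Un down_closed_Times A B2 c step.prems)
  have pow: "S \<in> ?A" if "S \<noteq> {}" "S \<subseteq> P" for S using complexD[OF c _ that(2,1)] by simp
  have pow2: "T \<in> ?A2" if "T \<noteq> {}" "T \<subseteq> Q" for T using complexD[OF c2 _ that(2,1)] by simp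
  \<comment> \<open>All subsets of \<open>P\<close> lie in \<open>?A\<close> and all subsets of
    \<open>Q\<close> in \<open>B2\<close>, so a pair is present as soon as one of its members lies
    in the horn of its factor. This is the bihorn.\<close>
  have mem: "(S, T) \<in> A \<times> B2 \<union> ?A \<times> A2 \<longleftrightarrow> \<not> P - {t} \<subseteq> S \<or> \<not> Q - {u} \<subseteq> T"
    if "S \<noteq> {}" "T \<noteq> {}" "S \<subseteq> P" "T \<subseteq> Q" for S T
  proof -
    have "S \<in> A \<longleftrightarrow> \<not> P - {t} \<subseteq> S" using fill_mem[OF A P(2-5) that(1,3)] .
    moreover have "T \<in> A2 \<longleftrightarrow> \<not> Q - {u} \<subseteq> T" using fill_mem[OF step.prems step.hyps(2-5) that(2,4)] .
    ultimately show ?thesis using pow[OF that(1,3)] pow2[OF that(2,4)] sub by blast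
  qed
  have "extends X (A \<times> B2 \<union> ?A \<times> A2)
      (A \<times> B2 \<union> ?A \<times> A2 \<union> {(S, T). S \<noteq> {} \<and> T \<noteq> {} \<and> S \<subseteq> P \<and> T \<subseteq> Q})"
    by (rule extends_attach[OF X dc P(1) step.hyps(1) P(2) step.hyps(2) P(3) step.hyps(3) mem])
  moreover have "A \<times> B2 \<union> ?A \<times> A2 \<union> {(S, T). S \<noteq> {} \<and> T \<noteq> {} \<and> S \<subseteq> P \<and> T \<subseteq> Q} = A \<times> B2 \<union> ?A \<times> ?A2"
    (is "?L = ?R")
  proof
    show "?L \<subseteq> ?R"
    proof
      fix z assume "z \<in> ?L"
      then consider "z \<in> A \<times> B2 \<union> ?A \<times> A2"
        | S T where "z = (S, T)" "S \<noteq> {}" "T \<noteq> {}" "S \<subseteq> P" "T \<subseteq> Q" by blast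
      then show "z \<in> ?R"
      proof cases
        case 1
        then show ?thesis by blast
      next
        case (2 S T)
        then have "z \<in> ?A \<times> ?A2" using pow[of S] pow2[of T] by (simp del: Un_iff Un_insert_right)
        then show ?thesis by blast
      qed
    qed
    have "P \<noteq> {}" "Q \<noteq> {}" "P - {t} \<noteq> {}" "Q - {u} \<noteq> {}"
      using diff_singleton_nonempty[OF P(3)] diff_singleton_nonempty[OF step.hyps(3)] by auto
    then have "{P, P - {t}} \<times> {Q, Q - {u}} \<subseteq> {(S, T). S \<noteq> {} \<and> T \<noteq> {} \<and> S \<subseteq> P \<and> T \<subseteq> Q}"
      by auto
    moreover have "A \<times> ?A2 \<subseteq> A \<times> B2" using sub by auto
    ultimately show "?R \<subseteq> ?L" by blast
  qed
  ultimately have "extends X (A \<times> B2 \<union> ?A \<times> A2) (A \<times> B2 \<union> ?A \<times> ?A2)" by simp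
  then show ?case by (rule extends_trans[OF _ IH]) blast
qed

text \<open>The fillings of the first factor are carried out one at a time. The stage after one of
  them is \<open>?A \<times> B2 \<union> B1 \<times> A2\<close>, and the intersection computed in
  \<open>eq\<close> is the source of \<open>extends_product_step\<close>.\<close>

theorem extends_product:
  fixes A1 :: "'v::order set set" and A2 :: "'w::order set set"
  assumes "kan X" "anod A1 B1" "complex A1" "anod A2 B2" "complex A2"
  shows "extends X (A1 \<times> B2 \<union> B1 \<times> A2) (B1 \<times> B2)"
  using assms(2,3)
proof (induction rule: anod.induct)
  case (refl B)
  have "B \<times> B2 \<union> B \<times> A2 = B \<times> B2" using anod_subset[OF assms(4)] by blast
  then show ?case by (simp only: extends_refl)
next
  case (step P t A B1)
  let ?A = "A \<union> {P, P - {t}}"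
  have c: "complex ?A" using complex_fill[OF step.prems step.hyps(2-5)] .
  have B2: "complex B2" using complex_anod[OF assms(4,5)] .
  have B1: "complex B1" using complex_anod[OF step.hyps(6) c] .
  have sub: "?A \<subseteq> B1" "A2 \<subseteq> B2" using anod_subset[OF step.hyps(6)] anod_subset[OF assms(4)] .
  have eq: "(A \<times> B2 \<union> B1 \<times> A2) \<inter> (?A \<times> B2) = A \<times> B2 \<union> ?A \<times> A2" using sub by blast
  have "extends X (A \<times> B2 \<union> B1 \<times> A2) ((A \<times> B2 \<union> B1 \<times> A2) \<union> ?A \<times> B2)"
  proof (rule extends_glue)
    show "extends X ((A \<times> B2 \<union> B1 \<times> A2) \<inter> (?A \<times> B2)) (?A \<times> B2)"
      unfolding eq by (rule extends_product_step[OF assms(1) step.hyps(1-5) step.prems assms(4,5)])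
  qed (intro down_closed_Un down_closed_Times step.prems B2 B1 assms(5) c)+
  moreover have "(A \<times> B2 \<union> B1 \<times> A2) \<union> ?A \<times> B2 = ?A \<times> B2 \<union> B1 \<times> A2" by blast
  ultimately have "extends X (A \<times> B2 \<union> B1 \<times> A2) (?A \<times> B2 \<union> B1 \<times> A2)" by simp
  then show ?case by (rule extends_trans[OF _ step.IH[OF c]]) blast
qed

section \<open>Matchings on the chains of a prism\<close>

lemma wf_lex_min:
  fixes f :: "'b \<Rightarrow> nat \<times> nat"
  assumes "x \<in> Q"
  obtains z where "z \<in> Q" "\<And>y. y \<in> Q \<Longrightarrow> \<not> (fst (f y) < fst (f z) \<or> fst (f y) = fst (f z) \<and> snd (f y) < snd (f z))"
proof -
  have "wf (inv_image (less_than <*lex*> less_than) f)" by (intro wf_inv_image wf_lex_prod wf_less_than)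
  from wfE_min[OF this assms] obtain z where z: "z \<in> Q"
    "\<And>y. (y, z) \<in> inv_image (less_than <*lex*> less_than) f \<Longrightarrow> y \<notin> Q" by blast
  show thesis
  proof (rule that[OF z(1)])
    fix y assume "y \<in> Q"
    then have "(y, z) \<notin> inv_image (less_than <*lex*> less_than) f" using z(2) by blast
    then show "\<not> (fst (f y) < fst (f z) \<or> fst (f y) = fst (f z) \<and> snd (f y) < snd (f z))"
      by (cases "f y"; cases "f z") (auto simp: inv_image_def)
  qed
qed

text \<open>Toggling the vertex \<open>t U\<close> matches the simplices outside \<open>A\<close> in pairs; each pair is a horn
  filling, in the order given by cardinality and then by \<open>\<rho>\<close>.\<close>

lemma anod_matching:
  fixes A B :: "'v::order set set" and t :: "'v set \<Rightarrow> 'v" and \<rho> :: "'v \<Rightarrow> nat"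
  assumes "A \<subseteq> B" "finite (B - A)"
    and B: "\<And>U. U \<in> B \<Longrightarrow> is_chain U \<and> U \<noteq> {}"
    and tog: "\<And>U. U \<in> B - A \<Longrightarrow> insert (t U) U \<in> B - A \<and> t (insert (t U) U) = t U \<and>
        U - {t U} \<in> B - A \<and> t (U - {t U}) = t U"
    and face: "\<And>U s. U \<in> B - A \<Longrightarrow> t U \<in> U \<Longrightarrow> s \<in> U \<Longrightarrow> s \<noteq> t U \<Longrightarrow>
        U - {s} \<in> A \<or> U - {s} \<in> B - A \<and> (t (U - {s}) \<in> U - {s} \<or> \<rho> (t (U - {s})) < \<rho> (t U))"
  shows "anod A B"
proof -
  define T where "T = {U \<in> B - A. t U \<in> U}"
  define h where "h U = U - {t U}" for U
  have finT: "finite T" by (rule finite_subset[OF _ assms(2)]) (auto simp: T_def)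
  \<comment> \<open>\<open>T\<close> consists of the upper members of the pairs, \<open>h\<close>
    gives the lower members, and \<open>R\<close> stands for the pairs added so far.
    \<open>R\<close> may be any subset of \<open>T\<close>, because the next pair is chosen minimal
    among all that remain.\<close>
  have "anod (A \<union> R \<union> h ` R) B" if "R \<subseteq> T" for R
    using that
  proof (induction "card (T - R)" arbitrary: R)
    case 0
    then have "T - R = {}" using finT by simp
    then have RT: "R = T" using 0 by auto
    have "A \<union> T \<union> h ` T = B"
    proof
      have "h U \<in> B" if "U \<in> T" for U using tog[of U] that by (simp add: T_def h_def)
      moreover have "T \<subseteq> B" by (auto simp: T_def)
      ultimately show "A \<union> T \<union> h ` T \<subseteq> B" using assms(1) by auto
      show "B \<subseteq> A \<union> T \<union> h ` T"
      proof
        fix U assume "U \<in> B"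
        show "U \<in> A \<union> T \<union> h ` T"
        proof (cases "U \<in> A \<or> t U \<in> U")
          case True
          then show ?thesis using \<open>U \<in> B\<close> by (auto simp: T_def)
        next
          case False
          then have U: "U \<in> B - A" "t U \<notin> U" using \<open>U \<in> B\<close> by auto
          then have "insert (t U) U \<in> T" "h (insert (t U) U) = U" using tog[OF U(1)] by (auto simp: T_def h_def)
          then show ?thesis by (metis UnI2 imageI)
        qed
      qed
    qed
    then show ?case using RT anod.refl by metis
  next
    case (Suc n)
    then have "T - R \<noteq> {}" by auto
    then obtain U0 where "U0 \<in> T - R" by blast
    from wf_lex_min[OF this, of "\<lambda>U. (card U, \<rho> (t U))"]
    obtain U where U: "U \<in> T - R" and min: "\<And>W. W \<in> T - R \<Longrightarrow>
        \<not> (card W < card U \<or> card W = card U \<and> \<rho> (t W) < \<rho> (t U))" by auto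
    have UB: "U \<in> B - A" "t U \<in> U" using U by (auto simp: T_def)
    have finU: "finite U" using B UB(1) by (auto simp: is_chain_def)
    show ?case
    proof (rule anod.step[of U "t U"])
      show "is_chain U" using B UB by auto
      show "t U \<in> U" by (rule UB(2))
      have "U - {t U} \<noteq> {}" using tog[OF UB(1)] B by blast
      then have "card (U - {t U}) \<noteq> 0" using finU by auto
      then show "2 \<le> card U" using UB(2) finU by simp
      \<comment> \<open>The lower member was not added before: it is not an upper member, since its
        toggled vertex \<open>t U\<close> is missing from it, and it is the lower member of
        \<open>U\<close> only.\<close>
      show "U - {t U} \<notin> A \<union> R \<union> h ` R"
      proof
        assume "U - {t U} \<in> A \<union> R \<union> h ` R"
        then consider "U - {t U} \<in> A" | "U - {t U} \<in> R" | W where "W \<in> R" "U - {t U} = h W" by blast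
        then show False
        proof cases
          case 1
          then show ?thesis using tog[OF UB(1)] by blast
        next
          case 2
          then have "t (U - {t U}) \<in> U - {t U}" using Suc.prems by (auto simp: T_def)
          then show ?thesis using tog[OF UB(1)] by auto
        next
          case (3 W)
          have W: "W \<in> B - A" "t W \<in> W" using 3 Suc.prems by (auto simp: T_def)
          have "t U = t W" using tog[OF UB(1)] tog[OF W(1)] 3(2) by (auto simp: h_def)
          then have "U = W" using 3(2) W(2) UB(2) by (auto simp: h_def)
          then show ?thesis using 3(1) U by blast
        qed
      qed
      show "\<forall>s\<in>U - {t U}. U - {s} \<in> A \<union> R \<union> h ` R"
      proof
        fix s assume s: "s \<in> U - {t U}"
        let ?W = "U - {s}"
        have cW: "Suc (card ?W) = card U" by (rule card_Suc_Diff1) (use s finU in auto)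
        from face[OF UB, of s] s consider "?W \<in> A" | "?W \<in> B - A" "t ?W \<in> ?W"
          | "?W \<in> B - A" "t ?W \<notin> ?W" "\<rho> (t ?W) < \<rho> (t U)" by blast
        then show "?W \<in> A \<union> R \<union> h ` R"
        proof cases
          case 1
          then show ?thesis by blast
        next
          case 2
          then have "?W \<in> T" by (simp add: T_def)
          then show ?thesis using min[of ?W] cW by auto
        next
          case 3
          \<comment> \<open>A face \<open>?W\<close> that is a lower member is added together with
            its upper member \<open>?V\<close>. The latter has as many elements as \<open>U\<close>
            but a smaller \<open>\<rho>\<close>, so by minimality of \<open>U\<close> it is in
            \<open>R\<close>.\<close>
          let ?V = "insert (t ?W) ?W"
          have V: "?V \<in> T" "t ?V = t ?W" using tog[OF 3(1)] by (auto simp: T_def)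
          have "card ?V = card U" using cW 3(2) finU by simp
          then have "?V \<in> R" using min[of ?V] V 3(3) by auto
          moreover have "h ?V = ?W" unfolding h_def V(2) using 3(2) by auto
          ultimately show ?thesis by (metis UnI2 imageI)
        qed
      qed
      have "T - insert U R = (T - R) - {U}" by blast
      then have "card (T - insert U R) = n" using Suc.hyps(2) U finT by (simp add: card_Diff_singleton)
      then have "anod (A \<union> insert U R \<union> h ` insert U R) B" using Suc.hyps(1)[of "insert U R"] U Suc.prems by auto
      moreover have "A \<union> insert U R \<union> h ` insert U R = A \<union> R \<union> h ` R \<union> {U, U - {t U}}"
        by (auto simp: h_def)
      ultimately show "anod (A \<union> R \<union> h ` R \<union> {U, U - {t U}}) B" by simp
    qed
  qed
  from this[of "{}"] show ?thesis by simp
qed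

text \<open>With the product order on pairs, a chain in \<open>S \<times> {..p}\<close> is a
  nondegenerate simplex of the product of the simplex on \<open>S\<close> with Delta[p].\<close>

definition prism :: "nat set \<Rightarrow> nat \<Rightarrow> (nat \<times> nat) set set" where
  "prism S p = {U. U \<noteq> {} \<and> is_chain U \<and> fst ` U \<subseteq> S \<and> snd ` U \<subseteq> {..p}}"

text \<open>The union of (boundary of the simplex on \<open>S\<close>) x Delta[p] and (simplex on
  \<open>S\<close>) x (horn of Delta[p] for \<open>k\<close>).\<close>

definition prism_horn :: "nat set \<Rightarrow> nat \<Rightarrow> nat \<Rightarrow> (nat \<times> nat) set set" where
  "prism_horn S p k = {U \<in> prism S p. fst ` U \<noteq> S \<or> \<not> {..p} - {k} \<subseteq> snd ` U}"

lemma is_chain_subset: "is_chain S \<Longrightarrow> T \<subseteq> S \<Longrightarrow> is_chain T"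
  by (auto simp: is_chain_def intro: finite_subset)

lemma is_chain_insert:
  fixes t :: "'v::order"
  assumes "is_chain U" "\<And>u. u \<in> U \<Longrightarrow> u \<le> t \<or> t \<le> u"
  shows "is_chain (insert t U)"
  using assms unfolding is_chain_def by auto

lemma complex_prism: "complex (prism S p)"
proof (rule complexI)
  fix U V assume "U \<in> prism S p" "V \<subseteq> U" "V \<noteq> {}"
  then show "V \<in> prism S p"
    unfolding prism_def mem_Collect_eq by (meson image_mono is_chain_subset order_trans)
qed (simp add: prism_def)

lemma complex_prism_horn: "complex (prism_horn S p k)"
proof (rule complexI)
  fix U V assume *: "U \<in> prism_horn S p k" "V \<subseteq> U" "V \<noteq> {}"
  then have V: "V \<in> prism S p" using complexD[OF complex_prism, of U S p V] by (simp add: prism_horn_def)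
  have "fst ` V \<subseteq> fst ` U" "snd ` V \<subseteq> snd ` U" "fst ` U \<subseteq> S" using * by (auto simp: prism_horn_def prism_def)
  then show "V \<in> prism_horn S p k" using *(1) V unfolding prism_horn_def mem_Collect_eq by blast
qed (simp add: prism_horn_def prism_def)

text \<open>The toggled vertex is \<open>(i, k)\<close> where \<open>(i, k - 1)\<close> is the last vertex over \<open>k - 1\<close>, or, when
  \<open>k = 0\<close>, where \<open>(i, 1)\<close> is the first vertex over \<open>1\<close>.\<close>

lemma anod_prism:
  assumes S: "finite S" and p: "1 \<le> p" and k: "k \<le> p"
  shows "anod (prism_horn S p k) (prism S p)"
proof -
  \<comment> \<open>A neighbour of \<open>k\<close>, taken below it if possible. A chain outside
    \<open>prism_horn\<close> has a vertex over it, and no second coordinate lies strictly between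
    \<open>k'\<close> and \<open>k\<close>, so inserting \<open>(i0 U, k)\<close> leaves a
    chain.\<close>
  define k' where "k' = (if k = 0 then 1 else k - 1)"
  define I where "I U = {i. (i, k') \<in> U}" for U :: "(nat \<times> nat) set"
  define i0 where "i0 U = (if k = 0 then Min (I U) else Max (I U))" for U
  define t where "t U = (i0 U, k)" for U
  \<comment> \<open>Removing a vertex can only move the extremal index inwards: the maximum drops
    for \<open>k > 0\<close>, the minimum grows for \<open>k = 0\<close>. In both cases
    \<open>\<rho>\<close> decreases unless the index stays where it is.\<close>
  define \<rho> where "\<rho> x = (if k = 0 then Max S - fst x else fst x)" for x :: "nat \<times> nat"
  have kk: "k' \<noteq> k" "k' \<le> p" using p k by (auto simp: k'_def)
  let ?D = "prism S p - prism_horn S p k"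
  have D: "U \<in> ?D \<longleftrightarrow> U \<noteq> {} \<and> is_chain U \<and> fst ` U = S \<and> snd ` U \<subseteq> {..p} \<and> {..p} - {k} \<subseteq> snd ` U" for U
    by (auto simp: prism_def prism_horn_def)
  have I: "finite (I U)" "I U \<noteq> {}" if "is_chain U" "{..p} - {k} \<subseteq> snd ` U" for U
  proof -
    have "I U \<subseteq> fst ` U" by (force simp: I_def)
    then show "finite (I U)" using that(1) by (auto simp: is_chain_def intro: finite_subset)
    have "k' \<in> snd ` U" using that(2) kk by auto
    then show "I U \<noteq> {}" by (auto simp: I_def)
  qed
  have i0: "(i0 U, k') \<in> U" "\<And>i. (i, k') \<in> U \<Longrightarrow> if k = 0 then i0 U \<le> i else i \<le> i0 U"
    if "is_chain U" "{..p} - {k} \<subseteq> snd ` U" for U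
  proof -
    have "i0 U \<in> I U" using I[OF that] by (simp add: i0_def)
    then show "(i0 U, k') \<in> U" by (simp add: I_def)
    fix i assume "(i, k') \<in> U"
    then have "i \<in> I U" by (simp add: I_def)
    then show "if k = 0 then i0 U \<le> i else i \<le> i0 U" using I(1)[OF that] by (simp add: i0_def)
  qed
  show ?thesis
  proof (rule anod_matching[where t = t and \<rho> = \<rho>])
    show "prism_horn S p k \<subseteq> prism S p" by (auto simp: prism_horn_def)
    have "prism S p \<subseteq> Pow (S \<times> {..p})" by (force simp: prism_def)
    then show "finite (prism S p - prism_horn S p k)" using S by (meson finite_Diff finite_Pow_iff finite_SigmaI finite_atMost finite_subset)
    show "is_chain U \<and> U \<noteq> {}" if "U \<in> prism S p" for U using that by (simp add: prism_def)
  next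
    fix U assume U: "U \<in> ?D"
    then have *: "is_chain U" "{..p} - {k} \<subseteq> snd ` U" "fst ` U = S" "snd ` U \<subseteq> {..p}" using D by auto
    have cmp: "(x, y) \<le> (i0 U, k) \<or> (i0 U, k) \<le> (x, y)" if "(x, y) \<in> U" for x y
    proof -
      have "(x, y) \<le> (i0 U, k') \<or> (i0 U, k') \<le> (x, y)"
        using *(1) that i0(1)[OF *(1,2)] unfolding is_chain_def by blast
      moreover have "y = k' \<Longrightarrow> if k = 0 then i0 U \<le> x else x \<le> i0 U" using i0(2)[OF *(1,2)] that by blast
      ultimately show ?thesis by (cases "k = 0") (auto simp: k'_def le_Suc_eq)
    qed
    have mem: "i0 U \<in> S" using i0(1)[OF *(1,2)] *(3) by force
    have "is_chain (insert (t U) U)"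
      by (rule is_chain_insert[OF *(1)]) (use cmp in \<open>simp only: t_def split_paired_Ball_Sigma split_paired_all\<close>)
    then have 1: "insert (t U) U \<in> ?D" using D * mem k by (auto simp: t_def)
    \<comment> \<open>The vertex \<open>(i0 U, k')\<close> remains and has the same first coordinate
      as the one that is removed.\<close>
    have "fst ` (U - {t U}) = S"
    proof
      show "fst ` (U - {t U}) \<subseteq> S" using *(3) by auto
      show "S \<subseteq> fst ` (U - {t U})"
      proof
        fix i assume "i \<in> S"
        then obtain y where y: "(i, y) \<in> U" using *(3) by force
        show "i \<in> fst ` (U - {t U})"
        proof (cases "(i, y) = t U")
          case True
          then have "(i, k') \<in> U - {t U}" using i0(1)[OF *(1,2)] kk by (simp add: t_def)
          then show ?thesis by force
        next
          case False
          then show ?thesis using y by force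
        qed
      qed
    qed
    moreover have "{..p} - {k} \<subseteq> snd ` (U - {t U})"
    proof
      fix y assume "y \<in> {..p} - {k}"
      then obtain x where "(x, y) \<in> U" "y \<noteq> k" using *(2) by force
      then have "(x, y) \<in> U - {t U}" by (simp add: t_def)
      then show "y \<in> snd ` (U - {t U})" by force
    qed
    moreover have "U - {t U} \<noteq> {}" using i0(1)[OF *(1,2)] kk by (auto simp: t_def)
    ultimately have 2: "U - {t U} \<in> ?D" using D * is_chain_subset[OF *(1), of "U - {t U}"] by auto
    have I_tog: "I (insert (t U) U) = I U" "I (U - {t U}) = I U" using kk by (auto simp: I_def t_def)
    have t_cong: "t V = t U" if "I V = I U" for V using that by (simp add: t_def i0_def)
    have 3: "t (insert (t U) U) = t U" "t (U - {t U}) = t U" by (rule t_cong, rule I_tog)+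
    show "insert (t U) U \<in> ?D \<and> t (insert (t U) U) = t U \<and> U - {t U} \<in> ?D \<and> t (U - {t U}) = t U"
      by (intro conjI 1 2 3)
  next
    fix U s assume U: "U \<in> ?D" "t U \<in> U" "s \<in> U" "s \<noteq> t U"
    then have *: "is_chain U" "{..p} - {k} \<subseteq> snd ` U" "fst ` U = S" "snd ` U \<subseteq> {..p}" using D by auto
    let ?W = "U - {s}"
    have "?W \<in> prism S p" using complexD[OF complex_prism, of U S p ?W] U by auto
    moreover have "t ?W \<in> ?W \<or> \<rho> (t ?W) < \<rho> (t U)" if "?W \<in> ?D"
    proof -
      have W: "is_chain ?W" "{..p} - {k} \<subseteq> snd ` ?W" using that D by auto
      have a: "(i0 ?W, k') \<in> U" using i0(1)[OF W] by blast
      show ?thesis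
      proof (cases "i0 ?W = i0 U")
        case True
        then show ?thesis using U by (simp add: t_def)
      next
        case False
        have "i0 ?W \<in> S" using a *(3) by force
        then have "i0 ?W \<le> Max S" using S by simp
        then show ?thesis using False i0(2)[OF *(1,2) a] by (cases "k = 0") (auto simp: \<rho>_def t_def)
      qed
    qed
    ultimately show "?W \<in> prism_horn S p k \<or> ?W \<in> ?D \<and> (t ?W \<in> ?W \<or> \<rho> (t ?W) < \<rho> (t U))"
      by blast
  qed
qed

text \<open>The product of the bisimplicial set with vertex sets in \<open>\<Q>\<close> and
  Delta[p,q]. A cell is a pair of chains of pairs: the first coordinates belong to the factor
  described by \<open>\<Q>\<close>, the second ones to Delta[p,q].\<close>

definition full_cells :: "(nat set \<times> nat set) set \<Rightarrow> nat \<Rightarrow> nat \<Rightarrow> ((nat \<times> nat) set \<times> (nat \<times> nat) set) set" where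
  "full_cells \<Q> p q = {(U, V). is_chain U \<and> is_chain V \<and> U \<noteq> {} \<and> V \<noteq> {} \<and>
     (fst ` U, fst ` V) \<in> \<Q> \<and> snd ` U \<subseteq> {..p} \<and> snd ` V \<subseteq> {..q}}"

text \<open>The union of \<open>\<P>\<close> x Delta[p,q] and \<open>\<Q>\<close> x (bihorn), a
  pushout product of two inclusions.\<close>

definition part_cells ::
    "(nat set \<times> nat set) set \<Rightarrow> (nat set \<times> nat set) set \<Rightarrow> nat \<Rightarrow> nat \<Rightarrow> nat \<Rightarrow> nat \<Rightarrow>
     ((nat \<times> nat) set \<times> (nat \<times> nat) set) set" where
  "part_cells \<P> \<Q> p q k l = {(U, V) \<in> full_cells \<Q> p q. (fst ` U, fst ` V) \<in> \<P> \<or>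
     \<not> {..p} - {k} \<subseteq> snd ` U \<or> \<not> {..q} - {l} \<subseteq> snd ` V}"

lemma down_closedD:
  "down_closed \<K> \<Longrightarrow> (S, T) \<in> \<K> \<Longrightarrow> S' \<subseteq> S \<Longrightarrow> T' \<subseteq> T \<Longrightarrow> S' \<noteq> {} \<Longrightarrow> T' \<noteq> {} \<Longrightarrow> (S', T') \<in> \<K>"
  unfolding down_closed_def
  by (drule spec[of _ S], drule spec[of _ T], drule spec[of _ S'], drule spec[of _ T'])
    (drule (1) mp, drule (1) mp, drule (1) mp, drule (1) mp, drule (1) mp)

lemma down_closedI:
  assumes "\<And>S T S' T'. (S, T) \<in> \<K> \<Longrightarrow> S' \<subseteq> S \<Longrightarrow> T' \<subseteq> T \<Longrightarrow> S' \<noteq> {} \<Longrightarrow> T' \<noteq> {} \<Longrightarrow> (S', T') \<in> \<K>"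
  shows "down_closed \<K>"
  unfolding down_closed_def
proof (intro allI impI)
  fix S T S' T' assume "(S, T) \<in> \<K>" "S' \<subseteq> S" "T' \<subseteq> T" "S' \<noteq> {}" "T' \<noteq> {}"
  then show "(S', T') \<in> \<K>" by (rule assms)
qed

lemma down_closed_part:
  assumes "down_closed \<P>" "down_closed \<Q>"
  shows "down_closed (part_cells \<P> \<Q> p q k l)"
proof (rule down_closedI)
  fix U V U' V'
  assume *: "(U, V) \<in> part_cells \<P> \<Q> p q k l" "U' \<subseteq> U" "V' \<subseteq> V" "U' \<noteq> {}" "V' \<noteq> {}"
  have i: "fst ` U' \<subseteq> fst ` U" "fst ` V' \<subseteq> fst ` V" "snd ` U' \<subseteq> snd ` U" "snd ` V' \<subseteq> snd ` V"
      "fst ` U' \<noteq> {}" "fst ` V' \<noteq> {}" using * by auto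
  have c: "is_chain U'" "is_chain V'"
    using * is_chain_subset[of U U'] is_chain_subset[of V V'] by (auto simp: part_cells_def full_cells_def)
  show "(U', V') \<in> part_cells \<P> \<Q> p q k l"
  proof -
    from *(1) have Q: "(fst ` U, fst ` V) \<in> \<Q>" and s: "snd ` U \<subseteq> {..p}" "snd ` V \<subseteq> {..q}"
      and h: "(fst ` U, fst ` V) \<in> \<P> \<or> \<not> {..p} - {k} \<subseteq> snd ` U \<or> \<not> {..q} - {l} \<subseteq> snd ` V"
      by (simp_all add: part_cells_def full_cells_def)
    have "(fst ` U', fst ` V') \<in> \<Q>" by (rule down_closedD[OF assms(2) Q i(1,2,5,6)])
    moreover have "snd ` U' \<subseteq> {..p}" "snd ` V' \<subseteq> {..q}" using i(3,4) s by (meson order_trans)+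
    moreover have "(fst ` U', fst ` V') \<in> \<P> \<or> \<not> {..p} - {k} \<subseteq> snd ` U' \<or> \<not> {..q} - {l} \<subseteq> snd ` V'"
      using h
    proof (elim disjE)
      assume "(fst ` U, fst ` V) \<in> \<P>"
      then show ?thesis using down_closedD[OF assms(1) _ i(1,2,5,6)] by simp
    qed (use i(3,4) order_trans in metis)+
    ultimately show ?thesis using *(4,5) c by (simp add: part_cells_def full_cells_def)
  qed
qed

text \<open>The pairs in \<open>\<Q> - \<P>\<close> are attached one at a time, smallest first. When
  \<open>(S, T)\<close> is attached, its proper faces are in \<open>\<P>\<close>, so what is missing
  over it is the product of the inclusions of \<open>prism_horn S p k\<close> in
  \<open>prism S p\<close> and of \<open>prism_horn T q l\<close> in \<open>prism T q\<close>. Both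
  are composites of horn fillings.\<close>

lemma extends_part_full:
  assumes X: "kan X" and pq: "1 \<le> p" "1 \<le> q" "k \<le> p" "l \<le> q"
    and Q: "finite \<Q>" "down_closed \<Q>" "\<And>S T. (S, T) \<in> \<Q> \<Longrightarrow> finite S \<and> finite T"
    and P: "\<P> \<subseteq> \<Q>" "down_closed \<P>"
  shows "extends X (part_cells \<P> \<Q> p q k l) (full_cells \<Q> p q)"
  using P
proof (induction "card (\<Q> - \<P>)" arbitrary: \<P>)
  case 0
  then have "\<P> = \<Q>" using Q(1) by auto
  then have "part_cells \<P> \<Q> p q k l = full_cells \<Q> p q"
    by (auto simp: part_cells_def full_cells_def)
  then show ?case by (simp add: extends_refl)
next
  case (Suc n)
  then have "\<Q> - \<P> \<noteq> {}" by auto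
  then obtain z0 where "z0 \<in> \<Q> - \<P>" by blast
  from ex_has_least_nat[of "\<lambda>z. z \<in> \<Q> - \<P>", OF this, of "\<lambda>z. card (fst z) + card (snd z)"]
  obtain z where z: "z \<in> \<Q> - \<P>" and
    min0: "\<And>y. y \<in> \<Q> - \<P> \<Longrightarrow> card (fst z) + card (snd z) \<le> card (fst y) + card (snd y)" by blast
  obtain S T where ST: "z = (S, T)" by (cases z)
  have fin: "finite S" "finite T" using Q(3) z ST by auto
  have min: "(S', T') \<in> \<P>" if "S' \<subseteq> S" "T' \<subseteq> T" "S' \<noteq> {}" "T' \<noteq> {}" "(S', T') \<noteq> (S, T)" for S' T'
  proof (rule ccontr)
    assume "(S', T') \<notin> \<P>"
    moreover have "(S', T') \<in> \<Q>" using down_closedD[OF Q(2), of S T S' T'] z ST that by simp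
    ultimately have "\<not> card S' + card T' < card S + card T" using min0[of "(S', T')"] ST by simp
    moreover have "S' \<subset> S \<and> T' \<subseteq> T \<or> T' \<subset> T \<and> S' \<subseteq> S" using that by auto
    then have "card S' + card T' < card S + card T"
      using psubset_card_mono[of S S'] psubset_card_mono[of T T'] card_mono[of S S'] card_mono[of T T'] fin
      by (meson add_le_less_mono add_less_le_mono)
    ultimately show False by blast
  qed
  let ?P' = "insert (S, T) \<P>"
  have dcP': "down_closed ?P'"
  proof (rule down_closedI)
    fix S1 T1 S' T' assume *: "(S1, T1) \<in> ?P'" "S' \<subseteq> S1" "T' \<subseteq> T1" "S' \<noteq> {}" "T' \<noteq> {}"
    show "(S', T') \<in> ?P'"
    proof (cases "(S1, T1) \<in> \<P>")
      case True
      then show ?thesis using down_closedD[OF Suc.prems(2) _ *(2-5)] by simp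
    next
      case False
      then show ?thesis using min[of S' T'] * by auto
    qed
  qed
  let ?B1 = "prism S p" and ?B2 = "prism T q" and ?A1 = "prism_horn S p k" and ?A2 = "prism_horn T q l"
  let ?A = "part_cells \<P> \<Q> p q k l"
  have IH: "extends X (part_cells ?P' \<Q> p q k l) (full_cells \<Q> p q)"
  proof (rule Suc.hyps(1)[OF _ _ dcP'])
    have "\<Q> - ?P' = (\<Q> - \<P>) - {(S, T)}" by blast
    then show "n = card (\<Q> - ?P')" using Suc.hyps(2) z ST Q(1) by (simp add: card_Diff_singleton)
    show "?P' \<subseteq> \<Q>" using z ST Suc.prems(1) by simp
  qed
  have inB: "(U, V) \<in> full_cells \<Q> p q \<and> fst ` U \<noteq> {} \<and> fst ` V \<noteq> {} \<and> fst ` U \<subseteq> S \<and> fst ` V \<subseteq> T"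
    if "U \<in> ?B1" "V \<in> ?B2" for U V
  proof -
    have *: "fst ` U \<noteq> {}" "fst ` V \<noteq> {}" "fst ` U \<subseteq> S" "fst ` V \<subseteq> T" using that by (auto simp: prism_def)
    then have "(fst ` U, fst ` V) \<in> \<Q>" using down_closedD[OF Q(2), of S T "fst ` U" "fst ` V"] z ST by simp
    then show ?thesis using * that by (simp add: full_cells_def prism_def)
  qed
  have step: "extends X ?A (?A \<union> ?B1 \<times> ?B2)"
  proof (rule extends_glue[OF down_closed_part[OF Suc.prems(2) Q(2)] down_closed_Times[OF complex_prism complex_prism]])
    have mem: "(U, V) \<in> ?A \<longleftrightarrow> U \<in> ?A1 \<or> V \<in> ?A2" if "U \<in> ?B1" "V \<in> ?B2" for U V
    proof -
      have "(fst ` U, fst ` V) \<in> \<P> \<longleftrightarrow> fst ` U \<noteq> S \<or> fst ` V \<noteq> T"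
        using min[of "fst ` U" "fst ` V"] inB[OF that] z ST by blast
      then show ?thesis using inB[OF that] that by (simp add: part_cells_def prism_horn_def) blast
    qed
    have sub: "?A1 \<subseteq> ?B1" "?A2 \<subseteq> ?B2" by (auto simp: prism_horn_def)
    have "?A \<inter> ?B1 \<times> ?B2 = ?A1 \<times> ?B2 \<union> ?B1 \<times> ?A2"
    proof (rule Set.set_eqI)
      fix z :: "(nat \<times> nat) set \<times> (nat \<times> nat) set"
      obtain U V where z: "z = (U, V)" by (cases z)
      show "z \<in> ?A \<inter> ?B1 \<times> ?B2 \<longleftrightarrow> z \<in> ?A1 \<times> ?B2 \<union> ?B1 \<times> ?A2"
        using mem[of U V] subsetD[OF sub(1), of U] subsetD[OF sub(2), of V]
        unfolding z Int_iff Un_iff mem_Sigma_iff by blast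
    qed
    then show "extends X (?A \<inter> ?B1 \<times> ?B2) (?B1 \<times> ?B2)"
      using extends_product[OF X anod_prism[OF fin(1) pq(1,3)] complex_prism_horn anod_prism[OF fin(2) pq(2,4)] complex_prism_horn]
      by simp
  qed
  have "?A \<union> ?B1 \<times> ?B2 = part_cells ?P' \<Q> p q k l"
  proof (rule Set.set_eqI)
    fix z :: "(nat \<times> nat) set \<times> (nat \<times> nat) set"
    obtain U V where z: "z = (U, V)" by (cases z)
    have "z \<in> part_cells ?P' \<Q> p q k l" if "z \<in> ?B1 \<times> ?B2"
      using that min[of "fst ` U" "fst ` V"] inB[of U V] unfolding z part_cells_def by auto
    moreover have "z \<in> ?B1 \<times> ?B2" if "z \<in> part_cells ?P' \<Q> p q k l" "z \<notin> ?A"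
      using that by (auto simp: z part_cells_def full_cells_def prism_def)
    moreover have "z \<in> part_cells ?P' \<Q> p q k l" if "z \<in> ?A" using that by (auto simp: part_cells_def)
    ultimately show "z \<in> ?A \<union> ?B1 \<times> ?B2 \<longleftrightarrow> z \<in> part_cells ?P' \<Q> p q k l" by blast
  qed
  then have "extends X ?A (part_cells ?P' \<Q> p q k l)" using step by simp
  then show ?case by (rule extends_trans[OF _ IH]) (auto simp: part_cells_def)
qed

section \<open>Cells of a product as lists of pairs\<close>

lemma sorted_wrt_fst_snd:
  fixes u :: "(nat \<times> nat) list"
  assumes "sorted_wrt (\<le>) u"
  shows "sorted (map fst u)" "sorted (map snd u)"
  unfolding sorted_map
  by (rule sorted_wrt_mono_rel[OF _ assms]; simp add: less_eq_prod_def)+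

lemma sorted_wrt_zip:
  fixes a b :: "nat list"
  assumes "sorted a" "sorted b"
  shows "sorted_wrt (\<le>) (zip a b)"
  using assms by (auto simp: sorted_wrt_iff_nth_less less_eq_prod_def)

lemma is_chain_sorted:
  fixes u :: "'v::order list"
  assumes "sorted_wrt (\<le>) u"
  shows "is_chain (set u)"
  unfolding is_chain_def
proof (intro conjI ballI)
  fix x y assume "x \<in> set u" "y \<in> set u"
  then obtain i j where ij: "i < length u" "u ! i = x" "j < length u" "u ! j = y" by (auto simp: in_set_conv_nth)
  show "x \<le> y \<or> y \<le> x"
    using assms ij by (cases i j rule: linorder_cases) (auto simp: sorted_wrt_iff_nth_less)
qed simp

lemma pick_zip:
  assumes "\<theta> \<in> ops k m" "length a = Suc m" "length b = Suc m"
  shows "pick (zip a b) \<theta> = zip (pick a \<theta>) (pick b \<theta>)"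
  using assms by (intro nth_equalityI) (auto simp: pick_def ops_def subset_iff less_Suc_eq_le)

text \<open>The form in which extensions are applied. The predicate \<open>R\<close> cuts out a
  subobject of Delta[M,N]; the values of \<open>f\<close> count on its product with Delta[p,q] and
  on the product of Delta[M,N] with the bihorn. Zipping the lists of the two factors turns a cell of
  the product into a cell of \<open>cplx\<close>, where \<open>extends_part_full\<close>
  applies.\<close>

lemma box_extend:
  fixes f :: "nat \<Rightarrow> nat \<Rightarrow> bistd_cell \<times> bistd_cell \<Rightarrow> 'a" and R :: "nat set \<Rightarrow> nat set \<Rightarrow> bool"
  assumes X: "kan X" and pq: "1 \<le> p" "1 \<le> q" "k \<le> p" "l \<le> q"
    and R: "\<And>S T S' T'. R S T \<Longrightarrow> S' \<subseteq> S \<Longrightarrow> T' \<subseteq> T \<Longrightarrow> S' \<noteq> {} \<Longrightarrow> T' \<noteq> {} \<Longrightarrow> R S' T'"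
    and fX: "\<And>i j a b c d. a \<in> ops i M \<Longrightarrow> b \<in> ops j N \<Longrightarrow> c \<in> ops i p \<Longrightarrow> d \<in> ops j q \<Longrightarrow>
        R (set a) (set b) \<or> (c, d) \<in> cells (bihorn p q k l) i j \<Longrightarrow> f i j ((a, b), (c, d)) \<in> cells X i j"
    and fn: "\<And>i j a b c d i' j' \<theta> \<phi>. a \<in> ops i M \<Longrightarrow> b \<in> ops j N \<Longrightarrow> c \<in> ops i p \<Longrightarrow> d \<in> ops j q \<Longrightarrow>
        R (set a) (set b) \<or> (c, d) \<in> cells (bihorn p q k l) i j \<Longrightarrow> \<theta> \<in> ops i' i \<Longrightarrow> \<phi> \<in> ops j' j \<Longrightarrow>
        f i' j' ((pick a \<theta>, pick b \<phi>), (pick c \<theta>, pick d \<phi>)) = act X i j \<theta> \<phi> (f i j ((a, b), (c, d)))"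
  obtains g where "nat_on (bprod (bistd M N) (bistd p q)) X g"
    and "\<And>i j a b c d. a \<in> ops i M \<Longrightarrow> b \<in> ops j N \<Longrightarrow> c \<in> ops i p \<Longrightarrow> d \<in> ops j q \<Longrightarrow>
        R (set a) (set b) \<or> (c, d) \<in> cells (bihorn p q k l) i j \<Longrightarrow> g i j ((a, b), (c, d)) = f i j ((a, b), (c, d))"
proof -
  define \<Q> where "\<Q> = {(S, T). S \<noteq> {} \<and> T \<noteq> {} \<and> S \<subseteq> {..M} \<and> T \<subseteq> {..N}}"
  define \<P> where "\<P> = {(S, T) \<in> \<Q>. R S T}"
  have "\<Q> \<subseteq> Pow {..M} \<times> Pow {..N}" by (auto simp: \<Q>_def)
  then have finQ: "finite \<Q>" by (rule finite_subset) simp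
  have finST: "finite S \<and> finite T" if "(S, T) \<in> \<Q>" for S T
    using that by (auto simp: \<Q>_def intro: finite_subset)
  have dcQ: "down_closed \<Q>" by (rule down_closedI) (auto simp: \<Q>_def)
  have dcP: "down_closed \<P>"
  proof (rule down_closedI)
    fix S T S' T' assume *: "(S, T) \<in> \<P>" "S' \<subseteq> S" "T' \<subseteq> T" "S' \<noteq> {}" "T' \<noteq> {}"
    then show "(S', T') \<in> \<P>"
      using R[OF _ *(2-5)] down_closedD[OF dcQ _ *(2-5)] by (simp add: \<P>_def)
  qed
  have PQ: "\<P> \<subseteq> \<Q>" by (auto simp: \<P>_def)
  let ?A = "part_cells \<P> \<Q> p q k l" and ?B = "full_cells \<Q> p q"
  have ext: "extends X ?A ?B" by (rule extends_part_full[OF X pq finQ dcQ finST PQ dcP])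
  define F where "F = (\<lambda>i j (u :: (nat \<times> nat) list, w). f i j ((map fst u, map fst w), (map snd u, map snd w)))"
  have A: "map fst u \<in> ops i M \<and> map fst w \<in> ops j N \<and> map snd u \<in> ops i p \<and> map snd w \<in> ops j q \<and>
      (R (set (map fst u)) (set (map fst w)) \<or> (map snd u, map snd w) \<in> cells (bihorn p q k l) i j)"
    if "(u, w) \<in> cells (cplx ?A) i j" for u w i j
  proof -
    have *: "length u = Suc i" "length w = Suc j" "sorted_wrt (\<le>) u" "sorted_wrt (\<le>) w"
      "(set u, set w) \<in> ?A" using that by (simp_all add: cells_cplx)
    have q: "fst ` set u \<subseteq> {..M}" "fst ` set w \<subseteq> {..N}" "snd ` set u \<subseteq> {..p}" "snd ` set w \<subseteq> {..q}"
      and h: "R (fst ` set u) (fst ` set w) \<or> \<not> {..p} - {k} \<subseteq> snd ` set u \<or> \<not> {..q} - {l} \<subseteq> snd ` set w"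
      using *(5) unfolding part_cells_def full_cells_def \<P>_def \<Q>_def mem_Collect_eq case_prod_conv by blast+
    have "map fst u \<in> ops i M" "map fst w \<in> ops j N" "map snd u \<in> ops i p" "map snd w \<in> ops j q"
      using * q sorted_wrt_fst_snd[of u] sorted_wrt_fst_snd[of w] by (simp_all add: ops_def)
    then show ?thesis using h by (simp add: cells_bihorn)
  qed
  have "nat_on (cplx ?A) X F"
  proof (rule nat_onI)
    fix i j x assume x: "x \<in> cells (cplx ?A) i j"
    obtain u w where uw: "x = (u, w)" by (cases x)
    show "F i j x \<in> cells X i j" using A[of u w i j] x uw fX[of "map fst u" i "map fst w" j "map snd u" "map snd w"]
      by (simp add: F_def)
  next
    fix i j i' j' \<theta> \<phi> x assume *: "\<theta> \<in> ops i' i" "\<phi> \<in> ops j' j" "x \<in> cells (cplx ?A) i j"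
    obtain u w where uw: "x = (u, w)" by (cases x)
    have l: "length u = Suc i" "length w = Suc j" using *(3) by (simp_all add: uw cells_cplx)
    show "F i' j' (act (cplx ?A) i j \<theta> \<phi> x) = act X i j \<theta> \<phi> (F i j x)"
      using A[of u w i j] *(3) fn[of "map fst u" i "map fst w" j "map snd u" "map snd w", OF _ _ _ _ _ *(1,2)]
      by (simp add: uw F_def act_cplx map_pick[OF *(1) l(1)] map_pick[OF *(2) l(2)])
  qed
  with ext obtain G where G: "nat_on (cplx ?B) X G" "\<forall>i j. \<forall>c \<in> cells (cplx ?A) i j. G i j c = F i j c"
    unfolding extends_def by meson
  define g where "g = (\<lambda>i j ((a, b), (c, d)). G i j (zip a c :: (nat \<times> nat) list, zip b d :: (nat \<times> nat) list))"
  have B: "(zip a c, zip b d) \<in> cells (cplx ?B) i j" "fst ` set (zip a c) = set a" "fst ` set (zip b d) = set b"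
      "snd ` set (zip a c) = set c" "snd ` set (zip b d) = set d"
    if "a \<in> ops i M" "b \<in> ops j N" "c \<in> ops i p" "d \<in> ops j q" for a b c d i j
  proof -
    have l: "length a = Suc i" "length b = Suc j" "length c = Suc i" "length d = Suc j"
      and s: "sorted a" "sorted b" "sorted c" "sorted d"
      using that by (simp_all add: ops_def)
    show e: "fst ` set (zip a c) = set a" "fst ` set (zip b d) = set b"
      "snd ` set (zip a c) = set c" "snd ` set (zip b d) = set d"
      using l by (metis list.set_map map_fst_zip map_snd_zip)+
    have "set a \<noteq> {}" "set b \<noteq> {}" "set a \<subseteq> {..M}" "set b \<subseteq> {..N}" "set c \<subseteq> {..p}" "set d \<subseteq> {..q}"
      using that by (auto simp: ops_def)
    moreover have "set (zip a c) \<noteq> {}" "set (zip b d) \<noteq> {}" using e(1,2) calculation(1,2) by auto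
    ultimately show "(zip a c, zip b d) \<in> cells (cplx ?B) i j"
      using l sorted_wrt_zip[OF s(1,3)] sorted_wrt_zip[OF s(2,4)] is_chain_sorted[of "zip a c"] is_chain_sorted[of "zip b d"]
      unfolding cells_cplx full_cells_def \<Q>_def mem_Collect_eq case_prod_conv e by simp
  qed
  show thesis
  proof (rule that)
    show "nat_on (bprod (bistd M N) (bistd p q)) X g"
    proof (rule nat_onI)
      fix i j x assume "x \<in> cells (bprod (bistd M N) (bistd p q)) i j"
      then show "g i j x \<in> cells X i j" using nat_onD(1)[OF G(1) B(1)] by (auto simp: g_def)
    next
      fix i j i' j' \<theta> \<phi> x
      assume *: "\<theta> \<in> ops i' i" "\<phi> \<in> ops j' j" "x \<in> cells (bprod (bistd M N) (bistd p q)) i j"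
      obtain a b c d where x: "x = ((a, b), (c, d))" by (metis prod.exhaust)
      have o: "a \<in> ops i M" "b \<in> ops j N" "c \<in> ops i p" "d \<in> ops j q" using *(3) by (simp_all add: x)
      show "g i' j' (act (bprod (bistd M N) (bistd p q)) i j \<theta> \<phi> x) = act X i j \<theta> \<phi> (g i j x)"
        using nat_onD(2)[OF G(1) B(1)[OF o] *(1,2)] pick_zip[OF *(1), of a c] pick_zip[OF *(2), of b d] o
        by (simp add: x g_def act_bprod act_bistd act_cplx opsD(1))
    qed
    fix i j a b c d
    assume o: "a \<in> ops i M" "b \<in> ops j N" "c \<in> ops i p" "d \<in> ops j q"
      and h: "R (set a) (set b) \<or> (c, d) \<in> cells (bihorn p q k l) i j"
    have "(set (zip a c), set (zip b d)) \<in> ?B" using B(1)[OF o] by (simp add: cells_cplx)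
    moreover from this have "(set a, set b) \<in> \<Q>" unfolding full_cells_def mem_Collect_eq case_prod_conv B(2-5)[OF o] by simp
    ultimately have "(set (zip a c), set (zip b d)) \<in> ?A"
      using h o unfolding part_cells_def mem_Collect_eq case_prod_conv B(2-5)[OF o] \<P>_def cells_bihorn by simp
    then have "(zip a c, zip b d) \<in> cells (cplx ?A) i j" using B(1)[OF o] by (simp add: cells_cplx)
    then have "g i j ((a, b), (c, d)) = F i j (zip a c, zip b d)" using G(2) by (simp add: g_def)
    then show "g i j ((a, b), (c, d)) = f i j ((a, b), (c, d))" using o by (simp add: F_def opsD(1))
  qed
qed

section \<open>Relative function complexes\<close>

text \<open>The fiber of the restriction from \<open>Hom K X\<close> to \<open>Hom L X\<close> over
  the constant map. Both \<open>loops\<close> and \<open>loop_Z\<close> are of this kind, which lets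
  the loop variable and the cell variable be treated alike.\<close>

definition rel_Hom :: "'k bisset \<Rightarrow> 'k bisset \<Rightarrow> 'a bisset \<Rightarrow> 'a \<Rightarrow> ('k \<times> bistd_cell, 'a) bimap bisset" where
  "rel_Hom K L X v = (Hom K X)\<lparr>cells := (\<lambda>p q. {f. is_bimap (bprod K (bistd p q)) X f \<and>
     (\<forall>i j. \<forall>x \<in> cells L i j. \<forall>y \<in> cells (bistd p q) i j. f i j (x, y) = base X v i j)})\<rparr>"

lemma cells_rel_Hom:
  "f \<in> cells (rel_Hom K L X v) p q \<longleftrightarrow> is_bimap (bprod K (bistd p q)) X f \<and>
     (\<forall>i j. \<forall>x \<in> cells L i j. \<forall>y \<in> cells (bistd p q) i j. f i j (x, y) = base X v i j)"
  by (simp add: rel_Hom_def)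

lemma act_Hom:
  assumes "\<theta> \<in> ops k m" "\<phi> \<in> ops l n"
  shows "act (Hom K X) m n \<theta> \<phi> f = (\<lambda>i j. \<lambda>(x, a, b) \<in> cells (bprod K (bistd k l)) i j. f i j (x, pick \<theta> a, pick \<phi> b))"
  using assms by (simp add: Hom_def comp_op_pick opsD(1))

lemma act_rel_Hom: "act (rel_Hom K L X v) = act (Hom K X)"
  by (simp add: rel_Hom_def)

lemma base_cells: "bisimplicial_set X \<Longrightarrow> v \<in> cells X 0 0 \<Longrightarrow> base X v m n \<in> cells X m n"
  unfolding base_def by (rule act_cells) (auto intro: replicate_ops simp del: replicate_Suc)

lemma act_base:
  assumes "bisimplicial_set X" "v \<in> cells X 0 0" "\<theta> \<in> ops k m" "\<phi> \<in> ops l n"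
  shows "act X m n \<theta> \<phi> (base X v m n) = base X v k l"
  unfolding base_def
  by (subst act_act[OF assms(1,2) replicate_ops replicate_ops assms(3,4)])
    (simp_all add: pick_replicate[OF assms(3)] pick_replicate[OF assms(4)] del: replicate_Suc)

lemma base_00: "bisimplicial_set X \<Longrightarrow> v \<in> cells X 0 0 \<Longrightarrow> base X v 0 0 = v"
  using act_id[of X v 0 0] by (simp add: base_def id_op_def)

lemma is_bimapD:
  assumes "is_bimap K X f" "x \<in> cells K m n"
  shows "f m n x \<in> cells X m n"
    and "\<theta> \<in> ops k m \<Longrightarrow> \<phi> \<in> ops l n \<Longrightarrow> f k l (act K m n \<theta> \<phi> x) = act X m n \<theta> \<phi> (f m n x)"
  using assms by (auto simp: is_bimap_def)

lemma is_bimap_undefined: "is_bimap K X f \<Longrightarrow> x \<notin> cells K m n \<Longrightarrow> f m n x = undefined"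
  by (auto simp: is_bimap_def)

lemma bimap_eqI:
  assumes "is_bimap K X f" "is_bimap K X g" "\<And>m n x. x \<in> cells K m n \<Longrightarrow> f m n x = g m n x"
  shows "f = g"
proof (intro ext)
  fix m n x
  show "f m n x = g m n x"
    using assms(3) is_bimap_undefined[OF assms(1)] is_bimap_undefined[OF assms(2)]
    by (cases "x \<in> cells K m n") simp_all
qed

lemma replicate_pick: "\<theta> \<in> ops k 0 \<Longrightarrow> \<theta> = replicate (Suc k) 0"
  by (auto simp: ops_def replicate_eqI simp del: replicate_Suc intro!: replicate_eqI)

lemma const_is_bimap:
  assumes "bisimplicial_set K" "bisimplicial_set X" "v \<in> cells X 0 0"
  shows "is_bimap K X (const_bimap K X v)"
  using assms act_cells[OF assms(1)] by (auto simp: is_bimap_def const_bimap_def base_cells act_base)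

lemma bisimplicial_bprod:
  assumes "bisimplicial_set K" "bisimplicial_set L"
  shows "bisimplicial_set (bprod K L)"
  using assms unfolding bisimplicial_set_def by (auto simp: bprod_def)

lemma act_rel_Hom_bimap:
  assumes K: "bisimplicial_set K" and f: "is_bimap (bprod K (bistd m n)) X f"
    and op: "\<theta> \<in> ops k m" "\<phi> \<in> ops l n"
  shows "is_bimap (bprod K (bistd k l)) X (act (Hom K X) m n \<theta> \<phi> f)"
  unfolding is_bimap_def
proof (intro conjI allI ballI)
  fix i j
  show "act (Hom K X) m n \<theta> \<phi> f i j \<in> cells (bprod K (bistd k l)) i j \<rightarrow>\<^sub>E cells X i j"
    unfolding act_Hom[OF op] restrict_PiE_iff
    using is_bimapD(1)[OF f] pick_ops op by auto
next
  fix i j i' j' \<theta>' \<phi>' z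
  assume *: "\<theta>' \<in> ops i' i" "\<phi>' \<in> ops j' j" "z \<in> cells (bprod K (bistd k l)) i j"
  obtain x a b where z: "z = (x, (a, b))" by (metis prod.exhaust)
  have o: "x \<in> cells K i j" "a \<in> ops i k" "b \<in> ops j l" using *(3) by (simp_all add: z)
  show "act (Hom K X) m n \<theta> \<phi> f i' j' (act (bprod K (bistd k l)) i j \<theta>' \<phi>' z) =
    act X i j \<theta>' \<phi>' (act (Hom K X) m n \<theta> \<phi> f i j z)"
    using is_bimapD(2)[OF f, of "(x, pick \<theta> a, pick \<phi> b)" i j, OF _ *(1,2)] * o op act_cells[OF K o(1) *(1,2)]
    by (simp add: z act_Hom[OF op] act_bprod act_bistd pick_ops pick_pick)
qed

lemma act_rel_Hom_apply:
  assumes "\<theta> \<in> ops k m" "\<phi> \<in> ops l n" "x \<in> cells K i j" "a \<in> ops i k" "b \<in> ops j l"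
  shows "act (Hom K X) m n \<theta> \<phi> f i j (x, (a, b)) = f i j (x, (pick \<theta> a, pick \<phi> b))"
  using assms by (simp add: act_Hom[OF assms(1,2)])

lemma bisimplicial_rel_Hom:
  assumes K: "bisimplicial_set K" "\<And>i j. cells L i j \<subseteq> cells K i j"
  shows "bisimplicial_set (rel_Hom K L X v)"
  unfolding bisimplicial_set_def comp_op_pick act_rel_Hom
proof (intro conjI allI ballI)
  fix m n k l \<theta> \<phi> f
  assume op: "\<theta> \<in> ops k m" "\<phi> \<in> ops l n" and f: "f \<in> cells (rel_Hom K L X v) m n"
  show "act (Hom K X) m n \<theta> \<phi> f \<in> cells (rel_Hom K L X v) k l"
    unfolding cells_rel_Hom
  proof (intro conjI allI ballI)
    show "is_bimap (bprod K (bistd k l)) X (act (Hom K X) m n \<theta> \<phi> f)"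
      by (rule act_rel_Hom_bimap[OF K(1) _ op]) (use f in \<open>simp add: cells_rel_Hom\<close>)
    fix i j x y assume x: "x \<in> cells L i j" and y: "y \<in> cells (bistd k l) i j"
    obtain a b where ab: "y = (a, b)" by (cases y)
    show "act (Hom K X) m n \<theta> \<phi> f i j (x, y) = base X v i j"
      using f x y K(2) op act_rel_Hom_apply[OF op, of x K i j a b X f] by (auto simp: ab cells_rel_Hom pick_ops)
  qed
next
  fix m n f assume f: "f \<in> cells (rel_Hom K L X v) m n"
  then have b: "is_bimap (bprod K (bistd m n)) X f" by (simp add: cells_rel_Hom)
  show "act (Hom K X) m n (id_op m) (id_op n) f = f"
  proof (rule bimap_eqI[OF act_rel_Hom_bimap[OF K(1) b id_op_ops id_op_ops] b])
    fix i j z assume "z \<in> cells (bprod K (bistd m n)) i j"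
    then show "act (Hom K X) m n (id_op m) (id_op n) f i j z = f i j z"
      by (auto simp: act_Hom[OF id_op_ops id_op_ops] id_pick)
  qed
next
  fix m n k l p q \<theta> \<phi> \<theta>' \<phi>' f
  assume op: "\<theta> \<in> ops k m" "\<phi> \<in> ops l n" "\<theta>' \<in> ops p k" "\<phi>' \<in> ops q l" and f: "f \<in> cells (rel_Hom K L X v) m n"
  then have b: "is_bimap (bprod K (bistd m n)) X f" by (simp add: cells_rel_Hom)
  show "act (Hom K X) k l \<theta>' \<phi>' (act (Hom K X) m n \<theta> \<phi> f) = act (Hom K X) m n (pick \<theta> \<theta>') (pick \<phi> \<phi>') f"
  proof (rule bimap_eqI[OF act_rel_Hom_bimap[OF K(1) act_rel_Hom_bimap[OF K(1) b op(1,2)] op(3,4)]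
        act_rel_Hom_bimap[OF K(1) b pick_ops[OF op(1,3)] pick_ops[OF op(2,4)]]])
    fix i j z assume "z \<in> cells (bprod K (bistd p q)) i j"
    then show "act (Hom K X) k l \<theta>' \<phi>' (act (Hom K X) m n \<theta> \<phi> f) i j z = act (Hom K X) m n (pick \<theta> \<theta>') (pick \<phi> \<phi>') f i j z"
      using op by (auto simp: act_Hom act_Hom[OF pick_ops[OF op(1,3)] pick_ops[OF op(2,4)]] pick_ops pick_pick)
  qed
qed

lemma base_rel_Hom:
  "base (rel_Hom K L X v) (Hom_pt K X v) p q = const_bimap (bprod K (bistd p q)) X v"
  unfolding base_def[of "rel_Hom K L X v"] act_rel_Hom
  by (subst act_Hom[OF replicate_ops replicate_ops, OF le0 le0], intro ext)
    (auto simp: Hom_pt_def const_bimap_def restrict_def pick_replicate replicate_ops simp del: replicate_Suc)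

lemma Hom_pt_cells:
  assumes "bisimplicial_set K" "bisimplicial_set X" "v \<in> cells X 0 0" "\<And>i j. cells L i j \<subseteq> cells K i j"
  shows "Hom_pt K X v \<in> cells (rel_Hom K L X v) 0 0"
  unfolding cells_rel_Hom Hom_pt_def
  using const_is_bimap[OF bisimplicial_bprod[OF assms(1) bisimplicial_bistd] assms(2,3)] assms(4)
  by (auto simp: const_bimap_def subset_iff)

lemma Hom_restr_eq_base:
  assumes "f \<in> cells (Hom K X) p q" "\<And>i j. cells L i j \<subseteq> cells K i j"
  shows "Hom_restr K L X p q f = const_bimap (bprod L (bistd p q)) X v \<longleftrightarrow>
     (\<forall>i j. \<forall>x \<in> cells L i j. \<forall>y \<in> cells (bistd p q) i j. f i j (x, y) = base X v i j)"
  using assms by (auto simp: Hom_restr_def restr_bimap_def const_bimap_def fun_eq_iff restrict_def)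

lemma loops_rel_Hom: "loops X v = rel_Hom (bistd 1 1) (bd_A 1 1) X v"
proof -
  have sub: "cells (bd_A 1 1) i j \<subseteq> cells (bistd 1 1) i j" for i j unfolding cells_bd_A by auto
  have "base (Hom (bd_A 1 1) X) (Hom_pt (bd_A 1 1) X v) p q = const_bimap (bprod (bd_A 1 1) (bistd p q)) X v" for p q
    using base_rel_Hom[of "bd_A 1 1" "bd_A 1 1" X v p q] by (simp add: base_def act_rel_Hom)
  then have "f \<in> cells (loops X v) p q \<longleftrightarrow> f \<in> cells (rel_Hom (bistd 1 1) (bd_A 1 1) X v) p q" for f p q
    using Hom_restr_eq_base[of f "bistd 1 1" X p q "bd_A 1 1" v, OF _ sub]
    by (auto simp: loops_def preimage_def point_def cells_rel_Hom Hom_def)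
  then have "cells (loops X v) = cells (rel_Hom (bistd 1 1) (bd_A 1 1) X v)" by blast
  then show ?thesis by (simp add: loops_def preimage_def rel_Hom_def Hom_def)
qed

text \<open>\<open>point X v\<close> has a single cell in each bidegree, so the constant map is the
  only map into it and the fiber product becomes a fiber. The hypotheses ensure that the constant
  map is a map.\<close>

lemma loop_Z_rel_Hom:
  assumes "bisimplicial_set X" "v \<in> cells X 0 0"
  shows "loop_Z X v m n = rel_Hom (bistd m n) (bd_BC m n) X v"
proof -
  let ?L = "bd_BC m n" and ?K = "bistd m n"
  have sub: "cells ?L i j \<subseteq> cells ?K i j" for i j by (auto simp: cells_bd_BC)
  have "Hom_restr ?K ?L X p q f \<in> cells (Hom ?L (point X v)) p q \<longleftrightarrow>
      Hom_restr ?K ?L X p q f = const_bimap (bprod ?L (bistd p q)) X v" (is "?l \<longleftrightarrow> ?r") for p q f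
  proof
    assume ?l
    then show ?r by (auto simp: Hom_def is_bimap_def point_def const_bimap_def fun_eq_iff PiE_def extensional_def restrict_def)
  next
    assume r: ?r
    have cl: "bisimplicial_set ?L"
      unfolding bisimplicial_set_def comp_op_pick
    proof (intro conjI allI ballI)
      fix i j k l \<theta> \<phi> x
      assume *: "\<theta> \<in> ops k i" "\<phi> \<in> ops l j" "x \<in> cells ?L i j"
      obtain a b where x: "x = (a, b)" by (cases x)
      show "act ?L i j \<theta> \<phi> x \<in> cells ?L k l"
        using * set_pick_ops[of a i m \<theta> k] set_pick_ops[of b j n \<phi> l] pick_ops[of a i m \<theta> k] pick_ops[of b j n \<phi> l]
        unfolding x by (auto simp: cells_bd_BC act_bd_BC)
    qed (auto simp: cells_bd_BC act_bd_BC pick_pick ops_def intro!: pick_id)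
    show ?l
      unfolding r using const_is_bimap[OF bisimplicial_bprod[OF cl bisimplicial_bistd] assms]
      by (auto simp: Hom_def is_bimap_def point_def const_bimap_def)
  qed
  then have "f \<in> cells (loop_Z X v m n) p q \<longleftrightarrow> f \<in> cells (rel_Hom ?K ?L X v) p q" for f p q
    using Hom_restr_eq_base[of f ?K X p q ?L v, OF _ sub]
    by (auto simp: loop_Z_def preimage_def cells_rel_Hom Hom_def)
  then have "cells (loop_Z X v m n) = cells (rel_Hom ?K ?L X v)" by blast
  then show ?thesis by (simp add: loop_Z_def preimage_def rel_Hom_def Hom_def)
qed

text \<open>The adjoint of a cell of \<open>rel_Hom\<close> is a map on a product. Evaluation at the
  identity operators shows that it is constant over \<open>M\<close>; the converse uses that
  \<open>M\<close> is closed under operators.\<close>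

lemma trivial_cell_map_rel_Hom:
  assumes f: "f \<in> cells (rel_Hom K L X v) p q" and M: "\<And>i j. cells M i j \<subseteq> cells (bistd p q) i j"
    and Mc: "\<And>i j i' j' \<theta> \<phi> a b. (a, b) \<in> cells M i j \<Longrightarrow> \<theta> \<in> ops i' i \<Longrightarrow> \<phi> \<in> ops j' j \<Longrightarrow> (pick a \<theta>, pick b \<phi>) \<in> cells M i' j'"
  shows "trivial_on M (rel_Hom K L X v) (Hom_pt K X v) (cell_map (rel_Hom K L X v) p q f) \<longleftrightarrow>
    (\<forall>i j. \<forall>x \<in> cells K i j. \<forall>y \<in> cells M i j. f i j (x, y) = base X v i j)" (is "?l \<longleftrightarrow> ?r")
proof -
  let ?Z = "rel_Hom K L X v"
  have "?l \<longleftrightarrow> (\<forall>i j. \<forall>(a, b) \<in> cells M i j. act ?Z p q a b f = const_bimap (bprod K (bistd i j)) X v)"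
  proof
    assume l: ?l
    show "\<forall>i j. \<forall>(a, b) \<in> cells M i j. act ?Z p q a b f = const_bimap (bprod K (bistd i j)) X v"
    proof (intro allI ballI, clarify)
      fix i j a b assume ab: "(a, b) \<in> cells M i j"
      have "restr_bimap M (cell_map ?Z p q f) i j (a, b) = const_bimap M ?Z (Hom_pt K X v) i j (a, b)"
        using l by (simp add: trivial_on_def)
      moreover have "(a, b) \<in> cells (bistd p q) i j" using ab M by blast
      ultimately show "act ?Z p q a b f = const_bimap (bprod K (bistd i j)) X v"
        using ab by (simp add: restr_bimap_def cell_map_def const_bimap_def[of M] base_rel_Hom)
    qed
  next
    assume r: "\<forall>i j. \<forall>(a, b) \<in> cells M i j. act ?Z p q a b f = const_bimap (bprod K (bistd i j)) X v"
    have e: "restr_bimap M (cell_map ?Z p q f) i j c = const_bimap M ?Z (Hom_pt K X v) i j c" for i j c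
    proof (cases "c \<in> cells M i j")
      case True
      obtain a b where c: "c = (a, b)" by (cases c)
      have "(a, b) \<in> cells (bistd p q) i j" using True M c by blast
      then show ?thesis
        using True bspec[OF r[THEN spec, THEN spec] True]
        by (simp add: c restr_bimap_def cell_map_def const_bimap_def[of M] base_rel_Hom)
    qed (simp add: restr_bimap_def const_bimap_def)
    show ?l unfolding trivial_on_def by (rule ext, rule ext, rule ext, rule e)
  qed
  also have "\<dots> \<longleftrightarrow> ?r"
  proof
    assume l: "\<forall>i j. \<forall>(a, b) \<in> cells M i j. act ?Z p q a b f = const_bimap (bprod K (bistd i j)) X v"
    show ?r
    proof (intro allI ballI)
      fix i j x y assume x: "x \<in> cells K i j" and y: "y \<in> cells M i j"
      obtain a b where ab: "y = (a, b)" by (cases y)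
      have o: "a \<in> ops i p" "b \<in> ops j q" using y M[of i j] ab by auto
      have "act ?Z p q a b f i j (x, (id_op i, id_op j)) = base X v i j"
        using bspec[OF l[THEN spec, THEN spec] y] x by (simp add: ab const_bimap_def id_op_ops)
      then show "f i j (x, y) = base X v i j"
        using act_rel_Hom_apply[OF o x id_op_ops id_op_ops, of X f] o
        by (simp add: act_rel_Hom ab pick_id opsD(1))
    qed
  next
    assume r: ?r
    show "\<forall>i j. \<forall>(a, b) \<in> cells M i j. act ?Z p q a b f = const_bimap (bprod K (bistd i j)) X v"
    proof (intro allI ballI, clarify, intro ext)
      fix i j a b i' j' z assume ab: "(a, b) \<in> cells M i j"
      then have o: "a \<in> ops i p" "b \<in> ops j q" using M[of i j] by auto
      show "act ?Z p q a b f i' j' z = const_bimap (bprod K (bistd i j)) X v i' j' z"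
      proof (cases "z \<in> cells (bprod K (bistd i j)) i' j'")
        case True
        then obtain x c d where z: "z = (x, (c, d))" "x \<in> cells K i' j'" "c \<in> ops i' i" "d \<in> ops j' j" by auto
        then have "f i' j' (x, (pick a c, pick b d)) = base X v i' j'" using r Mc[OF ab] by blast
        then show ?thesis using z by (simp add: act_rel_Hom act_Hom[OF o] const_bimap_def)
      next
        case False
        then show ?thesis by (simp add: act_rel_Hom act_Hom[OF o] const_bimap_def del: cells_bprod)
      qed
    qed
  qed
  finally show ?thesis .
qed

text \<open>By adjunction a bihorn in \<open>rel_Hom\<close> is a map on the product of Delta[M,N]
  with a bihorn, to be extended to Delta[p,q] with the base point as value over \<open>L\<close>. As
  \<open>L\<close> is cut out by \<open>R\<close>, this is an instance of
  \<open>box_extend\<close>.\<close>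

lemma kan_rel_Hom:
  fixes X :: "'a bisset" and R :: "nat set \<Rightarrow> nat set \<Rightarrow> bool"
  assumes X: "kan X" and v: "v \<in> cells X 0 0"
    and R: "\<And>S T S' T'. R S T \<Longrightarrow> S' \<subseteq> S \<Longrightarrow> T' \<subseteq> T \<Longrightarrow> S' \<noteq> {} \<Longrightarrow> T' \<noteq> {} \<Longrightarrow> R S' T'"
    and L: "\<And>i j. cells L i j = {(a, b) \<in> ops i M \<times> ops j N. R (set a) (set b)}"
  shows "kan (rel_Hom (bistd M N) L X v)"
proof -
  let ?K = "bistd M N" and ?Z = "rel_Hom (bistd M N) L X v"
  have bX: "bisimplicial_set X" using X by (rule kan_bisimplicial)
  have bZ: "bisimplicial_set ?Z" by (rule bisimplicial_rel_Hom[OF bisimplicial_bistd]) (auto simp: L)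
  have Rp: "R (set (pick a \<theta>)) (set (pick b \<phi>))"
    if "R (set a) (set b)" "a \<in> ops i M" "b \<in> ops j N" "\<theta> \<in> ops i' i" "\<phi> \<in> ops j' j" for a b \<theta> \<phi> i j i' j'
    by (rule R[OF that(1) set_pick_ops[OF that(2,4)] set_pick_ops[OF that(3,5)]])
      (use pick_ops[OF that(2,4)] pick_ops[OF that(3,5)] in \<open>auto dest: ops_nonempty\<close>)
  show ?thesis
    unfolding kan_def
  proof (intro conjI bZ allI impI)
    fix p q k l :: nat and g
    assume pq: "1 \<le> p" "1 \<le> q" "k \<le> p" "l \<le> q" and g: "nat_on (bihorn p q k l) ?Z g"
    let ?H = "bihorn p q k l"
    \<comment> \<open>The adjoint of \<open>g\<close>: the cell \<open>g i j (c, d)\<close> of the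
      function complex is evaluated at its top simplex, which the identity operators name. Outside
      the bihorn the value counts only over \<open>L\<close>, where it is the base point.\<close>
    define f where "f = (\<lambda>i j ((a, b), (c, d)). if (c, d) \<in> cells ?H i j
      then g i j (c, d) i j ((a, b), (id_op i, id_op j)) else base X v i j)"
    have gZ: "is_bimap (bprod ?K (bistd i j)) X (g i j (c, d))"
      and gbase: "R (set a) (set b) \<Longrightarrow> a \<in> ops i' M \<Longrightarrow> b \<in> ops j' N \<Longrightarrow> y \<in> cells (bistd i j) i' j' \<Longrightarrow>
        g i j (c, d) i' j' ((a, b), y) = base X v i' j'"
      if "(c, d) \<in> cells ?H i j" for i j c d i' j' a b y
      using nat_onD(1)[OF g that] by (auto simp: cells_rel_Hom L)
    \<comment> \<open>Naturality of \<open>g\<close> moves an operator from the bihorn variable into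
      the argument of the function.\<close>
    have gact: "g i' j' (pick c \<theta>, pick d \<phi>) i' j' ((a, b), (id_op i', id_op j')) = g i j (c, d) i' j' ((a, b), (\<theta>, \<phi>))"
      if "(c, d) \<in> cells ?H i j" "\<theta> \<in> ops i' i" "\<phi> \<in> ops j' j" "a \<in> ops i' M" "b \<in> ops j' N" for i j c d i' j' \<theta> \<phi> a b
      using nat_onD(2)[OF g that(1-3)] that
        act_rel_Hom_apply[OF that(2,3), of "(a, b)" ?K i' j' "id_op i'" "id_op j'" X "g i j (c, d)"]
      by (simp add: act_bihorn act_rel_Hom id_op_ops pick_id opsD(1))
    have fR: "f i j ((a, b), y) = base X v i j" if "R (set a) (set b)" "a \<in> ops i M" "b \<in> ops j N" for i j a b y
      using gbase[of "fst y" "snd y" i j a b i j] that by (cases y) (auto simp: f_def id_op_ops)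
    have horn_pick: "(pick c \<theta>, pick d \<phi>) \<in> cells ?H i' j'"
      if "(c, d) \<in> cells ?H i j" "\<theta> \<in> ops i' i" "\<phi> \<in> ops j' j" for c d i j \<theta> \<phi> i' j'
      using act_cells[OF bisimplicial_bihorn that] by (simp add: act_bihorn)
    obtain G where G: "nat_on (bprod ?K (bistd p q)) X G"
      and Gf: "\<And>i j a b c d. a \<in> ops i M \<Longrightarrow> b \<in> ops j N \<Longrightarrow> c \<in> ops i p \<Longrightarrow> d \<in> ops j q \<Longrightarrow>
        R (set a) (set b) \<or> (c, d) \<in> cells ?H i j \<Longrightarrow> G i j ((a, b), (c, d)) = f i j ((a, b), (c, d))"
    proof (rule box_extend[OF X pq R, where f = f and M = M and N = N])
      fix i j a b c d
      assume *: "a \<in> ops i M" "b \<in> ops j N" "c \<in> ops i p" "d \<in> ops j q" "R (set a) (set b) \<or> (c, d) \<in> cells ?H i j"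
      show "f i j ((a, b), (c, d)) \<in> cells X i j"
      proof (cases "(c, d) \<in> cells ?H i j")
        case True
        then show ?thesis using is_bimapD(1)[OF gZ[OF True], of "((a, b), (id_op i, id_op j))" i j] * by (simp add: f_def id_op_ops)
      next
        case False
        then show ?thesis using base_cells[OF bX v] by (simp add: f_def)
      qed
      fix i' j' \<theta> \<phi> assume op: "\<theta> \<in> ops i' i" "\<phi> \<in> ops j' j"
      show "f i' j' ((pick a \<theta>, pick b \<phi>), (pick c \<theta>, pick d \<phi>)) = act X i j \<theta> \<phi> (f i j ((a, b), (c, d)))"
      proof (cases "(c, d) \<in> cells ?H i j")
        case True
        have "f i' j' ((pick a \<theta>, pick b \<phi>), (pick c \<theta>, pick d \<phi>)) = g i j (c, d) i' j' ((pick a \<theta>, pick b \<phi>), (\<theta>, \<phi>))"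
          using horn_pick[OF True op] gact[OF True op pick_ops[OF *(1) op(1)] pick_ops[OF *(2) op(2)]] by (simp add: f_def)
        also have "\<dots> = act X i j \<theta> \<phi> (g i j (c, d) i j ((a, b), (id_op i, id_op j)))"
          using is_bimapD(2)[OF gZ[OF True], of "((a, b), (id_op i, id_op j))" i j, OF _ op] * op
          by (simp add: id_op_ops act_bprod act_bistd id_pick)
        finally show ?thesis using True by (simp add: f_def)
      next
        case False
        then have r: "R (set a) (set b)" using * by blast
        show ?thesis
          using fR[OF r *(1,2)] fR[OF Rp[OF r *(1,2) op] pick_ops[OF *(1) op(1)] pick_ops[OF *(2) op(2)]] act_base[OF bX v op]
          by simp
      qed
    next
      fix g
      assume "nat_on (bprod ?K (bistd p q)) X g"
        and "\<And>i j a b c d. a \<in> ops i M \<Longrightarrow> b \<in> ops j N \<Longrightarrow> c \<in> ops i p \<Longrightarrow> d \<in> ops j q \<Longrightarrow>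
          R (set a) (set b) \<or> (c, d) \<in> cells ?H i j \<Longrightarrow> g i j ((a, b), (c, d)) = f i j ((a, b), (c, d))"
      then show thesis by (rule that)
    qed
    let ?x = "restr_bimap (bprod ?K (bistd p q)) G"
    have xb: "is_bimap (bprod ?K (bistd p q)) X ?x"
      by (rule restr_bimap_is_bimap[OF G act_cells[OF bisimplicial_bprod[OF bisimplicial_bistd bisimplicial_bistd]]])
    have xZ: "?x \<in> cells ?Z p q"
      unfolding cells_rel_Hom
    proof (intro conjI xb allI ballI)
      fix i j x y assume xy: "x \<in> cells L i j" "y \<in> cells (bistd p q) i j"
      obtain a b c d where e: "x = (a, b)" "y = (c, d)" by (metis prod.exhaust)
      have *: "a \<in> ops i M" "b \<in> ops j N" "c \<in> ops i p" "d \<in> ops j q" "R (set a) (set b)" using xy by (auto simp: e L)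
      then show "?x i j (x, y) = base X v i j" using Gf[of a i b j c d] fR[of a b i j "(c, d)"] by (simp add: e restr_bimap_def)
    qed
    show "\<exists>x\<in>cells ?Z p q. \<forall>i j. \<forall>(c, d)\<in>cells ?H i j. act ?Z p q c d x = g i j (c, d)"
    proof (intro bexI[OF _ xZ] allI ballI, clarify)
      fix i j c d assume h: "(c, d) \<in> cells ?H i j"
      then have o: "c \<in> ops i p" "d \<in> ops j q" by (auto simp: cells_bihorn)
      show "act ?Z p q c d ?x = g i j (c, d)"
        unfolding act_rel_Hom
      proof (rule bimap_eqI[OF act_rel_Hom_bimap[OF bisimplicial_bistd xb o] gZ[OF h]])
        fix i' j' z assume "z \<in> cells (bprod ?K (bistd i j)) i' j'"
        then obtain a b c' d' where z: "z = ((a, b), (c', d'))" and ops: "a \<in> ops i' M" "b \<in> ops j' N" "c' \<in> ops i' i" "d' \<in> ops j' j"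
          by auto
        have "act (Hom ?K X) p q c d ?x i' j' z = f i' j' ((a, b), (pick c c', pick d d'))"
          using act_rel_Hom_apply[OF o, of "(a, b)" ?K i' j' c' d' X ?x] ops o
            Gf[of a i' b j' "pick c c'" "pick d d'"] horn_pick[OF h ops(3,4)]
          by (simp add: z restr_bimap_def pick_ops)
        also have "\<dots> = g i j (c, d) i' j' z"
          using gact[OF h ops(3,4,1,2)] horn_pick[OF h ops(3,4)] by (simp add: f_def z)
        finally show "act (Hom ?K X) p q c d ?x i' j' z = g i j (c, d) i' j' z" .
      qed
    qed
  qed
qed

section \<open>Groups presented by triangles\<close>

text \<open>\<open>tri a b c\<close> says that some 2-simplex has the faces \<open>a\<close>, \<open>c\<close>, \<open>b\<close> opposite to the vertices 0, 1, 2;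
  \<open>inner1\<close> and \<open>inner2\<close> are the inner horn fillings of 3-simplices.\<close>

locale triangles =
  fixes S :: "'b set" and e :: 'b and tri :: "'b \<Rightarrow> 'b \<Rightarrow> 'b \<Rightarrow> bool"
  assumes e_in: "e \<in> S"
    and tri_in: "tri a b c \<Longrightarrow> a \<in> S \<and> b \<in> S \<and> c \<in> S"
    and unit_right: "a \<in> S \<Longrightarrow> tri a e a"
    and unit_left: "a \<in> S \<Longrightarrow> tri e a a"
    and comp_ex: "a \<in> S \<Longrightarrow> b \<in> S \<Longrightarrow> \<exists>c. tri a b c"
    and div_ex: "a \<in> S \<Longrightarrow> c \<in> S \<Longrightarrow> \<exists>b. tri a b c"
    and inner2: "tri a b p \<Longrightarrow> tri a q r \<Longrightarrow> tri b c q \<Longrightarrow> tri p c r"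
    and inner1: "tri a b p \<Longrightarrow> tri p c r \<Longrightarrow> tri b c q \<Longrightarrow> tri a q r"
begin

definition rel :: "('b \<times> 'b) set" where "rel = {(a, b). tri a e b}"

text \<open>This and the next four lemmas come from 3-simplices with one degenerate face, supplied
  by \<open>unit_right\<close> or \<open>unit_left\<close>. Together they allow an edge of a
  triangle to be replaced by an equivalent one in each of the three positions.\<close>

lemma tri_rel_result: "tri a b c \<Longrightarrow> tri c e c' \<Longrightarrow> tri a b c'"
  using inner1[of a b c e c' b] unit_right[of b] tri_in[of a b c] by blast

lemma tri_unique: "tri a b c \<Longrightarrow> tri a b c' \<Longrightarrow> tri c e c'"
  using inner2[of a b c b c' e] unit_right[of b] tri_in[of a b c] by blast

lemma rel_sym: "tri a e b \<Longrightarrow> tri b e a"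
  using tri_unique[of a e b a] unit_right[of a] tri_in[of a e b] by blast

lemma tri_rel_right: "tri b e b' \<Longrightarrow> tri a b c \<Longrightarrow> tri a b' c"
  using inner1[of a b c e c b'] unit_right[of c] tri_in[of a b c] by blast

lemma tri_rel_left: "tri a e a' \<Longrightarrow> tri a b c \<Longrightarrow> tri a' b c"
  using inner2[of a e a' b c b] unit_left[of b] tri_in[of a b c] by blast

lemma equiv_rel: "equiv S rel"
proof (rule equivI)
  show "rel \<subseteq> S \<times> S" using tri_in by (auto simp: rel_def)
  show "refl_on S rel" using unit_right by (auto simp: rel_def refl_on_def)
  show "sym rel" using rel_sym by (auto simp: rel_def sym_def)
  show "trans rel" using tri_rel_result by (auto simp: rel_def trans_def)
qed

lemma class_eq: "a \<in> S \<Longrightarrow> b \<in> S \<Longrightarrow> rel `` {a} = rel `` {b} \<longleftrightarrow> tri a e b"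
  using eq_equiv_class_iff[OF equiv_rel, of a b] by (simp add: rel_def)

lemma tri_cong:
  assumes "tri a b c" "tri a e a'" "tri b e b'" "tri a' b' c'"
  shows "rel `` {c} = rel `` {c'}"
proof -
  have "tri a' b' c" using tri_rel_left[OF assms(2) tri_rel_right[OF assms(3,1)]] .
  then have "tri c e c'" using assms(4) tri_unique by blast
  then show ?thesis using class_eq tri_in by blast
qed

lemma quotient_rep:
  assumes "P \<in> S // rel"
  obtains a where "a \<in> S" "P = rel `` {a}" "a \<in> P"
  using assms equiv_class_self[OF equiv_rel] by (auto elim!: quotientE)

text \<open>\<open>mul\<close> may be any operation that triangles compute on representatives, so
  that products defined by different fillers are covered at once. Associativity is a single use of
  \<open>inner1\<close>, and inverses come from \<open>div_ex\<close>.\<close>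

theorem group_quotient:
  assumes mul: "\<And>P Q a b c. P \<in> S // rel \<Longrightarrow> Q \<in> S // rel \<Longrightarrow> a \<in> P \<Longrightarrow> b \<in> Q \<Longrightarrow> tri a b c \<Longrightarrow>
      mul P Q = rel `` {c}"
  shows "group \<lparr>carrier = S // rel, mult = mul, one = rel `` {e}\<rparr>" (is "group ?G")
proof -
  have cls: "rel `` {a} \<in> S // rel" "a \<in> rel `` {a}" if "a \<in> S" for a
    using that equiv_class_self[OF equiv_rel] by (auto intro: quotientI)
  have m: "mul (rel `` {a}) (rel `` {b}) = rel `` {c}" if "tri a b c" for a b c
    using mul[OF cls(1) cls(1) cls(2) cls(2) that] tri_in[OF that] by blast
  have mon: "monoid ?G"
  proof (rule monoidI; simp)
    fix P Q assume "P \<in> S // rel" "Q \<in> S // rel"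
    then obtain a b where "a \<in> S" "b \<in> S" "P = rel `` {a}" "Q = rel `` {b}" by (metis quotient_rep)
    moreover obtain c where "tri a b c" using comp_ex[OF calculation(1,2)] by blast
    ultimately show "mul P Q \<in> S // rel" using m cls(1) tri_in by metis
  next
    show "rel `` {e} \<in> S // rel" using cls(1)[OF e_in] .
  next
    fix P Q R assume "P \<in> S // rel" "Q \<in> S // rel" "R \<in> S // rel"
    then obtain a b c where abc: "a \<in> S" "b \<in> S" "c \<in> S" "P = rel `` {a}" "Q = rel `` {b}" "R = rel `` {c}"
      by (metis quotient_rep)
    obtain p where p: "tri a b p" using comp_ex abc by blast
    obtain r where r: "tri p c r" using comp_ex abc tri_in[OF p] by blast
    obtain q where q: "tri b c q" using comp_ex abc by blast
    have "tri a q r" by (rule inner1[OF p r q])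
    then show "mul (mul P Q) R = mul P (mul Q R)" using m p q r abc by simp
  next
    fix P assume "P \<in> S // rel"
    then obtain a where "a \<in> S" "P = rel `` {a}" by (metis quotient_rep)
    then show "mul (rel `` {e}) P = P" "mul P (rel `` {e}) = P"
      using m[OF unit_left] m[OF unit_right] by simp_all
  qed
  interpret monoid ?G by (rule mon)
  \<comment> \<open>\<open>div_ex\<close> solves for the second edge only and so gives right
    inverses. If \<open>R\<close> is a right inverse of the right inverse \<open>Q\<close> of
    \<open>P\<close>, then \<open>P = R\<close> by associativity, so \<open>Q\<close> is also a left
    inverse.\<close>
  have right_inv: "\<exists>Q \<in> S // rel. mul P Q = rel `` {e}" if P: "P \<in> S // rel" for P
  proof -
    obtain a where a: "a \<in> S" "P = rel `` {a}" using P by (metis quotient_rep)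
    obtain b where b: "tri a b e" using div_ex[OF a(1) e_in] by (rule exE)
    then show ?thesis
      using m[OF b] a(2) cls(1)[of b] tri_in[OF b] by (intro bexI[of _ "rel `` {b}"]) simp_all
  qed
  show ?thesis
  proof (rule group_l_invI)
    fix P assume P: "P \<in> carrier ?G"
    then obtain Q where Q: "Q \<in> carrier ?G" "P \<otimes>\<^bsub>?G\<^esub> Q = \<one>\<^bsub>?G\<^esub>" using right_inv[of P] by auto
    then obtain R where R: "R \<in> carrier ?G" "Q \<otimes>\<^bsub>?G\<^esub> R = \<one>\<^bsub>?G\<^esub>" using right_inv[of Q] by auto
    have "P = P \<otimes>\<^bsub>?G\<^esub> (Q \<otimes>\<^bsub>?G\<^esub> R)" using P R(2) by (simp del: monoid.simps partial_object.simps)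
    also have "\<dots> = (P \<otimes>\<^bsub>?G\<^esub> Q) \<otimes>\<^bsub>?G\<^esub> R" by (rule m_assoc[OF P Q(1) R(1), symmetric])
    also have "\<dots> = R" unfolding Q(2) by (rule l_one[OF R(1)])
    finally have "Q \<otimes>\<^bsub>?G\<^esub> P = \<one>\<^bsub>?G\<^esub>" using R(2) by (simp del: monoid.simps partial_object.simps)
    then show "\<exists>y\<in>carrier ?G. y \<otimes>\<^bsub>?G\<^esub> P = \<one>\<^bsub>?G\<^esub>" using Q(1) by blast
  qed
qed

lemma comm_group_quotient:
  assumes mul: "\<And>P Q a b c. P \<in> S // rel \<Longrightarrow> Q \<in> S // rel \<Longrightarrow> a \<in> P \<Longrightarrow> b \<in> Q \<Longrightarrow> tri a b c \<Longrightarrow>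
      mul P Q = rel `` {c}"
    and comm: "\<And>a b. a \<in> S \<Longrightarrow> b \<in> S \<Longrightarrow> \<exists>c. tri a b c \<and> tri b a c"
  shows "comm_group \<lparr>carrier = S // rel, mult = mul, one = rel `` {e}\<rparr>" (is "comm_group ?G")
proof (rule group.group_comm_groupI[OF group_quotient[OF mul]])
  fix P Q assume PQ: "P \<in> carrier ?G" "Q \<in> carrier ?G"
  obtain a where a: "a \<in> S" "a \<in> P" using PQ(1) by (auto elim: quotient_rep)
  obtain b where b: "b \<in> S" "b \<in> Q" using PQ(2) by (auto elim: quotient_rep)
  obtain c where "tri a b c" "tri b a c" using comm[OF a(1) b(1)] by blast
  then show "P \<otimes>\<^bsub>?G\<^esub> Q = Q \<otimes>\<^bsub>?G\<^esub> P"
    using mul[of P Q a b c] mul[of Q P b a c] a b PQ by simp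
qed

end

section \<open>The simplicial set of collapsed diagonal cells\<close>

text \<open>The cells of bidegree \<open>(n, n)\<close> that factor through the quotient of \<open>\<Delta>\<^bsup>n,n\<^esup>\<close> in which
  \<open>(\<sigma>, \<tau>)\<close> is identified with \<open>(max s \<sigma>, max s \<tau>)\<close> as soon as \<open>\<sigma> \<ge> s\<close> or \<open>\<tau> \<ge> s\<close>. The Aeppli product
  is composition of edges in this simplicial set.\<close>

definition collapsed :: "'a bisset \<Rightarrow> nat \<Rightarrow> 'a \<Rightarrow> bool" where
  "collapsed Z n z \<longleftrightarrow> z \<in> cells Z n n \<and>
     (\<forall>i j s. \<forall>\<sigma> \<in> ops i n. \<forall>\<tau> \<in> ops j n. s \<le> n \<longrightarrow> set \<sigma> \<subseteq> {s..} \<or> set \<tau> \<subseteq> {s..} \<longrightarrow>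
        act Z n n \<sigma> \<tau> z = act Z n n (map (max s) \<sigma>) (map (max s) \<tau>) z)"

lemma collapsed_cells: "collapsed Z n z \<Longrightarrow> z \<in> cells Z n n"
  by (simp add: collapsed_def)

lemma collapsedD:
  assumes "collapsed Z n z" "\<sigma> \<in> ops i n" "\<tau> \<in> ops j n" "s \<le> n" "set \<sigma> \<subseteq> {s..} \<or> set \<tau> \<subseteq> {s..}"
  shows "act Z n n \<sigma> \<tau> z = act Z n n (map (max s) \<sigma>) (map (max s) \<tau>) z"
  by (rule conjunct2[OF assms(1)[unfolded collapsed_def], rule_format, OF assms(2-5)])

lemma max_ops: "\<sigma> \<in> ops i n \<Longrightarrow> s \<le> n \<Longrightarrow> map (max s) \<sigma> \<in> ops i n"
  by (erule map_mono_ops) auto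

text \<open>A diagonal operator \<open>\<mu>\<close> is compatible with the collapse because raising
  to \<open>\<mu> ! s\<close> after \<open>\<mu>\<close> is \<open>\<mu>\<close> after raising to
  \<open>s\<close>. The condition at \<open>s\<close> for the new cell is that at
  \<open>\<mu> ! s\<close> for the old one.\<close>

lemma collapsed_act:
  assumes Z: "bisimplicial_set Z" and z: "collapsed Z n z" and \<mu>: "\<mu> \<in> ops k n"
  shows "collapsed Z k (act Z n n \<mu> \<mu> z)"
  unfolding collapsed_def
proof (intro conjI allI ballI impI)
  have zc: "z \<in> cells Z n n" using z by (rule collapsed_cells)
  show "act Z n n \<mu> \<mu> z \<in> cells Z k k" by (rule act_cells[OF Z zc \<mu> \<mu>])
  fix i j s \<sigma> \<tau> assume *: "\<sigma> \<in> ops i k" "\<tau> \<in> ops j k" "s \<le> k" "set \<sigma> \<subseteq> {s..} \<or> set \<tau> \<subseteq> {s..}"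
  have mono: "\<mu> ! x \<le> \<mu> ! y" if "x \<le> y" "y \<le> k" for x y
    using \<mu> that by (auto simp: ops_def sorted_iff_nth_mono)
  have pm: "map (max (\<mu> ! s)) (pick \<mu> \<rho>) = pick \<mu> (map (max s) \<rho>)" if "\<rho> \<in> ops l k" for \<rho> l
    unfolding pick_def map_map
  proof (rule map_cong[OF HOL.refl])
    fix x assume "x \<in> set \<rho>"
    then have "x \<le> k" using that by (auto simp: ops_def)
    then show "(max (\<mu> ! s) \<circ> (!) \<mu>) x = ((!) \<mu> \<circ> max s) x"
      using mono[of x s] mono[of s x] *(3) by (cases "x \<le> s") (auto simp: max_def dest: antisym)
  qed
  have ge: "set (pick \<mu> \<rho>) \<subseteq> {\<mu> ! s..}" if "\<rho> \<in> ops l k" "set \<rho> \<subseteq> {s..}" for \<rho> l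
    using that mono by (auto simp: pick_def ops_def)
  have "act Z k k \<sigma> \<tau> (act Z n n \<mu> \<mu> z) = act Z n n (pick \<mu> \<sigma>) (pick \<mu> \<tau>) z"
    by (rule act_act[OF Z zc \<mu> \<mu> *(1,2)])
  also have "\<dots> = act Z n n (map (max (\<mu> ! s)) (pick \<mu> \<sigma>)) (map (max (\<mu> ! s)) (pick \<mu> \<tau>)) z"
    by (rule collapsedD[OF z pick_ops[OF \<mu> *(1)] pick_ops[OF \<mu> *(2)] ops_nth_le[OF \<mu> *(3)]])
      (use *(4) ge[OF *(1)] ge[OF *(2)] in blast)
  also have "\<dots> = act Z k k (map (max s) \<sigma>) (map (max s) \<tau>) (act Z n n \<mu> \<mu> z)"
    unfolding pm[OF *(1)] pm[OF *(2)]
    by (rule act_act[OF Z zc \<mu> \<mu> max_ops[OF *(1,3)] max_ops[OF *(2,3)], symmetric])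
  finally show "act Z k k \<sigma> \<tau> (act Z n n \<mu> \<mu> z) = act Z k k (map (max s) \<sigma>) (map (max s) \<tau>) (act Z n n \<mu> \<mu> z)" .
qed

section \<open>Horns of the collapsed simplex and their fillers\<close>

definition simplex_pairs :: "nat \<Rightarrow> (nat set \<times> nat set) set" where
  "simplex_pairs n = {(S, T). S \<noteq> {} \<and> T \<noteq> {} \<and> S \<subseteq> {..n} \<and> T \<subseteq> {..n}}"

text \<open>The cells of Delta[n,n] whose values the \<open>i\<close>-th face prescribes. For
  \<open>i = 0\<close> it is enough that one list avoids 0, because the collapse then raises the
  other list as well.\<close>

definition face_pair :: "nat \<Rightarrow> nat set \<Rightarrow> nat set \<Rightarrow> bool" where
  "face_pair i S T \<longleftrightarrow> (if i = 0 then 0 \<notin> S \<or> 0 \<notin> T else i \<notin> S \<and> i \<notin> T)"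

definition horn_pairs :: "nat \<Rightarrow> nat \<Rightarrow> (nat set \<times> nat set) set" where
  "horn_pairs n k = {(S, T) \<in> simplex_pairs n. \<exists>i\<le>n. i \<noteq> k \<and> face_pair i S T}"

lemma face_pair_mono: "face_pair i S T \<Longrightarrow> S' \<subseteq> S \<Longrightarrow> T' \<subseteq> T \<Longrightarrow> face_pair i S' T'"
  by (auto simp: face_pair_def split: if_splits)

lemma down_closed_simplex: "down_closed (simplex_pairs n)"
  by (rule down_closedI) (auto simp: simplex_pairs_def)

lemma down_closed_horn: "down_closed (horn_pairs n k)"
proof (rule down_closedI)
  fix S T S' T' assume *: "(S, T) \<in> horn_pairs n k" "S' \<subseteq> S" "T' \<subseteq> T" "S' \<noteq> {}" "T' \<noteq> {}"
  then obtain i where "i \<le> n" "i \<noteq> k" "face_pair i S T" by (auto simp: horn_pairs_def)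
  then have "\<exists>i\<le>n. i \<noteq> k \<and> face_pair i S' T'" using face_pair_mono[OF _ *(2,3)] by blast
  moreover have "(S', T') \<in> simplex_pairs n"
    by (rule down_closedD[OF down_closed_simplex _ *(2-5)]) (use *(1) in \<open>auto simp: horn_pairs_def\<close>)
  ultimately show "(S', T') \<in> horn_pairs n k" by (simp add: horn_pairs_def)
qed

lemma is_chain_nat: "finite (S :: nat set) \<Longrightarrow> is_chain S"
  by (auto simp: is_chain_def)

text \<open>A pair outside the horn has 0 in both sets and every \<open>i \<noteq> k\<close> in
  their union; without \<open>k\<close> it is an element of \<open>V\<close>. Adjoining
  \<open>k\<close> to both members of a pair in \<open>V\<close>, smaller pairs first, is a bihorn
  filling in which both missing faces are opposite to \<open>k\<close>. As 0 lies in both sets and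
  \<open>k\<close> in neither, \<open>k\<close> has to be positive.\<close>

lemma extends_horn_pairs:
  assumes Z: "kan Z" and k: "1 \<le> k" "k \<le> n"
  shows "extends Z (horn_pairs n k) (simplex_pairs n)"
proof -
  define V where "V = {(S, T). 0 \<in> S \<and> 0 \<in> T \<and> S \<union> T = {..n} - {k}}"
  define box where "box = (\<lambda>(S, T). {(S', T'). S' \<noteq> {} \<and> T' \<noteq> {} \<and> S' \<subseteq> insert k S \<and> T' \<subseteq> insert k T})"
  have boxI: "(S', T') \<in> box (S, T) \<longleftrightarrow> S' \<noteq> {} \<and> T' \<noteq> {} \<and> S' \<subseteq> insert k S \<and> T' \<subseteq> insert k T" for S T S' T'
    by (simp add: box_def)
  have "V \<subseteq> Pow {..n} \<times> Pow {..n}" by (auto simp: V_def)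
  then have finV: "finite V" by (rule finite_subset) simp
  have VD: "0 \<in> S" "0 \<in> T" "S \<subseteq> {..n}" "T \<subseteq> {..n}" "k \<notin> S" "k \<notin> T" "S \<union> T = {..n} - {k}" if "(S, T) \<in> V" for S T
    using that by (auto simp: V_def)
  \<comment> \<open>\<open>R\<close> is the set of pairs attached so far. Its closure under smaller
    pairs in \<open>V\<close> excludes that a new box is already contained in the box of a larger
    pair.\<close>
  have "extends Z (horn_pairs n k \<union> \<Union> (box ` R)) (simplex_pairs n)"
    if "R \<subseteq> V" "\<And>S T S' T'. (S, T) \<in> R \<Longrightarrow> (S', T') \<in> V \<Longrightarrow> S' \<subseteq> S \<Longrightarrow> T' \<subseteq> T \<Longrightarrow> (S', T') \<in> R" for R
    using that
  proof (induction "card (V - R)" arbitrary: R)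
    case 0
    then have "V - R = {}" using finV by simp
    then have RV: "R = V" using 0 by auto
    have "horn_pairs n k \<union> \<Union> (box ` V) = simplex_pairs n"
    proof
      have "box (S, T) \<subseteq> simplex_pairs n" if "(S, T) \<in> V" for S T
      proof -
        have "insert k S \<subseteq> {..n}" "insert k T \<subseteq> {..n}" using VD(3,4)[OF that] k by auto
        then show ?thesis unfolding box_def simplex_pairs_def by (auto dest: subsetD)
      qed
      then show "horn_pairs n k \<union> \<Union> (box ` V) \<subseteq> simplex_pairs n" by (auto simp: horn_pairs_def)
      show "simplex_pairs n \<subseteq> horn_pairs n k \<union> \<Union> (box ` V)"
      proof
        fix z assume z: "z \<in> simplex_pairs n"
        obtain S T where ST: "z = (S, T)" by (cases z)
        show "z \<in> horn_pairs n k \<union> \<Union> (box ` V)"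
        proof (cases "z \<in> horn_pairs n k")
          case False
          then have nf: "\<not> face_pair i S T" if "i \<le> n" "i \<noteq> k" for i
            using that z by (auto simp: ST horn_pairs_def)
          have "0 \<in> S" "0 \<in> T" using nf[of 0] k by (auto simp: face_pair_def)
          moreover have "i \<in> S \<union> T" if "i \<le> n" "i \<noteq> k" for i
            using nf[OF that] calculation by (cases "i = 0") (auto simp: face_pair_def)
          then have "(S - {k}) \<union> (T - {k}) = {..n} - {k}" using z by (auto simp: ST simplex_pairs_def)
          ultimately have "(S - {k}, T - {k}) \<in> V" using k by (auto simp: V_def)
          moreover have "z \<in> box (S - {k}, T - {k})" using z by (auto simp: ST boxI simplex_pairs_def)
          ultimately show ?thesis by blast
        qed simp
      qed
    qed
    then show ?case using RV by (simp add: extends_refl)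
  next
    case (Suc m)
    then have "V - R \<noteq> {}" by auto
    then obtain z0 where "z0 \<in> V - R" by blast
    from ex_has_least_nat[of "\<lambda>z. z \<in> V - R", OF this, of "\<lambda>z. card (fst z) + card (snd z)"]
    obtain z where z: "z \<in> V - R" and
      min0: "\<And>y. y \<in> V - R \<Longrightarrow> card (fst z) + card (snd z) \<le> card (fst y) + card (snd y)" by blast
    obtain S T where ST: "z = (S, T)" by (cases z)
    have V: "(S, T) \<in> V" "(S, T) \<notin> R" using z ST by auto
    note VD' = VD[OF V(1)]
    have fin: "finite S" "finite T" using VD'(3,4) by (auto intro: finite_subset)
    have min: "(S', T') \<in> R" if "(S', T') \<in> V" "S' \<subseteq> S" "T' \<subseteq> T" "(S', T') \<noteq> (S, T)" for S' T'
    proof (rule ccontr)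
      assume "(S', T') \<notin> R"
      then have "card S + card T \<le> card S' + card T'" using min0[of "(S', T')"] that(1) ST by simp
      moreover have "S' \<subset> S \<and> T' \<subseteq> T \<or> T' \<subset> T \<and> S' \<subseteq> S" using that by auto
      then have "card S' + card T' < card S + card T"
        using psubset_card_mono[of S S'] psubset_card_mono[of T T'] card_mono[of S S'] card_mono[of T T'] fin
        by (meson add_le_less_mono add_less_le_mono)
      ultimately show False by simp
    qed
    let ?A = "horn_pairs n k \<union> \<Union> (box ` R)"
    have dbox: "down_closed (box z)" for z by (cases z) (auto simp: down_closed_def box_def)
    have dU: "down_closed (\<Union> (box ` R))"
    proof (rule down_closedI)
      fix S1 T1 S' T' assume *: "(S1, T1) \<in> \<Union> (box ` R)" "S' \<subseteq> S1" "T' \<subseteq> T1" "S' \<noteq> {}" "T' \<noteq> {}"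
      then obtain w where w: "w \<in> R" "(S1, T1) \<in> box w" by blast
      have "(S', T') \<in> box w" by (rule down_closedD[OF dbox w(2) *(2-5)])
      then show "(S', T') \<in> \<Union> (box ` R)" using w(1) by blast
    qed
    have step: "extends Z ?A (?A \<union> {(S', T'). S' \<noteq> {} \<and> T' \<noteq> {} \<and> S' \<subseteq> insert k S \<and> T' \<subseteq> insert k T})"
    proof (rule extends_attach[OF Z down_closed_Un[OF down_closed_horn dU], where s = k and t = k])
      show "is_chain (insert k S)" "is_chain (insert k T)" using fin by (simp_all add: is_chain_nat)
      have "card {0, k} \<le> card (insert k S)" "card {0, k} \<le> card (insert k T)"
        by (rule card_mono; use fin VD'(1,2) in auto)+
      then show "2 \<le> card (insert k S)" "2 \<le> card (insert k T)" using k by auto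
      fix S' T' assume *: "S' \<noteq> {}" "T' \<noteq> {}" "S' \<subseteq> insert k S" "T' \<subseteq> insert k T"
      have "insert k S \<subseteq> {..n}" "insert k T \<subseteq> {..n}" using VD'(3,4) k by auto
      then have sp: "(S', T') \<in> simplex_pairs n"
        using * order_trans[OF *(3)] order_trans[OF *(4)] by (simp add: simplex_pairs_def)
      have ik: "insert k S - {k} = S" "insert k T - {k} = T" using VD'(5,6) by auto
      show "(S', T') \<in> ?A \<longleftrightarrow> \<not> insert k S - {k} \<subseteq> S' \<or> \<not> insert k T - {k} \<subseteq> T'"
        unfolding ik
      proof
        assume A: "(S', T') \<in> ?A"
        show "\<not> S \<subseteq> S' \<or> \<not> T \<subseteq> T'"
        proof (rule ccontr)
          assume "\<not> (\<not> S \<subseteq> S' \<or> \<not> T \<subseteq> T')"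
          then have sub: "S \<subseteq> S'" "T \<subseteq> T'" by auto
          have "(S', T') \<notin> horn_pairs n k"
          proof
            assume "(S', T') \<in> horn_pairs n k"
            then obtain i where i: "i \<le> n" "i \<noteq> k" "face_pair i S' T'" by (auto simp: horn_pairs_def)
            then have "face_pair i S T" using face_pair_mono sub by blast
            moreover have "i \<in> S \<union> T" using VD'(7) i by auto
            ultimately show False using VD'(1,2) by (auto simp: face_pair_def split: if_splits)
          qed
          then obtain S1 T1 where 1: "(S1, T1) \<in> R" "(S', T') \<in> box (S1, T1)" using A by auto
          then have "S \<subseteq> insert k S1" "T \<subseteq> insert k T1" using sub by (auto simp: boxI)
          then have "S \<subseteq> S1" "T \<subseteq> T1" using VD'(5,6) by auto
          then have "(S, T) \<in> R" by (rule Suc.prems(2)[OF 1(1) V(1)])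
          then show False using V(2) by blast
        qed
      next
        assume B: "\<not> S \<subseteq> S' \<or> \<not> T \<subseteq> T'"
        show "(S', T') \<in> ?A"
        proof (cases "(S', T') \<in> horn_pairs n k")
          case False
          then have nf: "\<not> face_pair i S' T'" if "i \<le> n" "i \<noteq> k" for i
            using that sp by (auto simp: horn_pairs_def)
          have 0: "0 \<in> S'" "0 \<in> T'" using nf[of 0] k by (auto simp: face_pair_def)
          have "i \<in> S' \<union> T'" if "i \<le> n" "i \<noteq> k" for i
            using nf[OF that] 0 by (cases "i = 0") (auto simp: face_pair_def)
          then have "(S' - {k}) \<union> (T' - {k}) = {..n} - {k}" using sp by (auto simp: simplex_pairs_def)
          then have "(S' - {k}, T' - {k}) \<in> V" using 0 k by (auto simp: V_def)
          moreover have "(S' - {k}, T' - {k}) \<noteq> (S, T)" using B by auto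
          ultimately have "(S' - {k}, T' - {k}) \<in> R" using min[of "S' - {k}" "T' - {k}"] * by blast
          moreover have "(S', T') \<in> box (S' - {k}, T' - {k})" using * by (auto simp: boxI)
          ultimately show ?thesis by blast
        qed simp
      qed
    qed auto
    have "extends Z (horn_pairs n k \<union> \<Union> (box ` insert (S, T) R)) (simplex_pairs n)"
    proof (rule Suc.hyps(1))
      have "V - insert (S, T) R = (V - R) - {(S, T)}" by blast
      then show "m = card (V - insert (S, T) R)" using Suc.hyps(2) V finV by (simp add: card_Diff_singleton)
      show "insert (S, T) R \<subseteq> V" using V Suc.prems(1) by blast
      fix S1 T1 S' T' assume *: "(S1, T1) \<in> insert (S, T) R" "(S', T') \<in> V" "S' \<subseteq> S1" "T' \<subseteq> T1"
      show "(S', T') \<in> insert (S, T) R"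
      proof (cases "(S1, T1) \<in> R")
        case True
        then show ?thesis using Suc.prems(2)[OF True *(2-4)] by simp
      next
        case False
        then show ?thesis using min[OF *(2)] * by auto
      qed
    qed
    moreover have "horn_pairs n k \<union> \<Union> (box ` insert (S, T) R) =
        ?A \<union> {(S', T'). S' \<noteq> {} \<and> T' \<noteq> {} \<and> S' \<subseteq> insert k S \<and> T' \<subseteq> insert k T}"
      by (auto simp: box_def)
    ultimately show ?case using extends_trans[OF step] by simp
  qed
  from this[of "{}"] show ?thesis by simp
qed

text \<open>The codegeneracy that repeats \<open>i\<close>, as a function on vertices. It is a left
  inverse of the coface omitting \<open>i\<close>; this includes the top \<open>i\<close>, where it
  leaves the lower vertices alone.\<close>

definition squash :: "nat \<Rightarrow> nat \<Rightarrow> nat" where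
  "squash i x = (if i < x then x - 1 else x)"

lemma squash_mono: "x \<le> y \<Longrightarrow> squash i x \<le> squash i y"
  by (auto simp: squash_def)

lemma length_coface: "i \<le> m \<Longrightarrow> length (coface m i) = m"
  by (simp add: coface_def)

lemma coface_nth: "i \<le> m \<Longrightarrow> x < m \<Longrightarrow> coface m i ! x = (if x < i then x else Suc x)"
  by (auto simp: coface_def nth_append simp del: upt_Suc)

lemma set_coface: "i \<le> m \<Longrightarrow> set (coface m i) = {..m} - {i}"
  by (auto simp: coface_def simp del: upt_Suc)

lemma coface_ops: "i \<le> Suc m \<Longrightarrow> coface (Suc m) i \<in> ops m (Suc m)"
  using length_coface[of i "Suc m"] set_coface[of i "Suc m"]
  by (auto simp: ops_def coface_def sorted_append simp del: upt_Suc)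

lemma squash_ops:
  assumes "\<sigma> \<in> ops p (Suc m)" "i \<le> Suc m" "i = Suc m \<Longrightarrow> Suc m \<notin> set \<sigma>"
  shows "map (squash i) \<sigma> \<in> ops p m"
proof -
  have "squash i x \<le> m" if "x \<in> set \<sigma>" for x
    using assms that by (auto simp: ops_def squash_def subset_iff le_Suc_eq)
  moreover have "sorted (map (squash i) \<sigma>)"
    using assms(1) unfolding sorted_map ops_def by (auto elim!: sorted_wrt_mono_rel[rotated] simp: squash_mono)
  ultimately show ?thesis using assms(1) by (auto simp: ops_def)
qed

lemma squash_coface: "i \<le> Suc m \<Longrightarrow> map (squash i) (coface (Suc m) i) = id_op m"
  by (intro nth_equalityI)
    (auto simp: length_coface coface_nth id_op_def squash_def simp del: upt_Suc)

lemma coface_squash: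
  assumes "set \<sigma> \<subseteq> {..Suc m}" "i \<notin> set \<sigma>" "i \<le> Suc m"
  shows "pick (coface (Suc m) i) (map (squash i) \<sigma>) = \<sigma>"
  unfolding pick_def map_map
proof (rule map_idI)
  fix x assume x: "x \<in> set \<sigma>"
  then have "x \<noteq> i" "x \<le> Suc m" using assms by auto
  then show "((!) (coface (Suc m) i) \<circ> squash i) x = x"
    using assms(3) by (auto simp: coface_nth squash_def)
qed

lemma cells_simplex_pairs:
  "(\<sigma>, \<tau>) \<in> cells (cplx (simplex_pairs n)) i j \<longleftrightarrow> \<sigma> \<in> ops i n \<and> \<tau> \<in> ops j n"
  by (auto simp: cells_cplx simplex_pairs_def ops_def)

lemma cells_horn_pairs:
  "(\<sigma>, \<tau>) \<in> cells (cplx (horn_pairs n k)) i j \<longleftrightarrow>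
     \<sigma> \<in> ops i n \<and> \<tau> \<in> ops j n \<and> (\<exists>r\<le>n. r \<noteq> k \<and> face_pair r (set \<sigma>) (set \<tau>))"
  by (auto simp: cells_cplx horn_pairs_def simplex_pairs_def ops_def)

text \<open>The faces \<open>x i\<close> prescribe values on the cells of \<open>horn_pairs\<close>,
  and \<open>extends_horn_pairs\<close> extends them to all of Delta[n,n]. The filler is
  automatically collapsed: at \<open>s \<ge> 1\<close> the condition concerns only cells one of
  whose lists avoids 0, and their values come from the face \<open>x 0\<close>, which is present
  because \<open>k \<ge> 1\<close>.\<close>

lemma collapsed_horn:
  assumes Z: "kan Z" and k: "1 \<le> k" "k \<le> Suc (Suc m)"
    and x: "\<And>i. i \<le> Suc (Suc m) \<Longrightarrow> i \<noteq> k \<Longrightarrow> collapsed Z (Suc m) (x i)"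
    and compat: "\<And>i j. i < j \<Longrightarrow> j \<le> Suc (Suc m) \<Longrightarrow> i \<noteq> k \<Longrightarrow> j \<noteq> k \<Longrightarrow>
      act Z (Suc m) (Suc m) (coface (Suc m) (j - 1)) (coface (Suc m) (j - 1)) (x i) =
      act Z (Suc m) (Suc m) (coface (Suc m) i) (coface (Suc m) i) (x j)"
  obtains z where "collapsed Z (Suc (Suc m)) z"
    and "\<And>i. i \<le> Suc (Suc m) \<Longrightarrow> i \<noteq> k \<Longrightarrow>
      act Z (Suc (Suc m)) (Suc (Suc m)) (coface (Suc (Suc m)) i) (coface (Suc (Suc m)) i) z = x i"
proof -
  let ?m = "Suc m" and ?n = "Suc (Suc m)"
  have bZ: "bisimplicial_set Z" using Z by (rule kan_bisimplicial)
  define val where "val i \<sigma> \<tau> = act Z ?m ?m (map (squash i) \<sigma>) (map (squash i) \<tau>) (x i)" for i \<sigma> \<tau>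
  define ok where "ok i \<sigma> \<tau> \<longleftrightarrow> i \<le> ?n \<and> i \<noteq> k \<and> face_pair i (set \<sigma>) (set \<tau>)" for i \<sigma> \<tau>
  have okD: "map (squash i) \<sigma> \<in> ops p ?m" "map (squash i) \<tau> \<in> ops q ?m" "collapsed Z ?m (x i)" "x i \<in> cells Z ?m ?m"
    if "ok i \<sigma> \<tau>" "\<sigma> \<in> ops p ?n" "\<tau> \<in> ops q ?n" for i \<sigma> \<tau> p q
    using that x[of i] collapsed_cells[of Z ?m "x i"]
    by (auto simp: ok_def face_pair_def split: if_splits intro!: squash_ops)
  \<comment> \<open>If both lists avoid \<open>i\<close> and \<open>j\<close>, the two values factor
    through the common codimension two face and agree by \<open>compat\<close>.\<close>
  have regular: "val i \<sigma> \<tau> = val j \<sigma> \<tau>"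
    if ij: "i < j" "j \<le> ?n" "i \<noteq> k" "j \<noteq> k" and o: "\<sigma> \<in> ops p ?n" "\<tau> \<in> ops q ?n"
      and av: "i \<notin> set \<sigma>" "j \<notin> set \<sigma>" "i \<notin> set \<tau>" "j \<notin> set \<tau>" for i j \<sigma> \<tau> p q
  proof -
    have oki: "ok i \<sigma> \<tau>" "ok j \<sigma> \<tau>" using ij av by (auto simp: ok_def face_pair_def)
    note di = okD[OF oki(1) o] and dj = okD[OF oki(2) o]
    have sq: "map (squash (j - 1)) (map (squash i) \<rho>) = map (squash i) (map (squash j) \<rho>)"
      "j - 1 \<notin> set (map (squash i) \<rho>)" "i \<notin> set (map (squash j) \<rho>)"
      if "i \<notin> set \<rho>" "j \<notin> set \<rho>" for \<rho>
    proof -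
      have k: "squash (j - 1) (squash i y) = squash i (squash j y)" "squash i y \<noteq> j - 1" "squash j y \<noteq> i"
        if "y \<in> set \<rho>" for y
      proof -
        have "y \<noteq> i" "y \<noteq> j" using that \<open>i \<notin> set \<rho>\<close> \<open>j \<notin> set \<rho>\<close> by auto
        then show "squash (j - 1) (squash i y) = squash i (squash j y)" "squash i y \<noteq> j - 1" "squash j y \<noteq> i"
          using ij(1) by (auto simp: squash_def)
      qed
      show "map (squash (j - 1)) (map (squash i) \<rho>) = map (squash i) (map (squash j) \<rho>)"
        using k(1) by simp
      show "j - 1 \<notin> set (map (squash i) \<rho>)" using k(2) unfolding set_map by (metis imageE)
      show "i \<notin> set (map (squash j) \<rho>)" using k(3) unfolding set_map by (metis imageE)
    qed
    define \<sigma>' where "\<sigma>' = map (squash i) (map (squash j) \<sigma>)"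
    define \<tau>' where "\<tau>' = map (squash i) (map (squash j) \<tau>)"
    have jm: "j - 1 \<le> ?m" "i \<le> ?m" using ij by auto
    have pi: "pick (coface ?m (j - 1)) \<sigma>' = map (squash i) \<sigma>" "pick (coface ?m (j - 1)) \<tau>' = map (squash i) \<tau>"
      unfolding \<sigma>'_def \<tau>'_def sq(1)[OF av(1,2), symmetric] sq(1)[OF av(3,4), symmetric]
      using coface_squash[OF _ sq(2)[OF av(1,2)] jm(1)] coface_squash[OF _ sq(2)[OF av(3,4)] jm(1)] opsD(3)[OF di(1)] opsD(3)[OF di(2)]
      by auto
    have pj: "pick (coface ?m i) \<sigma>' = map (squash j) \<sigma>" "pick (coface ?m i) \<tau>' = map (squash j) \<tau>"
      unfolding \<sigma>'_def \<tau>'_def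
      using coface_squash[OF _ sq(3)[OF av(1,2)] jm(2)] coface_squash[OF _ sq(3)[OF av(3,4)] jm(2)] opsD(3)[OF dj(1)] opsD(3)[OF dj(2)]
      by auto
    have o': "\<sigma>' \<in> ops p m" "\<tau>' \<in> ops q m"
      unfolding \<sigma>'_def \<tau>'_def
      using squash_ops[OF dj(1) jm(2)] squash_ops[OF dj(2) jm(2)] sq(3)[OF av(1,2)] sq(3)[OF av(3,4)] by blast+
    have "val i \<sigma> \<tau> = act Z m m \<sigma>' \<tau>' (act Z ?m ?m (coface ?m (j - 1)) (coface ?m (j - 1)) (x i))"
      unfolding val_def pi[symmetric]
      by (rule act_act[OF bZ di(4) coface_ops[OF jm(1)] coface_ops[OF jm(1)] o', symmetric])
    also have "\<dots> = act Z m m \<sigma>' \<tau>' (act Z ?m ?m (coface ?m i) (coface ?m i) (x j))"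
      unfolding compat[OF ij] ..
    also have "\<dots> = val j \<sigma> \<tau>"
      unfolding val_def pj[symmetric]
      by (rule act_act[OF bZ dj(4) coface_ops[OF jm(2)] coface_ops[OF jm(2)] o'])
    finally show ?thesis .
  qed
  \<comment> \<open>For the top face \<open>i = ?n\<close> the value \<open>s = ?n\<close> is
    excluded, because \<open>squash\<close> leaves it fixed, one above the range of
    \<open>x i\<close>.\<close>
  have norm: "val i \<sigma> \<tau> = val i (map (max s) \<sigma>) (map (max s) \<tau>)"
    if ok: "ok i \<sigma> \<tau>" and o: "\<sigma> \<in> ops p ?n" "\<tau> \<in> ops q ?n"
      and s: "s \<le> ?n" "i = ?n \<Longrightarrow> s \<noteq> i" "set \<sigma> \<subseteq> {s..} \<or> set \<tau> \<subseteq> {s..}" for i \<sigma> \<tau> s p q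
  proof -
    note d = okD[OF ok o]
    have "i \<le> ?n" using ok by (simp add: ok_def)
    then have sm: "squash i s \<le> ?m" using s(1,2) by (cases "s = ?n") (auto simp: squash_def)
    have "val i \<sigma> \<tau> = act Z ?m ?m (map (max (squash i s)) (map (squash i) \<sigma>)) (map (max (squash i s)) (map (squash i) \<tau>)) (x i)"
      unfolding val_def
    proof (rule collapsedD[OF d(3,1,2) sm])
      have "set (map (squash i) \<rho>) \<subseteq> {squash i s..}" if "set \<rho> \<subseteq> {s..}" for \<rho>
        using that by (auto intro!: squash_mono)
      from this[of \<sigma>] this[of \<tau>]
      show "set (map (squash i) \<sigma>) \<subseteq> {squash i s..} \<or> set (map (squash i) \<tau>) \<subseteq> {squash i s..}"
        using s(3) by blast
    qed
    moreover have "max (squash i s) (squash i y) = squash i (max s y)" for y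
      by (auto simp: squash_def max_def)
    ultimately show ?thesis by (simp add: val_def comp_def)
  qed
  have agree0: "val i \<sigma> \<tau> = val j \<sigma> \<tau>"
    if ij: "i < j" "ok i \<sigma> \<tau>" "ok j \<sigma> \<tau>" and o: "\<sigma> \<in> ops p ?n" "\<tau> \<in> ops q ?n" for i j \<sigma> \<tau> p q
  proof -
    have j: "j \<le> ?n" "j \<notin> set \<sigma>" "j \<notin> set \<tau>" "i \<noteq> k" "j \<noteq> k" using ij by (auto simp: ok_def face_pair_def split: if_splits)
    show ?thesis
    proof (cases "i = 0")
      case False
      then show ?thesis using regular[OF ij(1) j(1,4,5) o] ij(2) j by (auto simp: ok_def face_pair_def)
    next
      case True
      \<comment> \<open>A cell of the face 0 may still have 0 in one list. The collapse at the
        minimum \<open>s\<close> of the list without 0 replaces it by a cell both of whose lists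
        avoid 0. As \<open>s\<close> occurs in a list, it differs from \<open>j\<close>, so the
        raised lists still avoid \<open>j\<close>.\<close>
      define s where "s = (if 0 \<notin> set \<sigma> then Min (set \<sigma>) else Min (set \<tau>))"
      have ne: "set \<sigma> \<noteq> {}" "set \<tau> \<noteq> {}" using o by (auto dest: ops_nonempty)
      have s: "s \<in> set \<sigma> \<union> set \<tau>" "s \<noteq> 0" "set \<sigma> \<subseteq> {s..} \<or> set \<tau> \<subseteq> {s..}"
      proof -
        have "0 \<notin> set \<sigma> \<or> 0 \<notin> set \<tau>" using ij(2) True by (simp add: ok_def face_pair_def)
        then show "s \<in> set \<sigma> \<union> set \<tau>" "s \<noteq> 0" "set \<sigma> \<subseteq> {s..} \<or> set \<tau> \<subseteq> {s..}"
          using ne Min_in[of "set \<sigma>"] Min_in[of "set \<tau>"] by (auto simp: s_def intro!: gr0I)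
      qed
      have sn: "s \<le> ?n" "s \<noteq> j" using s(1) j o by (auto simp: ops_def)
      let ?\<sigma> = "map (max s) \<sigma>" and ?\<tau> = "map (max s) \<tau>"
      have av: "0 \<notin> set ?\<sigma>" "0 \<notin> set ?\<tau>" "j \<notin> set ?\<sigma>" "j \<notin> set ?\<tau>"
        using s(2) sn(2) j(2,3) by (auto simp: max_def split: if_splits)
      have "val i \<sigma> \<tau> = val i ?\<sigma> ?\<tau>" using norm[OF ij(2) o sn(1) _ s(3)] True by simp
      also have "\<dots> = val j ?\<sigma> ?\<tau>"
        using regular[OF ij(1) j(1,4,5) max_ops[OF o(1) sn(1)] max_ops[OF o(2) sn(1)]] av True by simp
      also have "\<dots> = val j \<sigma> \<tau>" using norm[OF ij(3) o sn(1) _ s(3)] sn(2) by simp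
      finally show ?thesis .
    qed
  qed
  have agree: "val i \<sigma> \<tau> = val j \<sigma> \<tau>"
    if "ok i \<sigma> \<tau>" "ok j \<sigma> \<tau>" "\<sigma> \<in> ops p ?n" "\<tau> \<in> ops q ?n" for i j \<sigma> \<tau> p q
  proof (cases i j rule: linorder_cases)
    case less
    then show ?thesis by (rule agree0[OF _ that])
  next
    case greater
    then show ?thesis by (rule agree0[OF _ that(2,1,3,4), symmetric])
  qed simp
  \<comment> \<open>A cell may lie on several of the prescribed faces; by \<open>agree\<close> any
    choice gives the same value.\<close>
  define \<Phi> where "\<Phi> = (\<lambda>(p::nat) (q::nat) (\<sigma>, \<tau>). val (SOME i. ok i \<sigma> \<tau>) \<sigma> \<tau>)"
  have Phi: "\<Phi> p q (\<sigma>, \<tau>) = val i \<sigma> \<tau>" if "ok i \<sigma> \<tau>" "\<sigma> \<in> ops p ?n" "\<tau> \<in> ops q ?n" for p q i \<sigma> \<tau>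
    unfolding \<Phi>_def using agree[OF someI[of "\<lambda>i. ok i \<sigma> \<tau>", OF that(1)] that] by simp
  let ?P = "horn_pairs ?n k"
  have okP: "(\<sigma>, \<tau>) \<in> cells (cplx ?P) p q \<longleftrightarrow> \<sigma> \<in> ops p ?n \<and> \<tau> \<in> ops q ?n \<and> (\<exists>i. ok i \<sigma> \<tau>)" for \<sigma> \<tau> p q
    by (auto simp: cells_horn_pairs ok_def)
  have "nat_on (cplx ?P) Z \<Phi>"
  proof (rule nat_onI)
    fix p q c assume c: "c \<in> cells (cplx ?P) p q"
    obtain \<sigma> \<tau> where e: "c = (\<sigma>, \<tau>)" by (cases c)
    obtain i where i: "ok i \<sigma> \<tau>" "\<sigma> \<in> ops p ?n" "\<tau> \<in> ops q ?n" using c okP e by auto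
    show "\<Phi> p q c \<in> cells Z p q"
      unfolding e Phi[OF i] val_def by (rule act_cells[OF bZ okD(4)[OF i] okD(1,2)[OF i]])
  next
    fix p q p' q' \<theta> \<phi> c assume op: "\<theta> \<in> ops p' p" "\<phi> \<in> ops q' q" and c: "c \<in> cells (cplx ?P) p q"
    obtain \<sigma> \<tau> where e: "c = (\<sigma>, \<tau>)" by (cases c)
    obtain i where i: "ok i \<sigma> \<tau>" "\<sigma> \<in> ops p ?n" "\<tau> \<in> ops q ?n" using c okP e by auto
    have i': "ok i (pick \<sigma> \<theta>) (pick \<tau> \<phi>)"
      using i(1) face_pair_mono[OF _ set_pick_ops[OF i(2) op(1)] set_pick_ops[OF i(3) op(2)]] by (auto simp: ok_def)
    have "\<Phi> p' q' (act (cplx ?P) p q \<theta> \<phi> c) = val i (pick \<sigma> \<theta>) (pick \<tau> \<phi>)"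
      unfolding e act_cplx by (rule Phi[OF i' pick_ops[OF i(2) op(1)] pick_ops[OF i(3) op(2)]])
    also have "\<dots> = act Z p q \<theta> \<phi> (val i \<sigma> \<tau>)"
      unfolding val_def using act_act[OF bZ okD(4)[OF i] okD(1,2)[OF i] op]
        map_pick[OF op(1) opsD(1)[OF i(2)], of "squash i"] map_pick[OF op(2) opsD(1)[OF i(3)], of "squash i"] by simp
    finally show "\<Phi> p' q' (act (cplx ?P) p q \<theta> \<phi> c) = act Z p q \<theta> \<phi> (\<Phi> p q c)"
      unfolding e Phi[OF i] .
  qed
  then obtain g where g: "nat_on (cplx (simplex_pairs ?n)) Z g"
    and gP: "\<forall>p q. \<forall>c \<in> cells (cplx ?P) p q. g p q c = \<Phi> p q c"
    using extends_horn_pairs[OF Z k] unfolding extends_def by meson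
  define z where "z = g ?n ?n (id_op ?n, id_op ?n)"
  have idc: "(id_op ?n, id_op ?n) \<in> cells (cplx (simplex_pairs ?n)) ?n ?n" by (simp add: cells_simplex_pairs id_op_ops)
  have zc: "z \<in> cells Z ?n ?n" unfolding z_def by (rule nat_onD(1)[OF g idc])
  have az: "act Z ?n ?n \<sigma> \<tau> z = val i \<sigma> \<tau>" if "ok i \<sigma> \<tau>" "\<sigma> \<in> ops p ?n" "\<tau> \<in> ops q ?n" for i \<sigma> \<tau> p q
  proof -
    have "act Z ?n ?n \<sigma> \<tau> z = g p q (\<sigma>, \<tau>)"
      using nat_onD(2)[OF g idc that(2,3)] that by (simp add: z_def act_cplx id_pick)
    also have "\<dots> = \<Phi> p q (\<sigma>, \<tau>)" using gP okP[of \<sigma> \<tau> p q] that by blast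
    finally show ?thesis using Phi[OF that] by simp
  qed
  show thesis
  proof (rule that)
    show "collapsed Z ?n z"
      unfolding collapsed_def
    proof (intro conjI zc allI ballI impI)
      fix p q s \<sigma> \<tau> assume *: "\<sigma> \<in> ops p ?n" "\<tau> \<in> ops q ?n" "s \<le> ?n" "set \<sigma> \<subseteq> {s..} \<or> set \<tau> \<subseteq> {s..}"
      show "act Z ?n ?n \<sigma> \<tau> z = act Z ?n ?n (map (max s) \<sigma>) (map (max s) \<tau>) z"
      proof (cases "s = 0")
        case True
        have "map (max s) \<rho> = \<rho>" for \<rho> :: "nat list" using True by (auto intro: map_idI)
        then show ?thesis by simp
      next
        case False
        \<comment> \<open>A list with values at least \<open>s \<ge> 1\<close> avoids 0, so both
          cells belong to the face 0, where \<open>norm\<close> compares them.\<close>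
        have ok: "ok 0 \<sigma> \<tau>" using False *(4) k by (auto simp: ok_def face_pair_def)
        have ok': "ok 0 (map (max s) \<sigma>) (map (max s) \<tau>)" using False k by (auto simp: ok_def face_pair_def)
        show ?thesis
          using az[OF ok *(1,2)] az[OF ok' max_ops[OF *(1,3)] max_ops[OF *(2,3)]] norm[OF ok *(1,2,3) _ *(4)] by simp
      qed
    qed
  next
    fix i assume i: "i \<le> ?n" "i \<noteq> k"
    have "ok i (coface ?n i) (coface ?n i)" using i by (auto simp: ok_def face_pair_def set_coface)
    then have "act Z ?n ?n (coface ?n i) (coface ?n i) z = val i (coface ?n i) (coface ?n i)"
      using az coface_ops[OF i(1)] by blast
    also have "\<dots> = x i"
      unfolding val_def squash_coface[OF i(1)] by (rule act_id[OF bZ collapsed_cells[OF x[OF i]]])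
    finally show "act Z ?n ?n (coface ?n i) (coface ?n i) z = x i" .
  qed
qed

section \<open>Pointwise description of relative homotopies\<close>

lemma rel_cells_iff:
  assumes L: "\<And>i j. cells L i j \<subseteq> cells (bistd m n) i j"
  shows "x \<in> rel_cells Y v m n L \<longleftrightarrow> x \<in> cells Y m n \<and>
     (\<forall>i j. \<forall>(a, b) \<in> cells L i j. act Y m n a b x = base Y v i j)"
proof -
  have "trivial_on L Y v (cell_map Y m n x) \<longleftrightarrow> (\<forall>i j. \<forall>(a, b) \<in> cells L i j. act Y m n a b x = base Y v i j)" (is "?l \<longleftrightarrow> ?r")
  proof
    assume l: ?l
    show ?r
    proof (intro allI ballI, clarify)
      fix i j a b assume ab: "(a, b) \<in> cells L i j"
      have "restr_bimap L (cell_map Y m n x) i j (a, b) = const_bimap L Y v i j (a, b)"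
        using l by (simp add: trivial_on_def)
      moreover have "(a, b) \<in> cells (bistd m n) i j" using ab L by blast
      ultimately show "act Y m n a b x = base Y v i j"
        using ab by (simp add: restr_bimap_def cell_map_def const_bimap_def)
    qed
  next
    assume r: ?r
    have e: "restr_bimap L (cell_map Y m n x) i j c = const_bimap L Y v i j c" for i j c
    proof (cases "c \<in> cells L i j")
      case True
      obtain a b where c: "c = (a, b)" by (cases c)
      have "(a, b) \<in> cells (bistd m n) i j" using True L c by blast
      then show ?thesis
        using True bspec[OF r[THEN spec, THEN spec] True]
        by (simp add: c restr_bimap_def cell_map_def const_bimap_def)
    qed (simp add: restr_bimap_def const_bimap_def)
    show ?l unfolding trivial_on_def by (rule ext, rule ext, rule ext, rule e)
  qed
  then show ?thesis by (simp add: rel_cells_def)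
qed

lemma restrict_eq_iff:
  "(\<lambda>i j. restrict (F i j) (A i j)) = (\<lambda>i j. restrict (G i j) (A i j)) \<longleftrightarrow>
     (\<forall>i j. \<forall>x\<in>A i j. F i j x = G i j x)" (is "?l \<longleftrightarrow> ?r")
proof
  assume l: ?l
  show ?r
  proof (intro allI ballI)
    fix i j x assume "x \<in> A i j"
    then show "F i j x = G i j x" using fun_cong[OF fun_cong[OF fun_cong[OF l, of i], of j], of x] by simp
  qed
next
  assume r: ?r
  show ?l by (rule ext, rule ext, rule restrict_ext) (use r in simp)
qed

lemma ops_avoid: "c \<in> ops i (Suc 0) \<Longrightarrow> 0 \<notin> set c \<Longrightarrow> c = replicate (Suc i) (Suc 0)"
  by (rule replicate_eqI) (auto simp: ops_def subset_iff le_Suc_eq)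

lemma ops_const: "c \<in> ops i m \<Longrightarrow> set c \<subseteq> {s} \<Longrightarrow> c = replicate (Suc i) s"
  by (rule replicate_eqI) (auto simp: ops_def)

lemma pick_singleton: "c \<in> ops i 0 \<Longrightarrow> pick [s] c = replicate (Suc i) s"
  using pick_replicate[of c i 0 s] by simp

text \<open>A simplex of Delta[1] that avoids one vertex is constant at the other. Hence each hatted
  face of \<open>h\<close> is its restriction to the cells on which \<open>c\<close>, or
  \<open>d\<close>, or both are constant.\<close>

lemma is_homotopy_iff:
  fixes K :: "'k bisset"
  shows "is_homotopy K X h f g \<longleftrightarrow> is_bimap (bprod K (bistd 1 1)) X h \<and>
    (\<forall>i j. \<forall>x \<in> cells K i j. \<forall>c \<in> ops i 1. \<forall>d \<in> ops j 1.
       (0 \<notin> set c \<or> 0 \<notin> set d \<longrightarrow> h i j (x, (c, d)) = f i j x) \<and>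
       (1 \<notin> set c \<and> 1 \<notin> set d \<longrightarrow> h i j (x, (c, d)) = g i j x))"
proof -
  have ops1: "[Suc 0] \<in> ops 0 1" "[0] \<in> ops 0 1" "[0, 0] \<in> ops 1 0" "[0] \<in> ops 0 0" by (auto simp: ops_def)
  have r01: "replicate (Suc i) 0 \<in> ops i 0" for i by (rule replicate_ops) simp
  have cf: "coface 1 0 = [Suc 0]" "coface 1 1 = [0]" "codegen 0 0 = [0, 0]" "id_op 0 = [0]"
    by (simp_all add: coface_def codegen_def id_op_def)
  have f1: "face1 (Hom K X) 1 1 0 h = degen2 (Hom K X) 0 0 0 (vertex_of K f) \<longleftrightarrow>
     (\<forall>i j. \<forall>x \<in> cells K i j. \<forall>d \<in> ops j 1. h i j (x, (replicate (Suc i) 1, d)) = f i j x)" (is "?l \<longleftrightarrow> ?r")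
  proof -
    have "?l \<longleftrightarrow> (\<forall>i j. \<forall>(x, a, b) \<in> cells (bprod K (bistd 0 1)) i j.
        h i j (x, pick [Suc 0] a, pick (id_op 1) b) = vertex_of K f i j (x, pick [0] a, pick [0, 0] b))"
      unfolding face1_def degen2_def cf act_Hom[OF ops1(1) id_op_ops] act_Hom[OF ops1(4) ops1(3)] restrict_eq_iff by (simp add: split_beta)
    also have "\<dots> \<longleftrightarrow> ?r"
    proof
      assume A: "\<forall>i j. \<forall>(x, a, b) \<in> cells (bprod K (bistd 0 1)) i j.
        h i j (x, pick [Suc 0] a, pick (id_op 1) b) = vertex_of K f i j (x, pick [0] a, pick [0, 0] b)"
      show ?r
      proof (intro allI ballI)
        fix i j x d assume "x \<in> cells K i j" "d \<in> ops j 1"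
        then show "h i j (x, (replicate (Suc i) 1, d)) = f i j x"
          using A[THEN spec, THEN spec, THEN bspec, of "(x, replicate (Suc i) 0, d)" i j] r01[of i] r01[of j]
            pick_ops[OF ops1(3), of d j]
          by (simp add: vertex_of_def pick_singleton id_pick del: replicate_Suc)
      qed
    next
      assume r: ?r
      show "\<forall>i j. \<forall>(x, a, b) \<in> cells (bprod K (bistd 0 1)) i j.
        h i j (x, pick [Suc 0] a, pick (id_op 1) b) = vertex_of K f i j (x, pick [0] a, pick [0, 0] b)"
        using r r01 pick_ops[OF ops1(3)] by (auto simp: vertex_of_def pick_singleton id_pick simp del: replicate_Suc)
    qed
    finally show ?thesis .
  qed
  have f2: "face2 (Hom K X) 1 1 0 h = degen1 (Hom K X) 0 0 0 (vertex_of K f) \<longleftrightarrow>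
     (\<forall>i j. \<forall>x \<in> cells K i j. \<forall>c \<in> ops i 1. h i j (x, (c, replicate (Suc j) 1)) = f i j x)" (is "?l \<longleftrightarrow> ?r")
  proof -
    have "?l \<longleftrightarrow> (\<forall>i j. \<forall>(x, a, b) \<in> cells (bprod K (bistd 1 0)) i j.
        h i j (x, pick (id_op 1) a, pick [Suc 0] b) = vertex_of K f i j (x, pick [0, 0] a, pick [0] b))"
      unfolding face2_def degen1_def cf act_Hom[OF id_op_ops ops1(1)] act_Hom[OF ops1(3) ops1(4)] restrict_eq_iff by (simp add: split_beta)
    also have "\<dots> \<longleftrightarrow> ?r"
    proof
      assume A: "\<forall>i j. \<forall>(x, a, b) \<in> cells (bprod K (bistd 1 0)) i j.
        h i j (x, pick (id_op 1) a, pick [Suc 0] b) = vertex_of K f i j (x, pick [0, 0] a, pick [0] b)"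
      show ?r
      proof (intro allI ballI)
        fix i j x c assume "x \<in> cells K i j" "c \<in> ops i 1"
        then show "h i j (x, (c, replicate (Suc j) 1)) = f i j x"
          using A[THEN spec, THEN spec, THEN bspec, of "(x, c, replicate (Suc j) 0)" i j] r01[of i] r01[of j]
            pick_ops[OF ops1(3), of c i]
          by (simp add: vertex_of_def pick_singleton id_pick del: replicate_Suc)
      qed
    next
      assume r: ?r
      show "\<forall>i j. \<forall>(x, a, b) \<in> cells (bprod K (bistd 1 0)) i j.
        h i j (x, pick (id_op 1) a, pick [Suc 0] b) = vertex_of K f i j (x, pick [0, 0] a, pick [0] b)"
        using r r01 pick_ops[OF ops1(3)] by (auto simp: vertex_of_def pick_singleton id_pick simp del: replicate_Suc)
    qed
    finally show ?thesis .
  qed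
  have f3: "face1 (Hom K X) 1 0 1 (face2 (Hom K X) 1 1 1 h) = vertex_of K g \<longleftrightarrow>
     (\<forall>i j. \<forall>x \<in> cells K i j. h i j (x, (replicate (Suc i) 0, replicate (Suc j) 0)) = g i j x)" (is "?l \<longleftrightarrow> ?r")
  proof -
    have "?l \<longleftrightarrow> (\<forall>i j. \<forall>(x, a, b) \<in> cells (bprod K (bistd 0 0)) i j.
        act (Hom K X) 1 1 (id_op 1) [0] h i j (x, pick [0] a, pick (id_op 0) b) = g i j x)"
      unfolding face1_def face2_def cf(2) vertex_of_def act_Hom[OF ops1(2) id_op_ops] restrict_eq_iff by (simp add: split_beta)
    also have "\<dots> \<longleftrightarrow> ?r"
    proof
      assume A: "\<forall>i j. \<forall>(x, a, b) \<in> cells (bprod K (bistd 0 0)) i j.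
        act (Hom K X) 1 1 (id_op 1) [0] h i j (x, pick [0] a, pick (id_op 0) b) = g i j x"
      show ?r
      proof (intro allI ballI)
        fix i j x assume "x \<in> cells K i j"
        then show "h i j (x, (replicate (Suc i) 0, replicate (Suc j) 0)) = g i j x"
          using A[THEN spec, THEN spec, THEN bspec, of "(x, replicate (Suc i) 0, replicate (Suc j) 0)" i j] r01[of i] r01[of j]
            replicate_ops[of 0 1 i] replicate_ops[of 0 1 j]
          by (simp add: act_Hom[OF id_op_ops ops1(2)] pick_singleton id_pick del: replicate_Suc One_nat_def)
      qed
    next
      assume r: ?r
      have "act (Hom K X) 1 1 (id_op 1) [0] h i j (x, pick [0] a, pick (id_op 0) b) = g i j x"
        if "x \<in> cells K i j" "a \<in> ops i 0" "b \<in> ops j 0" for i j x a b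
        using r that replicate_ops[of 0 1 i] replicate_pick[OF that(3)]
        by (simp add: act_Hom[OF id_op_ops ops1(2)] pick_singleton id_pick del: replicate_Suc One_nat_def)
      then show "\<forall>i j. \<forall>(x, a, b) \<in> cells (bprod K (bistd 0 0)) i j.
        act (Hom K X) 1 1 (id_op 1) [0] h i j (x, pick [0] a, pick (id_op 0) b) = g i j x" by auto
    qed
    finally show ?thesis .
  qed
  have c0: "c = replicate (Suc i) 0" if "c \<in> ops i 1" "1 \<notin> set c" for c i
    using ops_const[OF that(1), of 0] that by (auto simp: ops_def subset_iff le_Suc_eq)
  have c1: "c = replicate (Suc i) 1" if "c \<in> ops i 1" "0 \<notin> set c" for c i
    using ops_avoid[of c i] that by simp
  have r1: "replicate (Suc i) 1 \<in> ops i 1" "replicate (Suc i) 0 \<in> ops i 1" for i by (rule replicate_ops; simp)+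
  show ?thesis
    unfolding is_homotopy_def f1 f2 f3
  proof (intro conj_cong HOL.refl)
    show "((\<forall>i j. \<forall>x \<in> cells K i j. \<forall>d \<in> ops j 1. h i j (x, (replicate (Suc i) 1, d)) = f i j x) \<and>
       (\<forall>i j. \<forall>x \<in> cells K i j. \<forall>c \<in> ops i 1. h i j (x, (c, replicate (Suc j) 1)) = f i j x) \<and>
       (\<forall>i j. \<forall>x \<in> cells K i j. h i j (x, (replicate (Suc i) 0, replicate (Suc j) 0)) = g i j x)) \<longleftrightarrow>
      (\<forall>i j. \<forall>x \<in> cells K i j. \<forall>c \<in> ops i 1. \<forall>d \<in> ops j 1.
       (0 \<notin> set c \<or> 0 \<notin> set d \<longrightarrow> h i j (x, (c, d)) = f i j x) \<and>
       (1 \<notin> set c \<and> 1 \<notin> set d \<longrightarrow> h i j (x, (c, d)) = g i j x))" (is "?L \<longleftrightarrow> ?R")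
    proof
      assume L: ?L
      show ?R
      proof (intro allI ballI conjI impI)
        fix i j x c d assume *: "x \<in> cells K i j" "c \<in> ops i 1" "d \<in> ops j 1"
        show "h i j (x, (c, d)) = f i j x" if "0 \<notin> set c \<or> 0 \<notin> set d"
          using that L * c1[OF *(2)] c1[OF *(3)] by metis
        show "h i j (x, (c, d)) = g i j x" if "1 \<notin> set c \<and> 1 \<notin> set d"
          using that L * c0[OF *(2)] c0[OF *(3)] by metis
      qed
    next
      assume R: ?R
      show ?L
      proof (intro conjI allI ballI)
        fix i j x assume x: "x \<in> cells K i j"
        show "h i j (x, (replicate (Suc i) 1, d)) = f i j x" if "d \<in> ops j 1" for d
          using R[rule_format, OF x r1(1) that] by simp
        show "h i j (x, (c, replicate (Suc j) 1)) = f i j x" if "c \<in> ops i 1" for c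
          using R[rule_format, OF x that r1(1)] by simp
        show "h i j (x, (replicate (Suc i) 0, replicate (Suc j) 0)) = g i j x"
          using R[rule_format, OF x r1(2) r1(2)] by simp
      qed
    qed
  qed
qed

section \<open>Aeppli loops\<close>

definition aeppli_loops :: "'a bisset \<Rightarrow> 'a \<Rightarrow> 'a set" where
  "aeppli_loops Z v = rel_cells Z v 1 1 (bd_A 1 1)"

text \<open>The face operators of the simplicial set of collapsed cells: one coface acts in both
  indices.\<close>

definition dface :: "'a bisset \<Rightarrow> nat \<Rightarrow> nat \<Rightarrow> 'a \<Rightarrow> 'a" where
  "dface Z n i z = act Z n n (coface n i) (coface n i) z"

definition aeppli_tri :: "'a bisset \<Rightarrow> 'a \<Rightarrow> 'a \<Rightarrow> 'a \<Rightarrow> 'a \<Rightarrow> bool" where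
  "aeppli_tri Z v a b c \<longleftrightarrow> a \<in> aeppli_loops Z v \<and> b \<in> aeppli_loops Z v \<and> c \<in> aeppli_loops Z v \<and>
     (\<exists>z. collapsed Z 2 z \<and> dface Z 2 0 z = a \<and> dface Z 2 2 z = b \<and> dface Z 2 1 z = c)"

lemma coface_2: "coface 2 0 = [1, 2]" "coface 2 1 = [0, 2]" "coface 2 2 = [0, 1]"
  by (simp_all add: coface_def upt_rec)

lemma coface_1: "coface 1 0 = [1]" "coface 1 1 = [0]"
  by (simp_all add: coface_def)

lemma coface_ops': "1 \<le> n \<Longrightarrow> i \<le> n \<Longrightarrow> coface n i \<in> ops (n - 1) n"
  using coface_ops[of i "n - 1"] by simp

lemma coface_ops2: "i \<le> 2 \<Longrightarrow> coface 2 i \<in> ops 1 2"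
  using coface_ops'[of 2 i] by simp

lemma coface_ops3: "i \<le> 3 \<Longrightarrow> coface 3 i \<in> ops 2 3"
  using coface_ops'[of 3 i] by simp

lemma cells_bd_A_iff:
  "(\<sigma>, \<tau>) \<in> cells (bd_A 1 1) i j \<longleftrightarrow> \<sigma> \<in> ops i 1 \<and> \<tau> \<in> ops j 1 \<and>
     (0 \<notin> set \<sigma> \<or> 0 \<notin> set \<tau> \<or> 1 \<notin> set \<sigma> \<and> 1 \<notin> set \<tau>)"
  unfolding cells_bd_A by auto

lemma bd_A_sub: "cells (bd_A 1 1) i j \<subseteq> cells (bistd 1 1) i j"
  unfolding cells_bd_A by auto

lemma aeppli_loops_iff:
  "a \<in> aeppli_loops Z v \<longleftrightarrow> a \<in> cells Z 1 1 \<and>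
     (\<forall>i j \<sigma> \<tau>. (\<sigma>, \<tau>) \<in> cells (bd_A 1 1) i j \<longrightarrow> act Z 1 1 \<sigma> \<tau> a = base Z v i j)"
  unfolding aeppli_loops_def rel_cells_iff[OF bd_A_sub] by (simp add: Ball_def)

lemma aeppli_loops_cells: "a \<in> aeppli_loops Z v \<Longrightarrow> a \<in> cells Z 1 1"
  by (simp add: aeppli_loops_iff)

lemma aeppli_loops_base:
  "a \<in> aeppli_loops Z v \<Longrightarrow> \<sigma> \<in> ops i 1 \<Longrightarrow> \<tau> \<in> ops j 1 \<Longrightarrow>
     0 \<notin> set \<sigma> \<or> 0 \<notin> set \<tau> \<or> 1 \<notin> set \<sigma> \<and> 1 \<notin> set \<tau> \<Longrightarrow> act Z 1 1 \<sigma> \<tau> a = base Z v i j"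
  unfolding aeppli_loops_iff cells_bd_A_iff by simp

lemma aeppli_loop_collapsed:
  assumes a: "a \<in> aeppli_loops Z v"
  shows "collapsed Z 1 a"
  unfolding collapsed_def
proof (intro conjI allI ballI impI)
  show "a \<in> cells Z 1 1" using a by (rule aeppli_loops_cells)
  fix i j s \<sigma> \<tau> assume *: "\<sigma> \<in> ops i 1" "\<tau> \<in> ops j 1" "s \<le> 1" "set \<sigma> \<subseteq> {s..} \<or> set \<tau> \<subseteq> {s..}"
  show "act Z 1 1 \<sigma> \<tau> a = act Z 1 1 (map (max s) \<sigma>) (map (max s) \<tau>) a"
  proof (cases "s = 0")
    case True
    have "map (max s) \<rho> = \<rho>" for \<rho> :: "nat list" using True by (auto intro: map_idI)
    then show ?thesis by simp
  next
    case False
    have "0 \<notin> set \<sigma> \<or> 0 \<notin> set \<tau>" using *(4) False by auto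
    then have "act Z 1 1 \<sigma> \<tau> a = base Z v i j" using aeppli_loops_base[OF a *(1,2)] by blast
    moreover have "0 \<notin> set (map (max s) \<sigma>)" using False by auto
    then have "act Z 1 1 (map (max s) \<sigma>) (map (max s) \<tau>) a = base Z v i j"
      using aeppli_loops_base[OF a max_ops[OF *(1,3)] max_ops[OF *(2,3)]] by blast
    ultimately show ?thesis by simp
  qed
qed

lemma singleton_ops: "x \<le> n \<Longrightarrow> [x] \<in> ops 0 n"
  by (simp add: ops_def)

lemma ops1_zero: "\<sigma> \<in> ops i 1 \<Longrightarrow> 1 \<notin> set \<sigma> \<Longrightarrow> \<sigma> = replicate (Suc i) 0"
  by (rule ops_const) (auto simp: ops_def subset_iff le_Suc_eq)

lemma ops1_one: "\<sigma> \<in> ops i 1 \<Longrightarrow> 0 \<notin> set \<sigma> \<Longrightarrow> \<sigma> = replicate (Suc i) 1"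
  by (rule ops_const) (auto simp: ops_def subset_iff le_Suc_eq)

lemma act_const_vertex:
  assumes Z: "bisimplicial_set Z" and v: "v \<in> cells Z 0 0" and z: "z \<in> cells Z n n" and s: "s \<le> n"
    and vz: "act Z n n [s] [s] z = v"
  shows "act Z n n (replicate (Suc i) s) (replicate (Suc j) s) z = base Z v i j"
proof -
  have r: "replicate (Suc i) 0 \<in> ops i 0" for i by (rule replicate_ops) simp
  have "base Z v i j = act Z 0 0 (replicate (Suc i) 0) (replicate (Suc j) 0) (act Z n n [s] [s] z)"
    by (simp only: base_def vz)
  also have "\<dots> = act Z n n (pick [s] (replicate (Suc i) 0)) (pick [s] (replicate (Suc j) 0)) z"
    by (rule act_act[OF Z z singleton_ops[OF s] singleton_ops[OF s] r r])
  finally show ?thesis unfolding pick_singleton[OF r] ..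
qed

text \<open>The converse of \<open>aeppli_loop_collapsed\<close>: collapsed edges from
  \<open>v\<close> to \<open>v\<close> are loops. The collapse at 1 moves every cell with a list
  avoiding 0 to the vertex 1, and the remaining cells of \<open>bd_A 1 1\<close> lie at the vertex
  0.\<close>

lemma aeppli_loopI:
  assumes Z: "bisimplicial_set Z" and v: "v \<in> cells Z 0 0" and a: "collapsed Z 1 a"
    and v0: "act Z 1 1 [0] [0] a = v" and v1: "act Z 1 1 [1] [1] a = v"
  shows "a \<in> aeppli_loops Z v"
  unfolding aeppli_loops_iff
proof (intro conjI allI impI)
  show ac: "a \<in> cells Z 1 1" using a by (rule collapsed_cells)
  fix i j \<sigma> \<tau> assume "(\<sigma>, \<tau>) \<in> cells (bd_A 1 1) i j"
  then have *: "\<sigma> \<in> ops i 1" "\<tau> \<in> ops j 1" and h: "0 \<notin> set \<sigma> \<or> 0 \<notin> set \<tau> \<or> 1 \<notin> set \<sigma> \<and> 1 \<notin> set \<tau>"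
    by (simp_all add: cells_bd_A_iff[simplified])
  show "act Z 1 1 \<sigma> \<tau> a = base Z v i j"
  proof (cases "0 \<notin> set \<sigma> \<or> 0 \<notin> set \<tau>")
    case True
    have "set \<rho> \<subseteq> {1..} \<longleftrightarrow> 0 \<notin> set \<rho>" for \<rho> :: "nat list" by (auto simp: subset_iff intro!: Suc_leI gr0I)
    then have "act Z 1 1 \<sigma> \<tau> a = act Z 1 1 (map (max 1) \<sigma>) (map (max 1) \<tau>) a"
      using collapsedD[OF a *, of 1] True by simp
    moreover have n0: "0 \<notin> set (map (max 1) \<rho>)" for \<rho> :: "nat list" by auto
    moreover have "map (max 1) \<sigma> = replicate (Suc i) 1" by (rule ops1_one[OF max_ops[OF *(1) order_refl] n0])
    moreover have "map (max 1) \<tau> = replicate (Suc j) 1" by (rule ops1_one[OF max_ops[OF *(2) order_refl] n0])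
    ultimately show ?thesis using act_const_vertex[OF Z v ac _ v1] by simp
  next
    case False
    then have "\<sigma> = replicate (Suc i) 0" "\<tau> = replicate (Suc j) 0"
      using h ops1_zero[OF *(1)] ops1_zero[OF *(2)] by auto
    then show ?thesis using act_const_vertex[OF Z v ac _ v0] by simp
  qed
qed

lemma aeppli_loop_vertices:
  assumes "bisimplicial_set Z" "v \<in> cells Z 0 0" "a \<in> aeppli_loops Z v"
  shows "act Z 1 1 [0] [0] a = v" "act Z 1 1 [1] [1] a = v"
  using aeppli_loops_base[OF assms(3) singleton_ops singleton_ops, of 0 0]
    aeppli_loops_base[OF assms(3) singleton_ops singleton_ops, of 1 1] base_00[OF assms(1,2)] by simp_all

lemma collapsed_dface:
  "bisimplicial_set Z \<Longrightarrow> collapsed Z 2 z \<Longrightarrow> i \<le> 2 \<Longrightarrow> collapsed Z 1 (dface Z 2 i z)"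
  "bisimplicial_set Z \<Longrightarrow> collapsed Z 3 w \<Longrightarrow> j \<le> 3 \<Longrightarrow> collapsed Z 2 (dface Z 3 j w)"
  unfolding dface_def by (rule collapsed_act; (rule coface_ops2 coface_ops3 | assumption)+)+

lemma vertex_dface:
  assumes Z: "bisimplicial_set Z" and z: "collapsed Z 2 z" and i: "i \<le> 2" and x: "x \<le> 1"
  shows "act Z 1 1 [x] [x] (dface Z 2 i z) = act Z 2 2 [coface 2 i ! x] [coface 2 i ! x] z"
  unfolding dface_def
  using act_act[OF Z collapsed_cells[OF z] coface_ops2[OF i] coface_ops2[OF i] singleton_ops[OF x] singleton_ops[OF x]]
  by (simp add: pick_def)

lemma collapsed_horn2:
  assumes "kan Z" "1 \<le> k" "k \<le> 2" "\<And>i. i \<le> 2 \<Longrightarrow> i \<noteq> k \<Longrightarrow> collapsed Z 1 (x i)"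
    and "\<And>i j. i < j \<Longrightarrow> j \<le> 2 \<Longrightarrow> i \<noteq> k \<Longrightarrow> j \<noteq> k \<Longrightarrow> dface Z 1 (j - 1) (x i) = dface Z 1 i (x j)"
  obtains z where "collapsed Z 2 z" "\<And>i. i \<le> 2 \<Longrightarrow> i \<noteq> k \<Longrightarrow> dface Z 2 i z = x i"
proof -
  have e: "Suc 0 = 1" "Suc 1 = 2" by simp_all
  show thesis
  proof (rule collapsed_horn[where m = 0 and Z = Z and k = k and x = x, unfolded e, OF assms(1-4)])
    show "act Z 1 1 (coface 1 (j - 1)) (coface 1 (j - 1)) (x i) = act Z 1 1 (coface 1 i) (coface 1 i) (x j)"
      if "i < j" "j \<le> 2" "i \<noteq> k" "j \<noteq> k" for i j
      using assms(5)[OF that] by (simp only: dface_def)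
    fix z assume z: "collapsed Z 2 z" "\<And>i. i \<le> 2 \<Longrightarrow> i \<noteq> k \<Longrightarrow> act Z 2 2 (coface 2 i) (coface 2 i) z = x i"
    show thesis by (rule that[OF z(1)], unfold dface_def, rule z(2))
  qed
qed

lemma collapsed_horn3:
  assumes "kan Z" "1 \<le> k" "k \<le> 3" "\<And>i. i \<le> 3 \<Longrightarrow> i \<noteq> k \<Longrightarrow> collapsed Z 2 (x i)"
    and "\<And>i j. i < j \<Longrightarrow> j \<le> 3 \<Longrightarrow> i \<noteq> k \<Longrightarrow> j \<noteq> k \<Longrightarrow> dface Z 2 (j - 1) (x i) = dface Z 2 i (x j)"
  obtains z where "collapsed Z 3 z" "\<And>i. i \<le> 3 \<Longrightarrow> i \<noteq> k \<Longrightarrow> dface Z 3 i z = x i"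
proof -
  have e: "Suc 1 = 2" "Suc 2 = 3" by simp_all
  show thesis
  proof (rule collapsed_horn[where m = 1 and Z = Z and k = k and x = x, unfolded e, OF assms(1-4)])
    show "act Z 2 2 (coface 2 (j - 1)) (coface 2 (j - 1)) (x i) = act Z 2 2 (coface 2 i) (coface 2 i) (x j)"
      if "i < j" "j \<le> 3" "i \<noteq> k" "j \<noteq> k" for i j
      using assms(5)[OF that] by (simp only: dface_def)
    fix z assume z: "collapsed Z 3 z" "\<And>i. i \<le> 3 \<Longrightarrow> i \<noteq> k \<Longrightarrow> act Z 3 3 (coface 3 i) (coface 3 i) z = x i"
    show thesis by (rule that[OF z(1)], unfold dface_def, rule z(2))
  qed
qed

lemma dface_dface:
  assumes Z: "bisimplicial_set Z" and w: "collapsed Z 3 w" and ij: "i < j" "j \<le> 3"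
  shows "dface Z 2 i (dface Z 3 j w) = dface Z 2 (j - 1) (dface Z 3 i w)"
proof -
  have "i = 0 \<or> i = 1 \<or> i = 2" "j = 1 \<or> j = 2 \<or> j = 3" using ij by auto
  then have "pick (coface 3 j) (coface 2 i) = pick (coface 3 i) (coface 2 (j - 1))"
    using ij(1) by (elim disjE) (simp_all add: pick_def coface_def upt_rec)
  moreover have "dface Z 2 p (dface Z 3 q w) = act Z 3 3 (pick (coface 3 q) (coface 2 p)) (pick (coface 3 q) (coface 2 p)) w"
    if "p \<le> 2" "q \<le> 3" for p q
    unfolding dface_def
    by (rule act_act[OF Z collapsed_cells[OF w] coface_ops3[OF that(2)] coface_ops3[OF that(2)] coface_ops2[OF that(1)] coface_ops2[OF that(1)]])
  ultimately show ?thesis using ij by simp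
qed

lemma base_aeppli_loop:
  assumes Z: "bisimplicial_set Z" and v: "v \<in> cells Z 0 0"
  shows "base Z v 1 1 \<in> aeppli_loops Z v"
  using base_cells[OF Z v] act_base[OF Z v] by (simp add: aeppli_loops_iff[simplified] cells_bd_A_iff[simplified])

lemma triangles_aeppli:
  assumes Z: "kan Z" and v: "v \<in> cells Z 0 0"
  shows "triangles (aeppli_loops Z v) (base Z v 1 1) (aeppli_tri Z v)"
proof
  have bZ: "bisimplicial_set Z" using Z by (rule kan_bisimplicial)
  let ?L = "aeppli_loops Z v" and ?e = "base Z v 1 1"
  have d1: "dface Z 1 i a = v" if "a \<in> ?L" "i \<le> 1" for a i
  proof -
    have "i = 0 \<or> i = 1" using that(2) by auto
    then show ?thesis
      using aeppli_loop_vertices[OF bZ v that(1)]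
      by (elim disjE) (simp_all add: dface_def coface_1 del: One_nat_def)
  qed
  note vx = aeppli_loop_vertices[OF bZ v]
  show "?e \<in> ?L" by (rule base_aeppli_loop[OF bZ v])
  show "a \<in> ?L \<and> b \<in> ?L \<and> c \<in> ?L" if "aeppli_tri Z v a b c" for a b c
    using that by (simp add: aeppli_tri_def)
  have degen: "act Z 1 1 \<mu> \<mu> a \<in> cells Z 2 2" "collapsed Z 2 (act Z 1 1 \<mu> \<mu> a)"
      "\<And>i. i \<le> 2 \<Longrightarrow> dface Z 2 i (act Z 1 1 \<mu> \<mu> a) = act Z 1 1 (pick \<mu> (coface 2 i)) (pick \<mu> (coface 2 i)) a"
    if "a \<in> ?L" "\<mu> \<in> ops 2 1" for a \<mu>
  proof -
    have a: "a \<in> cells Z 1 1" using that(1) by (rule aeppli_loops_cells)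
    show "act Z 1 1 \<mu> \<mu> a \<in> cells Z 2 2" by (rule act_cells[OF bZ a that(2) that(2)])
    show "collapsed Z 2 (act Z 1 1 \<mu> \<mu> a)" by (rule collapsed_act[OF bZ aeppli_loop_collapsed[OF that(1)] that(2)])
    show "dface Z 2 i (act Z 1 1 \<mu> \<mu> a) = act Z 1 1 (pick \<mu> (coface 2 i)) (pick \<mu> (coface 2 i)) a" if "i \<le> 2" for i
      unfolding dface_def by (rule act_act[OF bZ a \<open>\<mu> \<in> ops 2 1\<close> \<open>\<mu> \<in> ops 2 1\<close> coface_ops2[OF that] coface_ops2[OF that]])
  qed
  \<comment> \<open>The two codegeneracies onto the edge; each gives one of the unit laws.\<close>
  have m: "[0, 0, 1] \<in> ops 2 1" "[0, 1, 1] \<in> ops 2 1" by (auto simp: ops_def)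
  have c1: "[0, 0] \<in> ops 1 1" "[1, 1] \<in> ops 1 1" by (auto simp: ops_def)
  have id1: "act Z 1 1 [0, 1] [0, 1] a = a" if "a \<in> ?L" for a
    using act_id[OF bZ aeppli_loops_cells[OF that]] by (simp add: id_op_def)
  show "aeppli_tri Z v a ?e a" if a: "a \<in> ?L" for a
    unfolding aeppli_tri_def
  proof (intro conjI exI[of _ "act Z 1 1 [0, 0, 1] [0, 0, 1] a"] a base_aeppli_loop[OF bZ v] degen(2)[OF a m(1)])
    show "dface Z 2 0 (act Z 1 1 [0, 0, 1] [0, 0, 1] a) = a" using degen(3)[OF a m(1), of 0] id1[OF a] coface_2 by (simp add: pick_def)
    show "dface Z 2 1 (act Z 1 1 [0, 0, 1] [0, 0, 1] a) = a" using degen(3)[OF a m(1), of 1] id1[OF a] coface_2 by (simp add: pick_def)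
    show "dface Z 2 2 (act Z 1 1 [0, 0, 1] [0, 0, 1] a) = ?e"
      using degen(3)[OF a m(1), of 2] aeppli_loops_base[OF a c1(1) c1(1)] coface_2 by (simp add: pick_def)
  qed
  show "aeppli_tri Z v ?e a a" if a: "a \<in> ?L" for a
    unfolding aeppli_tri_def
  proof (intro conjI exI[of _ "act Z 1 1 [0, 1, 1] [0, 1, 1] a"] a base_aeppli_loop[OF bZ v] degen(2)[OF a m(2)])
    show "dface Z 2 0 (act Z 1 1 [0, 1, 1] [0, 1, 1] a) = ?e"
      using degen(3)[OF a m(2), of 0] aeppli_loops_base[OF a c1(2) c1(2)] coface_2 by (simp add: pick_def)
    show "dface Z 2 1 (act Z 1 1 [0, 1, 1] [0, 1, 1] a) = a" using degen(3)[OF a m(2), of 1] id1[OF a] coface_2 by (simp add: pick_def)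
    show "dface Z 2 2 (act Z 1 1 [0, 1, 1] [0, 1, 1] a) = a" using degen(3)[OF a m(2), of 2] id1[OF a] coface_2 by (simp add: pick_def)
  qed
  show "\<exists>c. aeppli_tri Z v a b c" if ab: "a \<in> ?L" "b \<in> ?L" for a b
  proof -
    obtain z where z: "collapsed Z 2 z" "\<And>i. i \<le> 2 \<Longrightarrow> i \<noteq> 1 \<Longrightarrow> dface Z 2 i z = (if i = 0 then a else b)"
    proof (rule collapsed_horn2[OF Z, of 1 "\<lambda>i. if i = 0 then a else b"])
      show "collapsed Z 1 (if i = 0 then a else b)" for i using ab aeppli_loop_collapsed by auto
      show "dface Z 1 (j - 1) (if i = 0 then a else b) = dface Z 1 i (if j = 0 then a else b)"
        if "i < j" "j \<le> 2" "i \<noteq> 1" "j \<noteq> 1" for i j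
        using that ab d1 by auto
    qed auto
    have f: "dface Z 2 0 z = a" "dface Z 2 2 z = b" using z(2)[of 0] z(2)[of 2] by simp_all
    \<comment> \<open>The new edge runs from the start of \<open>b\<close> to the end of
      \<open>a\<close>, so it is again a loop.\<close>
    have "act Z 2 2 [0] [0] z = v" "act Z 2 2 [2] [2] z = v"
      using vertex_dface[OF bZ z(1), of 2 0] vertex_dface[OF bZ z(1), of 0 1] f vx ab coface_2 by simp_all
    then have "dface Z 2 1 z \<in> ?L"
      using vertex_dface[OF bZ z(1), of 1 0] vertex_dface[OF bZ z(1), of 1 1] coface_2
      by (intro aeppli_loopI[OF bZ v collapsed_dface(1)[OF bZ z(1)]]) simp_all
    then show ?thesis using f z(1) ab unfolding aeppli_tri_def by blast
  qed
  show "\<exists>b. aeppli_tri Z v a b c" if ac: "a \<in> ?L" "c \<in> ?L" for a c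
  proof -
    obtain z where z: "collapsed Z 2 z" "\<And>i. i \<le> 2 \<Longrightarrow> i \<noteq> 2 \<Longrightarrow> dface Z 2 i z = (if i = 0 then a else c)"
    proof (rule collapsed_horn2[OF Z, of 2 "\<lambda>i. if i = 0 then a else c"])
      show "collapsed Z 1 (if i = 0 then a else c)" for i using ac aeppli_loop_collapsed by auto
      show "dface Z 1 (j - 1) (if i = 0 then a else c) = dface Z 1 i (if j = 0 then a else c)"
        if "i < j" "j \<le> 2" "i \<noteq> 2" "j \<noteq> 2" for i j
        using that ac d1 by auto
    qed auto
    have f: "dface Z 2 0 z = a" "dface Z 2 1 z = c" using z(2)[of 0] z(2)[of 1] by simp_all
    have "act Z 2 2 [0] [0] z = v" "act Z 2 2 [1] [1] z = v"
      using vertex_dface[OF bZ z(1), of 1 0] vertex_dface[OF bZ z(1), of 0 0] f vx ac coface_2 by simp_all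
    then have "dface Z 2 2 z \<in> ?L"
      using vertex_dface[OF bZ z(1), of 2 0] vertex_dface[OF bZ z(1), of 2 1] coface_2
      by (intro aeppli_loopI[OF bZ v collapsed_dface(1)[OF bZ z(1)]]) simp_all
    then show ?thesis using f z(1) ac unfolding aeppli_tri_def by blast
  qed
  \<comment> \<open>The six loops label the edges of a 3-simplex with vertices 0, 1, 2, 3:
    \<open>a\<close>, \<open>b\<close>, \<open>c\<close> are the edges 23, 12, 01, and
    \<open>p\<close>, \<open>q\<close>, \<open>r\<close> are the edges 13, 02, 03. The four
    triangles are its faces.\<close>
  fix a b c p q r
  assume abp: "aeppli_tri Z v a b p" and bcq: "aeppli_tri Z v b c q"
  obtain x0 where x0: "collapsed Z 2 x0" "dface Z 2 0 x0 = a" "dface Z 2 2 x0 = b" "dface Z 2 1 x0 = p"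
    using abp by (auto simp: aeppli_tri_def)
  obtain x3 where x3: "collapsed Z 2 x3" "dface Z 2 0 x3 = b" "dface Z 2 2 x3 = c" "dface Z 2 1 x3 = q"
    using bcq by (auto simp: aeppli_tri_def)
  have cases3: "i = 0 \<or> i = 1 \<or> i = 2 \<or> i = 3" if "i \<le> 3" for i :: nat using that by auto
  show "aeppli_tri Z v p c r" if aqr: "aeppli_tri Z v a q r"
  proof -
    obtain x1 where x1: "collapsed Z 2 x1" "dface Z 2 0 x1 = a" "dface Z 2 2 x1 = q" "dface Z 2 1 x1 = r"
      using aqr by (auto simp: aeppli_tri_def)
    define x where "x i = (if i = 0 then x0 else if i = 1 then x1 else x3)" for i :: nat
    obtain w where w: "collapsed Z 3 w" "\<And>i. i \<le> 3 \<Longrightarrow> i \<noteq> 2 \<Longrightarrow> dface Z 3 i w = x i"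
    proof (rule collapsed_horn3[OF Z, of 2 x])
      show "collapsed Z 2 (x i)" for i using x0 x1 x3 by (simp add: x_def)
      show "dface Z 2 (j - 1) (x i) = dface Z 2 i (x j)" if "i < j" "j \<le> 3" "i \<noteq> 2" "j \<noteq> 2" for i j
        using cases3[of i] cases3[of j] that x0 x1 x3 by (auto simp: x_def)
    qed auto
    have "dface Z 2 0 (dface Z 3 2 w) = p" "dface Z 2 1 (dface Z 3 2 w) = r" "dface Z 2 2 (dface Z 3 2 w) = c"
      using dface_dface[OF bZ w(1), of 0 2] dface_dface[OF bZ w(1), of 1 2] dface_dface[OF bZ w(1), of 2 3]
        w(2)[of 0] w(2)[of 1] w(2)[of 3] x0 x1 x3 by (simp_all add: x_def)
    then show ?thesis using collapsed_dface(2)[OF bZ w(1), of 2] abp bcq aqr unfolding aeppli_tri_def by auto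
  qed
  show "aeppli_tri Z v a q r" if pcr: "aeppli_tri Z v p c r"
  proof -
    obtain x2 where x2: "collapsed Z 2 x2" "dface Z 2 0 x2 = p" "dface Z 2 2 x2 = c" "dface Z 2 1 x2 = r"
      using pcr by (auto simp: aeppli_tri_def)
    define x where "x i = (if i = 0 then x0 else if i = 2 then x2 else x3)" for i :: nat
    obtain w where w: "collapsed Z 3 w" "\<And>i. i \<le> 3 \<Longrightarrow> i \<noteq> 1 \<Longrightarrow> dface Z 3 i w = x i"
    proof (rule collapsed_horn3[OF Z, of 1 x])
      show "collapsed Z 2 (x i)" for i using x0 x2 x3 by (simp add: x_def)
      show "dface Z 2 (j - 1) (x i) = dface Z 2 i (x j)" if "i < j" "j \<le> 3" "i \<noteq> 1" "j \<noteq> 1" for i j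
        using cases3[of i] cases3[of j] that x0 x2 x3 by (auto simp: x_def)
    qed auto
    have "dface Z 2 0 (dface Z 3 1 w) = a" "dface Z 2 1 (dface Z 3 1 w) = r" "dface Z 2 2 (dface Z 3 1 w) = q"
      using dface_dface[OF bZ w(1), of 0 1] dface_dface[OF bZ w(1), of 1 2] dface_dface[OF bZ w(1), of 1 3]
        w(2)[of 0] w(2)[of 2] w(2)[of 3] x0 x2 x3 by (simp_all add: x_def)
    then show ?thesis using collapsed_dface(2)[OF bZ w(1), of 1] abp bcq pcr unfolding aeppli_tri_def by auto
  qed
qed

section \<open>Homotopies of loops as squares of collapsed cells\<close>

lemma trivial_on_iff: "trivial_on L X v f \<longleftrightarrow> (\<forall>i j. \<forall>x \<in> cells L i j. f i j x = base X v i j)"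
  unfolding trivial_on_def restr_bimap_def const_bimap_def by (rule restrict_eq_iff)

text \<open>Restricting a natural family to the cells of its domain turns it into a map without
  changing the conditions, so extensionality disappears from the description.\<close>

lemma homotopy_rel_iff:
  assumes L: "\<And>i j. cells L i j \<subseteq> cells (bistd m n) i j"
  shows "(x, y) \<in> homotopy_rel Y v m n L \<longleftrightarrow> x \<in> rel_cells Y v m n L \<and> y \<in> rel_cells Y v m n L \<and>
    (\<exists>h. nat_on (bprod (bistd m n) (bistd 1 1)) Y h \<and>
      (\<forall>i j. \<forall>(a, b) \<in> cells L i j. \<forall>c \<in> ops i 1. \<forall>d \<in> ops j 1. h i j ((a, b), (c, d)) = base Y v i j) \<and>
      (\<forall>i j. \<forall>a \<in> ops i m. \<forall>b \<in> ops j n. \<forall>c \<in> ops i 1. \<forall>d \<in> ops j 1.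
         (0 \<notin> set c \<or> 0 \<notin> set d \<longrightarrow> h i j ((a, b), (c, d)) = act Y m n a b x) \<and>
         (1 \<notin> set c \<and> 1 \<notin> set d \<longrightarrow> h i j ((a, b), (c, d)) = act Y m n a b y)))"
    (is "_ \<longleftrightarrow> _ \<and> _ \<and> (\<exists>h. ?n h \<and> ?t h \<and> ?e h)")
proof -
  let ?K = "bistd m n" and ?B = "bprod (bistd m n) (bistd 1 1)"
  have t: "trivial_on (bprod L (bistd 1 1)) Y v h \<longleftrightarrow> ?t h" for h
    unfolding trivial_on_iff by (simp add: Ball_def) (intro iffI allI impI; simp)
  have e: "is_homotopy ?K Y h (cell_map Y m n x) (cell_map Y m n y) \<longleftrightarrow> is_bimap ?B Y h \<and> ?e h" for h
    unfolding is_homotopy_iff by (simp add: cell_map_def)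
  have "homotopic_rel ?K L Y v (cell_map Y m n x) (cell_map Y m n y) \<longleftrightarrow> (\<exists>h. ?n h \<and> ?t h \<and> ?e h)"
    unfolding homotopic_rel_def t e
  proof
    assume "\<exists>h. (is_bimap ?B Y h \<and> ?e h) \<and> ?t h"
    then show "\<exists>h. ?n h \<and> ?t h \<and> ?e h" unfolding is_bimap_nat_on by (elim exE conjE) (intro exI conjI)
  next
    assume "\<exists>h. ?n h \<and> ?t h \<and> ?e h"
    then obtain h where h: "?n h" "?t h" "?e h" by (elim exE conjE)
    let ?h = "restr_bimap ?B h"
    have r: "?h i j ((a, b), (c, d)) = h i j ((a, b), (c, d))"
      if "a \<in> ops i m" "b \<in> ops j n" "c \<in> ops i 1" "d \<in> ops j 1" for i j a b c d
      using that by (simp add: restr_bimap_def)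
    have "is_bimap ?B Y ?h"
      by (rule restr_bimap_is_bimap[OF h(1) act_cells[OF bisimplicial_bprod[OF bisimplicial_bistd bisimplicial_bistd]]])
    moreover have "?e ?h"
    proof (intro allI ballI)
      fix i j a b c d assume *: "a \<in> ops i m" "b \<in> ops j n" "c \<in> ops i 1" "d \<in> ops j 1"
      show "(0 \<notin> set c \<or> 0 \<notin> set d \<longrightarrow> ?h i j ((a, b), (c, d)) = act Y m n a b x) \<and>
         (1 \<notin> set c \<and> 1 \<notin> set d \<longrightarrow> ?h i j ((a, b), (c, d)) = act Y m n a b y)"
        unfolding r[OF *] using h(3)[rule_format, OF *] by blast
    qed
    moreover have "?t ?h"
    proof (intro allI ballI, clarify)
      fix i j a b c d assume *: "(a, b) \<in> cells L i j" "c \<in> ops i 1" "d \<in> ops j 1"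
      have ab: "a \<in> ops i m" "b \<in> ops j n" using L[of i j] *(1) by auto
      show "?h i j ((a, b), (c, d)) = base Y v i j"
        unfolding r[OF ab *(2,3)] using h(2)[THEN spec, THEN spec, THEN bspec, OF *(1)] *(2,3) by simp
    qed
    ultimately show "\<exists>h. (is_bimap ?B Y h \<and> ?e h) \<and> ?t h" by (intro exI conjI)
  qed
  then show ?thesis by (simp only: homotopy_rel_def mem_Collect_eq case_prod_conv)
qed

lemma squash_0: "map (squash 0) \<sigma> = map (\<lambda>x. x - 1) \<sigma>"
  by (auto simp: squash_def)

text \<open>The collapse at 1 raises both lists into the face opposite to 0, and the predecessor
  renumbers the vertices of that face.\<close>

lemma tri_outer:
  assumes Z: "bisimplicial_set Z" and z: "collapsed Z 2 z" and o: "\<sigma> \<in> ops i 2" "\<tau> \<in> ops j 2"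
    and h: "0 \<notin> set \<sigma> \<or> 0 \<notin> set \<tau>"
  shows "act Z 2 2 \<sigma> \<tau> z = act Z 1 1 (map (\<lambda>x. x - 1) \<sigma>) (map (\<lambda>x. x - 1) \<tau>) (dface Z 2 0 z)"
proof -
  have s: "set \<rho> \<subseteq> {1..} \<longleftrightarrow> 0 \<notin> set \<rho>" for \<rho> :: "nat list" by (auto simp: subset_iff intro!: Suc_leI gr0I)
  have m: "map (max 1) \<rho> = pick (coface 2 0) (map (\<lambda>x. x - 1) \<rho>)" "map (\<lambda>x. x - 1) \<rho> \<in> ops k 1" if "\<rho> \<in> ops k 2" for \<rho> k
  proof -
    have "max 1 x = [1, 2] ! (x - 1)" if "x \<le> 2" for x :: nat
    proof -
      have "x = 0 \<or> x = 1 \<or> x = 2" using that by auto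
      then show ?thesis by auto
    qed
    then show "map (max 1) \<rho> = pick (coface 2 0) (map (\<lambda>x. x - 1) \<rho>)"
      using that by (auto simp: coface_2 pick_def ops_def)
    show "map (\<lambda>x. x - 1) \<rho> \<in> ops k 1" using that by (rule map_mono_ops) auto
  qed
  have "act Z 2 2 \<sigma> \<tau> z = act Z 2 2 (map (max 1) \<sigma>) (map (max 1) \<tau>) z"
    by (rule collapsedD[OF z o]) (use h s in auto)
  also have "\<dots> = act Z 1 1 (map (\<lambda>x. x - 1) \<sigma>) (map (\<lambda>x. x - 1) \<tau>) (dface Z 2 0 z)"
    unfolding m(1)[OF o(1)] m(1)[OF o(2)] dface_def
    by (rule act_act[OF Z collapsed_cells[OF z] coface_ops2 coface_ops2 m(2)[OF o(1)] m(2)[OF o(2)], symmetric]) simp_all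
  finally show ?thesis .
qed

lemma tri_middle:
  assumes Z: "bisimplicial_set Z" and z: "collapsed Z 2 z" and o: "\<sigma> \<in> ops i 2" "\<tau> \<in> ops j 2"
    and h: "1 \<notin> set \<sigma>" "1 \<notin> set \<tau>"
  shows "act Z 2 2 \<sigma> \<tau> z = act Z 1 1 (map (min 1) \<sigma>) (map (min 1) \<tau>) (dface Z 2 1 z)"
proof -
  have m: "pick (coface 2 1) (map (min 1) \<rho>) = \<rho>" "map (min 1) \<rho> \<in> ops k 1" if "\<rho> \<in> ops k 2" "1 \<notin> set \<rho>" for \<rho> k
  proof -
    have "[0, 2] ! (min 1 x) = x" if "x \<le> 2" "x \<noteq> 1" for x :: nat
    proof -
      have "x = 0 \<or> x = 2" using that by auto
      then show ?thesis by auto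
    qed
    then show "pick (coface 2 1) (map (min 1) \<rho>) = \<rho>"
      unfolding pick_def coface_2 map_map using that by (intro map_idI) (auto simp: ops_def)
    show "map (min 1) \<rho> \<in> ops k 1" using that(1) by (rule map_mono_ops) auto
  qed
  have "act Z 1 1 (map (min 1) \<sigma>) (map (min 1) \<tau>) (dface Z 2 1 z) =
      act Z 2 2 (pick (coface 2 1) (map (min 1) \<sigma>)) (pick (coface 2 1) (map (min 1) \<tau>)) z"
    unfolding dface_def
    by (rule act_act[OF Z collapsed_cells[OF z] coface_ops2 coface_ops2 m(2)[OF o(1) h(1)] m(2)[OF o(2) h(2)]]) simp_all
  then show ?thesis unfolding m(1)[OF o(1) h(1)] m(1)[OF o(2) h(2)] by simp
qed

lemma tri_lower:
  assumes Z: "bisimplicial_set Z" and z: "collapsed Z 2 z" and o: "\<sigma> \<in> ops i 1" "\<tau> \<in> ops j 1"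
  shows "act Z 2 2 \<sigma> \<tau> z = act Z 1 1 \<sigma> \<tau> (dface Z 2 2 z)"
proof -
  have m: "pick (coface 2 2) \<rho> = \<rho>" if "\<rho> \<in> ops k 1" for \<rho> k
  proof -
    have "[0, 1] ! x = x" if "x \<le> 1" for x :: nat
      using that by (cases "x = 0") auto
    then show ?thesis unfolding pick_def coface_2 using that by (intro map_idI) (auto simp: ops_def)
  qed
  have "act Z 1 1 \<sigma> \<tau> (dface Z 2 2 z) = act Z 2 2 (pick (coface 2 2) \<sigma>) (pick (coface 2 2) \<tau>) z"
    unfolding dface_def
    by (rule act_act[OF Z collapsed_cells[OF z] coface_ops2 coface_ops2 o]) simp_all
  then show ?thesis unfolding m[OF o(1)] m[OF o(2)] by simp
qed

text \<open>A homotopy is a square of collapsed cells; its two triangles share the diagonal \<open>g\<close>.\<close>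

lemma aeppli_tri_of_homotopy:
  assumes Z: "kan Z" and v: "v \<in> cells Z 0 0" and h: "(x, y) \<in> homotopy_rel Z v 1 1 (bd_A 1 1)"
  shows "aeppli_tri Z v x (base Z v 1 1) y"
proof -
  interpret triangles "aeppli_loops Z v" "base Z v 1 1" "aeppli_tri Z v" by (rule triangles_aeppli[OF Z v])
  have bZ: "bisimplicial_set Z" using Z by (rule kan_bisimplicial)
  from h[unfolded homotopy_rel_iff[OF bd_A_sub]] obtain H where
    x: "x \<in> aeppli_loops Z v" and y: "y \<in> aeppli_loops Z v" and
    H: "nat_on (bprod (bistd 1 1) (bistd 1 1)) Z H" and
    t: "\<forall>i j. \<forall>(a, b) \<in> cells (bd_A 1 1) i j. \<forall>c \<in> ops i 1. \<forall>d \<in> ops j 1. H i j ((a, b), (c, d)) = base Z v i j" and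
    e: "\<forall>i j. \<forall>a \<in> ops i 1. \<forall>b \<in> ops j 1. \<forall>c \<in> ops i 1. \<forall>d \<in> ops j 1.
         (0 \<notin> set c \<or> 0 \<notin> set d \<longrightarrow> H i j ((a, b), (c, d)) = act Z 1 1 a b x) \<and>
         (1 \<notin> set c \<and> 1 \<notin> set d \<longrightarrow> H i j ((a, b), (c, d)) = act Z 1 1 a b y)"
    unfolding aeppli_loops_def by (elim conjE exE)
  have t': "H i j ((a, b), (c, d)) = base Z v i j"
    if "a \<in> ops i 1" "b \<in> ops j 1" "c \<in> ops i 1" "d \<in> ops j 1" "0 \<notin> set a \<or> 0 \<notin> set b \<or> 1 \<notin> set a \<and> 1 \<notin> set b" for i j a b c d
  proof -
    have "(a, b) \<in> cells (bd_A 1 1) i j" unfolding cells_bd_A_iff using that by blast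
    from t[THEN spec, THEN spec, THEN bspec, OF this] show ?thesis using that by simp
  qed
  have e1: "H i j ((a, b), (c, d)) = act Z 1 1 a b x"
    if "a \<in> ops i 1" "b \<in> ops j 1" "c \<in> ops i 1" "d \<in> ops j 1" "0 \<notin> set c \<or> 0 \<notin> set d" for i j a b c d
    using e[rule_format, OF that(1-4)] that(5) by blast
  have e0: "H i j ((a, b), (c, d)) = act Z 1 1 a b y"
    if "a \<in> ops i 1" "b \<in> ops j 1" "c \<in> ops i 1" "d \<in> ops j 1" "1 \<notin> set c" "1 \<notin> set d" for i j a b c d
    using e[rule_format, OF that(1-4)] that(5,6) by blast
  \<comment> \<open>Two paths through the square: \<open>?p\<close> rises at the first step,
    \<open>?q\<close> at the second. In \<open>z1\<close> the loop variable follows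
    \<open>?p\<close> and the homotopy variable \<open>?q\<close>, in \<open>z2\<close> the other
    way round; both have the diagonal as their middle face.\<close>
  let ?p = "[0, 1, 1] :: nat list" and ?q = "[0, 0, 1] :: nat list"
  have pq: "?p \<in> ops 2 1" "?q \<in> ops 2 1" by (auto simp: ops_def)
  have c1: "[0, 0] \<in> ops 1 1" "[1, 1] \<in> ops 1 1" "[0, 1] \<in> ops 1 1" by (auto simp: ops_def)
  have actH: "act Z 2 2 \<sigma> \<tau> (H 2 2 ((r, r), (s, s))) = H i j ((pick r \<sigma>, pick r \<tau>), (pick s \<sigma>, pick s \<tau>))"
    if "r \<in> ops 2 1" "s \<in> ops 2 1" "\<sigma> \<in> ops i 2" "\<tau> \<in> ops j 2" for r s \<sigma> \<tau> i j
    using nat_onD(2)[OF H, of "((r, r), (s, s))" 2 2, OF _ that(3,4)] that by (simp add: act_bprod act_bistd)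
  have pick_p: "0 \<notin> set (pick ?p \<sigma>)" if "\<sigma> \<in> ops i 2" "0 \<notin> set \<sigma>" for \<sigma> i
  proof
    assume "0 \<in> set (pick ?p \<sigma>)"
    then obtain k where k: "k \<in> set \<sigma>" "?p ! k = 0" by (auto simp: pick_def)
    then have "k = 1 \<or> k = 2" using that by (auto simp: ops_def subset_iff le_Suc_eq numeral_2_eq_2)
    then show False using k(2) by auto
  qed
  \<comment> \<open>\<open>?q\<close> does not separate 0 from 1, so the collapse at 1 is not
    noticed by the loop variable of \<open>z2\<close>.\<close>
  have pick_q: "pick ?q (map (max 1) \<sigma>) = pick ?q \<sigma>" if "\<sigma> \<in> ops i 2" for \<sigma> i
  proof -
    have "?q ! max 1 k = ?q ! k" if "k \<le> 2" for k
    proof -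
      have "k = 0 \<or> k = 1 \<or> k = 2" using that by auto
      then show ?thesis by auto
    qed
    then show ?thesis using that by (auto simp: pick_def ops_def)
  qed
  have pick_q2: "0 \<notin> set (pick ?q \<sigma>)" if "\<sigma> \<in> ops i 2" "set \<sigma> \<subseteq> {2..}" for \<sigma> i
  proof
    assume "0 \<in> set (pick ?q \<sigma>)"
    then obtain k where k: "k \<in> set \<sigma>" "?q ! k = 0" by (auto simp: pick_def)
    then have "k = 2" using that by (auto simp: ops_def subset_iff intro!: antisym)
    then show False using k(2) by auto
  qed
  have max0: "map (max 0) \<rho> = \<rho>" for \<rho> :: "nat list" by (auto intro: map_idI)
  have s3: "s = 0 \<or> s = 1 \<or> s = 2" if "s \<le> 2" for s :: nat using that by auto
  define z1 where "z1 = H 2 2 ((?p, ?p), (?q, ?q))"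
  define z2 where "z2 = H 2 2 ((?q, ?q), (?p, ?p))"
  define g where "g = H 1 1 (([0, 1], [0, 1]), ([0, 1], [0, 1]))"
  have z1: "collapsed Z 2 z1"
    unfolding collapsed_def
  proof (intro conjI allI ballI impI)
    show "z1 \<in> cells Z 2 2" unfolding z1_def by (rule nat_onD(1)[OF H]) (use pq in simp)
    fix i j s \<sigma> \<tau> assume *: "\<sigma> \<in> ops i 2" "\<tau> \<in> ops j 2" "s \<le> 2" "set \<sigma> \<subseteq> {s..} \<or> set \<tau> \<subseteq> {s..}"
    show "act Z 2 2 \<sigma> \<tau> z1 = act Z 2 2 (map (max s) \<sigma>) (map (max s) \<tau>) z1"
    proof (cases "s = 0")
      case True
      then show ?thesis by (simp add: max0)
    next
      case False
      \<comment> \<open>As \<open>?p\<close> leaves 0 at the first step, a list avoiding 0 is sent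
        to the end of the loop variable, where \<open>H\<close> is the base point.\<close>
      have b: "act Z 2 2 \<sigma>' \<tau>' z1 = base Z v i j" if "\<sigma>' \<in> ops i 2" "\<tau>' \<in> ops j 2" "0 \<notin> set \<sigma>' \<or> 0 \<notin> set \<tau>'" for \<sigma>' \<tau>'
        unfolding z1_def actH[OF pq that(1,2)]
        by (rule t'[OF pick_ops[OF pq(1) that(1)] pick_ops[OF pq(1) that(2)] pick_ops[OF pq(2) that(1)] pick_ops[OF pq(2) that(2)]])
          (use pick_p[OF that(1)] pick_p[OF that(2)] that(3) in blast)
      have "0 \<notin> set (map (max s) \<sigma>)" using False by auto
      moreover have "0 \<notin> set \<sigma> \<or> 0 \<notin> set \<tau>" using *(4) False by auto
      ultimately show ?thesis using b[OF *(1,2)] b[OF max_ops[OF *(1,3)] max_ops[OF *(2,3)]] by simp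
    qed
  qed
  have z2: "collapsed Z 2 z2"
    unfolding collapsed_def
  proof (intro conjI allI ballI impI)
    show "z2 \<in> cells Z 2 2" unfolding z2_def by (rule nat_onD(1)[OF H]) (use pq in simp)
    fix i j s \<sigma> \<tau> assume *: "\<sigma> \<in> ops i 2" "\<tau> \<in> ops j 2" "s \<le> 2" "set \<sigma> \<subseteq> {s..} \<or> set \<tau> \<subseteq> {s..}"
    have b: "act Z 2 2 \<sigma>' \<tau>' z2 = act Z 1 1 (pick ?q \<sigma>') (pick ?q \<tau>') x"
      if "\<sigma>' \<in> ops i 2" "\<tau>' \<in> ops j 2" "0 \<notin> set \<sigma>' \<or> 0 \<notin> set \<tau>'" for \<sigma>' \<tau>'
      unfolding z2_def actH[OF pq(2,1) that(1,2)]
      by (rule e1[OF pick_ops[OF pq(2) that(1)] pick_ops[OF pq(2) that(2)] pick_ops[OF pq(1) that(1)] pick_ops[OF pq(1) that(2)]])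
        (use pick_p[OF that(1)] pick_p[OF that(2)] that(3) in blast)
    note mo = max_ops[OF *(1,3)] max_ops[OF *(2,3)]
    from s3[OF *(3)] show "act Z 2 2 \<sigma> \<tau> z2 = act Z 2 2 (map (max s) \<sigma>) (map (max s) \<tau>) z2"
    proof (elim disjE)
      assume "s = 0"
      then show ?thesis by (simp add: max0)
    next
      assume s: "s = 1"
      have "0 \<notin> set (map (max s) \<sigma>)" using s by auto
      moreover have "0 \<notin> set \<sigma> \<or> 0 \<notin> set \<tau>" using *(4) s by auto
      ultimately show ?thesis using b[OF *(1,2)] b[OF mo] pick_q[OF *(1)] pick_q[OF *(2)] unfolding s by simp
    next
      assume s: "s = 2"
      have "0 \<notin> set (map (max s) \<sigma>)" using s by auto
      moreover have "0 \<notin> set \<sigma> \<or> 0 \<notin> set \<tau>" using *(4) s by auto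
      moreover have "0 \<notin> set (pick ?q \<sigma>) \<or> 0 \<notin> set (pick ?q \<tau>)"
        using *(4) pick_q2[OF *(1)] pick_q2[OF *(2)] s by blast
      then have "act Z 1 1 (pick ?q \<sigma>) (pick ?q \<tau>) x = base Z v i j"
        using aeppli_loops_base[OF x pick_ops[OF pq(2) *(1)] pick_ops[OF pq(2) *(2)]] by blast
      moreover have "set (map (max s) \<sigma>) \<subseteq> {2..}" using s by auto
      then have "act Z 1 1 (pick ?q (map (max s) \<sigma>)) (pick ?q (map (max s) \<tau>)) x = base Z v i j"
        using aeppli_loops_base[OF x pick_ops[OF pq(2) mo(1)] pick_ops[OF pq(2) mo(2)]] pick_q2[OF mo(1)] by blast
      ultimately show ?thesis using b[OF *(1,2)] b[OF mo] by simp
    qed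
  qed
  have id1: "act Z 1 1 [0, 1] [0, 1] a = a" if "a \<in> aeppli_loops Z v" for a
    using act_id[OF bZ aeppli_loops_cells[OF that]] by (simp add: id_op_def)
  have dz1: "dface Z 2 i z1 = H 1 1 ((pick ?p (coface 2 i), pick ?p (coface 2 i)), (pick ?q (coface 2 i), pick ?q (coface 2 i)))"
    if "i \<le> 2" for i unfolding dface_def z1_def by (rule actH[OF pq coface_ops2[OF that] coface_ops2[OF that]])
  have dz2: "dface Z 2 i z2 = H 1 1 ((pick ?q (coface 2 i), pick ?q (coface 2 i)), (pick ?p (coface 2 i), pick ?p (coface 2 i)))"
    if "i \<le> 2" for i unfolding dface_def z2_def by (rule actH[OF pq(2,1) coface_ops2[OF that] coface_ops2[OF that]])
  have g: "g \<in> aeppli_loops Z v"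
    unfolding aeppli_loops_iff
  proof (intro conjI allI impI)
    show "g \<in> cells Z 1 1" unfolding g_def by (rule nat_onD(1)[OF H]) (use c1 in simp)
    fix i j \<sigma> \<tau> assume st: "(\<sigma>, \<tau>) \<in> cells (bd_A 1 1) i j"
    then have o: "\<sigma> \<in> ops i 1" "\<tau> \<in> ops j 1" using bd_A_sub by auto
    have p: "pick [0, 1] \<rho> = \<rho>" if "\<rho> \<in> ops k 1" for \<rho> k using id_pick[OF that] by (simp add: id_op_def)
    have "act Z 1 1 \<sigma> \<tau> g = H i j ((\<sigma>, \<tau>), (\<sigma>, \<tau>))"
      using nat_onD(2)[OF H, of "(([0, 1], [0, 1]), ([0, 1], [0, 1]))" 1 1, OF _ o] c1(3) p[OF o(1)] p[OF o(2)]
      by (simp add: g_def act_bprod act_bistd)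
    then show "act Z 1 1 \<sigma> \<tau> g = base Z v i j" using t[THEN spec, THEN spec, THEN bspec, OF st] o by simp
  qed
  have "aeppli_tri Z v (base Z v 1 1) y g"
    unfolding aeppli_tri_def
  proof (intro conjI exI[of _ z1] e_in y g z1)
    show "dface Z 2 0 z1 = base Z v 1 1" using dz1[of 0] t'[OF c1(2) c1(2) c1(3) c1(3)] by (simp add: coface_2 pick_def)
    show "dface Z 2 2 z1 = y" using dz1[of 2] e0[OF c1(3) c1(3) c1(1) c1(1)] id1[OF y] by (simp add: coface_2 pick_def)
    show "dface Z 2 1 z1 = g" using dz1[of 1] by (simp add: coface_2 coface_2(2)[simplified] pick_def g_def)
  qed
  moreover have "aeppli_tri Z v x (base Z v 1 1) g"
    unfolding aeppli_tri_def
  proof (intro conjI exI[of _ z2] e_in x g z2)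
    show "dface Z 2 0 z2 = x" using dz2[of 0] e1[OF c1(3) c1(3) c1(2) c1(2)] id1[OF x] by (simp add: coface_2 pick_def)
    show "dface Z 2 2 z2 = base Z v 1 1" using dz2[of 2] t'[OF c1(1) c1(1) c1(3) c1(3)] by (simp add: coface_2 pick_def)
    show "dface Z 2 1 z2 = g" using dz2[of 1] by (simp add: coface_2 coface_2(2)[simplified] pick_def g_def)
  qed
  \<comment> \<open>By \<open>z1\<close> the diagonal \<open>g\<close> is a composite of the unit
    with \<open>y\<close>, hence equivalent to \<open>y\<close>; by \<open>z2\<close> it is
    equivalent to \<open>x\<close>.\<close>
  ultimately show ?thesis using tri_unique[OF _ unit_left[OF y]] tri_rel_result by blast
qed

text \<open>By the Yoneda correspondence this is a map from Delta[2,2] to \<open>Z\<close>; the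
  bidegree is left to the lengths of the two lists.\<close>

definition nat_family :: "'a bisset \<Rightarrow> (nat list \<Rightarrow> nat list \<Rightarrow> 'a) \<Rightarrow> bool" where
  "nat_family Z F \<longleftrightarrow> (\<forall>i j. \<forall>\<sigma> \<in> ops i 2. \<forall>\<tau> \<in> ops j 2. F \<sigma> \<tau> \<in> cells Z i j \<and>
     (\<forall>i' j'. \<forall>\<theta> \<in> ops i' i. \<forall>\<phi> \<in> ops j' j. F (pick \<sigma> \<theta>) (pick \<tau> \<phi>) = act Z i j \<theta> \<phi> (F \<sigma> \<tau>)))"

lemma nat_familyD:
  assumes "nat_family Z F" "\<sigma> \<in> ops i 2" "\<tau> \<in> ops j 2"
  shows "F \<sigma> \<tau> \<in> cells Z i j"
    and "\<theta> \<in> ops i' i \<Longrightarrow> \<phi> \<in> ops j' j \<Longrightarrow> F (pick \<sigma> \<theta>) (pick \<tau> \<phi>) = act Z i j \<theta> \<phi> (F \<sigma> \<tau>)"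
  using assms by (simp_all add: nat_family_def)

lemma nat_family_act:
  assumes Z: "bisimplicial_set Z" and w: "w \<in> cells Z p q"
    and f: "\<And>x y. x \<le> y \<Longrightarrow> f x \<le> f y" "\<And>x. x \<le> 2 \<Longrightarrow> f x \<le> p"
    and g: "\<And>x y. x \<le> y \<Longrightarrow> g x \<le> g y" "\<And>x. x \<le> 2 \<Longrightarrow> g x \<le> q"
  shows "nat_family Z (\<lambda>\<sigma> \<tau>. act Z p q (map f \<sigma>) (map g \<tau>) w)"
  unfolding nat_family_def
proof (intro allI ballI conjI)
  fix i j \<sigma> \<tau> assume o: "\<sigma> \<in> ops i 2" "\<tau> \<in> ops j 2"
  have m: "map f \<sigma> \<in> ops i p" "map g \<tau> \<in> ops j q"
    using map_mono_ops[OF o(1), of f p] map_mono_ops[OF o(2), of g q] f g by blast+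
  show "act Z p q (map f \<sigma>) (map g \<tau>) w \<in> cells Z i j" by (rule act_cells[OF Z w m])
  fix i' j' \<theta> \<phi> assume op: "\<theta> \<in> ops i' i" "\<phi> \<in> ops j' j"
  show "act Z p q (map f (pick \<sigma> \<theta>)) (map g (pick \<tau> \<phi>)) w = act Z i j \<theta> \<phi> (act Z p q (map f \<sigma>) (map g \<tau>) w)"
    unfolding map_pick[OF op(1) opsD(1)[OF o(1)]] map_pick[OF op(2) opsD(1)[OF o(2)]]
    by (rule act_act[OF Z w m op, symmetric])
qed

text \<open>The bihorn that lacks the faces opposite to 2 is covered by three regions, one for each
  family, and agreement on the overlaps makes them one map. The two faces opposite to 0 share the
  family \<open>A\<close>, as they do in an Aeppli filler.\<close>

lemma fill_bihorn_2:
  assumes Z: "kan Z" and fam: "nat_family Z A" "nat_family Z B" "nat_family Z C"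
    and AB: "\<And>i j \<sigma> \<tau>. \<sigma> \<in> ops i 2 \<Longrightarrow> \<tau> \<in> ops j 2 \<Longrightarrow> 0 \<notin> set \<sigma> \<or> 0 \<notin> set \<tau> \<Longrightarrow> 1 \<notin> set \<sigma> \<Longrightarrow> A \<sigma> \<tau> = B \<sigma> \<tau>"
    and AC: "\<And>i j \<sigma> \<tau>. \<sigma> \<in> ops i 2 \<Longrightarrow> \<tau> \<in> ops j 2 \<Longrightarrow> 0 \<notin> set \<sigma> \<or> 0 \<notin> set \<tau> \<Longrightarrow> 1 \<notin> set \<tau> \<Longrightarrow> A \<sigma> \<tau> = C \<sigma> \<tau>"
    and BC: "\<And>i j \<sigma> \<tau>. \<sigma> \<in> ops i 2 \<Longrightarrow> \<tau> \<in> ops j 2 \<Longrightarrow> 1 \<notin> set \<sigma> \<Longrightarrow> 1 \<notin> set \<tau> \<Longrightarrow> B \<sigma> \<tau> = C \<sigma> \<tau>"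
  obtains z where "z \<in> cells Z 2 2"
    and "\<And>i j \<sigma> \<tau>. \<sigma> \<in> ops i 2 \<Longrightarrow> \<tau> \<in> ops j 2 \<Longrightarrow> 0 \<notin> set \<sigma> \<or> 0 \<notin> set \<tau> \<Longrightarrow> act Z 2 2 \<sigma> \<tau> z = A \<sigma> \<tau>"
    and "\<And>i j \<sigma> \<tau>. \<sigma> \<in> ops i 2 \<Longrightarrow> \<tau> \<in> ops j 2 \<Longrightarrow> 1 \<notin> set \<sigma> \<Longrightarrow> act Z 2 2 \<sigma> \<tau> z = B \<sigma> \<tau>"
    and "\<And>i j \<sigma> \<tau>. \<sigma> \<in> ops i 2 \<Longrightarrow> \<tau> \<in> ops j 2 \<Longrightarrow> 1 \<notin> set \<tau> \<Longrightarrow> act Z 2 2 \<sigma> \<tau> z = C \<sigma> \<tau>"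
proof -
  define F where "F = (\<lambda>(i::nat) (j::nat) (\<sigma>, \<tau>). if 0 \<notin> set \<sigma> \<or> 0 \<notin> set \<tau> then A \<sigma> \<tau> else if 1 \<notin> set \<sigma> then B \<sigma> \<tau> else C \<sigma> \<tau>)"
  have FA: "F i j (\<sigma>, \<tau>) = A \<sigma> \<tau>" if "0 \<notin> set \<sigma> \<or> 0 \<notin> set \<tau>" for i j \<sigma> \<tau>
    using that by (simp add: F_def)
  have FB: "F i j (\<sigma>, \<tau>) = B \<sigma> \<tau>" if "\<sigma> \<in> ops i 2" "\<tau> \<in> ops j 2" "1 \<notin> set \<sigma>" for i j \<sigma> \<tau>
    using that AB[OF that(1,2) _ that(3)] by (simp add: F_def)
  have FC: "F i j (\<sigma>, \<tau>) = C \<sigma> \<tau>" if "\<sigma> \<in> ops i 2" "\<tau> \<in> ops j 2" "1 \<notin> set \<tau>" for i j \<sigma> \<tau>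
    using that AC[OF that(1,2) _ that(3)] BC[OF that(1,2) _ that(3)] by (simp add: F_def)
  have "{..2} - {2} = {0, 1 :: nat}" by auto
  then have H: "(\<sigma>, \<tau>) \<in> cells (bihorn 2 2 2 2) i j \<longleftrightarrow> \<sigma> \<in> ops i 2 \<and> \<tau> \<in> ops j 2 \<and>
      ((0 \<notin> set \<sigma> \<or> 0 \<notin> set \<tau>) \<or> 1 \<notin> set \<sigma> \<or> 1 \<notin> set \<tau>)" for \<sigma> \<tau> i j
    unfolding cells_bihorn by auto
  have "nat_on (bihorn 2 2 2 2) Z F"
  proof (rule nat_onI)
    fix i j c assume c: "c \<in> cells (bihorn 2 2 2 2) i j"
    obtain \<sigma> \<tau> where e: "c = (\<sigma>, \<tau>)" by (cases c)
    have o: "\<sigma> \<in> ops i 2" "\<tau> \<in> ops j 2" using c e H by blast+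
    show "F i j c \<in> cells Z i j"
      unfolding e F_def using fam[THEN nat_familyD(1), OF o] by simp
  next
    fix i j i' j' \<theta> \<phi> c assume op: "\<theta> \<in> ops i' i" "\<phi> \<in> ops j' j" and c: "c \<in> cells (bihorn 2 2 2 2) i j"
    obtain \<sigma> \<tau> where e: "c = (\<sigma>, \<tau>)" by (cases c)
    have o: "\<sigma> \<in> ops i 2" "\<tau> \<in> ops j 2"
      and r: "(0 \<notin> set \<sigma> \<or> 0 \<notin> set \<tau>) \<or> 1 \<notin> set \<sigma> \<or> 1 \<notin> set \<tau>" using c unfolding e H by blast+
    note sub = set_pick_ops[OF o(1) op(1)] set_pick_ops[OF o(2) op(2)]
    note o' = pick_ops[OF o(1) op(1)] pick_ops[OF o(2) op(2)]
    from r show "F i' j' (act (bihorn 2 2 2 2) i j \<theta> \<phi> c) = act Z i j \<theta> \<phi> (F i j c)"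
      unfolding e act_bihorn
    proof (elim disjE[of "0 \<notin> set \<sigma> \<or> 0 \<notin> set \<tau>"] disjE[of "1 \<notin> set \<sigma>"])
      assume 0: "0 \<notin> set \<sigma> \<or> 0 \<notin> set \<tau>"
      then have "0 \<notin> set (pick \<sigma> \<theta>) \<or> 0 \<notin> set (pick \<tau> \<phi>)" using sub by blast
      then show "F i' j' (pick \<sigma> \<theta>, pick \<tau> \<phi>) = act Z i j \<theta> \<phi> (F i j (\<sigma>, \<tau>))"
        using FA 0 nat_familyD(2)[OF fam(1) o op] by simp
    next
      assume 1: "1 \<notin> set \<sigma>"
      then have "1 \<notin> set (pick \<sigma> \<theta>)" using sub by blast
      then show "F i' j' (pick \<sigma> \<theta>, pick \<tau> \<phi>) = act Z i j \<theta> \<phi> (F i j (\<sigma>, \<tau>))"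
        using FB[OF o 1] FB[OF o'] nat_familyD(2)[OF fam(2) o op] by simp
    next
      assume 1: "1 \<notin> set \<tau>"
      then have "1 \<notin> set (pick \<tau> \<phi>)" using sub by blast
      then show "F i' j' (pick \<sigma> \<theta>, pick \<tau> \<phi>) = act Z i j \<theta> \<phi> (F i j (\<sigma>, \<tau>))"
        using FC[OF o 1] FC[OF o'] nat_familyD(2)[OF fam(3) o op] by simp
    qed
  qed
  from kan_filler[OF Z _ _ _ _ this] obtain z where z: "z \<in> cells Z 2 2"
    and f: "\<And>i j a b. (a, b) \<in> cells (bihorn 2 2 2 2) i j \<Longrightarrow> act Z 2 2 a b z = F i j (a, b)" by auto
  show thesis
  proof (rule that[OF z])
    fix i j \<sigma> \<tau> assume o: "\<sigma> \<in> ops i 2" "\<tau> \<in> ops j 2"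
    show "act Z 2 2 \<sigma> \<tau> z = A \<sigma> \<tau>" if "0 \<notin> set \<sigma> \<or> 0 \<notin> set \<tau>"
      using f[of \<sigma> \<tau> i j] FA[OF that, of i j] o that H by simp
    show "act Z 2 2 \<sigma> \<tau> z = B \<sigma> \<tau>" if "1 \<notin> set \<sigma>"
      using f[of \<sigma> \<tau> i j] FB[OF o that] o that H by simp
    show "act Z 2 2 \<sigma> \<tau> z = C \<sigma> \<tau>" if "1 \<notin> set \<tau>"
      using f[of \<sigma> \<tau> i j] FC[OF o that] o that H by simp
  qed
qed

text \<open>The vertex \<open>(p, c)\<close> of the square \<open>\<Delta>\<^sup>1 \<times> \<Delta>\<^sup>1\<close> has position \<open>p + c\<close> in either of the two triangles
  \<open>c \<le> p\<close> and \<open>p \<le> c\<close>.\<close>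

definition add_ops :: "nat list \<Rightarrow> nat list \<Rightarrow> nat list" where
  "add_ops p c = map (\<lambda>(x, y). x + y) (zip p c)"

lemma zip_ops1:
  assumes "p \<in> ops i 1" "c \<in> ops i 1" "(x, y) \<in> set (zip p c)"
  shows "(x = 0 \<or> x = 1) \<and> (y = 0 \<or> y = 1)"
  using assms(1,2) set_zip_leftD[OF assms(3)] set_zip_rightD[OF assms(3)]
  by (auto simp: ops_def subset_iff le_Suc_eq)

lemma add_ops_ops:
  assumes "p \<in> ops i 1" "c \<in> ops i 1"
  shows "add_ops p c \<in> ops i 2"
proof (rule opsI)
  have s: "sorted_wrt (\<le>) (zip p c)" by (rule sorted_wrt_zip[OF opsD(2)[OF assms(1)] opsD(2)[OF assms(2)]])
  show "length (add_ops p c) = Suc i" using assms by (simp add: add_ops_def opsD(1))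
  show "sorted (add_ops p c)"
    unfolding add_ops_def sorted_map
    by (rule sorted_wrt_mono_rel[OF _ s]) (auto simp: less_eq_prod_def intro: add_mono)
  show "set (add_ops p c) \<subseteq> {..2}"
    using zip_ops1[OF assms] by (fastforce simp: add_ops_def)
qed

lemma add_ops_pick:
  assumes "p \<in> ops i 1" "c \<in> ops i 1" "\<theta> \<in> ops i' i"
  shows "add_ops (pick p \<theta>) (pick c \<theta>) = pick (add_ops p c) \<theta>"
    and "set (zip (pick p \<theta>) (pick c \<theta>)) \<subseteq> set (zip p c)"
proof -
  have l: "length (zip p c) = Suc i" using assms by (simp add: opsD(1))
  have z: "zip (pick p \<theta>) (pick c \<theta>) = pick (zip p c) \<theta>"
    by (rule pick_zip[OF assms(3) opsD(1)[OF assms(1)] opsD(1)[OF assms(2)], symmetric])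
  show "add_ops (pick p \<theta>) (pick c \<theta>) = pick (add_ops p c) \<theta>"
    unfolding add_ops_def z by (rule map_pick[OF assms(3) l])
  show "set (zip (pick p \<theta>) (pick c \<theta>)) \<subseteq> set (zip p c)"
    unfolding z by (rule set_pick_subset[OF assms(3) l])
qed

text \<open>A simplex of the square lies in the triangle \<open>c \<le> p\<close> if the vertex
  \<open>(0, 1)\<close> is absent and in \<open>p \<le> c\<close> if \<open>(1, 0)\<close> is; being
  a chain, it cannot contain both. On the first triangle \<open>min 1\<close> recovers
  \<open>p\<close> from the position, on the second the predecessor does.\<close>

lemma add_ops_facts:
  assumes p: "p \<in> ops i 1" and c: "c \<in> ops i 1"
  shows "(0, 1) \<notin> set (zip p c) \<Longrightarrow> map (min 1) (add_ops p c) = p"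
    and "(1, 0) \<notin> set (zip p c) \<Longrightarrow> map (\<lambda>x. x - 1) (add_ops p c) = p"
    and "(0, 1) \<notin> set (zip p c) \<Longrightarrow> (1, 0) \<notin> set (zip p c) \<Longrightarrow> 1 \<notin> set (add_ops p c)"
    and "(0, 1) \<notin> set (zip p c) \<or> (1, 0) \<notin> set (zip p c)"
    and "0 \<notin> set p \<or> 0 \<notin> set c \<Longrightarrow> 0 \<notin> set (add_ops p c)"
    and "1 \<notin> set p \<Longrightarrow> add_ops p c = c"
    and "1 \<notin> set p \<or> 0 \<notin> set c \<Longrightarrow> (1, 0) \<notin> set (zip p c)"
    and "0 \<notin> set p \<or> 1 \<notin> set c \<Longrightarrow> (0, 1) \<notin> set (zip p c)"
proof -
  have l: "length p = length c" using p c by (simp add: opsD(1))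
  have fst: "map fst (zip p c) = p" and snd: "map snd (zip p c) = c" using l by simp_all
  have z: "(x = 0 \<or> x = 1) \<and> (y = 0 \<or> y = 1)" if "(x, y) \<in> set (zip p c)" for x y
    by (rule zip_ops1[OF p c that])
  show "map (min 1) (add_ops p c) = p" if n: "(0, 1) \<notin> set (zip p c)"
  proof -
    have "map (min 1) (add_ops p c) = map fst (zip p c)"
      unfolding add_ops_def map_map
    proof (rule map_cong[OF HOL.refl])
      fix w assume w: "w \<in> set (zip p c)"
      obtain x y where xy: "w = (x, y)" by (cases w)
      show "(min 1 \<circ> (\<lambda>(x, y). x + y)) w = fst w" using z[of x y] w n unfolding xy by auto
    qed
    then show ?thesis using fst by simp
  qed
  show "map (\<lambda>x. x - 1) (add_ops p c) = p" if n: "(1, 0) \<notin> set (zip p c)"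
  proof -
    have "map (\<lambda>x. x - 1) (add_ops p c) = map fst (zip p c)"
      unfolding add_ops_def map_map
    proof (rule map_cong[OF HOL.refl])
      fix w assume w: "w \<in> set (zip p c)"
      obtain x y where xy: "w = (x, y)" by (cases w)
      show "((\<lambda>x. x - 1) \<circ> (\<lambda>(x, y). x + y)) w = fst w" using z[of x y] w n unfolding xy by auto
    qed
    then show ?thesis using fst by simp
  qed
  show "1 \<notin> set (add_ops p c)" if n: "(0, 1) \<notin> set (zip p c)" "(1, 0) \<notin> set (zip p c)"
  proof
    assume "1 \<in> set (add_ops p c)"
    then obtain x y where w: "(x, y) \<in> set (zip p c)" "1 = x + y" by (auto simp: add_ops_def)
    then show False using z[OF w(1)] n by auto
  qed
  show "(0, 1) \<notin> set (zip p c) \<or> (1, 0) \<notin> set (zip p c)"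
  proof (rule ccontr)
    assume "\<not> ?thesis"
    then have m: "(0, 1) \<in> set (zip p c)" "(1, 0) \<in> set (zip p c)" by auto
    have "is_chain (set (zip p c))"
      by (rule is_chain_sorted[OF sorted_wrt_zip[OF opsD(2)[OF p] opsD(2)[OF c]]])
    from bspec[OF bspec[OF conjunct2[OF this[unfolded is_chain_def]] m(1)] m(2)] show False by simp
  qed
  show "0 \<notin> set (add_ops p c)" if n: "0 \<notin> set p \<or> 0 \<notin> set c"
  proof
    assume "0 \<in> set (add_ops p c)"
    then obtain x y where w: "(x, y) \<in> set (zip p c)" "0 = x + y" by (auto simp: add_ops_def)
    then have "x = 0" "y = 0" by simp_all
    then show False using set_zip_leftD[OF w(1)] set_zip_rightD[OF w(1)] n by simp
  qed
  show "add_ops p c = c" if n: "1 \<notin> set p"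
  proof -
    have "add_ops p c = map snd (zip p c)"
      unfolding add_ops_def
    proof (rule map_cong[OF HOL.refl])
      fix w assume w: "w \<in> set (zip p c)"
      obtain x y where xy: "w = (x, y)" by (cases w)
      have "x \<in> set p" using set_zip_leftD w unfolding xy by fast
      then show "(\<lambda>(x, y). x + y) w = snd w" using z[of x y] w n unfolding xy by auto
    qed
    then show ?thesis using snd by simp
  qed
  show "(1, 0) \<notin> set (zip p c)" if "1 \<notin> set p \<or> 0 \<notin> set c"
    using that set_zip_leftD[of 1 0 p c] set_zip_rightD[of 1 0 p c] by blast
  show "(0, 1) \<notin> set (zip p c)" if "0 \<notin> set p \<or> 1 \<notin> set c"
    using that set_zip_leftD[of 0 1 p c] set_zip_rightD[of 0 1 p c] by blast
qed

lemma min_pred: "x \<le> 2 \<Longrightarrow> x \<noteq> 1 \<Longrightarrow> min 1 x = x - (1 :: nat)"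
  by auto

lemma map_min_pred: "\<sigma> \<in> ops i 2 \<Longrightarrow> 1 \<notin> set \<sigma> \<Longrightarrow> map (min 1) \<sigma> = map (\<lambda>x. x - 1) \<sigma>"
  using min_pred by (intro map_cong[OF HOL.refl]) (auto simp: ops_def)

lemma map_min_no0: "0 \<notin> set \<sigma> \<Longrightarrow> 0 \<notin> set (map (min (1 :: nat)) \<sigma>)"
  by (auto simp: min_def split: if_splits)

lemma map_pred_no0: "0 \<notin> set \<sigma> \<Longrightarrow> 1 \<notin> set \<sigma> \<Longrightarrow> 0 \<notin> set (map (\<lambda>x. x - (1 :: nat)) \<sigma>)"
  by (auto simp: diff_is_0_eq le_Suc_eq)

text \<open>The square is assembled from its two triangles, of which one is degenerate, and from two cells
  obtained by filling the bihorns that the mixed pairs of triangles leave open.\<close>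

lemma homotopy_of_aeppli_tri:
  assumes Z: "kan Z" and v: "v \<in> cells Z 0 0" and tri: "aeppli_tri Z v a (base Z v 1 1) b"
  shows "(a, b) \<in> homotopy_rel Z v 1 1 (bd_A 1 1)"
proof -
  have bZ: "bisimplicial_set Z" using Z by (rule kan_bisimplicial)
  obtain z where a: "a \<in> aeppli_loops Z v" and b: "b \<in> aeppli_loops Z v" and z: "collapsed Z 2 z"
    and f0: "dface Z 2 0 z = a" and f2: "dface Z 2 2 z = base Z v 1 1" and f1: "dface Z 2 1 z = b"
    using tri by (auto simp: aeppli_tri_def)
  have zc: "z \<in> cells Z 2 2" using z by (rule collapsed_cells)
  have ac: "a \<in> cells Z 1 1" "b \<in> cells Z 1 1" by (rule aeppli_loops_cells, fact)+
  have m1: "map (min 1) \<sigma> \<in> ops i 1" "map (\<lambda>x. x - 1) \<sigma> \<in> ops i 1" if "\<sigma> \<in> ops i 2" for \<sigma> i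
    using that by (auto elim!: map_mono_ops)
  have fb: "nat_family Z (\<lambda>\<sigma> \<tau>. act Z 1 1 (map (min 1) \<sigma>) (map (min 1) \<tau>) b)"
    by (rule nat_family_act[OF bZ ac(2)]) auto
  have fz: "nat_family Z (\<lambda>\<sigma> \<tau>. act Z 2 2 \<sigma> \<tau> z)"
    using nat_family_act[OF bZ zc, of "\<lambda>x. x" "\<lambda>x. x"] by simp
  have zA: "act Z 2 2 \<sigma> \<tau> z = act Z 1 1 (map (\<lambda>x. x - 1) \<sigma>) (map (\<lambda>x. x - 1) \<tau>) a"
    if "\<sigma> \<in> ops i 2" "\<tau> \<in> ops j 2" "0 \<notin> set \<sigma> \<or> 0 \<notin> set \<tau>" for \<sigma> \<tau> i j
    using tri_outer[OF bZ z that] f0 by simp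
  have zM: "act Z 2 2 \<sigma> \<tau> z = act Z 1 1 (map (min 1) \<sigma>) (map (min 1) \<tau>) b"
    if "\<sigma> \<in> ops i 2" "\<tau> \<in> ops j 2" "1 \<notin> set \<sigma>" "1 \<notin> set \<tau>" for \<sigma> \<tau> i j
    using tri_middle[OF bZ z that] f1 by simp
  have zL: "act Z 2 2 \<sigma> \<tau> z = base Z v i j" if "\<sigma> \<in> ops i 1" "\<tau> \<in> ops j 1" for \<sigma> \<tau> i j
    using tri_lower[OF bZ z that] f2 act_base[OF bZ v that] by simp
  \<comment> \<open>\<open>\<psi>\<close> belongs to the triangle \<open>c \<le> p\<close> in the
    first index and \<open>q \<le> d\<close> in the second. Along the diagonals it has to match its
    neighbours, which are \<open>z\<close> and the degenerate \<open>b\<close>; on the outer faces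
    it is prescribed by \<open>a\<close>.\<close>
  obtain \<psi> where psi: "\<psi> \<in> cells Z 2 2"
    and psiA: "\<And>i j \<sigma> \<tau>. \<sigma> \<in> ops i 2 \<Longrightarrow> \<tau> \<in> ops j 2 \<Longrightarrow> 0 \<notin> set \<sigma> \<or> 0 \<notin> set \<tau> \<Longrightarrow>
      act Z 2 2 \<sigma> \<tau> \<psi> = act Z 1 1 (map (min 1) \<sigma>) (map (\<lambda>x. x - 1) \<tau>) a"
    and psiB: "\<And>i j \<sigma> \<tau>. \<sigma> \<in> ops i 2 \<Longrightarrow> \<tau> \<in> ops j 2 \<Longrightarrow> 1 \<notin> set \<sigma> \<Longrightarrow> act Z 2 2 \<sigma> \<tau> \<psi> = act Z 2 2 \<sigma> \<tau> z"
    and psiC: "\<And>i j \<sigma> \<tau>. \<sigma> \<in> ops i 2 \<Longrightarrow> \<tau> \<in> ops j 2 \<Longrightarrow> 1 \<notin> set \<tau> \<Longrightarrow>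
      act Z 2 2 \<sigma> \<tau> \<psi> = act Z 1 1 (map (min 1) \<sigma>) (map (min 1) \<tau>) b"
  proof (rule fill_bihorn_2[OF Z _ fz fb])
    show "nat_family Z (\<lambda>\<sigma> \<tau>. act Z 1 1 (map (min 1) \<sigma>) (map (\<lambda>x. x - 1) \<tau>) a)"
      by (rule nat_family_act[OF bZ ac(1)]) auto
    fix i j \<sigma> \<tau> assume o: "\<sigma> \<in> ops i 2" "\<tau> \<in> ops j 2"
    show "act Z 1 1 (map (min 1) \<sigma>) (map (\<lambda>x. x - 1) \<tau>) a = act Z 2 2 \<sigma> \<tau> z"
      if "0 \<notin> set \<sigma> \<or> 0 \<notin> set \<tau>" "1 \<notin> set \<sigma>"
      unfolding map_min_pred[OF o(1) that(2)] by (rule zA[OF o that(1), symmetric])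
    show "act Z 1 1 (map (min 1) \<sigma>) (map (\<lambda>x. x - 1) \<tau>) a = act Z 1 1 (map (min 1) \<sigma>) (map (min 1) \<tau>) b"
      if "0 \<notin> set \<sigma> \<or> 0 \<notin> set \<tau>" "1 \<notin> set \<tau>"
    proof -
      have "0 \<notin> set (map (min 1) \<sigma>) \<or> 0 \<notin> set (map (\<lambda>x. x - 1) \<tau>)" "0 \<notin> set (map (min 1) \<sigma>) \<or> 0 \<notin> set (map (min 1) \<tau>)"
        using that map_min_no0[of \<sigma>] map_min_no0[of \<tau>] map_pred_no0[of \<tau>] by blast+
      then show ?thesis
        using aeppli_loops_base[OF a m1(1)[OF o(1)] m1(2)[OF o(2)]] aeppli_loops_base[OF b m1(1)[OF o(1)] m1(1)[OF o(2)]]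
        by metis
    qed
    show "act Z 2 2 \<sigma> \<tau> z = act Z 1 1 (map (min 1) \<sigma>) (map (min 1) \<tau>) b" if "1 \<notin> set \<sigma>" "1 \<notin> set \<tau>"
      by (rule zM[OF o that])
  next
    fix w assume "w \<in> cells Z 2 2"
      and "\<And>i j \<sigma> \<tau>. \<sigma> \<in> ops i 2 \<Longrightarrow> \<tau> \<in> ops j 2 \<Longrightarrow> 0 \<notin> set \<sigma> \<or> 0 \<notin> set \<tau> \<Longrightarrow>
        act Z 2 2 \<sigma> \<tau> w = act Z 1 1 (map (min 1) \<sigma>) (map (\<lambda>x. x - 1) \<tau>) a"
      and "\<And>i j \<sigma> \<tau>. \<sigma> \<in> ops i 2 \<Longrightarrow> \<tau> \<in> ops j 2 \<Longrightarrow> 1 \<notin> set \<sigma> \<Longrightarrow> act Z 2 2 \<sigma> \<tau> w = act Z 2 2 \<sigma> \<tau> z"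
      and "\<And>i j \<sigma> \<tau>. \<sigma> \<in> ops i 2 \<Longrightarrow> \<tau> \<in> ops j 2 \<Longrightarrow> 1 \<notin> set \<tau> \<Longrightarrow>
        act Z 2 2 \<sigma> \<tau> w = act Z 1 1 (map (min 1) \<sigma>) (map (min 1) \<tau>) b"
    then show thesis by (rule that)
  qed
  \<comment> \<open>The same as \<open>\<psi>\<close> with the two indices exchanged.\<close>
  obtain \<chi> where chi: "\<chi> \<in> cells Z 2 2"
    and chiA: "\<And>i j \<sigma> \<tau>. \<sigma> \<in> ops i 2 \<Longrightarrow> \<tau> \<in> ops j 2 \<Longrightarrow> 0 \<notin> set \<sigma> \<or> 0 \<notin> set \<tau> \<Longrightarrow>
      act Z 2 2 \<sigma> \<tau> \<chi> = act Z 1 1 (map (\<lambda>x. x - 1) \<sigma>) (map (min 1) \<tau>) a"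
    and chiB: "\<And>i j \<sigma> \<tau>. \<sigma> \<in> ops i 2 \<Longrightarrow> \<tau> \<in> ops j 2 \<Longrightarrow> 1 \<notin> set \<sigma> \<Longrightarrow>
      act Z 2 2 \<sigma> \<tau> \<chi> = act Z 1 1 (map (min 1) \<sigma>) (map (min 1) \<tau>) b"
    and chiC: "\<And>i j \<sigma> \<tau>. \<sigma> \<in> ops i 2 \<Longrightarrow> \<tau> \<in> ops j 2 \<Longrightarrow> 1 \<notin> set \<tau> \<Longrightarrow> act Z 2 2 \<sigma> \<tau> \<chi> = act Z 2 2 \<sigma> \<tau> z"
  proof (rule fill_bihorn_2[OF Z _ fb fz])
    show "nat_family Z (\<lambda>\<sigma> \<tau>. act Z 1 1 (map (\<lambda>x. x - 1) \<sigma>) (map (min 1) \<tau>) a)"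
      by (rule nat_family_act[OF bZ ac(1)]) auto
    fix i j \<sigma> \<tau> assume o: "\<sigma> \<in> ops i 2" "\<tau> \<in> ops j 2"
    show "act Z 1 1 (map (\<lambda>x. x - 1) \<sigma>) (map (min 1) \<tau>) a = act Z 2 2 \<sigma> \<tau> z"
      if "0 \<notin> set \<sigma> \<or> 0 \<notin> set \<tau>" "1 \<notin> set \<tau>"
      unfolding map_min_pred[OF o(2) that(2)] by (rule zA[OF o that(1), symmetric])
    show "act Z 1 1 (map (\<lambda>x. x - 1) \<sigma>) (map (min 1) \<tau>) a = act Z 1 1 (map (min 1) \<sigma>) (map (min 1) \<tau>) b"
      if "0 \<notin> set \<sigma> \<or> 0 \<notin> set \<tau>" "1 \<notin> set \<sigma>"
    proof -
      have "0 \<notin> set (map (\<lambda>x. x - 1) \<sigma>) \<or> 0 \<notin> set (map (min 1) \<tau>)" "0 \<notin> set (map (min 1) \<sigma>) \<or> 0 \<notin> set (map (min 1) \<tau>)"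
        using that map_min_no0[of \<sigma>] map_min_no0[of \<tau>] map_pred_no0[of \<sigma>] by blast+
      then show ?thesis
        using aeppli_loops_base[OF a m1(2)[OF o(1)] m1(1)[OF o(2)]] aeppli_loops_base[OF b m1(1)[OF o(1)] m1(1)[OF o(2)]]
        by metis
    qed
    show "act Z 1 1 (map (min 1) \<sigma>) (map (min 1) \<tau>) b = act Z 2 2 \<sigma> \<tau> z" if "1 \<notin> set \<sigma>" "1 \<notin> set \<tau>"
      by (rule zM[OF o that, symmetric])
  next
    fix w assume "w \<in> cells Z 2 2"
      and "\<And>i j \<sigma> \<tau>. \<sigma> \<in> ops i 2 \<Longrightarrow> \<tau> \<in> ops j 2 \<Longrightarrow> 0 \<notin> set \<sigma> \<or> 0 \<notin> set \<tau> \<Longrightarrow>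
        act Z 2 2 \<sigma> \<tau> w = act Z 1 1 (map (\<lambda>x. x - 1) \<sigma>) (map (min 1) \<tau>) a"
      and "\<And>i j \<sigma> \<tau>. \<sigma> \<in> ops i 2 \<Longrightarrow> \<tau> \<in> ops j 2 \<Longrightarrow> 1 \<notin> set \<sigma> \<Longrightarrow>
        act Z 2 2 \<sigma> \<tau> w = act Z 1 1 (map (min 1) \<sigma>) (map (min 1) \<tau>) b"
      and "\<And>i j \<sigma> \<tau>. \<sigma> \<in> ops i 2 \<Longrightarrow> \<tau> \<in> ops j 2 \<Longrightarrow> 1 \<notin> set \<tau> \<Longrightarrow> act Z 2 2 \<sigma> \<tau> w = act Z 2 2 \<sigma> \<tau> z"
    then show thesis by (rule that)
  qed
  \<comment> \<open>One value for each pair of triangles. \<open>V1\<close> to \<open>V4\<close>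
    show that the order of the tests does not matter where two triangles meet.\<close>
  define h where "h = (\<lambda>(i::nat) (j::nat) ((p, q), (c, d)).
     let U = set (zip p c); W = set (zip q d); \<sigma> = add_ops p c; \<tau> = add_ops q d in
     if (0, 1) \<notin> U \<and> (0, 1) \<notin> W then act Z 1 1 p q b
     else if (1, 0) \<notin> U \<and> (1, 0) \<notin> W then act Z 2 2 \<sigma> \<tau> z
     else if (0, 1) \<notin> U \<and> (1, 0) \<notin> W then act Z 2 2 \<sigma> \<tau> \<psi>
     else act Z 2 2 \<sigma> \<tau> \<chi>)"
  have V1: "h i j ((p, q), (c, d)) = act Z 1 1 p q b" if "(0, 1) \<notin> set (zip p c)" "(0, 1) \<notin> set (zip q d)" for i j p q c d
    using that by (simp add: h_def)
  have V2: "h i j ((p, q), (c, d)) = act Z 2 2 (add_ops p c) (add_ops q d) z"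
    if "p \<in> ops i 1" "q \<in> ops j 1" "c \<in> ops i 1" "d \<in> ops j 1" "(1, 0) \<notin> set (zip p c)" "(1, 0) \<notin> set (zip q d)" for i j p q c d
  proof (cases "(0, 1) \<notin> set (zip p c) \<and> (0, 1) \<notin> set (zip q d)")
    case True
    then show ?thesis
      using V1[of p c q d i j] zM[OF add_ops_ops[OF that(1,3)] add_ops_ops[OF that(2,4)]]
        add_ops_facts(1,3)[OF that(1,3)] add_ops_facts(1,3)[OF that(2,4)] that by simp
  next
    case False
    then show ?thesis using that by (auto simp: h_def Let_def)
  qed
  have V3: "h i j ((p, q), (c, d)) = act Z 2 2 (add_ops p c) (add_ops q d) \<psi>"
    if "p \<in> ops i 1" "q \<in> ops j 1" "c \<in> ops i 1" "d \<in> ops j 1" "(0, 1) \<notin> set (zip p c)" "(1, 0) \<notin> set (zip q d)" for i j p q c d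
  proof -
    note o = add_ops_ops[OF that(1,3)] add_ops_ops[OF that(2,4)]
    show ?thesis
    proof (cases "(0, 1) \<notin> set (zip q d)")
      case True
      then show ?thesis
        using V1[of p c q d i j] psiC[OF o] add_ops_facts(1)[OF that(1,3)] add_ops_facts(1,3)[OF that(2,4)] that by simp
    next
      case False
      show ?thesis
      proof (cases "(1, 0) \<notin> set (zip p c)")
        case True
        then show ?thesis using V2[OF that(1-4) True that(6)] psiB[OF o] add_ops_facts(3)[OF that(1,3)] that by simp
      next
        case False
        then show ?thesis using that \<open>\<not> (0, 1) \<notin> set (zip q d)\<close> by (simp add: h_def Let_def)
      qed
    qed
  qed
  have V4: "h i j ((p, q), (c, d)) = act Z 2 2 (add_ops p c) (add_ops q d) \<chi>"
    if "p \<in> ops i 1" "q \<in> ops j 1" "c \<in> ops i 1" "d \<in> ops j 1" "(1, 0) \<notin> set (zip p c)" "(0, 1) \<notin> set (zip q d)" for i j p q c d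
  proof -
    note o = add_ops_ops[OF that(1,3)] add_ops_ops[OF that(2,4)]
    show ?thesis
    proof (cases "(0, 1) \<notin> set (zip p c)")
      case True
      then show ?thesis
        using V1[of p c q d i j] chiB[OF o] add_ops_facts(1,3)[OF that(1,3)] add_ops_facts(1)[OF that(2,4)] that by simp
    next
      case False
      show ?thesis
      proof (cases "(1, 0) \<notin> set (zip q d)")
        case True
        then show ?thesis using V2[OF that(1-5) True] chiC[OF o] add_ops_facts(3)[OF that(2,4)] that by simp
      next
        case False
        then show ?thesis using that \<open>\<not> (0, 1) \<notin> set (zip p c)\<close> by (simp add: h_def Let_def)
      qed
    qed
  qed
  have four: thesis
    if "p \<in> ops i 1" "q \<in> ops j 1" "c \<in> ops i 1" "d \<in> ops j 1"
      and "(0, 1) \<notin> set (zip p c) \<Longrightarrow> (0, 1) \<notin> set (zip q d) \<Longrightarrow> thesis"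
      and "(1, 0) \<notin> set (zip p c) \<Longrightarrow> (1, 0) \<notin> set (zip q d) \<Longrightarrow> thesis"
      and "(0, 1) \<notin> set (zip p c) \<Longrightarrow> (1, 0) \<notin> set (zip q d) \<Longrightarrow> thesis"
      and "(1, 0) \<notin> set (zip p c) \<Longrightarrow> (0, 1) \<notin> set (zip q d) \<Longrightarrow> thesis" for i j p q c d thesis
    using add_ops_facts(4)[OF that(1,3)] add_ops_facts(4)[OF that(2,4)] that(5-8) by blast
  \<comment> \<open>Where a position avoids 0 the value is that of \<open>a\<close>. Only over the
    pair of degenerate triangles it is that of \<open>b\<close>; there \<open>p\<close> or
    \<open>q\<close> avoids 0, so both are the base point.\<close>
  have zero: "h i j ((p, q), (c, d)) = act Z 1 1 p q a"
    if o: "p \<in> ops i 1" "q \<in> ops j 1" "c \<in> ops i 1" "d \<in> ops j 1"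
      and n: "0 \<notin> set (add_ops p c) \<or> 0 \<notin> set (add_ops q d)"
      and n1: "\<not> ((0, 1) \<notin> set (zip p c) \<and> (0, 1) \<notin> set (zip q d)) \<or> (0 \<notin> set p \<or> 0 \<notin> set q)" for i j p q c d
  proof (rule four[OF o])
    note ao = add_ops_ops[OF o(1,3)] add_ops_ops[OF o(2,4)]
    note fp = add_ops_facts[OF o(1,3)] and fq = add_ops_facts[OF o(2,4)]
    show ?thesis if "(0, 1) \<notin> set (zip p c)" "(0, 1) \<notin> set (zip q d)"
      using V1[OF that, of i j] n1 that aeppli_loops_base[OF a o(1,2)] aeppli_loops_base[OF b o(1,2)] by metis
    show ?thesis if "(1, 0) \<notin> set (zip p c)" "(1, 0) \<notin> set (zip q d)"
      using V2[OF o that] zA[OF ao n] fp(2)[OF that(1)] fq(2)[OF that(2)] by simp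
    show ?thesis if "(0, 1) \<notin> set (zip p c)" "(1, 0) \<notin> set (zip q d)"
      using V3[OF o that] psiA[OF ao n] fp(1)[OF that(1)] fq(2)[OF that(2)] by simp
    show ?thesis if "(1, 0) \<notin> set (zip p c)" "(0, 1) \<notin> set (zip q d)"
      using V4[OF o that] chiA[OF ao n] fp(2)[OF that(1)] fq(1)[OF that(2)] by simp
  qed
  have nat: "nat_on (bprod (bistd 1 1) (bistd 1 1)) Z h"
  proof (rule nat_onI)
    fix i j x assume "x \<in> cells (bprod (bistd 1 1) (bistd 1 1)) i j"
    then obtain p q c d where x: "x = ((p, q), (c, d))" and o: "p \<in> ops i 1" "q \<in> ops j 1" "c \<in> ops i 1" "d \<in> ops j 1"
      by auto
    note ao = add_ops_ops[OF o(1,3)] add_ops_ops[OF o(2,4)]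
    show "h i j x \<in> cells Z i j"
      unfolding x h_def Let_def
      using act_cells[OF bZ ac(2) o(1,2)] act_cells[OF bZ zc ao] act_cells[OF bZ psi ao] act_cells[OF bZ chi ao] by simp
  next
    fix i j i' j' \<theta> \<phi> x
    assume op: "\<theta> \<in> ops i' i" "\<phi> \<in> ops j' j" and "x \<in> cells (bprod (bistd 1 1) (bistd 1 1)) i j"
    then obtain p q c d where x: "x = ((p, q), (c, d))" and o: "p \<in> ops i 1" "q \<in> ops j 1" "c \<in> ops i 1" "d \<in> ops j 1"
      by auto
    note ao = add_ops_ops[OF o(1,3)] add_ops_ops[OF o(2,4)]
    note po = pick_ops[OF o(1) op(1)] pick_ops[OF o(2) op(2)] pick_ops[OF o(3) op(1)] pick_ops[OF o(4) op(2)]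
    note ap = add_ops_pick[OF o(1,3) op(1)] and aq = add_ops_pick[OF o(2,4) op(2)]
    have "h i' j' ((pick p \<theta>, pick q \<phi>), (pick c \<theta>, pick d \<phi>)) = act Z i j \<theta> \<phi> (h i j ((p, q), (c, d)))"
    proof (rule four[OF o])
      show ?thesis if t: "(0, 1) \<notin> set (zip p c)" "(0, 1) \<notin> set (zip q d)"
        using V1[OF t, of i j] V1[OF contra_subsetD[OF ap(2) t(1)] contra_subsetD[OF aq(2) t(2)], of i' j']
          act_act[OF bZ ac(2) o(1,2) op] by simp
      show ?thesis if t: "(1, 0) \<notin> set (zip p c)" "(1, 0) \<notin> set (zip q d)"
        using V2[OF o t] V2[OF po contra_subsetD[OF ap(2) t(1)] contra_subsetD[OF aq(2) t(2)]]
          act_act[OF bZ zc ao op] ap(1) aq(1) by simp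
      show ?thesis if t: "(0, 1) \<notin> set (zip p c)" "(1, 0) \<notin> set (zip q d)"
        using V3[OF o t] V3[OF po contra_subsetD[OF ap(2) t(1)] contra_subsetD[OF aq(2) t(2)]]
          act_act[OF bZ psi ao op] ap(1) aq(1) by simp
      show ?thesis if t: "(1, 0) \<notin> set (zip p c)" "(0, 1) \<notin> set (zip q d)"
        using V4[OF o t] V4[OF po contra_subsetD[OF ap(2) t(1)] contra_subsetD[OF aq(2) t(2)]]
          act_act[OF bZ chi ao op] ap(1) aq(1) by simp
    qed
    then show "h i' j' (act (bprod (bistd 1 1) (bistd 1 1)) i j \<theta> \<phi> x) = act Z i j \<theta> \<phi> (h i j x)"
      by (simp add: x act_bprod act_bistd)
  qed
  have bd: "h i j ((p, q), (c, d)) = base Z v i j"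
    if pq: "(p, q) \<in> cells (bd_A 1 1) i j" and cd: "c \<in> ops i 1" "d \<in> ops j 1" for i j p q c d
  proof -
    have o: "p \<in> ops i 1" "q \<in> ops j 1" "c \<in> ops i 1" "d \<in> ops j 1"
      and r: "(0 \<notin> set p \<or> 0 \<notin> set q) \<or> 1 \<notin> set p \<and> 1 \<notin> set q"
      using pq cd unfolding cells_bd_A_iff by blast+
    show ?thesis
      using r
    proof (rule disjE)
      assume 0: "0 \<notin> set p \<or> 0 \<notin> set q"
      then have n: "0 \<notin> set (add_ops p c) \<or> 0 \<notin> set (add_ops q d)"
        using add_ops_facts(5)[OF o(1,3)] add_ops_facts(5)[OF o(2,4)] by blast
      have "h i j ((p, q), (c, d)) = act Z 1 1 p q a" by (rule zero[OF o n disjI2[OF 0]])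
      also have "\<dots> = base Z v i j" by (rule aeppli_loops_base[OF a o(1,2)]) (use 0 in blast)
      finally show ?thesis .
    next
      assume 1: "1 \<notin> set p \<and> 1 \<notin> set q"
      \<comment> \<open>At the initial vertex of the loop both indices lie in the second triangle,
        with positions \<open>c\<close> and \<open>d\<close>. So the value comes from the face of
        \<open>z\<close> opposite to 2, which is the unit.\<close>
      have "h i j ((p, q), (c, d)) = act Z 2 2 (add_ops p c) (add_ops q d) z"
        by (rule V2[OF o]) (use 1 add_ops_facts(7)[OF o(1,3)] add_ops_facts(7)[OF o(2,4)] in blast)+
      then show ?thesis
        using 1 add_ops_facts(6)[OF o(1,3)] add_ops_facts(6)[OF o(2,4)] zL[OF o(3,4)] by simp
    qed
  qed
  show ?thesis
    unfolding homotopy_rel_iff[OF bd_A_sub]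
  proof (intro conjI exI[of _ h] nat allI ballI)
    show "a \<in> rel_cells Z v 1 1 (bd_A 1 1)" "b \<in> rel_cells Z v 1 1 (bd_A 1 1)"
      using a b by (simp_all only: aeppli_loops_def)
    show "case x of (p, q) \<Rightarrow> \<forall>c\<in>ops i 1. \<forall>d\<in>ops j 1. h i j ((p, q), (c, d)) = base Z v i j"
      if "x \<in> cells (bd_A 1 1) i j" for i j x
      using bd[of "fst x" "snd x" i j] that by (cases x) simp
    fix i j p q c d assume o: "p \<in> ops i 1" "q \<in> ops j 1" "c \<in> ops i 1" "d \<in> ops j 1"
    note fp = add_ops_facts[OF o(1,3)] and fq = add_ops_facts[OF o(2,4)]
    show "0 \<notin> set c \<or> 0 \<notin> set d \<longrightarrow> h i j ((p, q), (c, d)) = act Z 1 1 p q a"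
    proof
      assume 0: "0 \<notin> set c \<or> 0 \<notin> set d"
      show "h i j ((p, q), (c, d)) = act Z 1 1 p q a"
      proof (rule zero[OF o])
        show "0 \<notin> set (add_ops p c) \<or> 0 \<notin> set (add_ops q d)" using 0 fp(5) fq(5) by blast
        have "0 \<notin> set p" if "0 \<notin> set c" "(0, 1) \<notin> set (zip p c)"
          using fp(1)[OF that(2)] fp(5) that(1) map_min_no0[of "add_ops p c"] by simp
        moreover have "0 \<notin> set q" if "0 \<notin> set d" "(0, 1) \<notin> set (zip q d)"
          using fq(1)[OF that(2)] fq(5) that(1) map_min_no0[of "add_ops q d"] by simp
        ultimately show "\<not> ((0, 1) \<notin> set (zip p c) \<and> (0, 1) \<notin> set (zip q d)) \<or> (0 \<notin> set p \<or> 0 \<notin> set q)"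
          using 0 by blast
      qed
    qed
    show "1 \<notin> set c \<and> 1 \<notin> set d \<longrightarrow> h i j ((p, q), (c, d)) = act Z 1 1 p q b"
      using V1[of p c q d i j] fp(8) fq(8) by blast
  qed
qed

lemma homotopy_rel_aeppli:
  assumes "kan Z" "v \<in> cells Z 0 0"
  shows "(a, b) \<in> homotopy_rel Z v 1 1 (bd_A 1 1) \<longleftrightarrow> aeppli_tri Z v a (base Z v 1 1) b"
  using aeppli_tri_of_homotopy[OF assms] homotopy_of_aeppli_tri[OF assms] by blast

section \<open>Aeppli fillers as 2-simplices\<close>

lemma aeppli_triI:
  assumes Z: "bisimplicial_set Z" and v: "v \<in> cells Z 0 0" and z: "collapsed Z 2 z"
    and f: "dface Z 2 0 z \<in> aeppli_loops Z v" "dface Z 2 2 z \<in> aeppli_loops Z v"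
  shows "aeppli_tri Z v (dface Z 2 0 z) (dface Z 2 2 z) (dface Z 2 1 z)"
proof -
  have "act Z 2 2 [0] [0] z = v" "act Z 2 2 [2] [2] z = v"
    using vertex_dface[OF Z z, of 2 0] vertex_dface[OF Z z, of 0 1] f
      aeppli_loop_vertices[OF Z v] coface_2 by simp_all
  then have "dface Z 2 1 z \<in> aeppli_loops Z v"
    using vertex_dface[OF Z z, of 1 0] vertex_dface[OF Z z, of 1 1] coface_2
    by (intro aeppli_loopI[OF Z v collapsed_dface(1)[OF Z z]]) simp_all
  then show ?thesis using f z unfolding aeppli_tri_def by blast
qed

lemma face1_face2:
  assumes Z: "bisimplicial_set Z" and z: "z \<in> cells Z (Suc m) (Suc n)" and ij: "i \<le> Suc m" "j \<le> Suc n"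
  shows "face1 Z (Suc m) n i (face2 Z (Suc m) (Suc n) j z) = act Z (Suc m) (Suc n) (coface (Suc m) i) (coface (Suc n) j) z"
  unfolding face1_def face2_def
  using act_act[OF Z z id_op_ops coface_ops[OF ij(2)] coface_ops[OF ij(1)] id_op_ops]
  by (simp add: id_pick[OF coface_ops[OF ij(1)]] pick_id[OF length_coface[OF ij(2)]])

lemma codegen_1: "codegen 1 0 = [0, 0, 1]"
  by (simp add: codegen_def upt_rec)

text \<open>The two equations for the faces opposite to 0 say together that on a cell with a list
  avoiding 0 the value is that of \<open>a\<close> at the predecessors of both lists. This gives the
  collapse at 1, and the one at 2 because \<open>a\<close> is collapsed at 1. Conversely,
  \<open>tri_outer\<close> recovers the two equations.\<close>

lemma is_A_filler_iff:
  assumes Z: "bisimplicial_set Z" and v: "v \<in> cells Z 0 0" and a: "a \<in> aeppli_loops Z v"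
  shows "is_A_filler Z a b z \<longleftrightarrow> collapsed Z 2 z \<and> dface Z 2 0 z = a \<and> dface Z 2 2 z = b"
proof -
  have ac: "a \<in> cells Z 1 1" using a by (rule aeppli_loops_cells)
  have o: "[0, 1] \<in> ops 1 1" "[0, 0, 1] \<in> ops 2 1" "[0, 1, 2] \<in> ops 2 2" "[1, 2] \<in> ops 1 2" by (auto simp: ops_def)
  have ids: "id_op 2 = [0, 1, 2]" "id_op 1 = [0, 1]" by (simp_all add: id_op_def upt_rec)
  have last: "face1 Z 2 1 2 (face2 Z 2 2 2 z) = dface Z 2 2 z" if "z \<in> cells Z 2 2"
    using face1_face2[OF Z, of z 1 1 2 2, unfolded Suc_1] that by (simp add: dface_def)
  have pred: "pick (id_op 1) (map (\<lambda>x. x - 1) \<sigma>) = map (\<lambda>x. x - 1) \<sigma>" "pick [0, 0, 1] \<sigma> = map (\<lambda>x. x - 1) \<sigma>"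
      "map (\<lambda>x. x - 1) \<sigma> \<in> ops i 1"
    if "\<sigma> \<in> ops i 2" for \<sigma> i
  proof -
    show m: "map (\<lambda>x. x - 1) \<sigma> \<in> ops i 1" using that by (auto elim!: map_mono_ops)
    show "pick (id_op 1) (map (\<lambda>x. x - 1) \<sigma>) = map (\<lambda>x. x - 1) \<sigma>" by (rule id_pick[OF m])
    have "[0, 0, 1] ! x = x - 1" if "x \<le> 2" for x :: nat
    proof -
      have "x = 0 \<or> x = 1 \<or> x = 2" using that by auto
      then show ?thesis by auto
    qed
    then show "pick [0, 0, 1] \<sigma> = map (\<lambda>x. x - 1) \<sigma>" using that by (auto simp: pick_def ops_def)
  qed
  show ?thesis
  proof
    assume A: "is_A_filler Z a b z"
    then have zc: "z \<in> cells Z 2 2"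
      and f1: "act Z 2 2 (coface 2 0) (id_op 2) z = act Z 1 1 (id_op 1) [0, 0, 1] a"
      and f2: "act Z 2 2 (id_op 2) (coface 2 0) z = act Z 1 1 [0, 0, 1] (id_op 1) a"
      and f3: "dface Z 2 2 z = b"
      using last by (auto simp: is_A_filler_def face1_def face2_def degen1_def degen2_def codegen_1[simplified])
    have out: "act Z 2 2 \<sigma> \<tau> z = act Z 1 1 (map (\<lambda>x. x - 1) \<sigma>) (map (\<lambda>x. x - 1) \<tau>) a"
      if st: "\<sigma> \<in> ops i 2" "\<tau> \<in> ops j 2" and n: "0 \<notin> set \<sigma> \<or> 0 \<notin> set \<tau>" for \<sigma> \<tau> i j
      using n
    proof
      assume n: "0 \<notin> set \<sigma>"
      have "pick (coface (Suc 1) 0) (map (squash 0) \<sigma>) = \<sigma>"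
        by (rule coface_squash) (use st n in \<open>auto simp: ops_def\<close>)
      then have "pick (coface 2 0) (map (\<lambda>x. x - 1) \<sigma>) = \<sigma>" by (simp only: squash_0 Suc_1)
      then have "act Z 2 2 \<sigma> \<tau> z = act Z 1 2 (map (\<lambda>x. x - 1) \<sigma>) \<tau> (act Z 2 2 (coface 2 0) (id_op 2) z)"
        using act_act[OF Z zc coface_ops2 id_op_ops pred(3)[OF st(1)] st(2), of 0] id_pick[OF st(2)] by simp
      also have "\<dots> = act Z 1 1 (pick (id_op 1) (map (\<lambda>x. x - 1) \<sigma>)) (pick [0, 0, 1] \<tau>) a"
        unfolding f1 by (rule act_act[OF Z ac id_op_ops o(2) pred(3)[OF st(1)] st(2)])
      finally show ?thesis unfolding pred(1)[OF st(1)] pred(2)[OF st(2)] .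
    next
      assume n: "0 \<notin> set \<tau>"
      have "pick (coface (Suc 1) 0) (map (squash 0) \<tau>) = \<tau>"
        by (rule coface_squash) (use st n in \<open>auto simp: ops_def\<close>)
      then have "pick (coface 2 0) (map (\<lambda>x. x - 1) \<tau>) = \<tau>" by (simp only: squash_0 Suc_1)
      then have "act Z 2 2 \<sigma> \<tau> z = act Z 2 1 \<sigma> (map (\<lambda>x. x - 1) \<tau>) (act Z 2 2 (id_op 2) (coface 2 0) z)"
        using act_act[OF Z zc id_op_ops coface_ops2 st(1) pred(3)[OF st(2)], of 0] id_pick[OF st(1)] by simp
      also have "\<dots> = act Z 1 1 (pick [0, 0, 1] \<sigma>) (pick (id_op 1) (map (\<lambda>x. x - 1) \<tau>)) a"
        unfolding f2 by (rule act_act[OF Z ac o(2) id_op_ops st(1) pred(3)[OF st(2)]])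
      finally show ?thesis unfolding pred(1)[OF st(2)] pred(2)[OF st(1)] .
    qed
    have "collapsed Z 2 z"
      unfolding collapsed_def
    proof (intro conjI zc allI ballI impI)
      fix i j s \<sigma> \<tau> assume *: "\<sigma> \<in> ops i 2" "\<tau> \<in> ops j 2" "s \<le> 2" "set \<sigma> \<subseteq> {s..} \<or> set \<tau> \<subseteq> {s..}"
      show "act Z 2 2 \<sigma> \<tau> z = act Z 2 2 (map (max s) \<sigma>) (map (max s) \<tau>) z"
      proof (cases "s = 0")
        case True
        have "map (max s) \<rho> = \<rho>" for \<rho> :: "nat list" using True by (auto intro: map_idI)
        then show ?thesis by simp
      next
        case False
        have n: "0 \<notin> set \<sigma> \<or> 0 \<notin> set \<tau>" using *(4) False by auto
        have n': "0 \<notin> set (map (max s) \<sigma>) \<or> 0 \<notin> set (map (max s) \<tau>)" using False by auto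
        note e = out[OF *(1,2) n] out[OF max_ops[OF *(1,3)] max_ops[OF *(2,3)] n']
        have p: "map (\<lambda>x. x - 1) (map (max s) \<rho>) = map (max (s - 1)) (map (\<lambda>x. x - 1) \<rho>)" for \<rho> :: "nat list"
          by (auto simp: max_def)
        have s1: "s - 1 \<le> 1" using *(3) by simp
        have sub: "set (map (\<lambda>x. x - 1) \<rho>) \<subseteq> {s - 1..}" if "set \<rho> \<subseteq> {s..}" for \<rho> :: "nat list"
          using that by (auto simp: subset_iff intro: diff_le_mono)
        show ?thesis
          unfolding e p
          by (rule collapsedD[OF aeppli_loop_collapsed[OF a] pred(3)[OF *(1)] pred(3)[OF *(2)] s1])
            (use *(4) sub[of \<sigma>] sub[of \<tau>] in blast)
      qed
    qed
    moreover have "dface Z 2 0 z = a"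
      using out[OF coface_ops2 coface_ops2, of 0 0] act_id[OF Z ac] by (simp add: dface_def coface_2 ids[simplified])
    ultimately show "collapsed Z 2 z \<and> dface Z 2 0 z = a \<and> dface Z 2 2 z = b" using f3 by simp
  next
    assume A: "collapsed Z 2 z \<and> dface Z 2 0 z = a \<and> dface Z 2 2 z = b"
    then have z: "collapsed Z 2 z" and f0: "dface Z 2 0 z = a" and f2: "dface Z 2 2 z = b" by auto
    have zc: "z \<in> cells Z 2 2" using z by (rule collapsed_cells)
    have p1: "map (\<lambda>x. x - 1) (coface 2 0) = [0, 1]" "map (\<lambda>x. x - 1) (id_op 2) = [0, 0, 1]" by (simp_all add: coface_2 ids)
    have "act Z 2 2 (coface 2 0) (id_op 2) z = act Z 1 1 [0, 1] [0, 0, 1] a"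
      using tri_outer[OF Z z coface_ops2 id_op_ops, of 0] f0 unfolding p1 by (simp add: coface_2)
    moreover have "act Z 2 2 (id_op 2) (coface 2 0) z = act Z 1 1 [0, 0, 1] [0, 1] a"
      using tri_outer[OF Z z id_op_ops coface_ops2, of 0] f0 unfolding p1 by (simp add: coface_2)
    ultimately show "is_A_filler Z a b z"
      using zc last[OF zc] f2
      by (simp add: is_A_filler_def face1_def face2_def degen1_def degen2_def codegen_1[simplified] ids[simplified])
  qed
qed

text \<open>All representatives and all fillers give triangles whose first two edges are equivalent
  to \<open>a\<close> and \<open>b\<close>. By \<open>tri_cong\<close> their third edges are
  equivalent, so the definite description is satisfied by one class only.\<close>

lemma A_mult_eq:
  assumes Z: "kan Z" and v: "v \<in> cells Z 0 0"
    and P: "P \<in> aeppli_loops Z v // homotopy_rel Z v 1 1 (bd_A 1 1)"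
    and Q: "Q \<in> aeppli_loops Z v // homotopy_rel Z v 1 1 (bd_A 1 1)"
    and ab: "a \<in> P" "b \<in> Q" and tri: "aeppli_tri Z v a b c"
  shows "A_mult Z v P Q = homotopy_rel Z v 1 1 (bd_A 1 1) `` {c}"
proof -
  interpret triangles "aeppli_loops Z v" "base Z v 1 1" "aeppli_tri Z v" by (rule triangles_aeppli[OF Z v])
  have bZ: "bisimplicial_set Z" using Z by (rule kan_bisimplicial)
  have r: "homotopy_rel Z v 1 1 (bd_A 1 1) = rel"
    unfolding rel_def using homotopy_rel_aeppli[OF Z v] by auto
  have sub: "aeppli_tri Z v a1 (base Z v 1 1) a2" if "P \<in> aeppli_loops Z v // rel" "a1 \<in> P" "a2 \<in> P" for P a1 a2
    using quotient_eq_iff[OF equiv_rel that(1) that(1) that(2,3)] unfolding rel_def by simp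
  have inL: "x \<in> aeppli_loops Z v" if "P \<in> aeppli_loops Z v // rel" "x \<in> P" for P x
    using in_quotient_imp_subset[OF equiv_rel that(1)] that(2) by blast
  have cls: "class_A Z v 1 1 x = rel `` {x}" for x unfolding class_A_def r ..
  have d1: "face1 Z 2 1 1 (face2 Z 2 2 1 z) = dface Z 2 1 z" if "collapsed Z 2 z" for z
    using face1_face2[OF bZ, of z 1 1 1 1, unfolded Suc_1] collapsed_cells[OF that] by (simp add: dface_def)
  show ?thesis
    unfolding A_mult_def r
  proof (rule the_equality)
    obtain z where z: "collapsed Z 2 z" "dface Z 2 0 z = a" "dface Z 2 2 z = b" "dface Z 2 1 z = c"
      using tri by (auto simp: aeppli_tri_def)
    have "is_A_filler Z a b z" using is_A_filler_iff[OF bZ v] z tri_in[OF tri] by blast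
    moreover have "rel `` {c} = class_A Z v 1 1 (face1 Z 2 1 1 (face2 Z 2 2 1 z))"
      unfolding cls d1[OF z(1)] z(4) ..
    ultimately show "\<exists>\<alpha>\<in>P. \<exists>\<beta>\<in>Q. \<exists>\<theta>. is_A_filler Z \<alpha> \<beta> \<theta> \<and> rel `` {c} = class_A Z v 1 1 (face1 Z 2 1 1 (face2 Z 2 2 1 \<theta>))"
      using ab by blast
  next
    fix C assume "\<exists>\<alpha>\<in>P. \<exists>\<beta>\<in>Q. \<exists>\<theta>. is_A_filler Z \<alpha> \<beta> \<theta> \<and> C = class_A Z v 1 1 (face1 Z 2 1 1 (face2 Z 2 2 1 \<theta>))"
    then obtain \<alpha> \<beta> \<theta> where *: "\<alpha> \<in> P" "\<beta> \<in> Q" "is_A_filler Z \<alpha> \<beta> \<theta>"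
      and C: "C = class_A Z v 1 1 (face1 Z 2 1 1 (face2 Z 2 2 1 \<theta>))" by blast
    have L: "\<alpha> \<in> aeppli_loops Z v" "\<beta> \<in> aeppli_loops Z v" using inL P Q * unfolding r by blast+
    have th: "collapsed Z 2 \<theta>" "dface Z 2 0 \<theta> = \<alpha>" "dface Z 2 2 \<theta> = \<beta>"
      using is_A_filler_iff[OF bZ v L(1)] *(3) by blast+
    have "aeppli_tri Z v \<alpha> \<beta> (dface Z 2 1 \<theta>)" using aeppli_triI[OF bZ v th(1)] th L by simp
    then have "rel `` {dface Z 2 1 \<theta>} = rel `` {c}"
      using tri_cong[OF _ _ _ tri] sub[OF P[unfolded r] *(1) ab(1)] sub[OF Q[unfolded r] *(2) ab(2)] by blast
    then show "C = rel `` {c}" unfolding C cls d1[OF th(1)] .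
  qed
qed

section \<open>Exchanging the two directions of a loop\<close>

definition subcomplex :: "bistd_cell bisset \<Rightarrow> nat \<Rightarrow> nat \<Rightarrow> bool" where
  "subcomplex L m n \<longleftrightarrow> (\<forall>i j. cells L i j \<subseteq> cells (bistd m n) i j) \<and>
     (\<forall>i j i' j' \<theta> \<phi> a b. (a, b) \<in> cells L i j \<longrightarrow> \<theta> \<in> ops i' i \<longrightarrow> \<phi> \<in> ops j' j \<longrightarrow>
        (pick a \<theta>, pick b \<phi>) \<in> cells L i' j')"

lemma subcomplex_sub: "subcomplex L m n \<Longrightarrow> cells L i j \<subseteq> cells (bistd m n) i j"
  unfolding subcomplex_def by (elim conjE allE)

lemma subcomplex_pick:
  assumes "subcomplex L m n" "(a, b) \<in> cells L i j" "\<theta> \<in> ops i' i" "\<phi> \<in> ops j' j"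
  shows "(pick a \<theta>, pick b \<phi>) \<in> cells L i' j'"
  by (rule conjunct2[OF assms(1)[unfolded subcomplex_def], rule_format, OF assms(2-4)])

lemma subcomplex_bd_BC: "subcomplex (bd_BC m n) m n"
  unfolding subcomplex_def
proof (intro conjI allI impI)
  show "cells (bd_BC m n) i j \<subseteq> cells (bistd m n) i j" for i j by (auto simp: cells_bd_BC)
  fix i j i' j' \<theta> \<phi> a b assume ab: "(a, b) \<in> cells (bd_BC m n) i j" and op: "\<theta> \<in> ops i' i" "\<phi> \<in> ops j' j"
  then have o: "a \<in> ops i m" "b \<in> ops j n" by (auto simp: cells_bd_BC)
  show "(pick a \<theta>, pick b \<phi>) \<in> cells (bd_BC m n) i' j'"
    using ab pick_ops[OF o(1) op(1)] pick_ops[OF o(2) op(2)] set_pick_ops[OF o(1) op(1)] set_pick_ops[OF o(2) op(2)]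
    by (auto simp: cells_bd_BC)
qed

lemma subcomplex_bd_A: "subcomplex (bd_A 1 1) 1 1"
  unfolding subcomplex_def
proof (intro conjI allI impI bd_A_sub)
  fix i j i' j' \<theta> \<phi> a b assume ab: "(a, b) \<in> cells (bd_A 1 1) i j" and op: "\<theta> \<in> ops i' i" "\<phi> \<in> ops j' j"
  then have o: "a \<in> ops i 1" "b \<in> ops j 1" unfolding cells_bd_A_iff by auto
  show "(pick a \<theta>, pick b \<phi>) \<in> cells (bd_A 1 1) i' j'"
    using ab pick_ops[OF o(1) op(1)] pick_ops[OF o(2) op(2)] set_pick_ops[OF o(1) op(1)] set_pick_ops[OF o(2) op(2)]
    unfolding cells_bd_A_iff by blast
qed

text \<open>In this form the pairs \<open>(K, L0)\<close> and \<open>(bistd m n, L1)\<close> play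
  symmetric roles, which makes the exchange of the two variables possible.\<close>

lemma rel_cells_rel_Hom:
  assumes L: "subcomplex L1 m n"
  shows "f \<in> rel_cells (rel_Hom K L0 X v) (Hom_pt K X v) m n L1 \<longleftrightarrow> is_bimap (bprod K (bistd m n)) X f \<and>
    (\<forall>i j. \<forall>x \<in> cells L0 i j. \<forall>y \<in> cells (bistd m n) i j. f i j (x, y) = base X v i j) \<and>
    (\<forall>i j. \<forall>x \<in> cells K i j. \<forall>y \<in> cells L1 i j. f i j (x, y) = base X v i j)"
  using trivial_cell_map_rel_Hom[where M = L1 and p = m and q = n, OF _ subcomplex_sub[OF L] subcomplex_pick[OF L], of f K L0 X v]
  by (auto simp: rel_cells_def cells_rel_Hom)

lemma flip_map_apply:
  "x \<in> cells K i j \<Longrightarrow> y \<in> cells L i j \<Longrightarrow> flip_map K L f i j (y, x) = f i j (x, y)"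
  by (simp add: flip_map_def)

lemma flip_map_bimap:
  assumes K: "bisimplicial_set K" and L: "bisimplicial_set L" and f: "is_bimap (bprod K L) X f"
  shows "is_bimap (bprod L K) X (flip_map K L f)"
  unfolding is_bimap_def
proof (intro conjI allI ballI)
  fix i j
  show "flip_map K L f i j \<in> cells (bprod L K) i j \<rightarrow>\<^sub>E cells X i j"
    unfolding flip_map_def restrict_PiE_iff using is_bimapD(1)[OF f] by auto
next
  fix i j i' j' \<theta> \<phi> w assume op: "\<theta> \<in> ops i' i" "\<phi> \<in> ops j' j" and "w \<in> cells (bprod L K) i j"
  then obtain y x where w: "w = (y, x)" "y \<in> cells L i j" "x \<in> cells K i j" by auto
  show "flip_map K L f i' j' (act (bprod L K) i j \<theta> \<phi> w) = act X i j \<theta> \<phi> (flip_map K L f i j w)"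
    using is_bimapD(2)[OF f, of "(x, y)" i j, OF _ op] w act_cells[OF K w(3) op] act_cells[OF L w(2) op]
    by (simp add: act_bprod flip_map_apply)
qed

lemma flip_map_flip:
  assumes K: "bisimplicial_set K" and L: "bisimplicial_set L" and f: "is_bimap (bprod K L) X f"
  shows "flip_map L K (flip_map K L f) = f"
proof (rule bimap_eqI[OF flip_map_bimap[OF L K flip_map_bimap[OF K L f]] f])
  fix i j w assume "w \<in> cells (bprod K L) i j"
  then show "flip_map L K (flip_map K L f) i j w = f i j w" by (auto simp: flip_map_apply)
qed

lemma flip_rel_cells:
  assumes L0: "subcomplex L0 p q" and L1: "subcomplex L1 m n"
    and f: "f \<in> rel_cells (rel_Hom (bistd p q) L0 X v) (Hom_pt (bistd p q) X v) m n L1"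
  shows "flip_map (bistd p q) (bistd m n) f \<in> rel_cells (rel_Hom (bistd m n) L1 X v) (Hom_pt (bistd m n) X v) p q L0"
    and "flip_map (bistd m n) (bistd p q) (flip_map (bistd p q) (bistd m n) f) = f"
proof -
  let ?K = "bistd p q" and ?L = "bistd m n"
  have b: "is_bimap (bprod ?K ?L) X f"
    and f0: "\<And>i j x y. x \<in> cells L0 i j \<Longrightarrow> y \<in> cells ?L i j \<Longrightarrow> f i j (x, y) = base X v i j"
    and f1: "\<And>i j x y. x \<in> cells ?K i j \<Longrightarrow> y \<in> cells L1 i j \<Longrightarrow> f i j (x, y) = base X v i j"
    using f unfolding rel_cells_rel_Hom[OF L1] by blast+
  show "flip_map ?K ?L f \<in> rel_cells (rel_Hom ?L L1 X v) (Hom_pt ?L X v) p q L0"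
    unfolding rel_cells_rel_Hom[OF L0]
  proof (intro conjI allI ballI flip_map_bimap[OF bisimplicial_bistd bisimplicial_bistd b])
    fix i j y x
    show "flip_map ?K ?L f i j (y, x) = base X v i j" if y: "y \<in> cells L1 i j" and x: "x \<in> cells ?K i j"
      using flip_map_apply[OF x subsetD[OF subcomplex_sub[OF L1] y], of f] f1[OF x y] by simp
    show "flip_map ?K ?L f i j (y, x) = base X v i j" if y: "y \<in> cells ?L i j" and x: "x \<in> cells L0 i j"
      using flip_map_apply[OF subsetD[OF subcomplex_sub[OF L0] x] y, of f] f0[OF x y] by simp
  qed
  show "flip_map ?L ?K (flip_map ?K ?L f) = f" by (rule flip_map_flip[OF bisimplicial_bistd bisimplicial_bistd b])
qed

text \<open>A cell of a function complex is determined by its values at the top simplices, which the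
  identity operators name; the exponential law follows.\<close>

definition uncurry_map ::
    "('m, ('k \<times> bistd_cell, 'a) bimap) bimap \<Rightarrow> ('k \<times> 'm, 'a) bimap" where
  "uncurry_map h = (\<lambda>i j (s, y). h i j y i j (s, (id_op i, id_op j)))"

lemma uncurry_rel_Hom:
  assumes K: "bisimplicial_set K" and h: "nat_on M (rel_Hom K L X v) h" and H_def: "H = uncurry_map h"
  shows "nat_on (bprod K M) X H"
    and "s \<in> cells L i j \<Longrightarrow> y \<in> cells M i j \<Longrightarrow> H i j (s, y) = base X v i j"
    and "y \<in> cells M i j \<Longrightarrow> s \<in> cells K i' j' \<Longrightarrow> c \<in> ops i' i \<Longrightarrow> d \<in> ops j' j \<Longrightarrow>
      h i j y i' j' (s, (c, d)) = H i' j' (s, act M i j c d y)"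
proof -
  have b: "is_bimap (bprod K (bistd i j)) X (h i j y)"
    and hb: "\<And>i' j' s t. s \<in> cells L i' j' \<Longrightarrow> t \<in> cells (bistd i j) i' j' \<Longrightarrow> h i j y i' j' (s, t) = base X v i' j'"
    if "y \<in> cells M i j" for y i j
    using nat_onD(1)[OF h that] unfolding cells_rel_Hom by blast+
  have u3: "h i j y i' j' (s, (c, d)) = H i' j' (s, act M i j c d y)"
    if "y \<in> cells M i j" "s \<in> cells K i' j'" "c \<in> ops i' i" "d \<in> ops j' j" for y i j s i' j' c d
    using nat_onD(2)[OF h that(1,3,4)] act_rel_Hom_apply[OF that(3,4,2) id_op_ops id_op_ops, of X "h i j y"]
    by (simp add: H_def uncurry_map_def act_rel_Hom pick_id opsD(1)[OF that(3)] opsD(1)[OF that(4)])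
  show "h i j y i' j' (s, (c, d)) = H i' j' (s, act M i j c d y)"
    if "y \<in> cells M i j" "s \<in> cells K i' j'" "c \<in> ops i' i" "d \<in> ops j' j" by (rule u3[OF that])
  show "H i j (s, y) = base X v i j" if "s \<in> cells L i j" "y \<in> cells M i j"
    using hb[OF that(2,1)] by (simp add: H_def uncurry_map_def id_op_ops)
  show "nat_on (bprod K M) X H"
  proof (rule nat_onI)
    fix i j w assume "w \<in> cells (bprod K M) i j"
    then obtain s y where w: "w = (s, y)" "s \<in> cells K i j" "y \<in> cells M i j" by auto
    show "H i j w \<in> cells X i j"
      using is_bimapD(1)[OF b[OF w(3)], of "(s, (id_op i, id_op j))" i j] w by (simp add: H_def uncurry_map_def id_op_ops)
  next
    fix i j i' j' \<theta> \<phi> w assume op: "\<theta> \<in> ops i' i" "\<phi> \<in> ops j' j" and "w \<in> cells (bprod K M) i j"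
    then obtain s y where w: "w = (s, y)" "s \<in> cells K i j" "y \<in> cells M i j" by auto
    have "H i' j' (act (bprod K M) i j \<theta> \<phi> w) = h i j y i' j' (act K i j \<theta> \<phi> s, (\<theta>, \<phi>))"
      using u3[OF w(3) act_cells[OF K w(2) op] op] by (simp add: w act_bprod)
    also have "\<dots> = act X i j \<theta> \<phi> (h i j y i j (s, (id_op i, id_op j)))"
      using is_bimapD(2)[OF b[OF w(3)], of "(s, (id_op i, id_op j))" i j, OF _ op] w
      by (simp add: act_bprod act_bistd id_op_ops id_pick[OF op(1)] id_pick[OF op(2)])
    finally show "H i' j' (act (bprod K M) i j \<theta> \<phi> w) = act X i j \<theta> \<phi> (H i j w)" by (simp add: H_def uncurry_map_def w)
  qed
qed

lemma curry_rel_Hom: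
  assumes K: "bisimplicial_set K" and M: "bisimplicial_set M" and L: "\<And>i j. cells L i j \<subseteq> cells K i j"
    and H: "nat_on (bprod K M) X H"
    and b: "\<And>i j s y. s \<in> cells L i j \<Longrightarrow> y \<in> cells M i j \<Longrightarrow> H i j (s, y) = base X v i j"
  shows "nat_on M (rel_Hom K L X v)
    (\<lambda>i j y i' j'. \<lambda>(s, (c, d)) \<in> cells (bprod K (bistd i j)) i' j'. H i' j' (s, act M i j c d y))" (is "nat_on M ?A ?h")
proof -
  have app: "?h i j y i' j' (s, (c, d)) = H i' j' (s, act M i j c d y)"
    if "s \<in> cells K i' j'" "c \<in> ops i' i" "d \<in> ops j' j" for i j y i' j' s c d
    using that by simp
  have bm: "is_bimap (bprod K (bistd i j)) X (?h i j y)" if y: "y \<in> cells M i j" for i j y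
    unfolding is_bimap_def
  proof (intro conjI allI ballI)
    fix i' j'
    show "?h i j y i' j' \<in> cells (bprod K (bistd i j)) i' j' \<rightarrow>\<^sub>E cells X i' j'"
      unfolding restrict_PiE_iff using nat_onD(1)[OF H] act_cells[OF M y] by auto
  next
    fix p q p' q' \<theta> \<phi> w assume op: "\<theta> \<in> ops p' p" "\<phi> \<in> ops q' q" and "w \<in> cells (bprod K (bistd i j)) p q"
    then obtain s c d where w: "w = (s, (c, d))" and o: "s \<in> cells K p q" "c \<in> ops p i" "d \<in> ops q j" by auto
    show "?h i j y p' q' (act (bprod K (bistd i j)) p q \<theta> \<phi> w) = act X p q \<theta> \<phi> (?h i j y p q w)"
      using nat_onD(2)[OF H, of "(s, act M i j c d y)" p q, OF _ op] act_cells[OF M y o(2,3)] o act_cells[OF K o(1) op]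
        pick_ops[OF o(2) op(1)] pick_ops[OF o(3) op(2)] act_act[OF M y o(2,3) op]
      by (simp add: w act_bprod act_bistd)
  qed
  show ?thesis
  proof (rule nat_onI)
    fix i j y assume y: "y \<in> cells M i j"
    show "?h i j y \<in> cells ?A i j"
      unfolding cells_rel_Hom
    proof (intro conjI bm[OF y] allI ballI)
      fix i' j' s t assume s: "s \<in> cells L i' j'" and "t \<in> cells (bistd i j) i' j'"
      then obtain c d where t: "t = (c, d)" "c \<in> ops i' i" "d \<in> ops j' j" by auto
      show "?h i j y i' j' (s, t) = base X v i' j'"
        unfolding t(1) app[OF subsetD[OF L s] t(2,3)] by (rule b[OF s act_cells[OF M y t(2,3)]])
    qed
  next
    fix i j k l \<theta> \<phi> y assume op: "\<theta> \<in> ops k i" "\<phi> \<in> ops l j" and y: "y \<in> cells M i j"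
    show "?h k l (act M i j \<theta> \<phi> y) = act ?A i j \<theta> \<phi> (?h i j y)"
      unfolding act_rel_Hom
    proof (rule bimap_eqI[OF bm[OF act_cells[OF M y op]] act_rel_Hom_bimap[OF K bm[OF y] op]])
      fix i' j' w assume "w \<in> cells (bprod K (bistd k l)) i' j'"
      then obtain s c d where w: "w = (s, (c, d))" and o: "s \<in> cells K i' j'" "c \<in> ops i' k" "d \<in> ops j' l" by auto
      show "?h k l (act M i j \<theta> \<phi> y) i' j' w = act (Hom K X) i j \<theta> \<phi> (?h i j y) i' j' w"
        unfolding w act_rel_Hom_apply[OF op o] app[OF o] app[OF o(1) pick_ops[OF op(1) o(2)] pick_ops[OF op(2) o(3)]]
        using act_act[OF M y op o(2,3)] by simp
    qed
  qed
qed

text \<open>A homotopy between maps from \<open>bistd m n\<close> into a function complex on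
  \<open>bistd p q\<close> is a single map on the product of both with Delta[1,1]. Read with the
  first two factors exchanged, it is a homotopy between the flipped maps, and the two conditions of
  being relative change places.\<close>

lemma flip_homotopy_rel:
  assumes L0: "subcomplex L0 p q" and L1: "subcomplex L1 m n"
    and fg: "(f, g) \<in> homotopy_rel (rel_Hom (bistd p q) L0 X v) (Hom_pt (bistd p q) X v) m n L1"
  shows "(flip_map (bistd p q) (bistd m n) f, flip_map (bistd p q) (bistd m n) g) \<in>
    homotopy_rel (rel_Hom (bistd m n) L1 X v) (Hom_pt (bistd m n) X v) p q L0"
proof -
  let ?K = "bistd p q" and ?L = "bistd m n" and ?I = "bistd 1 1"
  let ?A = "rel_Hom ?K L0 X v" and ?B = "rel_Hom ?L L1 X v"
  note bs = bisimplicial_bistd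
  from fg[unfolded homotopy_rel_iff[OF subcomplex_sub[OF L1]]] obtain h where
    f: "f \<in> rel_cells ?A (Hom_pt ?K X v) m n L1" and g: "g \<in> rel_cells ?A (Hom_pt ?K X v) m n L1" and
    h: "nat_on (bprod ?L ?I) ?A h" and
    t: "\<forall>i j. \<forall>(a, b) \<in> cells L1 i j. \<forall>c \<in> ops i 1. \<forall>d \<in> ops j 1. h i j ((a, b), (c, d)) = base ?A (Hom_pt ?K X v) i j" and
    e: "\<forall>i j. \<forall>a \<in> ops i m. \<forall>b \<in> ops j n. \<forall>c \<in> ops i 1. \<forall>d \<in> ops j 1.
         (0 \<notin> set c \<or> 0 \<notin> set d \<longrightarrow> h i j ((a, b), (c, d)) = act ?A m n a b f) \<and>
         (1 \<notin> set c \<and> 1 \<notin> set d \<longrightarrow> h i j ((a, b), (c, d)) = act ?A m n a b g)"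
    by (elim conjE exE)
  define H where "H = uncurry_map h"
  note H = uncurry_rel_Hom[OF bs h H_def]
  have Hf: "H i j (s, ((a, b), (c, d))) = k i j (s, (a, b))"
    if "s \<in> cells ?K i j" "a \<in> ops i m" "b \<in> ops j n" "h i j ((a, b), (c, d)) = act ?A m n a b k" for i j s a b c d k
    using that act_rel_Hom_apply[OF that(2,3,1) id_op_ops id_op_ops, of X k]
    by (simp add: H_def uncurry_map_def act_rel_Hom pick_id opsD(1)[OF that(2)] opsD(1)[OF that(3)])
  have H1: "H i j (s, ((a, b), (c, d))) = base X v i j"
    if "s \<in> cells ?K i j" "(a, b) \<in> cells L1 i j" "c \<in> ops i 1" "d \<in> ops j 1" for i j s a b c d
    using t[THEN spec, THEN spec, THEN bspec, OF that(2)] that(1,3,4)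
    by (simp add: H_def uncurry_map_def base_rel_Hom const_bimap_def id_op_ops)
  \<comment> \<open>\<open>H\<close> is ready for currying in \<open>?K\<close>; after the exchange
    of factors it is ready for currying in \<open>?L\<close>.\<close>
  define H' where "H' = (\<lambda>i j (x, (s, t)). H i j (s, (x, t)))"
  have H': "nat_on (bprod ?L (bprod ?K ?I)) X H'"
  proof (rule nat_onI)
    fix i j w assume "w \<in> cells (bprod ?L (bprod ?K ?I)) i j"
    then obtain x s u where w: "w = (x, (s, u))" "x \<in> cells ?L i j" "s \<in> cells ?K i j" "u \<in> cells ?I i j" by auto
    show "H' i j w \<in> cells X i j" using nat_onD(1)[OF H(1), of "(s, (x, u))" i j] w by (simp add: H'_def)
  next
    fix i j i' j' \<theta> \<phi> w assume op: "\<theta> \<in> ops i' i" "\<phi> \<in> ops j' j" and "w \<in> cells (bprod ?L (bprod ?K ?I)) i j"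
    then obtain x s u where w: "w = (x, (s, u))" "x \<in> cells ?L i j" "s \<in> cells ?K i j" "u \<in> cells ?I i j" by auto
    show "H' i' j' (act (bprod ?L (bprod ?K ?I)) i j \<theta> \<phi> w) = act X i j \<theta> \<phi> (H' i j w)"
      using nat_onD(2)[OF H(1), of "(s, (x, u))" i j, OF _ op] w by (simp add: H'_def act_bprod)
  qed
  have H'b: "H' i j (x, y) = base X v i j" if "x \<in> cells L1 i j" "y \<in> cells (bprod ?K ?I) i j" for i j x y
    using that H1[of "fst y" i j "fst x" "snd x" "fst (snd y)" "snd (snd y)"]
    by (cases x; cases y) (auto simp: H'_def)
  define h' where "h' = (\<lambda>i j y i' j'. \<lambda>(s, (c, d)) \<in> cells (bprod ?L (bistd i j)) i' j'. H' i' j' (s, act (bprod ?K ?I) i j c d y))"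
  have h': "nat_on (bprod ?K ?I) ?B h'"
    unfolding h'_def by (rule curry_rel_Hom[OF bs bisimplicial_bprod[OF bs bs] subcomplex_sub[OF L1] H' H'b])
  have h'b: "is_bimap (bprod ?L (bistd i j)) X (h' i j y)" if "y \<in> cells (bprod ?K ?I) i j" for i j y
    using nat_onD(1)[OF h' that] by (simp add: cells_rel_Hom)
  have app: "h' i j ((a, b), (c, d)) i' j' (x, (\<theta>, \<phi>)) = H i' j' ((pick a \<theta>, pick b \<phi>), (x, (pick c \<theta>, pick d \<phi>)))"
    if "x \<in> cells ?L i' j'" "\<theta> \<in> ops i' i" "\<phi> \<in> ops j' j" for i j a b c d i' j' x \<theta> \<phi>
    using that by (simp add: h'_def H'_def act_bprod act_bistd)
  have flipk: "act ?B p q a b (flip_map ?K ?L k) i' j' (x, (\<theta>, \<phi>)) = k i' j' ((pick a \<theta>, pick b \<phi>), x)"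
    if "x \<in> cells ?L i' j'" "\<theta> \<in> ops i' i" "\<phi> \<in> ops j' j" "a \<in> ops i p" "b \<in> ops j q" for i j a b i' j' x \<theta> \<phi> k
    using act_rel_Hom_apply[OF that(4,5,1-3), of X "flip_map ?K ?L k"] that(1)
      pick_ops[OF that(4,2)] pick_ops[OF that(5,3)]
    by (simp add: act_rel_Hom flip_map_apply)
  \<comment> \<open>Equality of cells of the function complex is tested after all operators, so the
    end condition on \<open>(c, d)\<close> is assumed for all its images under
    \<open>pick\<close>.\<close>
  have end_eq: "h' i j ((a, b), (c, d)) = act ?B p q a b (flip_map ?K ?L k)"
    if o: "a \<in> ops i p" "b \<in> ops j q" "c \<in> ops i 1" "d \<in> ops j 1"
      and k: "k \<in> rel_cells ?A (Hom_pt ?K X v) m n L1"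
      and eq: "\<And>i' j' \<theta> \<phi> x. \<theta> \<in> ops i' i \<Longrightarrow> \<phi> \<in> ops j' j \<Longrightarrow> x \<in> cells ?L i' j' \<Longrightarrow>
         h i' j' (x, (pick c \<theta>, pick d \<phi>)) = act ?A m n (fst x) (snd x) k" for i j a b c d k
  proof -
    have kb: "is_bimap (bprod ?L ?K) X (flip_map ?K ?L k)"
      using k flip_map_bimap[OF bs bs] unfolding rel_cells_rel_Hom[OF L1] by blast
    show ?thesis
      unfolding act_rel_Hom
    proof (rule bimap_eqI[OF h'b act_rel_Hom_bimap[OF bs kb o(1,2)]])
      show "((a, b), (c, d)) \<in> cells (bprod ?K ?I) i j" using o by simp
      fix i' j' w assume "w \<in> cells (bprod ?L (bistd i j)) i' j'"
      then obtain x \<theta> \<phi> where w: "w = (x, (\<theta>, \<phi>))" "x \<in> cells ?L i' j'" "\<theta> \<in> ops i' i" "\<phi> \<in> ops j' j" by auto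
      obtain x1 x2 where x: "x = (x1, x2)" by (cases x)
      have "H i' j' ((pick a \<theta>, pick b \<phi>), (x, (pick c \<theta>, pick d \<phi>))) = k i' j' ((pick a \<theta>, pick b \<phi>), x)"
        unfolding x by (rule Hf) (use w x o pick_ops eq[OF w(3,4,2)] in auto)
      then show "h' i j ((a, b), (c, d)) i' j' w = act (Hom ?L X) p q a b (flip_map ?K ?L k) i' j' w"
        unfolding w(1) app[OF w(2-4)] flipk[OF w(2-4) o(1,2), unfolded act_rel_Hom] .
    qed
  qed
  show ?thesis
    unfolding homotopy_rel_iff[OF subcomplex_sub[OF L0]]
  proof (intro conjI exI[of _ h'] h' allI ballI)
    show "flip_map ?K ?L f \<in> rel_cells ?B (Hom_pt ?L X v) p q L0" by (rule flip_rel_cells(1)[OF L0 L1 f])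
    show "flip_map ?K ?L g \<in> rel_cells ?B (Hom_pt ?L X v) p q L0" by (rule flip_rel_cells(1)[OF L0 L1 g])
    fix i j
    have "h' i j ((a, b), (c, d)) = base ?B (Hom_pt ?L X v) i j"
      if ab: "(a, b) \<in> cells L0 i j" and cd: "c \<in> ops i 1" "d \<in> ops j 1" for a b c d
    proof (intro ext)
      fix i' j' w
      have o: "a \<in> ops i p" "b \<in> ops j q" using subcomplex_sub[OF L0] ab by auto
      show "h' i j ((a, b), (c, d)) i' j' w = base ?B (Hom_pt ?L X v) i j i' j' w"
      proof (cases "w \<in> cells (bprod ?L (bistd i j)) i' j'")
        case True
        then obtain x \<theta> \<phi> where w: "w = (x, (\<theta>, \<phi>))" "x \<in> cells ?L i' j'" "\<theta> \<in> ops i' i" "\<phi> \<in> ops j' j" by auto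
        have "H i' j' ((pick a \<theta>, pick b \<phi>), (x, (pick c \<theta>, pick d \<phi>))) = base X v i' j'"
          by (rule H(2)[OF subcomplex_pick[OF L0 ab w(3,4)]]) (use w(2) pick_ops[OF cd(1) w(3)] pick_ops[OF cd(2) w(4)] in simp)
        then show ?thesis using True unfolding base_rel_Hom const_bimap_def w(1) app[OF w(2-4)] by simp
      next
        case False
        then show ?thesis by (simp add: h'_def base_rel_Hom const_bimap_def del: cells_bprod)
      qed
    qed
    then show "case x of (a, b) \<Rightarrow> \<forall>c\<in>ops i 1. \<forall>d\<in>ops j 1. h' i j ((a, b), c, d) = base ?B (Hom_pt ?L X v) i j"
      if "x \<in> cells L0 i j" for x using that by (cases x) simp
    fix a b c d assume o: "a \<in> ops i p" "b \<in> ops j q" "c \<in> ops i 1" "d \<in> ops j 1"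
    show "0 \<notin> set c \<or> 0 \<notin> set d \<longrightarrow> h' i j ((a, b), (c, d)) = act ?B p q a b (flip_map ?K ?L f)"
    proof
      assume n: "0 \<notin> set c \<or> 0 \<notin> set d"
      show "h' i j ((a, b), (c, d)) = act ?B p q a b (flip_map ?K ?L f)"
      proof (rule end_eq[OF o f])
        fix i' j' \<theta> \<phi> x assume op: "\<theta> \<in> ops i' i" "\<phi> \<in> ops j' j" and x: "x \<in> cells ?L i' j'"
        have "0 \<notin> set (pick c \<theta>) \<or> 0 \<notin> set (pick d \<phi>)"
          using n set_pick_ops[OF o(3) op(1)] set_pick_ops[OF o(4) op(2)] by blast
        then show "h i' j' (x, (pick c \<theta>, pick d \<phi>)) = act ?A m n (fst x) (snd x) f"
          using e[rule_format, OF _ _ pick_ops[OF o(3) op(1)] pick_ops[OF o(4) op(2)], of "fst x" "snd x"] x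
          by (cases x) simp
      qed
    qed
    show "1 \<notin> set c \<and> 1 \<notin> set d \<longrightarrow> h' i j ((a, b), (c, d)) = act ?B p q a b (flip_map ?K ?L g)"
    proof
      assume n: "1 \<notin> set c \<and> 1 \<notin> set d"
      show "h' i j ((a, b), (c, d)) = act ?B p q a b (flip_map ?K ?L g)"
      proof (rule end_eq[OF o g])
        fix i' j' \<theta> \<phi> x assume op: "\<theta> \<in> ops i' i" "\<phi> \<in> ops j' j" and x: "x \<in> cells ?L i' j'"
        have "1 \<notin> set (pick c \<theta>) \<and> 1 \<notin> set (pick d \<phi>)"
          using n set_pick_ops[OF o(3) op(1)] set_pick_ops[OF o(4) op(2)] by blast
        then show "h i' j' (x, (pick c \<theta>, pick d \<phi>)) = act ?A m n (fst x) (snd x) g"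
          using e[rule_format, OF _ _ pick_ops[OF o(3) op(1)] pick_ops[OF o(4) op(2)], of "fst x" "snd x"] x
          by (cases x) simp
      qed
    qed
  qed
qed

section \<open>The group of loops\<close>

text \<open>Triangles are carried along the bijection \<open>F\<close> with inverse
  \<open>G\<close>. For the flip, this moves the composition of loops from \<open>loop_Z\<close> to
  the cells of the loop space.\<close>

lemma triangles_transfer:
  assumes "triangles L e' t" and F: "\<And>a. a \<in> S \<Longrightarrow> F a \<in> L" "\<And>a. a \<in> S \<Longrightarrow> G (F a) = a"
    and G: "\<And>b. b \<in> L \<Longrightarrow> G b \<in> S" "\<And>b. b \<in> L \<Longrightarrow> F (G b) = b" and e: "e \<in> S" "F e = e'"
  shows "triangles S e (\<lambda>a b c. a \<in> S \<and> b \<in> S \<and> c \<in> S \<and> t (F a) (F b) (F c))"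
proof -
  interpret triangles L e' t by fact
  show ?thesis
  proof
    show "e \<in> S" by (rule e(1))
    show "a \<in> S \<and> b \<in> S \<and> c \<in> S" if "a \<in> S \<and> b \<in> S \<and> c \<in> S \<and> t (F a) (F b) (F c)" for a b c
      using that by simp
    show "a \<in> S \<and> e \<in> S \<and> a \<in> S \<and> t (F a) (F e) (F a)" "e \<in> S \<and> a \<in> S \<and> a \<in> S \<and> t (F e) (F a) (F a)"
      if "a \<in> S" for a
      using that e unit_right[OF F(1)[OF that]] unit_left[OF F(1)[OF that]] by simp_all
    show "\<exists>c. a \<in> S \<and> b \<in> S \<and> c \<in> S \<and> t (F a) (F b) (F c)" if ab: "a \<in> S" "b \<in> S" for a b
    proof -
      obtain c where c: "t (F a) (F b) c" using comp_ex[OF F(1)[OF ab(1)] F(1)[OF ab(2)]] by (rule exE)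
      then show ?thesis using ab G tri_in[OF c] by (intro exI[of _ "G c"]) simp
    qed
    show "\<exists>b. a \<in> S \<and> b \<in> S \<and> c \<in> S \<and> t (F a) (F b) (F c)" if ac: "a \<in> S" "c \<in> S" for a c
    proof -
      obtain b where b: "t (F a) b (F c)" using div_ex[OF F(1)[OF ac(1)] F(1)[OF ac(2)]] by (rule exE)
      then show ?thesis using ac G tri_in[OF b] by (intro exI[of _ "G b"]) simp
    qed
    fix a b c p q r
    assume 1: "a \<in> S \<and> b \<in> S \<and> p \<in> S \<and> t (F a) (F b) (F p)" and 3: "b \<in> S \<and> c \<in> S \<and> q \<in> S \<and> t (F b) (F c) (F q)"
    show "p \<in> S \<and> c \<in> S \<and> r \<in> S \<and> t (F p) (F c) (F r)" if 2: "a \<in> S \<and> q \<in> S \<and> r \<in> S \<and> t (F a) (F q) (F r)"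
      using 1 2 3 inner2[of "F a" "F b" "F p" "F q" "F r" "F c"] by simp
    show "a \<in> S \<and> q \<in> S \<and> r \<in> S \<and> t (F a) (F q) (F r)" if 2: "p \<in> S \<and> c \<in> S \<and> r \<in> S \<and> t (F p) (F c) (F r)"
      using 1 2 3 inner1[of "F a" "F b" "F p" "F c" "F r" "F q"] by simp
  qed
qed

definition loop_cells :: "'a bisset \<Rightarrow> 'a \<Rightarrow> nat \<Rightarrow> nat \<Rightarrow> 'a loop set" where
  "loop_cells X v m n = rel_cells (loops X v) (loops_pt X v) m n (bd_BC m n)"

definition loop_tri :: "'a bisset \<Rightarrow> 'a \<Rightarrow> nat \<Rightarrow> nat \<Rightarrow> 'a loop \<Rightarrow> 'a loop \<Rightarrow> 'a loop \<Rightarrow> bool" where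
  "loop_tri X v m n a b c \<longleftrightarrow> a \<in> loop_cells X v m n \<and> b \<in> loop_cells X v m n \<and> c \<in> loop_cells X v m n \<and>
     aeppli_tri (loop_Z X v m n) (Hom_pt (bistd m n) X v) (flip_map (bistd 1 1) (bistd m n) a)
       (flip_map (bistd 1 1) (bistd m n) b) (flip_map (bistd 1 1) (bistd m n) c)"

context
  fixes X :: "'a bisset" and v :: 'a and m n :: nat
  assumes X: "kan X" and v: "v \<in> cells X 0 0"
begin

private lemma bX: "bisimplicial_set X"
  using X by (rule kan_bisimplicial)

private lemma Z_eq: "loop_Z X v m n = rel_Hom (bistd m n) (bd_BC m n) X v"
  by (rule loop_Z_rel_Hom[OF bX v])

lemma kan_loop_Z: "kan (loop_Z X v m n)"
  unfolding Z_eq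
  by (rule kan_rel_Hom[OF X v, where R = "\<lambda>S T. \<not> {..m} \<subseteq> S \<or> \<not> {..n} \<subseteq> T"]) (auto simp: cells_bd_BC)

lemma pt_loop_Z: "Hom_pt (bistd m n) X v \<in> cells (loop_Z X v m n) 0 0"
  unfolding Z_eq by (rule Hom_pt_cells[OF bisimplicial_bistd bX v subcomplex_sub[OF subcomplex_bd_BC]])

lemma loop_cells_iff:
  "f \<in> loop_cells X v m n \<longleftrightarrow> is_bimap (bprod (bistd 1 1) (bistd m n)) X f \<and>
    (\<forall>i j. \<forall>x \<in> cells (bd_A 1 1) i j. \<forall>y \<in> cells (bistd m n) i j. f i j (x, y) = base X v i j) \<and>
    (\<forall>i j. \<forall>x \<in> cells (bistd 1 1) i j. \<forall>y \<in> cells (bd_BC m n) i j. f i j (x, y) = base X v i j)"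
  unfolding loop_cells_def loops_rel_Hom loops_pt_def by (rule rel_cells_rel_Hom[OF subcomplex_bd_BC])

lemma aeppli_loops_Z:
  "aeppli_loops (loop_Z X v m n) (Hom_pt (bistd m n) X v) =
     rel_cells (rel_Hom (bistd m n) (bd_BC m n) X v) (Hom_pt (bistd m n) X v) 1 1 (bd_A 1 1)"
  by (simp only: aeppli_loops_def Z_eq)

lemma flip_loop_cells:
  "a \<in> loop_cells X v m n \<Longrightarrow> flip_map (bistd 1 1) (bistd m n) a \<in> aeppli_loops (loop_Z X v m n) (Hom_pt (bistd m n) X v)"
  "a \<in> loop_cells X v m n \<Longrightarrow> flip_map (bistd m n) (bistd 1 1) (flip_map (bistd 1 1) (bistd m n) a) = a"
  "b \<in> aeppli_loops (loop_Z X v m n) (Hom_pt (bistd m n) X v) \<Longrightarrow> flip_map (bistd m n) (bistd 1 1) b \<in> loop_cells X v m n"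
  "b \<in> aeppli_loops (loop_Z X v m n) (Hom_pt (bistd m n) X v) \<Longrightarrow>
     flip_map (bistd 1 1) (bistd m n) (flip_map (bistd m n) (bistd 1 1) b) = b"
  unfolding aeppli_loops_Z loop_cells_def loops_rel_Hom loops_pt_def
  by (erule flip_rel_cells[OF subcomplex_bd_A subcomplex_bd_BC] flip_rel_cells[OF subcomplex_bd_BC subcomplex_bd_A])+

lemma base_loop_cells: "base (loops X v) (loops_pt X v) m n \<in> loop_cells X v m n"
  unfolding loop_cells_iff loops_rel_Hom loops_pt_def base_rel_Hom
proof (intro conjI allI ballI)
  show "is_bimap (bprod (bistd 1 1) (bistd m n)) X (const_bimap (bprod (bistd 1 1) (bistd m n)) X v)"
    by (rule const_is_bimap[OF bisimplicial_bprod[OF bisimplicial_bistd bisimplicial_bistd] bX v])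
  fix i j x y
  show "const_bimap (bprod (bistd 1 1) (bistd m n)) X v i j (x, y) = base X v i j"
    if "x \<in> cells (bd_A 1 1) i j" "y \<in> cells (bistd m n) i j"
    using subsetD[OF subcomplex_sub[OF subcomplex_bd_A] that(1)] that(2) by (simp add: const_bimap_def)
  show "const_bimap (bprod (bistd 1 1) (bistd m n)) X v i j (x, y) = base X v i j"
    if "x \<in> cells (bistd 1 1) i j" "y \<in> cells (bd_BC m n) i j"
    using subsetD[OF subcomplex_sub[OF subcomplex_bd_BC] that(2)] that(1) by (simp add: const_bimap_def)
qed

lemma flip_base:
  "flip_map (bistd 1 1) (bistd m n) (base (loops X v) (loops_pt X v) m n) =
     base (loop_Z X v m n) (Hom_pt (bistd m n) X v) 1 1"
  unfolding Z_eq loops_rel_Hom loops_pt_def base_rel_Hom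
  by (intro ext) (auto simp: flip_map_def const_bimap_def restrict_def)

lemma triangles_loop: "triangles (loop_cells X v m n) (base (loops X v) (loops_pt X v) m n) (loop_tri X v m n)"
  using triangles_transfer[OF triangles_aeppli[OF kan_loop_Z pt_loop_Z], of "loop_cells X v m n"
      "flip_map (bistd 1 1) (bistd m n)" "flip_map (bistd m n) (bistd 1 1)" "base (loops X v) (loops_pt X v) m n",
      OF flip_loop_cells base_loop_cells flip_base]
  by (simp only: loop_tri_def[abs_def])

lemma homotopy_rel_flip:
  assumes "a \<in> loop_cells X v m n" "b \<in> loop_cells X v m n"
  shows "(a, b) \<in> homotopy_rel (loops X v) (loops_pt X v) m n (bd_BC m n) \<longleftrightarrow>
    (flip_map (bistd 1 1) (bistd m n) a, flip_map (bistd 1 1) (bistd m n) b) \<in>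
      homotopy_rel (loop_Z X v m n) (Hom_pt (bistd m n) X v) 1 1 (bd_A 1 1)" (is "?l \<longleftrightarrow> ?r")
proof
  assume ?l
  then show ?r
    unfolding Z_eq loops_rel_Hom loops_pt_def by (rule flip_homotopy_rel[OF subcomplex_bd_A subcomplex_bd_BC])
next
  assume ?r
  then show ?l
    using flip_homotopy_rel[OF subcomplex_bd_BC subcomplex_bd_A, of "flip_map (bistd 1 1) (bistd m n) a"
        "flip_map (bistd 1 1) (bistd m n) b" m n X v] flip_loop_cells(2)[OF assms(1)] flip_loop_cells(2)[OF assms(2)]
    by (simp only: Z_eq loops_rel_Hom loops_pt_def)
qed

text \<open>After the flip, Bott-Chern homotopy in the loop space is Aeppli homotopy in
  \<open>loop_Z\<close>, and that is a triangle with a unit edge. So \<open>pi_BC\<close> is the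
  quotient to which \<open>group_quotient\<close> applies.\<close>

lemma homotopy_rel_loop_tri:
  "homotopy_rel (loops X v) (loops_pt X v) m n (bd_BC m n) =
     triangles.rel (base (loops X v) (loops_pt X v) m n) (loop_tri X v m n)"
proof -
  interpret triangles "loop_cells X v m n" "base (loops X v) (loops_pt X v) m n" "loop_tri X v m n"
    by (rule triangles_loop)
  have "(a, b) \<in> homotopy_rel (loops X v) (loops_pt X v) m n (bd_BC m n) \<longleftrightarrow>
      loop_tri X v m n a (base (loops X v) (loops_pt X v) m n) b" for a b
  proof (cases "a \<in> loop_cells X v m n \<and> b \<in> loop_cells X v m n")
    case True
    then show ?thesis
      unfolding loop_tri_def flip_base
      using homotopy_rel_flip[of a b] homotopy_rel_aeppli[OF kan_loop_Z pt_loop_Z] base_loop_cells by blast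
  next
    case False
    then show ?thesis unfolding loop_tri_def homotopy_rel_def loop_cells_def by blast
  qed
  then show ?thesis unfolding rel_def by auto
qed

lemma loop_mult_eq:
  assumes P: "P \<in> loop_cells X v m n // homotopy_rel (loops X v) (loops_pt X v) m n (bd_BC m n)"
    and Q: "Q \<in> loop_cells X v m n // homotopy_rel (loops X v) (loops_pt X v) m n (bd_BC m n)"
    and ab: "a \<in> P" "b \<in> Q" and tri: "loop_tri X v m n a b c"
  shows "loop_mult X v m n P Q = homotopy_rel (loops X v) (loops_pt X v) m n (bd_BC m n) `` {c}"
proof -
  let ?F = "flip_map (bistd 1 1) (bistd m n)" and ?G = "flip_map (bistd m n) (bistd 1 1)"
  let ?r = "homotopy_rel (loops X v) (loops_pt X v) m n (bd_BC m n)"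
  let ?Z = "loop_Z X v m n" and ?p = "Hom_pt (bistd m n) X v"
  let ?s = "homotopy_rel ?Z ?p 1 1 (bd_A 1 1)"
  interpret triangles "loop_cells X v m n" "base (loops X v) (loops_pt X v) m n" "loop_tri X v m n"
    by (rule triangles_loop)
  have r_in: "x \<in> loop_cells X v m n \<and> y \<in> loop_cells X v m n" if "(x, y) \<in> ?r" for x y
    using that by (simp add: homotopy_rel_def loop_cells_def)
  have s_in: "x \<in> aeppli_loops ?Z ?p \<and> y \<in> aeppli_loops ?Z ?p" if "(x, y) \<in> ?s" for x y
    using that unfolding homotopy_rel_def aeppli_loops_def by blast
  \<comment> \<open>The flip is a bijection that respects the homotopy relations in both directions,
    so the image of a class is a whole class.\<close>
  have img: "?F ` (?r `` {x}) = ?s `` {?F x}" if x: "x \<in> loop_cells X v m n" for x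
  proof
    show "?F ` (?r `` {x}) \<subseteq> ?s `` {?F x}" using homotopy_rel_flip[OF x] r_in by blast
    show "?s `` {?F x} \<subseteq> ?F ` (?r `` {x})"
    proof
      fix y assume y: "y \<in> ?s `` {?F x}"
      then have yL: "y \<in> aeppli_loops ?Z ?p" using s_in by blast
      note g = flip_loop_cells(3,4)[OF yL]
      have "(x, ?G y) \<in> ?r" using homotopy_rel_flip[OF x g(1)] g(2) y by simp
      then show "y \<in> ?F ` (?r `` {x})" using g(2) by (metis Image_singleton_iff imageI)
    qed
  qed
  have cls: "?F ` W \<in> aeppli_loops ?Z ?p // ?s" if W: "W \<in> loop_cells X v m n // ?r" for W
  proof -
    obtain x where x: "x \<in> loop_cells X v m n" "W = ?r `` {x}" using W by (rule quotientE)
    show ?thesis unfolding x(2) img[OF x(1)] by (rule quotientI[OF flip_loop_cells(1)[OF x(1)]])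
  qed
  have t: "aeppli_tri ?Z ?p (?F a) (?F b) (?F c)" and c: "c \<in> loop_cells X v m n"
    using tri by (simp_all add: loop_tri_def)
  have "A_mult ?Z ?p (?F ` P) (?F ` Q) = ?s `` {?F c}"
    by (rule A_mult_eq[OF kan_loop_Z pt_loop_Z cls[OF P] cls[OF Q] imageI[OF ab(1)] imageI[OF ab(2)] t])
  then have "loop_mult X v m n P Q = ?G ` (?F ` (?r `` {c}))"
    unfolding loop_mult_def img[OF c] by simp
  also have "\<dots> = ?r `` {c}"
  proof -
    have "?G (?F x) = x" if "x \<in> ?r `` {c}" for x using r_in flip_loop_cells(2) that by blast
    then show ?thesis by (simp add: image_image)
  qed
  finally show ?thesis .
qed

theorem group_loop_group: "group (loop_group X v m n)"
proof -
  interpret triangles "loop_cells X v m n" "base (loops X v) (loops_pt X v) m n" "loop_tri X v m n"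
    by (rule triangles_loop)
  show ?thesis
    unfolding loop_group_def pi_BC_def class_BC_def loop_cells_def[symmetric] homotopy_rel_loop_tri
    by (rule group_quotient) (rule loop_mult_eq[unfolded homotopy_rel_loop_tri])
qed

end

section \<open>The Bott-Chern product\<close>

lemma codegen_nth: "i \<le> m \<Longrightarrow> x \<le> Suc m \<Longrightarrow> codegen m i ! x = squash i x"
  by (auto simp: codegen_def nth_append squash_def simp del: upt_Suc)

lemma codegen_ops: "i \<le> m \<Longrightarrow> codegen m i \<in> ops (Suc m) m"
  by (auto simp: ops_def codegen_def sorted_append simp del: upt_Suc)

lemma pick_codegen: "i \<le> m \<Longrightarrow> x \<in> ops k (Suc m) \<Longrightarrow> pick (codegen m i) x = map (squash i) x"
  by (auto simp: pick_def ops_def codegen_nth)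

text \<open>A composition that varies over Delta[p,q]: in the factor Delta[2,2] the outer faces
  carry \<open>T1\<close>, the face opposite to 2 carries \<open>T2\<close>, and the face opposite
  to 1 carries \<open>T\<close>. Over \<open>H1\<close> and \<open>H2\<close> one of the two loops
  is constant, so the composition is a degeneracy of the other one. All this lives on a subobject of
  Delta[2,2] times Delta[p,q] and on Delta[2,2] times the bihorn, so \<open>box_extend\<close>
  supplies the rest.\<close>

lemma box_extend_loops:
  fixes H1 H2 :: "nat list \<Rightarrow> nat list \<Rightarrow> bool"
  assumes X: "kan X" and pq: "1 \<le> p" "1 \<le> q" "k \<le> p" "l \<le> q"
    and horn: "\<And>i j c d. c \<in> ops i p \<Longrightarrow> d \<in> ops j q \<Longrightarrow> (c, d) \<in> cells (bihorn p q k l) i j \<longleftrightarrow> H1 c d \<or> H2 c d"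
    and Hp: "\<And>i j i' j' c d \<theta> \<phi>. c \<in> ops i p \<Longrightarrow> d \<in> ops j q \<Longrightarrow> \<theta> \<in> ops i' i \<Longrightarrow> \<phi> \<in> ops j' j \<Longrightarrow>
      (H1 c d \<longrightarrow> H1 (pick c \<theta>) (pick d \<phi>)) \<and> (H2 c d \<longrightarrow> H2 (pick c \<theta>) (pick d \<phi>))"
    and T: "T1 \<in> cells (loops X v) p q" "T2 \<in> cells (loops X v) p q" "T \<in> cells (loops X v) p q"
    and TH: "\<And>i j s c d. s \<in> cells (bistd 1 1) i j \<Longrightarrow> c \<in> ops i p \<Longrightarrow> d \<in> ops j q \<Longrightarrow>
      (H1 c d \<longrightarrow> T i j (s, (c, d)) = T1 i j (s, (c, d)) \<and> T2 i j (s, (c, d)) = base X v i j) \<and>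
      (H2 c d \<longrightarrow> T i j (s, (c, d)) = T2 i j (s, (c, d)) \<and> T1 i j (s, (c, d)) = base X v i j)"
  obtains G where "nat_on (bprod (bistd 2 2) (bistd p q)) X G"
    and "\<And>i j a b c d. a \<in> ops i 2 \<Longrightarrow> b \<in> ops j 2 \<Longrightarrow> c \<in> ops i p \<Longrightarrow> d \<in> ops j q \<Longrightarrow>
      (0 \<notin> set a \<or> 0 \<notin> set b) \<or> H1 c d \<Longrightarrow>
      G i j ((a, b), (c, d)) = T1 i j ((map (\<lambda>x. x - 1) a, map (\<lambda>x. x - 1) b), (c, d))"
    and "\<And>i j a b c d. a \<in> ops i 2 \<Longrightarrow> b \<in> ops j 2 \<Longrightarrow> c \<in> ops i p \<Longrightarrow> d \<in> ops j q \<Longrightarrow>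
      (2 \<notin> set a \<and> 2 \<notin> set b) \<or> H2 c d \<Longrightarrow>
      G i j ((a, b), (c, d)) = T2 i j ((map (min 1) a, map (min 1) b), (c, d))"
    and "\<And>i j a b c d. a \<in> ops i 2 \<Longrightarrow> b \<in> ops j 2 \<Longrightarrow> c \<in> ops i p \<Longrightarrow> d \<in> ops j q \<Longrightarrow>
      1 \<notin> set a \<Longrightarrow> 1 \<notin> set b \<Longrightarrow>
      G i j ((a, b), (c, d)) = T i j ((map (min 1) a, map (min 1) b), (c, d))"
proof -
  have bim: "is_bimap (bprod (bistd 1 1) (bistd p q)) X U"
    and bd: "\<And>i j a b t. a \<in> ops i 1 \<Longrightarrow> b \<in> ops j 1 \<Longrightarrow> t \<in> cells (bistd p q) i j \<Longrightarrow>
      0 \<notin> set a \<or> 0 \<notin> set b \<or> 1 \<notin> set a \<and> 1 \<notin> set b \<Longrightarrow> U i j ((a, b), t) = base X v i j"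
    if "U \<in> cells (loops X v) p q" for U
  proof -
    show "is_bimap (bprod (bistd 1 1) (bistd p q)) X U" using that unfolding loops_rel_Hom cells_rel_Hom by blast
    show "U i j ((a, b), t) = base X v i j"
      if "a \<in> ops i 1" "b \<in> ops j 1" "t \<in> cells (bistd p q) i j" "0 \<notin> set a \<or> 0 \<notin> set b \<or> 1 \<notin> set a \<and> 1 \<notin> set b"
      for i j a b t
    proof -
      have "(a, b) \<in> cells (bd_A 1 1) i j" using that unfolding cells_bd_A_iff by blast
      then show ?thesis using \<open>U \<in> cells (loops X v) p q\<close> that(3) unfolding loops_rel_Hom cells_rel_Hom by blast
    qed
  qed
  define pr where "pr = (\<lambda>x :: nat. x - 1)"
  define mn where "mn = (\<lambda>x :: nat. min 1 x)"
  have pm: "map pr a \<in> ops i 1" "map mn a \<in> ops i 1" if "a \<in> ops i 2" for a i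
    using that unfolding pr_def mn_def by (auto elim!: map_mono_ops)
  define A where "A = (\<lambda>i j ((a, b), t :: bistd_cell). T1 i j ((map pr a, map pr b), t))"
  define B where "B = (\<lambda>i j ((a, b), t :: bistd_cell). T2 i j ((map mn a, map mn b), t))"
  define C where "C = (\<lambda>i j ((a, b), t :: bistd_cell). T i j ((map mn a, map mn b), t))"
  define rA where "rA a b c d \<longleftrightarrow> (0 \<notin> set a \<or> 0 \<notin> set b) \<or> H1 c d" for a b :: "nat list" and c d
  define rB where "rB a b c d \<longleftrightarrow> (2 \<notin> set a \<and> 2 \<notin> set b) \<or> H2 c d" for a b :: "nat list" and c d
  define rC where "rC a b \<longleftrightarrow> 1 \<notin> set a \<and> 1 \<notin> set b" for a b :: "nat list"
  \<comment> \<open>Where the regions of \<open>A\<close> and \<open>B\<close> overlap, both values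
    are the base point: each part of one region, be it a face of Delta[2,2] or a piece of the
    bihorn, makes the other map constant.\<close>
  have AB: "A i j ((a, b), (c, d)) = B i j ((a, b), (c, d))"
    if o: "a \<in> ops i 2" "b \<in> ops j 2" "c \<in> ops i p" "d \<in> ops j q" and r: "rA a b c d" "rB a b c d" for i j a b c d
  proof -
    have t: "(c, d) \<in> cells (bistd p q) i j" using o by simp
    have sp: "(map pr a, map pr b) \<in> cells (bistd 1 1) i j" and sm: "(map mn a, map mn b) \<in> cells (bistd 1 1) i j"
      using pm o by simp_all
    note TA = TH[OF sp o(3,4)] and TB = TH[OF sm o(3,4)]
    have m0: "0 \<notin> set (map mn a) \<or> 0 \<notin> set (map mn b)" if "0 \<notin> set a \<or> 0 \<notin> set b"
      using that map_min_no0[of a] map_min_no0[of b] unfolding mn_def by blast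
    have p1: "1 \<notin> set (map pr e)" if "2 \<notin> set e" "e \<in> ops i 2" for e i
    proof
      assume "1 \<in> set (map pr e)"
      then obtain y where y: "y \<in> set e" "1 = y - 1" by (auto simp: pr_def)
      then have "y = 2" using that(2) by (auto simp: ops_def)
      then show False using y(1) that(1) by simp
    qed
    have low: "A i j ((a, b), (c, d)) = base X v i j" if "2 \<notin> set a \<and> 2 \<notin> set b"
      unfolding A_def using bd[OF T(1) pm(1)[OF o(1)] pm(1)[OF o(2)] t] p1[OF _ o(1)] p1[OF _ o(2)] that by simp
    have up: "B i j ((a, b), (c, d)) = base X v i j" if "0 \<notin> set a \<or> 0 \<notin> set b"
      unfolding B_def using bd[OF T(2) pm(2)[OF o(1)] pm(2)[OF o(2)] t] m0[OF that] by auto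
    have h2: "A i j ((a, b), (c, d)) = base X v i j" if "H2 c d" using TA that by (simp add: A_def)
    have h1: "B i j ((a, b), (c, d)) = base X v i j" if "H1 c d" using TB that by (simp add: B_def)
    have "A i j ((a, b), (c, d)) = base X v i j" using r(2) low h2 unfolding rB_def by blast
    moreover have "B i j ((a, b), (c, d)) = base X v i j" using r(1) up h1 unfolding rA_def by blast
    ultimately show ?thesis by simp
  qed
  have AC: "A i j ((a, b), (c, d)) = C i j ((a, b), (c, d))"
    if o: "a \<in> ops i 2" "b \<in> ops j 2" "c \<in> ops i p" "d \<in> ops j q" and r: "rA a b c d" "rC a b" for i j a b c d
  proof -
    have t: "(c, d) \<in> cells (bistd p q) i j" using o by simp
    have e: "map mn a = map pr a" "map mn b = map pr b"
      using map_min_pred[OF o(1)] map_min_pred[OF o(2)] r(2) unfolding rC_def pr_def mn_def by blast+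
    show ?thesis
      using r(1) unfolding rA_def
    proof
      assume "0 \<notin> set a \<or> 0 \<notin> set b"
      then have "0 \<notin> set (map pr a) \<or> 0 \<notin> set (map pr b)"
        unfolding e[symmetric] using map_min_no0[of a] map_min_no0[of b] unfolding mn_def by blast
      then show ?thesis
        using bd[OF T(1) pm(1)[OF o(1)] pm(1)[OF o(2)] t] bd[OF T(3) pm(1)[OF o(1)] pm(1)[OF o(2)] t]
        by (auto simp: A_def C_def e)
    next
      assume h: "H1 c d"
      have sp: "(map pr a, map pr b) \<in> cells (bistd 1 1) i j" using pm o by simp
      show ?thesis using TH[OF sp o(3,4)] h by (simp add: A_def C_def e)
    qed
  qed
  have BC: "B i j ((a, b), (c, d)) = C i j ((a, b), (c, d))"
    if o: "a \<in> ops i 2" "b \<in> ops j 2" "c \<in> ops i p" "d \<in> ops j q" and r: "rB a b c d" "rC a b" for i j a b c d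
  proof -
    have t: "(c, d) \<in> cells (bistd p q) i j" using o by simp
    show ?thesis
      using r(1) unfolding rB_def
    proof
      assume 2: "2 \<notin> set a \<and> 2 \<notin> set b"
      have "1 \<notin> set (map mn e)" if "e \<in> ops i 2" "1 \<notin> set e" "2 \<notin> set e" for e i
      proof
        assume "1 \<in> set (map mn e)"
        then obtain y where y: "y \<in> set e" "1 = min 1 y" by (auto simp: mn_def)
        then have "y = 1 \<or> y = 2" using that(1) by (auto simp: ops_def min_def split: if_splits)
        then show False using y(1) that(2,3) by blast
      qed
      then have "1 \<notin> set (map mn a) \<and> 1 \<notin> set (map mn b)" using o(1,2) 2 r(2) unfolding rC_def by blast
      then show ?thesis
        using bd[OF T(2) pm(2)[OF o(1)] pm(2)[OF o(2)] t] bd[OF T(3) pm(2)[OF o(1)] pm(2)[OF o(2)] t]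
        by (simp add: B_def C_def)
    next
      assume h: "H2 c d"
      have sm: "(map mn a, map mn b) \<in> cells (bistd 1 1) i j" using pm o by simp
      show ?thesis using TH[OF sm o(3,4)] h by (simp add: B_def C_def)
    qed
  qed
  have fam: "U i j ((map f a, map f b), (c, d)) \<in> cells X i j \<and>
      U i' j' ((map f (pick a \<theta>), map f (pick b \<phi>)), (pick c \<theta>, pick d \<phi>)) = act X i j \<theta> \<phi> (U i j ((map f a, map f b), (c, d)))"
    if U: "U \<in> cells (loops X v) p q" and f: "map f a \<in> ops i 1" "map f b \<in> ops j 1"
      and o: "a \<in> ops i 2" "b \<in> ops j 2" "c \<in> ops i p" "d \<in> ops j q" and op: "\<theta> \<in> ops i' i" "\<phi> \<in> ops j' j"
    for U f a b c d i j \<theta> \<phi> i' j'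
    unfolding map_pick[OF op(1) opsD(1)[OF o(1)]] map_pick[OF op(2) opsD(1)[OF o(2)]]
    using is_bimapD(1)[OF bim[OF U], of "((map f a, map f b), (c, d))" i j]
      is_bimapD(2)[OF bim[OF U], of "((map f a, map f b), (c, d))" i j, OF _ op] f o
    by (simp add: act_bprod act_bistd)
  define F where "F = (\<lambda>(i::nat) (j::nat) ((a, b), (c, d)). if rA a b c d then A i j ((a, b), (c, d))
      else if rB a b c d then B i j ((a, b), (c, d)) else C i j ((a, b), (c, d)))"
  have FA: "F i j ((a, b), (c, d)) = A i j ((a, b), (c, d))" if "rA a b c d" for i j a b c d
    using that by (simp add: F_def)
  have FB: "F i j ((a, b), (c, d)) = B i j ((a, b), (c, d))"
    if "a \<in> ops i 2" "b \<in> ops j 2" "c \<in> ops i p" "d \<in> ops j q" "rB a b c d" for i j a b c d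
    using AB[OF that(1-4) _ that(5)] that(5) by (simp add: F_def)
  have FC: "F i j ((a, b), (c, d)) = C i j ((a, b), (c, d))"
    if "a \<in> ops i 2" "b \<in> ops j 2" "c \<in> ops i p" "d \<in> ops j q" "rC a b" for i j a b c d
    using AC[OF that(1-4) _ that(5)] BC[OF that(1-4) _ that(5)] by (simp add: F_def)
  \<comment> \<open>The subobject of Delta[2,2] over which the value is prescribed for every cell of
    Delta[p,q].\<close>
  define R where "R S T \<longleftrightarrow> (0 \<notin> S \<or> 0 \<notin> T) \<or> (2 \<notin> S \<and> 2 \<notin> T) \<or> (1 \<notin> S \<and> 1 \<notin> T)" for S T :: "nat set"
  have reg: "rA a b c d \<or> rB a b c d \<or> rC a b \<longleftrightarrow> R (set a) (set b) \<or> (c, d) \<in> cells (bihorn p q k l) i j"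
    if "c \<in> ops i p" "d \<in> ops j q" for a b c d i j
    unfolding horn[OF that] rA_def rB_def rC_def R_def by blast
  obtain G where G: "nat_on (bprod (bistd 2 2) (bistd p q)) X G"
    and GF: "\<And>i j a b c d. a \<in> ops i 2 \<Longrightarrow> b \<in> ops j 2 \<Longrightarrow> c \<in> ops i p \<Longrightarrow> d \<in> ops j q \<Longrightarrow>
        R (set a) (set b) \<or> (c, d) \<in> cells (bihorn p q k l) i j \<Longrightarrow> G i j ((a, b), (c, d)) = F i j ((a, b), (c, d))"
  proof (rule box_extend[OF X pq, where f = F and R = R and M = 2 and N = 2])
    show "R S' T'" if "R S T" "S' \<subseteq> S" "T' \<subseteq> T" for S T S' T' using that unfolding R_def by blast
    fix i j a b c d
    assume o: "a \<in> ops i 2" "b \<in> ops j 2" "c \<in> ops i p" "d \<in> ops j q"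
      and r: "R (set a) (set b) \<or> (c, d) \<in> cells (bihorn p q k l) i j"
    note fA = fam[OF T(1) pm(1)[OF o(1)] pm(1)[OF o(2)] o]
      and fB = fam[OF T(2) pm(2)[OF o(1)] pm(2)[OF o(2)] o]
      and fC = fam[OF T(3) pm(2)[OF o(1)] pm(2)[OF o(2)] o]
    show "F i j ((a, b), (c, d)) \<in> cells X i j"
      using fA[OF id_op_ops id_op_ops] fB[OF id_op_ops id_op_ops] fC[OF id_op_ops id_op_ops]
      by (simp add: F_def A_def B_def C_def)
    fix i' j' \<theta> \<phi> assume op: "\<theta> \<in> ops i' i" "\<phi> \<in> ops j' j"
    note po = pick_ops[OF o(1) op(1)] pick_ops[OF o(2) op(2)] pick_ops[OF o(3) op(1)] pick_ops[OF o(4) op(2)]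
    note sub = set_pick_ops[OF o(1) op(1)] set_pick_ops[OF o(2) op(2)] Hp[OF o(3,4) op]
    from r[folded reg[OF o(3,4)]]
    show "F i' j' ((pick a \<theta>, pick b \<phi>), (pick c \<theta>, pick d \<phi>)) = act X i j \<theta> \<phi> (F i j ((a, b), (c, d)))"
    proof (elim disjE[of "rA a b c d"] disjE[of "rB a b c d"])
      assume 1: "rA a b c d"
      then have "rA (pick a \<theta>) (pick b \<phi>) (pick c \<theta>) (pick d \<phi>)" using sub unfolding rA_def by blast
      then show ?thesis using FA 1 fA[OF op] by (simp add: A_def)
    next
      assume 1: "rB a b c d"
      then have "rB (pick a \<theta>) (pick b \<phi>) (pick c \<theta>) (pick d \<phi>)" using sub unfolding rB_def by blast
      then show ?thesis using FB[OF o 1] FB[OF po] fB[OF op] by (simp add: B_def)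
    next
      assume 1: "rC a b"
      then have "rC (pick a \<theta>) (pick b \<phi>)" using sub unfolding rC_def by blast
      then show ?thesis using FC[OF o 1] FC[OF po] fC[OF op] by (simp add: C_def)
    qed
  next
    fix g
    assume "nat_on (bprod (bistd 2 2) (bistd p q)) X g"
      and "\<And>i j a b c d. a \<in> ops i 2 \<Longrightarrow> b \<in> ops j 2 \<Longrightarrow> c \<in> ops i p \<Longrightarrow> d \<in> ops j q \<Longrightarrow>
        R (set a) (set b) \<or> (c, d) \<in> cells (bihorn p q k l) i j \<Longrightarrow> g i j ((a, b), (c, d)) = F i j ((a, b), (c, d))"
    then show thesis by (rule that)
  qed
  show thesis
  proof (rule that[OF G])
    fix i j a b c d assume o: "a \<in> ops i 2" "b \<in> ops j 2" "c \<in> ops i p" "d \<in> ops j q"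
    show "G i j ((a, b), (c, d)) = T1 i j ((map (\<lambda>x. x - 1) a, map (\<lambda>x. x - 1) b), (c, d))"
      if "(0 \<notin> set a \<or> 0 \<notin> set b) \<or> H1 c d"
    proof -
      have r: "rA a b c d" using that by (simp only: rA_def)
      then show ?thesis using GF[OF o] reg[OF o(3,4), of a b] FA[OF r, of i j] by (simp add: A_def pr_def)
    qed
    show "G i j ((a, b), (c, d)) = T2 i j ((map (min 1) a, map (min 1) b), (c, d))"
      if "(2 \<notin> set a \<and> 2 \<notin> set b) \<or> H2 c d"
    proof -
      have r: "rB a b c d" using that by (simp only: rB_def)
      then show ?thesis using GF[OF o] reg[OF o(3,4), of a b] FB[OF o r] by (simp add: B_def mn_def)
    qed
    show "G i j ((a, b), (c, d)) = T i j ((map (min 1) a, map (min 1) b), (c, d))" if "1 \<notin> set a" "1 \<notin> set b"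
    proof -
      have r: "rC a b" using that by (simp only: rC_def simp_thms)
      then show ?thesis using GF[OF o] reg[OF o(3,4), of a b] FC[OF o r] by (simp add: C_def mn_def)
    qed
  qed
qed

text \<open>A vertex \<open>r\<close> missing from \<open>y1\<close> yields the vertex
  \<open>coface (Suc m) k ! r\<close> missing from its image, and this vertex differs from
  \<open>k\<close>. Thus the boundary of the face that the bihorn lacks is contained in the
  bihorn.\<close>

lemma coface_bd_BC:
  assumes kl: "k \<le> m" "l \<le> n" and y: "(y1, y2) \<in> cells (bd_BC m n) i j"
  shows "(pick (coface (Suc m) k) y1, pick (coface (Suc n) l) y2) \<in> cells (bihorn (Suc m) (Suc n) k l) i j"
proof -
  have o: "y1 \<in> ops i m" "y2 \<in> ops j n" and ns: "\<not> {..m} \<subseteq> set y1 \<or> \<not> {..n} \<subseteq> set y2"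
    using y by (auto simp: cells_bd_BC)
  have miss: "\<not> {..Suc M} - {K} \<subseteq> set (pick (coface (Suc M) K) y)"
    if K: "K \<le> M" and y: "y \<in> ops i M" and n: "\<not> {..M} \<subseteq> set y" for M K y i
  proof -
    obtain r where r: "r \<le> M" "r \<notin> set y" using n by auto
    let ?x = "coface (Suc M) K ! r"
    have x: "?x \<in> {..Suc M} - {K}" using K r(1) by (auto simp: coface_nth)
    have "?x \<notin> set (pick (coface (Suc M) K) y)"
    proof
      assume "?x \<in> set (pick (coface (Suc M) K) y)"
      then obtain r' where r': "r' \<in> set y" "coface (Suc M) K ! r' = ?x" by (auto simp: pick_def)
      have "r' \<le> M" using r'(1) y by (auto simp: ops_def)
      then have "r' = r" using r'(2) r(1) K by (auto simp: coface_nth split: if_splits)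
      then show False using r'(1) r(2) by simp
    qed
    then show ?thesis using x by blast
  qed
  have km: "k \<le> Suc m" "l \<le> Suc n" using kl by auto
  show ?thesis
    using pick_ops[OF coface_ops[OF km(1)] o(1)] pick_ops[OF coface_ops[OF km(2)] o(2)]
      ns miss[OF kl(1) o(1)] miss[OF kl(2) o(2)] unfolding cells_bihorn by blast
qed

text \<open>The composition from \<open>box_extend_loops\<close>, restricted to the face that the
  bihorn lacks, is a cell \<open>W\<close> of bidegree \<open>(2, 2)\<close> and an Aeppli filler
  for \<open>a\<close>, \<open>b\<close> with result \<open>g\<close>. It is constant over
  \<open>bd_BC m n\<close>: that boundary lies in the bihorn, where the composition is a degeneracy
  of \<open>T1\<close> or \<open>T2\<close>, and these restrict to \<open>a\<close> and
  \<open>b\<close>.\<close>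

lemma loop_tri_of_extension:
  fixes H1 H2 :: "nat list \<Rightarrow> nat list \<Rightarrow> bool"
  assumes X: "kan X" and v: "v \<in> cells X 0 0" and kl: "k \<le> m" "l \<le> n"
    and horn: "\<And>i j c d. c \<in> ops i (Suc m) \<Longrightarrow> d \<in> ops j (Suc n) \<Longrightarrow>
      (c, d) \<in> cells (bihorn (Suc m) (Suc n) k l) i j \<longleftrightarrow> H1 c d \<or> H2 c d"
    and Hp: "\<And>i j i' j' c d \<theta> \<phi>. c \<in> ops i (Suc m) \<Longrightarrow> d \<in> ops j (Suc n) \<Longrightarrow> \<theta> \<in> ops i' i \<Longrightarrow> \<phi> \<in> ops j' j \<Longrightarrow>
      (H1 c d \<longrightarrow> H1 (pick c \<theta>) (pick d \<phi>)) \<and> (H2 c d \<longrightarrow> H2 (pick c \<theta>) (pick d \<phi>))"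
    and T: "T1 \<in> cells (loops X v) (Suc m) (Suc n)" "T2 \<in> cells (loops X v) (Suc m) (Suc n)"
      "T \<in> cells (loops X v) (Suc m) (Suc n)"
    and TH: "\<And>i j s c d. s \<in> cells (bistd 1 1) i j \<Longrightarrow> c \<in> ops i (Suc m) \<Longrightarrow> d \<in> ops j (Suc n) \<Longrightarrow>
      (H1 c d \<longrightarrow> T i j (s, (c, d)) = T1 i j (s, (c, d)) \<and> T2 i j (s, (c, d)) = base X v i j) \<and>
      (H2 c d \<longrightarrow> T i j (s, (c, d)) = T2 i j (s, (c, d)) \<and> T1 i j (s, (c, d)) = base X v i j)"
    and abg: "a \<in> loop_cells X v m n" "b \<in> loop_cells X v m n" "g \<in> loop_cells X v m n"
    and restr: "\<And>i j s y1 y2. s \<in> cells (bistd 1 1) i j \<Longrightarrow> y1 \<in> ops i m \<Longrightarrow> y2 \<in> ops j n \<Longrightarrow>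
      T1 i j (s, (pick (coface (Suc m) k) y1, pick (coface (Suc n) l) y2)) = a i j (s, (y1, y2)) \<and>
      T2 i j (s, (pick (coface (Suc m) k) y1, pick (coface (Suc n) l) y2)) = b i j (s, (y1, y2)) \<and>
      T i j (s, (pick (coface (Suc m) k) y1, pick (coface (Suc n) l) y2)) = g i j (s, (y1, y2))"
  shows "loop_tri X v m n a b g"
proof -
  obtain G where G: "nat_on (bprod (bistd 2 2) (bistd (Suc m) (Suc n))) X G"
    and GA: "\<And>i j a b c d. a \<in> ops i 2 \<Longrightarrow> b \<in> ops j 2 \<Longrightarrow> c \<in> ops i (Suc m) \<Longrightarrow> d \<in> ops j (Suc n) \<Longrightarrow>
      (0 \<notin> set a \<or> 0 \<notin> set b) \<or> H1 c d \<Longrightarrow>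
      G i j ((a, b), (c, d)) = T1 i j ((map (\<lambda>x. x - 1) a, map (\<lambda>x. x - 1) b), (c, d))"
    and GB: "\<And>i j a b c d. a \<in> ops i 2 \<Longrightarrow> b \<in> ops j 2 \<Longrightarrow> c \<in> ops i (Suc m) \<Longrightarrow> d \<in> ops j (Suc n) \<Longrightarrow>
      (2 \<notin> set a \<and> 2 \<notin> set b) \<or> H2 c d \<Longrightarrow>
      G i j ((a, b), (c, d)) = T2 i j ((map (min 1) a, map (min 1) b), (c, d))"
    and GC: "\<And>i j a b c d. a \<in> ops i 2 \<Longrightarrow> b \<in> ops j 2 \<Longrightarrow> c \<in> ops i (Suc m) \<Longrightarrow> d \<in> ops j (Suc n) \<Longrightarrow>
      1 \<notin> set a \<Longrightarrow> 1 \<notin> set b \<Longrightarrow>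
      G i j ((a, b), (c, d)) = T i j ((map (min 1) a, map (min 1) b), (c, d))"
  proof -
    have s: "1 \<le> Suc m" "1 \<le> Suc n" "k \<le> Suc m" "l \<le> Suc n" using kl by auto
    show thesis
      by (rule box_extend_loops[where ?H1.0 = H1 and ?H2.0 = H2 and k = k and l = l and ?T1.0 = T1 and ?T2.0 = T2 and T = T, OF X s _ _ T _ that])
        (fact horn Hp TH)+
  qed
  let ?L = "bistd m n" and ?Z = "loop_Z X v m n" and ?F = "flip_map (bistd 1 1) (bistd m n)"
  have bX: "bisimplicial_set X" using X by (rule kan_bisimplicial)
  note bs = bisimplicial_bistd
  have Z_eq: "?Z = rel_Hom ?L (bd_BC m n) X v" by (rule loop_Z_rel_Hom[OF bX v])
  have kZ: "kan ?Z" by (rule kan_loop_Z[OF X v])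
  have bZ: "bisimplicial_set ?Z" by (rule kan_bisimplicial[OF kZ])
  have ptZ: "Hom_pt ?L X v \<in> cells ?Z 0 0" by (rule pt_loop_Z[OF X v])
  have km: "k \<le> Suc m" "l \<le> Suc n" using kl by auto
  let ?dm = "coface (Suc m) k" and ?dn = "coface (Suc n) l"
  have dops: "pick ?dm y \<in> ops i (Suc m)" "pick ?dn z \<in> ops j (Suc n)" if "y \<in> ops i m" "z \<in> ops j n" for y z i j
    using pick_ops[OF coface_ops[OF km(1)] that(1)] pick_ops[OF coface_ops[OF km(2)] that(2)] .
  have min_ops: "map (min 1) x \<in> ops i 1" "map (\<lambda>x. x - 1) x \<in> ops i 1" if "x \<in> ops i 2" for x i
    using that by (auto elim!: map_mono_ops)
  have H_bd: "H1 (pick ?dm y1) (pick ?dn y2) \<or> H2 (pick ?dm y1) (pick ?dn y2)" if "(y1, y2) \<in> cells (bd_BC m n) i j" for y1 y2 i j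
    using coface_bd_BC[OF kl that] dops[of y1 i y2 j] horn[of "pick ?dm y1" i "pick ?dn y2" j] that by (simp add: cells_bd_BC)
  define W where "W = (\<lambda>i j. \<lambda>((y1, y2), t) \<in> cells (bprod ?L (bistd 2 2)) i j. G i j (t, (pick ?dm y1, pick ?dn y2)))"
  have Wapp: "W i j ((y1, y2), (c, d)) = G i j ((c, d), (pick ?dm y1, pick ?dn y2))"
    if "y1 \<in> ops i m" "y2 \<in> ops j n" "c \<in> ops i 2" "d \<in> ops j 2" for i j y1 y2 c d
    using that by (simp add: W_def)
  have Wb: "is_bimap (bprod ?L (bistd 2 2)) X W"
    unfolding is_bimap_def
  proof (intro conjI allI ballI)
    fix i j
    show "W i j \<in> cells (bprod ?L (bistd 2 2)) i j \<rightarrow>\<^sub>E cells X i j"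
      unfolding W_def restrict_PiE_iff using nat_onD(1)[OF G] dops by auto
  next
    fix i j i' j' \<theta> \<phi> w assume op: "\<theta> \<in> ops i' i" "\<phi> \<in> ops j' j" and "w \<in> cells (bprod ?L (bistd 2 2)) i j"
    then obtain y1 y2 c d where w: "w = ((y1, y2), (c, d))" and o: "y1 \<in> ops i m" "y2 \<in> ops j n" "c \<in> ops i 2" "d \<in> ops j 2"
      by auto
    show "W i' j' (act (bprod ?L (bistd 2 2)) i j \<theta> \<phi> w) = act X i j \<theta> \<phi> (W i j w)"
      using nat_onD(2)[OF G, of "((c, d), (pick ?dm y1, pick ?dn y2))" i j, OF _ op] o dops[OF o(1,2)]
        Wapp[OF pick_ops[OF o(1) op(1)] pick_ops[OF o(2) op(2)] pick_ops[OF o(3) op(1)] pick_ops[OF o(4) op(2)]]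
      by (simp add: w act_bprod act_bistd Wapp[OF o] pick_pick[OF o(1) op(1)] pick_pick[OF o(2) op(2)])
  qed
  have base_a: "h i j (s, (y1, y2)) = base X v i j"
    if "h \<in> loop_cells X v m n" "s \<in> cells (bistd 1 1) i j" "(y1, y2) \<in> cells (bd_BC m n) i j" for h s y1 y2 i j
    using that unfolding loop_cells_iff[OF X v] by blast
  have WZ: "W \<in> cells ?Z 2 2"
    unfolding Z_eq cells_rel_Hom
  proof (intro conjI Wb allI ballI)
    fix i j y t assume y: "y \<in> cells (bd_BC m n) i j" and t: "t \<in> cells (bistd 2 2) i j"
    obtain y1 y2 where y12: "y = (y1, y2)" by (cases y)
    obtain c d where cd: "t = (c, d)" "c \<in> ops i 2" "d \<in> ops j 2" using t by auto
    have o: "y1 \<in> ops i m" "y2 \<in> ops j n" using y y12 by (auto simp: cells_bd_BC)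
    note d = dops[OF o]
    have s: "(map (\<lambda>x. x - 1) c, map (\<lambda>x. x - 1) d) \<in> cells (bistd 1 1) i j"
      "(map (min 1) c, map (min 1) d) \<in> cells (bistd 1 1) i j"
      using min_ops cd by simp_all
    have "G i j ((c, d), (pick ?dm y1, pick ?dn y2)) = base X v i j"
      using H_bd[OF y[unfolded y12]]
    proof
      assume h: "H1 (pick ?dm y1) (pick ?dn y2)"
      show ?thesis
        using GA[OF cd(2,3) d disjI2[OF h]] restr[OF s(1) o] base_a[OF abg(1) s(1) y[unfolded y12]] by simp
    next
      assume h: "H2 (pick ?dm y1) (pick ?dn y2)"
      show ?thesis
        using GB[OF cd(2,3) d disjI2[OF h]] restr[OF s(2) o] base_a[OF abg(2) s(2) y[unfolded y12]] by simp
    qed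
    then show "W i j (y, t) = base X v i j" unfolding y12 cd(1) by (simp add: Wapp[OF o cd(2,3)])
  qed
  have bim: "is_bimap (bprod ?L (bistd 1 1)) X (?F h)" if "h \<in> loop_cells X v m n" for h
    using that flip_map_bimap[OF bs bs] unfolding loop_cells_iff[OF X v] by blast
  have Fapp: "?F h i j (y, s) = h i j (s, y)" if "y \<in> cells ?L i j" "s \<in> cells (bistd 1 1) i j" for h i j y s
    by (rule flip_map_apply[OF that(2,1)])
  have aW: "act ?Z 2 2 \<mu> \<nu> W i j ((y1, y2), (c, d)) = G i j ((pick \<mu> c, pick \<nu> d), (pick ?dm y1, pick ?dn y2))"
    if "\<mu> \<in> ops M 2" "\<nu> \<in> ops N 2" "y1 \<in> ops i m" "y2 \<in> ops j n" "c \<in> ops i M" "d \<in> ops j N" for \<mu> \<nu> M N i j y1 y2 c d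
    using act_rel_Hom_apply[OF that(1,2) _ that(5,6), of "(y1, y2)" ?L X W] that
    by (simp add: Z_eq act_rel_Hom Wapp pick_ops)
  have Wact: "is_bimap (bprod ?L (bistd M N)) X (act ?Z 2 2 \<mu> \<nu> W)" if "\<mu> \<in> ops M 2" "\<nu> \<in> ops N 2" for \<mu> \<nu> M N
    unfolding Z_eq act_rel_Hom by (rule act_rel_Hom_bimap[OF bs Wb that])
  have face_eq: "act ?Z 2 2 \<mu> \<nu> W = act ?Z 1 1 \<mu>' \<nu>' (?F h)"
    if op: "\<mu> \<in> ops M 2" "\<nu> \<in> ops N 2" "\<mu>' \<in> ops M 1" "\<nu>' \<in> ops N 1" and h: "h \<in> loop_cells X v m n"
      and eq: "\<And>i j c d y1 y2. c \<in> ops i M \<Longrightarrow> d \<in> ops j N \<Longrightarrow> y1 \<in> ops i m \<Longrightarrow> y2 \<in> ops j n \<Longrightarrow>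
        G i j ((pick \<mu> c, pick \<nu> d), (pick ?dm y1, pick ?dn y2)) = h i j ((pick \<mu>' c, pick \<nu>' d), (y1, y2))"
    for \<mu> \<nu> \<mu>' \<nu>' M N h
  proof (rule bimap_eqI[OF Wact[OF op(1,2)]])
    show "is_bimap (bprod ?L (bistd M N)) X (act ?Z 1 1 \<mu>' \<nu>' (?F h))"
      unfolding Z_eq act_rel_Hom by (rule act_rel_Hom_bimap[OF bs bim[OF h] op(3,4)])
    fix i j w assume "w \<in> cells (bprod ?L (bistd M N)) i j"
    then obtain y1 y2 c d where w: "w = ((y1, y2), (c, d))" and o: "y1 \<in> ops i m" "y2 \<in> ops j n" "c \<in> ops i M" "d \<in> ops j N"
      by auto
    have "act ?Z 1 1 \<mu>' \<nu>' (?F h) i j ((y1, y2), (c, d)) = h i j ((pick \<mu>' c, pick \<nu>' d), (y1, y2))"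
      using act_rel_Hom_apply[OF op(3,4) _ o(3,4), of "(y1, y2)" ?L X "?F h"] o
        Fapp[of "(y1, y2)" i j "(pick \<mu>' c, pick \<nu>' d)" h] pick_ops[OF op(3) o(3)] pick_ops[OF op(4) o(4)]
      by (simp add: Z_eq act_rel_Hom)
    then show "act ?Z 2 2 \<mu> \<nu> W i j w = act ?Z 1 1 \<mu>' \<nu>' (?F h) i j w"
      unfolding w aW[OF op(1,2) o] eq[OF o(3,4,1,2)] by simp
  qed
  have id1: "act ?Z 1 1 (id_op 1) (id_op 1) (?F h) = ?F h" if "h \<in> loop_cells X v m n" for h
    by (rule act_id[OF bZ aeppli_loops_cells[OF flip_loop_cells(1)[OF X v that]]])
  have c0: "coface 2 0 = [1, 2]" "coface 2 1 = [0, 2]" "coface 2 2 = [0, 1]" by (rule coface_2)+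
  have o001: "[0, 0, 1] \<in> ops 2 1" by (auto simp: ops_def)
  have pr12: "map (\<lambda>x. x - 1) (pick (coface 2 0) c) = c" "0 \<notin> set (pick (coface 2 0) c)" if "c \<in> ops i 1" for c i
  proof -
    have e: "[1, 2] ! x = Suc x" if "x \<le> 1" for x :: nat using that by (cases "x = 0") auto
    then show "map (\<lambda>x. x - 1) (pick (coface 2 0) c) = c"
      unfolding c0 pick_def map_map using that by (intro map_idI) (auto simp: ops_def)
    show "0 \<notin> set (pick (coface 2 0) c)" unfolding c0 pick_def using that e by (auto simp: ops_def)
  qed
  have pr001: "map (\<lambda>x. x - 1) d = pick [0, 0, 1] d" if "d \<in> ops j 2" for d j
  proof -
    have "x - 1 = [0, 0, 1] ! x" if "x \<le> 2" for x :: nat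
    proof -
      have "x = 0 \<or> x = 1 \<or> x = 2" using that by auto
      then show ?thesis by auto
    qed
    then show ?thesis using that by (auto simp: pick_def ops_def)
  qed
  have mn02: "map (min 1) (pick (coface 2 1) c) = c" "1 \<notin> set (pick (coface 2 1) c)" if "c \<in> ops i 1" for c i
  proof -
    have e: "[0, 2] ! x = 2 * x" if "x \<le> 1" for x :: nat using that by (cases "x = 0") auto
    then show "map (min 1) (pick (coface 2 1) c) = c"
      unfolding c0 pick_def map_map using that by (intro map_idI) (auto simp: ops_def min_def)
    show "1 \<notin> set (pick (coface 2 1) c)" unfolding c0 pick_def using that e by (auto simp: ops_def)
  qed
  have mn01: "map (min 1) (pick (coface 2 2) c) = c" "2 \<notin> set (pick (coface 2 2) c)" if "c \<in> ops i 1" for c i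
  proof -
    have e: "[0, 1] ! x = x" if "x \<le> 1" for x :: nat using that by (cases "x = 0") auto
    then show "map (min 1) (pick (coface 2 2) c) = c"
      unfolding c0 pick_def map_map using that by (intro map_idI) (auto simp: ops_def min_def)
    show "2 \<notin> set (pick (coface 2 2) c)" unfolding c0 pick_def using that e by (auto simp: ops_def)
  qed
  have co: "coface 2 0 \<in> ops 1 2" "coface 2 1 \<in> ops 1 2" "coface 2 2 \<in> ops 1 2" by (rule coface_ops2; simp)+
  have f1: "act ?Z 2 2 (coface 2 0) (id_op 2) W = act ?Z 1 1 (id_op 1) [0, 0, 1] (?F a)"
  proof (rule face_eq[OF co(1) id_op_ops id_op_ops o001 abg(1)])
    fix i j c d y1 y2 assume o: "c \<in> ops i 1" "d \<in> ops j 2" "y1 \<in> ops i m" "y2 \<in> ops j n"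
    have "(c, map (\<lambda>x. x - 1) d) \<in> cells (bistd 1 1) i j" using o min_ops by simp
    note r = restr[OF this o(3,4)]
    show "G i j ((pick (coface 2 0) c, pick (id_op 2) d), (pick ?dm y1, pick ?dn y2)) =
      a i j ((pick (id_op 1) c, pick [0, 0, 1] d), (y1, y2))"
      unfolding id_pick[OF o(1)] id_pick[OF o(2)] pr001[OF o(2), symmetric]
      using GA[OF pick_ops[OF co(1) o(1)] o(2) dops[OF o(3,4)]] pr12[OF o(1)] r by simp
  qed
  have f2: "act ?Z 2 2 (id_op 2) (coface 2 0) W = act ?Z 1 1 [0, 0, 1] (id_op 1) (?F a)"
  proof (rule face_eq[OF id_op_ops co(1) o001 id_op_ops abg(1)])
    fix i j c d y1 y2 assume o: "c \<in> ops i 2" "d \<in> ops j 1" "y1 \<in> ops i m" "y2 \<in> ops j n"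
    have "(map (\<lambda>x. x - 1) c, d) \<in> cells (bistd 1 1) i j" using o min_ops by simp
    note r = restr[OF this o(3,4)]
    show "G i j ((pick (id_op 2) c, pick (coface 2 0) d), (pick ?dm y1, pick ?dn y2)) =
      a i j ((pick [0, 0, 1] c, pick (id_op 1) d), (y1, y2))"
      unfolding id_pick[OF o(1)] id_pick[OF o(2)] pr001[OF o(1), symmetric]
      using GA[OF o(1) pick_ops[OF co(1) o(2)] dops[OF o(3,4)]] pr12[OF o(2)] r by simp
  qed
  have "dface ?Z 2 2 W = act ?Z 1 1 (id_op 1) (id_op 1) (?F b)"
    unfolding dface_def
  proof (rule face_eq[OF co(3,3) id_op_ops id_op_ops abg(2)])
    fix i j c d y1 y2 assume o: "c \<in> ops i 1" "d \<in> ops j 1" "y1 \<in> ops i m" "y2 \<in> ops j n"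
    have "(c, d) \<in> cells (bistd 1 1) i j" using o by simp
    note r = restr[OF this o(3,4)]
    show "G i j ((pick (coface 2 2) c, pick (coface 2 2) d), (pick ?dm y1, pick ?dn y2)) =
      b i j ((pick (id_op 1) c, pick (id_op 1) d), (y1, y2))"
      unfolding id_pick[OF o(1)] id_pick[OF o(2)]
      using GB[OF pick_ops[OF co(3) o(1)] pick_ops[OF co(3) o(2)] dops[OF o(3,4)]] mn01[OF o(1)] mn01[OF o(2)] r by simp
  qed
  then have f3: "dface ?Z 2 2 W = ?F b" unfolding id1[OF abg(2)] .
  have "dface ?Z 2 1 W = act ?Z 1 1 (id_op 1) (id_op 1) (?F g)"
    unfolding dface_def
  proof (rule face_eq[OF co(2,2) id_op_ops id_op_ops abg(3)])
    fix i j c d y1 y2 assume o: "c \<in> ops i 1" "d \<in> ops j 1" "y1 \<in> ops i m" "y2 \<in> ops j n"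
    have "(c, d) \<in> cells (bistd 1 1) i j" using o by simp
    note r = restr[OF this o(3,4)]
    show "G i j ((pick (coface 2 1) c, pick (coface 2 1) d), (pick ?dm y1, pick ?dn y2)) =
      g i j ((pick (id_op 1) c, pick (id_op 1) d), (y1, y2))"
      unfolding id_pick[OF o(1)] id_pick[OF o(2)]
      using GC[OF pick_ops[OF co(2) o(1)] pick_ops[OF co(2) o(2)] dops[OF o(3,4)]] mn02[OF o(1)] mn02[OF o(2)] r by simp
  qed
  then have f4: "dface ?Z 2 1 W = ?F g" unfolding id1[OF abg(3)] .
  have "face1 ?Z 2 1 2 (face2 ?Z 2 2 2 W) = ?F b"
    using face1_face2[OF bZ, of W 1 1 2 2, unfolded Suc_1] WZ f3 by (simp add: dface_def)
  then have "is_A_filler ?Z (?F a) (?F b) W"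
    using WZ f1 f2
    by (simp add: is_A_filler_def face1_def face2_def degen1_def degen2_def codegen_1[simplified])
  then have c: "collapsed ?Z 2 W" and d0: "dface ?Z 2 0 W = ?F a"
    using is_A_filler_iff[OF bZ ptZ flip_loop_cells(1)[OF X v abg(1)]] by blast+
  show ?thesis
    unfolding loop_tri_def aeppli_tri_def
    using abg flip_loop_cells(1)[OF X v] c d0 f3 f4 by blast
qed

section \<open>Faces and degeneracies in the loop space, pointwise\<close>

lemma loops_act_apply:
  assumes "\<theta> \<in> ops k m" "\<phi> \<in> ops l n" "s \<in> cells (bistd 1 1) p q" "c \<in> ops p k" "d \<in> ops q l"
  shows "act (loops X v) m n \<theta> \<phi> f p q (s, (c, d)) = f p q (s, (pick \<theta> c, pick \<phi> d))"
  unfolding loops_rel_Hom act_rel_Hom by (rule act_rel_Hom_apply[OF assms])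

lemma bisimplicial_loops: "bisimplicial_set (loops X v)"
  unfolding loops_rel_Hom
  by (rule bisimplicial_rel_Hom[OF bisimplicial_bistd bd_A_sub])

lemma loops_eq_iff:
  assumes f: "f \<in> cells (loops X v) m n" "g \<in> cells (loops X v) m n"
  shows "f = g \<longleftrightarrow> (\<forall>p q s c d. s \<in> cells (bistd 1 1) p q \<longrightarrow> c \<in> ops p m \<longrightarrow> d \<in> ops q n \<longrightarrow>
    f p q (s, (c, d)) = g p q (s, (c, d)))" (is "_ \<longleftrightarrow> ?r")
proof
  assume r: ?r
  have b: "is_bimap (bprod (bistd 1 1) (bistd m n)) X f" "is_bimap (bprod (bistd 1 1) (bistd m n)) X g"
    using f unfolding loops_rel_Hom cells_rel_Hom by blast+
  show "f = g"
  proof (rule bimap_eqI[OF b])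
    fix p q x assume "x \<in> cells (bprod (bistd 1 1) (bistd m n)) p q"
    then obtain s c d where "x = (s, (c, d))" "s \<in> cells (bistd 1 1) p q" "c \<in> ops p m" "d \<in> ops q n"
      by (cases x) auto
    then show "f p q x = g p q x" using r by blast
  qed
qed blast

lemma loops_base_apply:
  assumes "s \<in> cells (bistd 1 1) p q" "c \<in> ops p m" "d \<in> ops q n"
  shows "base (loops X v) (loops_pt X v) m n p q (s, (c, d)) = base X v p q"
  using assms by (simp add: loops_rel_Hom loops_pt_def base_rel_Hom const_bimap_def)

text \<open>The \<open>i\<close>-th face records the values on lists that avoid \<open>i\<close>.
  Renumbering these with \<open>squash\<close>, instead of inserting a gap with
  \<open>coface\<close>, places the conditions for different faces on cells of the same object,
  where they can be joined into one.\<close>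

lemma face1_loops_iff:
  assumes f: "f \<in> cells (loops X v) (Suc m) n" and i: "i \<le> Suc m" and g: "g \<in> cells (loops X v) m n"
  shows "face1 (loops X v) (Suc m) n i f = g \<longleftrightarrow>
    (\<forall>p q s c d. s \<in> cells (bistd 1 1) p q \<longrightarrow> c \<in> ops p (Suc m) \<longrightarrow> d \<in> ops q n \<longrightarrow> i \<notin> set c \<longrightarrow>
      f p q (s, (c, d)) = g p q (s, (map (squash i) c, d)))" (is "?l \<longleftrightarrow> ?r")
proof -
  note co = coface_ops[OF i]
  have "?l \<longleftrightarrow> (\<forall>p q s c d. s \<in> cells (bistd 1 1) p q \<longrightarrow> c \<in> ops p m \<longrightarrow> d \<in> ops q n \<longrightarrow>
      f p q (s, (pick (coface (Suc m) i) c, d)) = g p q (s, (c, d)))" (is "_ \<longleftrightarrow> ?k")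
    unfolding face1_def loops_eq_iff[OF act_cells[OF bisimplicial_loops f co id_op_ops] g]
    by (simp add: loops_act_apply[OF co id_op_ops] id_pick)
  moreover have "?k \<longleftrightarrow> ?r"
  proof (intro iffI allI impI)
    fix p q s c d assume k: ?k and s: "s \<in> cells (bistd 1 1) p q" and c: "c \<in> ops p (Suc m)" "i \<notin> set c"
      and d: "d \<in> ops q n"
    have "map (squash i) c \<in> ops p m" by (rule squash_ops[OF c(1) i]) (use c(2) in simp)
    then show "f p q (s, (c, d)) = g p q (s, (map (squash i) c, d))"
      using k s d coface_squash[OF opsD(3)[OF c(1)] c(2) i] by force
  next
    fix p q s c d assume r: ?r and s: "s \<in> cells (bistd 1 1) p q" and c: "c \<in> ops p m" and d: "d \<in> ops q n"
    have "i \<notin> set (pick (coface (Suc m) i) c)"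
      using set_pick_ops[OF co c] unfolding set_coface[OF i] by blast
    moreover have "map (squash i) (pick (coface (Suc m) i) c) = c"
      using map_pick[OF c length_coface[OF i], of "squash i"] squash_coface[OF i] id_pick[OF c] by simp
    ultimately show "f p q (s, (pick (coface (Suc m) i) c, d)) = g p q (s, (c, d))"
      using r s d pick_ops[OF co c] by force
  qed
  ultimately show ?thesis by blast
qed

lemma face2_loops_iff:
  assumes f: "f \<in> cells (loops X v) m (Suc n)" and i: "i \<le> Suc n" and g: "g \<in> cells (loops X v) m n"
  shows "face2 (loops X v) m (Suc n) i f = g \<longleftrightarrow>
    (\<forall>p q s c d. s \<in> cells (bistd 1 1) p q \<longrightarrow> c \<in> ops p m \<longrightarrow> d \<in> ops q (Suc n) \<longrightarrow> i \<notin> set d \<longrightarrow>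
      f p q (s, (c, d)) = g p q (s, (c, map (squash i) d)))" (is "?l \<longleftrightarrow> ?r")
proof -
  note co = coface_ops[OF i]
  have "?l \<longleftrightarrow> (\<forall>p q s c d. s \<in> cells (bistd 1 1) p q \<longrightarrow> c \<in> ops p m \<longrightarrow> d \<in> ops q n \<longrightarrow>
      f p q (s, (c, pick (coface (Suc n) i) d)) = g p q (s, (c, d)))" (is "_ \<longleftrightarrow> ?k")
    unfolding face2_def loops_eq_iff[OF act_cells[OF bisimplicial_loops f id_op_ops co] g]
    by (simp add: loops_act_apply[OF id_op_ops co] id_pick)
  moreover have "?k \<longleftrightarrow> ?r"
  proof (intro iffI allI impI)
    fix p q s c d assume k: ?k and s: "s \<in> cells (bistd 1 1) p q" and d: "d \<in> ops q (Suc n)" "i \<notin> set d"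
      and c: "c \<in> ops p m"
    have "map (squash i) d \<in> ops q n" by (rule squash_ops[OF d(1) i]) (use d(2) in simp)
    then show "f p q (s, (c, d)) = g p q (s, (c, map (squash i) d))"
      using k s c coface_squash[OF opsD(3)[OF d(1)] d(2) i] by force
  next
    fix p q s c d assume r: ?r and s: "s \<in> cells (bistd 1 1) p q" and d: "d \<in> ops q n" and c: "c \<in> ops p m"
    have "i \<notin> set (pick (coface (Suc n) i) d)"
      using set_pick_ops[OF co d] unfolding set_coface[OF i] by blast
    moreover have "map (squash i) (pick (coface (Suc n) i) d) = d"
      using map_pick[OF d length_coface[OF i], of "squash i"] squash_coface[OF i] id_pick[OF d] by simp
    ultimately show "f p q (s, (c, pick (coface (Suc n) i) d)) = g p q (s, (c, d))"
      using r s c pick_ops[OF co d] by force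
  qed
  ultimately show ?thesis by blast
qed

text \<open>The cells of the bihorn in \<open>\<Delta>\<^bsup>m+1,n+1\<^esup>\<close> on which a Bott-Chern filler of \<open>\<alpha>\<close> and \<open>\<beta>\<close> is determined by
  \<open>\<alpha>\<close> and by \<open>\<beta>\<close>, respectively.\<close>

definition bc_lower :: "nat \<Rightarrow> nat \<Rightarrow> nat list \<Rightarrow> nat list \<Rightarrow> bool" where
  "bc_lower m n c d \<longleftrightarrow> (\<exists>i<m. i \<notin> set c) \<or> (\<exists>j<n. j \<notin> set d)"

definition bc_upper :: "nat \<Rightarrow> nat \<Rightarrow> nat list \<Rightarrow> nat list \<Rightarrow> bool" where
  "bc_upper m n c d \<longleftrightarrow> Suc m \<notin> set c \<or> Suc n \<notin> set d"

lemma cells_bihorn_bc: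
  assumes "c \<in> ops i (Suc m)" "d \<in> ops j (Suc n)"
  shows "(c, d) \<in> cells (bihorn (Suc m) (Suc n) m n) i j \<longleftrightarrow> bc_lower m n c d \<or> bc_upper m n c d"
proof -
  have *: "\<not> {..Suc M} - {M} \<subseteq> S \<longleftrightarrow> (\<exists>i<M. i \<notin> S) \<or> Suc M \<notin> S" for M S
  proof -
    have "{..Suc M} - {M} = insert (Suc M) {..<M}" by auto
    then show ?thesis by auto
  qed
  show ?thesis using assms unfolding cells_bihorn * bc_lower_def bc_upper_def by auto
qed

lemma bc_regions_pick:
  assumes "c \<in> ops i p" "d \<in> ops j q" "\<theta> \<in> ops i' i" "\<phi> \<in> ops j' j"
  shows "(bc_lower m n c d \<longrightarrow> bc_lower m n (pick c \<theta>) (pick d \<phi>)) \<and>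
    (bc_upper m n c d \<longrightarrow> bc_upper m n (pick c \<theta>) (pick d \<phi>))"
  using set_pick_ops[OF assms(1,3)] set_pick_ops[OF assms(2,4)] unfolding bc_lower_def bc_upper_def by blast

lemma squash_low_notin: "i < k \<Longrightarrow> i \<notin> set c \<Longrightarrow> i \<notin> set (map (squash k) c)"
  by (auto simp: squash_def split: if_splits)

lemma squash_top_notin: "1 \<le> m \<Longrightarrow> Suc m \<notin> set c \<Longrightarrow> m \<notin> set (map (squash (m - 1)) c)"
  by (auto simp: squash_def split: if_splits)

lemma squash_ops': "c \<in> ops p (Suc m) \<Longrightarrow> k \<le> m \<Longrightarrow> map (squash k) c \<in> ops p m"
  by (rule squash_ops) auto

text \<open>The codegeneracies \<open>m - 1\<close> and \<open>m\<close> are both left inverse to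
  the coface \<open>m\<close>; the next lemma is the other case. Hence the degeneracies of the two
  factors restrict on the remaining face to the factors themselves.\<close>

lemma squash_pred_coface:
  assumes "1 \<le> m" "c \<in> ops p m"
  shows "map (squash (m - 1)) (pick (coface (Suc m) m) c) = c"
proof -
  have "map (squash (m - 1)) (coface (Suc m) m) = id_op m"
    by (intro nth_equalityI) (use assms(1) in \<open>auto simp: length_coface coface_nth id_op_def squash_def simp del: upt_Suc\<close>)
  then show ?thesis
    using map_pick[OF assms(2) length_coface[of m "Suc m"], of "squash (m - 1)"] id_pick[OF assms(2)] by simp
qed

lemma squash_coface_pick:
  assumes "c \<in> ops p m"
  shows "map (squash m) (pick (coface (Suc m) m) c) = c"
  using map_pick[OF assms length_coface[of m "Suc m"], of "squash m"] squash_coface[of m m] id_pick[OF assms] by simp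

lemma loops_codegen_apply:
  assumes "i \<le> m" "j \<le> n" "s \<in> cells (bistd 1 1) p q" "c \<in> ops p (Suc m)" "d \<in> ops q (Suc n)"
  shows "act (loops X v) m n (codegen m i) (codegen n j) f p q (s, (c, d)) = f p q (s, (map (squash i) c, map (squash j) d))"
  using loops_act_apply[OF codegen_ops[OF assms(1)] codegen_ops[OF assms(2)] assms(3-5)]
  by (simp add: pick_codegen[OF assms(1,4)] pick_codegen[OF assms(2,5)])

lemma degen_loops_apply:
  assumes s: "s \<in> cells (bistd 1 1) p q"
  shows "i \<le> m \<Longrightarrow> c \<in> ops p (Suc m) \<Longrightarrow> d \<in> ops q n \<Longrightarrow>
      degen1 (loops X v) m n i f p q (s, (c, d)) = f p q (s, (map (squash i) c, d))"
    and "j \<le> n \<Longrightarrow> c \<in> ops p m \<Longrightarrow> d \<in> ops q (Suc n) \<Longrightarrow>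
      degen2 (loops X v) m n j f p q (s, (c, d)) = f p q (s, (c, map (squash j) d))"
  using loops_act_apply[OF codegen_ops id_op_ops s] loops_act_apply[OF id_op_ops codegen_ops s]
  by (simp_all add: degen1_def degen2_def pick_codegen id_pick)

lemma degen_loops_cells:
  assumes "f \<in> cells (loops X v) m n"
  shows "i \<le> m \<Longrightarrow> degen1 (loops X v) m n i f \<in> cells (loops X v) (Suc m) n"
    and "j \<le> n \<Longrightarrow> degen2 (loops X v) m n j f \<in> cells (loops X v) m (Suc n)"
  unfolding degen1_def degen2_def
  using act_cells[OF bisimplicial_loops assms] codegen_ops id_op_ops by blast+

section \<open>Bott-Chern fillers in the loop space\<close>

context
  fixes X :: "'a bisset" and v :: 'a and m n :: nat
  assumes X: "kan X" and v: "v \<in> cells X 0 0" and mn: "1 \<le> m" "1 \<le> n"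
begin

private abbreviation (input) "Y \<equiv> loops X v"
private abbreviation (input) "pt \<equiv> loops_pt X v"

private lemma base_Y: "base Y pt k l \<in> cells Y k l"
  using base_loop_cells[OF X v, of k l] unfolding loop_cells_def rel_cells_def by blast

private lemma cells_Y: "f \<in> loop_cells X v m n \<Longrightarrow> f \<in> cells Y m n"
  unfolding loop_cells_def rel_cells_def by blast

private lemma miss:
  assumes f: "f \<in> loop_cells X v m n" and s: "s \<in> cells (bistd 1 1) p q" and cd: "c \<in> ops p m" "d \<in> ops q n"
    and "(i \<le> m \<and> i \<notin> set c) \<or> (j \<le> n \<and> j \<notin> set d)"
  shows "f p q (s, (c, d)) = base X v p q"
proof -
  have "(c, d) \<in> cells (bd_BC m n) p q" using assms(5) cd unfolding cells_bd_BC by auto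
  then show ?thesis using f s unfolding loop_cells_iff[OF X v] by blast
qed

text \<open>The twofold degeneracy of \<open>f\<close> with indices \<open>m - 1\<close> and
  \<open>n - 1\<close>; a filler coincides with it on the faces that are prescribed by
  \<alpha>.\<close>

private definition lower :: "'a loop \<Rightarrow> nat \<Rightarrow> nat \<Rightarrow> bistd_cell \<Rightarrow> nat list \<Rightarrow> nat list \<Rightarrow> 'a" where
  "lower f p q s c d = f p q (s, (map (squash (m - 1)) c, map (squash (n - 1)) d))"

text \<open>The twofold degeneracy with indices \<open>m\<close> and \<open>n\<close>; a filler
  coincides with it on the two top faces, which are prescribed by \<beta>.\<close>

private definition upper :: "'a loop \<Rightarrow> nat \<Rightarrow> nat \<Rightarrow> bistd_cell \<Rightarrow> nat list \<Rightarrow> nat list \<Rightarrow> 'a" where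
  "upper f p q s c d = f p q (s, (map (squash m) c, map (squash n) d))"

private lemma sq_ops:
  assumes "c \<in> ops p (Suc m)" "d \<in> ops q (Suc n)"
  shows "map (squash (m - 1)) c \<in> ops p m" "map (squash (n - 1)) d \<in> ops q n"
    "map (squash m) c \<in> ops p m" "map (squash n) d \<in> ops q n"
  using assms by (simp_all add: squash_ops')

text \<open>Under \<open>squash (m - 1)\<close> a vertex below \<open>m - 1\<close> is hit by itself
  only, and \<open>m\<close> is hit by \<open>Suc m\<close> only. A list that avoids one of these is
  therefore sent to a list that avoids a vertex, where \<open>f\<close> is the base point.\<close>

private lemma lower_base:
  assumes f: "f \<in> loop_cells X v m n" and s: "s \<in> cells (bistd 1 1) p q" and cd: "c \<in> ops p (Suc m)" "d \<in> ops q (Suc n)"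
    and "(i < m - 1 \<and> i \<notin> set c) \<or> (j < n - 1 \<and> j \<notin> set d) \<or> bc_upper m n c d"
  shows "lower f p q s c d = base X v p q"
proof -
  have "(i \<le> m \<and> i \<notin> set (map (squash (m - 1)) c)) \<or> (j \<le> n \<and> j \<notin> set (map (squash (n - 1)) d)) \<or>
      (m \<le> m \<and> m \<notin> set (map (squash (m - 1)) c)) \<or> (n \<le> n \<and> n \<notin> set (map (squash (n - 1)) d))"
    using assms(5) squash_low_notin[of i "m - 1" c] squash_low_notin[of j "n - 1" d]
      squash_top_notin[OF mn(1), of c] squash_top_notin[OF mn(2), of d] unfolding bc_upper_def by linarith
  then show ?thesis unfolding lower_def using miss[OF f s sq_ops(1,2)[OF cd]] by blast
qed

text \<open>Under \<open>squash m\<close> every vertex below \<open>m\<close> is hit by itself only,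
  so a list avoiding it is sent to the boundary.\<close>

private lemma upper_base:
  assumes f: "f \<in> loop_cells X v m n" and s: "s \<in> cells (bistd 1 1) p q" and cd: "c \<in> ops p (Suc m)" "d \<in> ops q (Suc n)"
    and low: "bc_lower m n c d"
  shows "upper f p q s c d = base X v p q"
proof -
  from low consider i where "i < m" "i \<notin> set c" | j where "j < n" "j \<notin> set d" unfolding bc_lower_def by blast
  then have "\<exists>i j. (i \<le> m \<and> i \<notin> set (map (squash m) c)) \<or> (j \<le> n \<and> j \<notin> set (map (squash n) d))"
    using squash_low_notin[of _ m c] squash_low_notin[of _ n d] by (cases; blast intro: less_imp_le)
  then show ?thesis unfolding upper_def using miss[OF f s sq_ops(3,4)[OF cd]] by blast
qed

text \<open>By \<open>lower_base\<close> the faces required to be constant are also restrictions of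
  \<open>lower \<alpha>\<close>. So the conditions on all faces below \<open>m\<close> and
  \<open>n\<close> combine to one condition on \<open>bc_lower\<close>, and those on the two top
  faces to one on \<open>bc_upper\<close>.\<close>

private lemma is_BC_filler_iff:
  assumes a: "\<alpha> \<in> loop_cells X v m n" and b: "\<beta> \<in> loop_cells X v m n"
  shows "is_BC_filler Y pt m n \<alpha> \<beta> \<theta> \<longleftrightarrow> \<theta> \<in> cells Y (Suc m) (Suc n) \<and>
    (\<forall>p q s c d. s \<in> cells (bistd 1 1) p q \<longrightarrow> c \<in> ops p (Suc m) \<longrightarrow> d \<in> ops q (Suc n) \<longrightarrow>
      (bc_lower m n c d \<longrightarrow> \<theta> p q (s, (c, d)) = lower \<alpha> p q s c d) \<and>
      (bc_upper m n c d \<longrightarrow> \<theta> p q (s, (c, d)) = upper \<beta> p q s c d))"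
proof (cases "\<theta> \<in> cells Y (Suc m) (Suc n)")
  case th: True
  define D where "D P t \<longleftrightarrow> (\<forall>p q s c d. s \<in> cells (bistd 1 1) p q \<longrightarrow> c \<in> ops p (Suc m) \<longrightarrow> d \<in> ops q (Suc n) \<longrightarrow>
    P c d \<longrightarrow> \<theta> p q (s, (c, d)) = t p q s c d)" for P :: "nat list \<Rightarrow> nat list \<Rightarrow> bool" and t
  have F1: "face1 Y (Suc m) (Suc n) i \<theta> = g \<longleftrightarrow> D (\<lambda>c d. i \<notin> set c) t"
    if i: "i \<le> Suc m" and g: "g \<in> cells Y m (Suc n)"
      and e: "\<And>p q s c d. s \<in> cells (bistd 1 1) p q \<Longrightarrow> c \<in> ops p (Suc m) \<Longrightarrow> d \<in> ops q (Suc n) \<Longrightarrow> i \<notin> set c \<Longrightarrow>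
        map (squash i) c \<in> ops p m \<Longrightarrow> g p q (s, (map (squash i) c, d)) = t p q s c d" for i g t
  proof -
    have e': "g p q (s, (map (squash i) c, d)) = t p q s c d"
      if "s \<in> cells (bistd 1 1) p q" "c \<in> ops p (Suc m)" "d \<in> ops q (Suc n)" "i \<notin> set c" for p q s c d
      by (rule e[OF that squash_ops[OF that(2) i]]) (use that(4) in simp)
    show ?thesis unfolding face1_loops_iff[OF th i g] D_def
      by (intro all_cong1 imp_cong HOL.refl) (simp only: e' not_False_eq_True)
  qed
  have F2: "face2 Y (Suc m) (Suc n) j \<theta> = g \<longleftrightarrow> D (\<lambda>c d. j \<notin> set d) t"
    if j: "j \<le> Suc n" and g: "g \<in> cells Y (Suc m) n"
      and e: "\<And>p q s c d. s \<in> cells (bistd 1 1) p q \<Longrightarrow> c \<in> ops p (Suc m) \<Longrightarrow> d \<in> ops q (Suc n) \<Longrightarrow> j \<notin> set d \<Longrightarrow>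
        map (squash j) d \<in> ops q n \<Longrightarrow> g p q (s, (c, map (squash j) d)) = t p q s c d" for j g t
  proof -
    have e': "g p q (s, (c, map (squash j) d)) = t p q s c d"
      if "s \<in> cells (bistd 1 1) p q" "c \<in> ops p (Suc m)" "d \<in> ops q (Suc n)" "j \<notin> set d" for p q s c d
      by (rule e[OF that squash_ops[OF that(3) j]]) (use that(4) in simp)
    show ?thesis unfolding face2_loops_iff[OF th j g] D_def
      by (intro all_cong1 imp_cong HOL.refl) (simp only: e' not_False_eq_True)
  qed
  have l1: "face1 Y (Suc m) (Suc n) i \<theta> = base Y pt m (Suc n) \<longleftrightarrow> D (\<lambda>c d. i \<notin> set c) (lower \<alpha>)" if "i < m - 1" for i
  proof (rule F1)
    fix p q s c d assume *: "s \<in> cells (bistd 1 1) p q" "c \<in> ops p (Suc m)" "d \<in> ops q (Suc n)" "i \<notin> set c"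
      "map (squash i) c \<in> ops p m"
    show "base Y pt m (Suc n) p q (s, (map (squash i) c, d)) = lower \<alpha> p q s c d"
      unfolding loops_base_apply[OF *(1,5,3)] by (rule lower_base[OF a *(1-3), symmetric]) (use that *(4) in blast)
  qed (use that base_Y in simp_all)
  have l2: "face2 Y (Suc m) (Suc n) j \<theta> = base Y pt (Suc m) n \<longleftrightarrow> D (\<lambda>c d. j \<notin> set d) (lower \<alpha>)" if "j < n - 1" for j
  proof (rule F2)
    fix p q s c d assume *: "s \<in> cells (bistd 1 1) p q" "c \<in> ops p (Suc m)" "d \<in> ops q (Suc n)" "j \<notin> set d"
      "map (squash j) d \<in> ops q n"
    show "base Y pt (Suc m) n p q (s, (c, map (squash j) d)) = lower \<alpha> p q s c d"
      unfolding loops_base_apply[OF *(1,2,5)] by (rule lower_base[OF a *(1-3), symmetric]) (use that *(4) in blast)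
  qed (use that base_Y in simp_all)
  have l1': "face1 Y (Suc m) (Suc n) (m - 1) \<theta> = degen2 Y m n (n - 1) \<alpha> \<longleftrightarrow> D (\<lambda>c d. m - 1 \<notin> set c) (lower \<alpha>)"
    by (rule F1) (simp_all add: degen_loops_cells(2) cells_Y[OF a] degen_loops_apply(2) lower_def)
  have l2': "face2 Y (Suc m) (Suc n) (n - 1) \<theta> = degen1 Y m n (m - 1) \<alpha> \<longleftrightarrow> D (\<lambda>c d. n - 1 \<notin> set d) (lower \<alpha>)"
    by (rule F2) (simp_all add: degen_loops_cells(1) cells_Y[OF a] degen_loops_apply(1) lower_def)
  \<comment> \<open>The top face is renumbered by \<open>squash (Suc k)\<close>, whereas the
    degeneracy is computed by \<open>squash k\<close>; they agree on lists without the top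
    vertex.\<close>
  have top: "map (squash (Suc k)) c = map (squash k) c" if "c \<in> ops p (Suc k)" "Suc k \<notin> set c" for k c p
    using that by (auto simp: ops_def squash_def subset_iff le_Suc_eq)
  have u1: "face1 Y (Suc m) (Suc n) (Suc m) \<theta> = degen2 Y m n n \<beta> \<longleftrightarrow> D (\<lambda>c d. Suc m \<notin> set c) (upper \<beta>)"
    by (rule F1) (simp_all add: degen_loops_cells(2) cells_Y[OF b] degen_loops_apply(2) upper_def top)
  have u2: "face2 Y (Suc m) (Suc n) (Suc n) \<theta> = degen1 Y m n m \<beta> \<longleftrightarrow> D (\<lambda>c d. Suc n \<notin> set d) (upper \<beta>)"
    by (rule F2) (simp_all add: degen_loops_cells(1) cells_Y[OF b] degen_loops_apply(1) upper_def top)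
  have D_or: "D (\<lambda>c d. P c d \<or> Q c d) t \<longleftrightarrow> D P t \<and> D Q t" for P Q t unfolding D_def by blast
  have D_all: "D (\<lambda>c d. \<exists>i<k. P i c d) t \<longleftrightarrow> (\<forall>i<k. D (P i) t)" for k :: nat and P t unfolding D_def by blast
  have lt: "(\<forall>i<k. P i) \<longleftrightarrow> (\<forall>i<k - 1. P i) \<and> P (k - 1)" if "1 \<le> k" for k :: nat and P
    using that less_Suc_eq[of _ "k - 1"] by auto
  have "is_BC_filler Y pt m n \<alpha> \<beta> \<theta> \<longleftrightarrow> (\<forall>i<m. D (\<lambda>c d. i \<notin> set c) (lower \<alpha>)) \<and>
      (\<forall>j<n. D (\<lambda>c d. j \<notin> set d) (lower \<alpha>)) \<and> D (\<lambda>c d. Suc m \<notin> set c) (upper \<beta>) \<and> D (\<lambda>c d. Suc n \<notin> set d) (upper \<beta>)"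
    unfolding lt[OF mn(1)] lt[OF mn(2)] using th l1 l2 l1' l2' u1 u2
    by (auto simp: is_BC_filler_def)
  also have "\<dots> \<longleftrightarrow> D (bc_lower m n) (lower \<alpha>) \<and> D (bc_upper m n) (upper \<beta>)"
    unfolding bc_lower_def[abs_def] bc_upper_def[abs_def] D_or D_all by (simp only: conj_assoc)
  also have "\<dots> \<longleftrightarrow> (\<forall>p q s c d. s \<in> cells (bistd 1 1) p q \<longrightarrow> c \<in> ops p (Suc m) \<longrightarrow> d \<in> ops q (Suc n) \<longrightarrow>
      (bc_lower m n c d \<longrightarrow> \<theta> p q (s, (c, d)) = lower \<alpha> p q s c d) \<and>
      (bc_upper m n c d \<longrightarrow> \<theta> p q (s, (c, d)) = upper \<beta> p q s c d))"
    unfolding D_def imp_conjR all_conj_distrib ..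
  finally show ?thesis using th by blast
qed (simp add: is_BC_filler_def)

text \<open>\<open>lower \<alpha>\<close> is constant where \<open>upper \<beta>\<close> prescribes
  the filler, and conversely. The hypotheses of \<open>loop_tri_of_extension\<close> are symmetric
  in the two regions with their maps, so it applies in both orders to the same \<theta> and gives
  the same third edge.\<close>

private lemma loop_tri_BC_filler:
  assumes a: "\<alpha> \<in> loop_cells X v m n" and b: "\<beta> \<in> loop_cells X v m n" and fil: "is_BC_filler Y pt m n \<alpha> \<beta> \<theta>"
    and g: "\<gamma> = face1 Y (m + 1) n m (face2 Y (m + 1) (n + 1) n \<theta>)"
  shows "loop_tri X v m n \<alpha> \<beta> \<gamma>" and "loop_tri X v m n \<beta> \<alpha> \<gamma>"
proof -
  let ?dm = "coface (Suc m) m" and ?dn = "coface (Suc n) n"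
  note fill = fil[unfolded is_BC_filler_iff[OF a b]]
  note th = conjunct1[OF fill] and th_eq = conjunct2[OF fill, rule_format]
  have le: "m \<le> Suc m" "n \<le> Suc n" "m - 1 \<le> m" "n - 1 \<le> n" by simp_all
  note dops = coface_ops[OF le(1)] coface_ops[OF le(2)]
  have g_eq: "\<gamma> = act Y (Suc m) (Suc n) ?dm ?dn \<theta>"
    unfolding g using face1_face2[OF bisimplicial_loops th le(1,2)] by simp
  have gY: "\<gamma> \<in> cells Y m n" unfolding g_eq by (rule act_cells[OF bisimplicial_loops th dops])
  have g_app: "\<gamma> p q (s, (y1, y2)) = \<theta> p q (s, (pick ?dm y1, pick ?dn y2))"
    if "s \<in> cells (bistd 1 1) p q" "y1 \<in> ops p m" "y2 \<in> ops q n" for p q s y1 y2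
    unfolding g_eq by (rule loops_act_apply[OF dops that])
  have low: "lower f p q s (pick ?dm y1) (pick ?dn y2) = f p q (s, (y1, y2))"
    and up: "upper f p q s (pick ?dm y1) (pick ?dn y2) = f p q (s, (y1, y2))"
    if "y1 \<in> ops p m" "y2 \<in> ops q n" for f p q s y1 y2
    unfolding lower_def upper_def squash_pred_coface[OF mn(1) that(1)] squash_pred_coface[OF mn(2) that(2)]
      squash_coface_pick[OF that(1)] squash_coface_pick[OF that(2)] by (rule HOL.refl)+
  \<comment> \<open>The two twofold degeneracies as cells of the loop space; \<theta> is their
    composite on the bihorn.\<close>
  define L where "L = act Y m n (codegen m (m - 1)) (codegen n (n - 1)) \<alpha>"
  define U where "U = act Y m n (codegen m m) (codegen n n) \<beta>"
  have L_app: "L p q (s, (c, d)) = lower \<alpha> p q s c d" and U_app: "U p q (s, (c, d)) = upper \<beta> p q s c d"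
    if "s \<in> cells (bistd 1 1) p q" "c \<in> ops p (Suc m)" "d \<in> ops q (Suc n)" for p q s c d
    unfolding L_def U_def lower_def upper_def by (rule loops_codegen_apply[OF _ _ that]; simp)+
  have LU: "L \<in> cells Y (Suc m) (Suc n)" "U \<in> cells Y (Suc m) (Suc n)"
    unfolding L_def U_def using act_cells[OF bisimplicial_loops cells_Y[OF a] codegen_ops[OF le(3)] codegen_ops[OF le(4)]]
      act_cells[OF bisimplicial_loops cells_Y[OF b] codegen_ops codegen_ops, of m n] by blast+
  have regions: "(bc_lower m n c d \<longrightarrow> \<theta> p q (s, (c, d)) = L p q (s, (c, d)) \<and> U p q (s, (c, d)) = base X v p q) \<and>
      (bc_upper m n c d \<longrightarrow> \<theta> p q (s, (c, d)) = U p q (s, (c, d)) \<and> L p q (s, (c, d)) = base X v p q)"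
    if "s \<in> cells (bistd 1 1) p q" "c \<in> ops p (Suc m)" "d \<in> ops q (Suc n)" for p q s c d
    unfolding L_app[OF that] U_app[OF that]
    using th_eq[OF that] lower_base[OF a that, of 0 0] upper_base[OF b that] by blast
  have restr: "L p q (s, (pick ?dm y1, pick ?dn y2)) = \<alpha> p q (s, (y1, y2))"
    "U p q (s, (pick ?dm y1, pick ?dn y2)) = \<beta> p q (s, (y1, y2))"
    "\<theta> p q (s, (pick ?dm y1, pick ?dn y2)) = \<gamma> p q (s, (y1, y2))"
    if "s \<in> cells (bistd 1 1) p q" "y1 \<in> ops p m" "y2 \<in> ops q n" for p q s y1 y2
    using L_app[OF that(1) pick_ops[OF dops(1) that(2)] pick_ops[OF dops(2) that(3)]]
      U_app[OF that(1) pick_ops[OF dops(1) that(2)] pick_ops[OF dops(2) that(3)]] low[OF that(2,3)] up[OF that(2,3)]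
      g_app[OF that] by simp_all
  \<comment> \<open>The boundary of the remaining face lies in the bihorn, where \<theta> restricts
    to \<alpha> or to \<beta>. So \<gamma> is again relative to \<open>bd_BC m n\<close>.\<close>
  have "\<gamma> p q (s, (y1, y2)) = base X v p q"
    if s: "s \<in> cells (bistd 1 1) p q" and y: "(y1, y2) \<in> cells (bd_BC m n) p q" for p q s y1 y2
  proof -
    have o: "y1 \<in> ops p m" "y2 \<in> ops q n" using y by (auto simp: cells_bd_BC)
    note po = pick_ops[OF dops(1) o(1)] pick_ops[OF dops(2) o(2)]
    have ab: "\<alpha> p q (s, (y1, y2)) = base X v p q" "\<beta> p q (s, (y1, y2)) = base X v p q"
      using a b s y unfolding loop_cells_iff[OF X v] by blast+
    have "bc_lower m n (pick ?dm y1) (pick ?dn y2) \<or> bc_upper m n (pick ?dm y1) (pick ?dn y2)"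
      using coface_bd_BC[OF order_refl order_refl y] unfolding cells_bihorn_bc[OF po] .
    then show ?thesis using regions[OF s po] restr[OF s o] ab by auto
  qed
  then have gL: "\<gamma> \<in> loop_cells X v m n"
    using gY unfolding loop_cells_iff[OF X v] loops_rel_Hom cells_rel_Hom by force
  show "loop_tri X v m n \<alpha> \<beta> \<gamma>"
    by (rule loop_tri_of_extension[where k = m and l = n and ?H1.0 = "bc_lower m n" and ?H2.0 = "bc_upper m n",
          OF X v order_refl order_refl cells_bihorn_bc bc_regions_pick LU th regions a b gL])
      (use restr in blast)+
  show "loop_tri X v m n \<beta> \<alpha> \<gamma>"
  proof (rule loop_tri_of_extension[where k = m and l = n and ?H1.0 = "bc_upper m n" and ?H2.0 = "bc_lower m n",
        OF X v order_refl order_refl _ _ LU(2,1) th _ b a gL])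
    fix i j c d assume o: "c \<in> ops i (Suc m)" "d \<in> ops j (Suc n)"
    show "(c, d) \<in> cells (bihorn (Suc m) (Suc n) m n) i j \<longleftrightarrow> bc_upper m n c d \<or> bc_lower m n c d"
      unfolding cells_bihorn_bc[OF o] by blast
    show "(bc_upper m n c d \<longrightarrow> bc_upper m n (pick c \<mu>) (pick d \<nu>)) \<and>
        (bc_lower m n c d \<longrightarrow> bc_lower m n (pick c \<mu>) (pick d \<nu>))"
      if "\<mu> \<in> ops i' i" "\<nu> \<in> ops j' j" for \<mu> \<nu> i' j'
      using bc_regions_pick[OF o that] by blast
    show "(bc_upper m n c d \<longrightarrow> \<theta> i j (s, (c, d)) = U i j (s, (c, d)) \<and> L i j (s, (c, d)) = base X v i j) \<and>
        (bc_lower m n c d \<longrightarrow> \<theta> i j (s, (c, d)) = L i j (s, (c, d)) \<and> U i j (s, (c, d)) = base X v i j)"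
      if "s \<in> cells (bistd 1 1) i j" for s
      using regions[OF that o] by blast
  qed (use restr in blast)
qed

text \<open>By adjunction a filler is a map on the product of Delta[1,1] with Delta[m+1,n+1] whose
  values over \<open>bd_A 1 1\<close> and over the bihorn are given; \<open>box_extend\<close>
  extends it.\<close>

private lemma BC_filler_ex:
  assumes a: "\<alpha> \<in> loop_cells X v m n" and b: "\<beta> \<in> loop_cells X v m n"
  shows "\<exists>\<theta>. is_BC_filler Y pt m n \<alpha> \<beta> \<theta>"
proof -
  have bX: "bisimplicial_set X" using X by (rule kan_bisimplicial)
  define R where "R S T \<longleftrightarrow> 0 \<notin> S \<or> 0 \<notin> T \<or> 1 \<notin> S \<and> 1 \<notin> T" for S T :: "nat set"
  have bd: "f i j ((x, y), t) = base X v i j"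
    if "f \<in> loop_cells X v m n" "x \<in> ops i 1" "y \<in> ops j 1" "t \<in> cells (bistd m n) i j" "R (set x) (set y)" for f i j x y t
  proof -
    have "(x, y) \<in> cells (bd_A 1 1) i j" using that unfolding cells_bd_A_iff R_def by blast
    then show ?thesis using that(1,4) unfolding loop_cells_iff[OF X v] by blast
  qed
  \<comment> \<open>Where both regions apply, both values are the base point. The last case covers
    cells outside the bihorn, whose value counts only over \<open>bd_A 1 1\<close>.\<close>
  define F where "F = (\<lambda>i j (s, (c, d)). if bc_lower m n c d then lower \<alpha> i j s c d
    else if bc_upper m n c d then upper \<beta> i j s c d else base X v i j)"
  have FL: "F i j (s, (c, d)) = lower \<alpha> i j s c d" if "bc_lower m n c d" for i j s c d
    using that by (simp add: F_def)
  have FU: "F i j (s, (c, d)) = upper \<beta> i j s c d"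
    if "s \<in> cells (bistd 1 1) i j" "c \<in> ops i (Suc m)" "d \<in> ops j (Suc n)" "bc_upper m n c d" for i j s c d
    using lower_base[OF a that(1-3), of 0 0] upper_base[OF b that(1-3)] that(4) by (simp add: F_def)
  have FR: "F i j ((x, y), (c, d)) = base X v i j"
    if o: "x \<in> ops i 1" "y \<in> ops j 1" "c \<in> ops i (Suc m)" "d \<in> ops j (Suc n)" and r: "R (set x) (set y)" for i j x y c d
    using bd[OF a o(1,2) _ r] bd[OF b o(1,2) _ r] sq_ops[OF o(3,4)] by (simp add: F_def lower_def upper_def)
  have bim: "is_bimap (bprod (bistd 1 1) (bistd m n)) X f" if "f \<in> loop_cells X v m n" for f
    using that unfolding loop_cells_iff[OF X v] by blast
  have nat: "f i' j' ((pick x \<mu>, pick y \<nu>), (map (squash k) (pick c \<mu>), map (squash l) (pick d \<nu>))) =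
      act X i j \<mu> \<nu> (f i j ((x, y), (map (squash k) c, map (squash l) d)))"
    if f: "f \<in> loop_cells X v m n" and o: "x \<in> ops i 1" "y \<in> ops j 1" "c \<in> ops i (Suc m)" "d \<in> ops j (Suc n)"
      and kl: "k \<le> m" "l \<le> n" and op: "\<mu> \<in> ops i' i" "\<nu> \<in> ops j' j" for f i j x y c d k l \<mu> \<nu> i' j'
    unfolding map_pick[OF op(1) opsD(1)[OF o(3)]] map_pick[OF op(2) opsD(1)[OF o(4)]]
    using is_bimapD(2)[OF bim[OF f], of "((x, y), (map (squash k) c, map (squash l) d))" i j, OF _ op]
      o squash_ops'[OF o(3) kl(1)] squash_ops'[OF o(4) kl(2)]
    by (simp add: act_bprod act_bistd)
  have pred: "m - 1 \<le> m" "n - 1 \<le> n" by simp_all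
  have cell: "F i j ((x, y), (c, d)) \<in> cells X i j"
    if o: "x \<in> ops i 1" "y \<in> ops j 1" "c \<in> ops i (Suc m)" "d \<in> ops j (Suc n)" for i j x y c d
  proof -
    have "f i j ((x, y), (c', d')) \<in> cells X i j" if "f \<in> loop_cells X v m n" "c' \<in> ops i m" "d' \<in> ops j n" for f c' d'
      by (rule is_bimapD(1)[OF bim[OF that(1)]]) (use o that in simp)
    from this[OF a sq_ops(1,2)[OF o(3,4)]] this[OF b sq_ops(3,4)[OF o(3,4)]] show ?thesis
      using base_cells[OF bX v] by (simp add: F_def lower_def upper_def)
  qed
  obtain G where G: "nat_on (bprod (bistd 1 1) (bistd (Suc m) (Suc n))) X G"
    and GF: "\<And>i j x y c d. x \<in> ops i 1 \<Longrightarrow> y \<in> ops j 1 \<Longrightarrow> c \<in> ops i (Suc m) \<Longrightarrow> d \<in> ops j (Suc n) \<Longrightarrow>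
        R (set x) (set y) \<or> (c, d) \<in> cells (bihorn (Suc m) (Suc n) m n) i j \<Longrightarrow>
        G i j ((x, y), (c, d)) = F i j ((x, y), (c, d))"
  proof (rule box_extend[OF X, where f = F and R = R and M = 1 and N = 1 and p = "Suc m" and q = "Suc n" and k = m and l = n])
    show "1 \<le> Suc m" "1 \<le> Suc n" "m \<le> Suc m" "n \<le> Suc n" by simp_all
    show "R S' T'" if "R S T" "S' \<subseteq> S" "T' \<subseteq> T" for S T S' T' using that unfolding R_def by blast
    fix i j x y c d
    assume o: "x \<in> ops i 1" "y \<in> ops j 1" "c \<in> ops i (Suc m)" "d \<in> ops j (Suc n)"
      and r: "R (set x) (set y) \<or> (c, d) \<in> cells (bihorn (Suc m) (Suc n) m n) i j"
    show "F i j ((x, y), (c, d)) \<in> cells X i j" by (rule cell[OF o])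
    fix i' j' \<mu> \<nu> assume op: "\<mu> \<in> ops i' i" "\<nu> \<in> ops j' j"
    note po = pick_ops[OF o(1) op(1)] pick_ops[OF o(2) op(2)] pick_ops[OF o(3) op(1)] pick_ops[OF o(4) op(2)]
    have s: "(x, y) \<in> cells (bistd 1 1) i j" "(pick x \<mu>, pick y \<nu>) \<in> cells (bistd 1 1) i' j'"
      using o po by simp_all
    from r consider "R (set x) (set y)" | "bc_lower m n c d" | "bc_upper m n c d"
      unfolding cells_bihorn_bc[OF o(3,4)] by blast
    then show "F i' j' ((pick x \<mu>, pick y \<nu>), (pick c \<mu>, pick d \<nu>)) = act X i j \<mu> \<nu> (F i j ((x, y), (c, d)))"
    proof cases
      case 1
      then have "R (set (pick x \<mu>)) (set (pick y \<nu>))"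
        using set_pick_ops[OF o(1) op(1)] set_pick_ops[OF o(2) op(2)] unfolding R_def by blast
      from FR[OF po this] FR[OF o 1] show ?thesis using act_base[OF bX v op] by simp
    next
      case 2
      then have "bc_lower m n (pick c \<mu>) (pick d \<nu>)" using bc_regions_pick[OF o(3,4) op] by blast
      from FL[OF this] FL[OF 2] show ?thesis using nat[OF a o pred op] by (simp add: lower_def)
    next
      case 3
      then have "bc_upper m n (pick c \<mu>) (pick d \<nu>)" using bc_regions_pick[OF o(3,4) op] by blast
      from FU[OF s(2) po(3,4) this] FU[OF s(1) o(3,4) 3] show ?thesis
        using nat[OF b o order_refl order_refl op] by (simp add: upper_def)
    qed
  next
    fix g
    assume "nat_on (bprod (bistd 1 1) (bistd (Suc m) (Suc n))) X g"
      and "\<And>i j x y c d. x \<in> ops i 1 \<Longrightarrow> y \<in> ops j 1 \<Longrightarrow> c \<in> ops i (Suc m) \<Longrightarrow> d \<in> ops j (Suc n) \<Longrightarrow>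
        R (set x) (set y) \<or> (c, d) \<in> cells (bihorn (Suc m) (Suc n) m n) i j \<Longrightarrow>
        g i j ((x, y), (c, d)) = F i j ((x, y), (c, d))"
    then show thesis by (rule that)
  qed
  let ?K = "bprod (bistd 1 1) (bistd (Suc m) (Suc n))"
  define \<theta> where "\<theta> = restr_bimap ?K G"
  have th_app: "\<theta> i j t = G i j t" if "t \<in> cells ?K i j" for i j t
    using that unfolding \<theta>_def restr_bimap_def by (rule restrict_apply')
  have "\<theta> \<in> cells Y (Suc m) (Suc n)"
    unfolding loops_rel_Hom cells_rel_Hom
  proof (intro conjI allI ballI)
    show "is_bimap ?K X \<theta>"
      unfolding \<theta>_def by (rule restr_bimap_is_bimap[OF G act_cells[OF bisimplicial_bprod[OF bisimplicial_bistd bisimplicial_bistd]]])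
    fix i j s t assume s: "s \<in> cells (bd_A 1 1) i j" and t: "t \<in> cells (bistd (Suc m) (Suc n)) i j"
    obtain x y c d where st: "s = (x, y)" "t = (c, d)" by (cases s, cases t)
    have o: "x \<in> ops i 1" "y \<in> ops j 1" "c \<in> ops i (Suc m)" "d \<in> ops j (Suc n)" and r: "R (set x) (set y)"
      using s t unfolding st cells_bd_A_iff R_def by simp_all
    show "\<theta> i j (s, t) = base X v i j"
      using th_app[of "(s, t)" i j] GF[OF o disjI1[OF r]] FR[OF o r] o unfolding st by simp
  qed
  moreover have "(bc_lower m n c d \<longrightarrow> \<theta> i j (s, (c, d)) = lower \<alpha> i j s c d) \<and>
      (bc_upper m n c d \<longrightarrow> \<theta> i j (s, (c, d)) = upper \<beta> i j s c d)"
    if s: "s \<in> cells (bistd 1 1) i j" and o: "c \<in> ops i (Suc m)" "d \<in> ops j (Suc n)" for i j s c d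
  proof -
    obtain x y where xy: "s = (x, y)" "x \<in> ops i 1" "y \<in> ops j 1" using s by auto
    have "\<theta> i j (s, (c, d)) = F i j (s, (c, d))" if "bc_lower m n c d \<or> bc_upper m n c d"
      using th_app[of "(s, (c, d))" i j] GF[OF xy(2,3) o] that o xy unfolding cells_bihorn_bc[OF o] by simp
    then show ?thesis using FL FU[OF s o] by metis
  qed
  ultimately show ?thesis unfolding is_BC_filler_iff[OF a b] by blast
qed

text \<open>The remaining face of any Bott-Chern filler of \<open>a\<close> and \<open>b\<close> is
  a composite in both orders.\<close>

private lemma loop_tri_comm:
  assumes a: "a \<in> loop_cells X v m n" and b: "b \<in> loop_cells X v m n"
  shows "\<exists>c. loop_tri X v m n a b c \<and> loop_tri X v m n b a c"
proof -
  obtain \<theta> where "is_BC_filler Y pt m n a b \<theta>" using BC_filler_ex[OF a b] ..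
  from loop_tri_BC_filler[OF a b this HOL.refl] show ?thesis by blast
qed

text \<open>Every Bott-Chern filler yields a triangle, and triangles with equivalent first two edges
  have equivalent third edges. Thus the product of two classes is the class of any composite of
  loops, which is also what \<open>loop_mult_eq\<close> says of \<diamond>.\<close>

private lemma BC_mult_eq:
  assumes P: "P \<in> loop_cells X v m n // homotopy_rel Y pt m n (bd_BC m n)"
    and Q: "Q \<in> loop_cells X v m n // homotopy_rel Y pt m n (bd_BC m n)"
    and ab: "a \<in> P" "b \<in> Q" and tri: "loop_tri X v m n a b c"
  shows "BC_mult Y pt m n P Q = homotopy_rel Y pt m n (bd_BC m n) `` {c}"
proof -
  interpret triangles "loop_cells X v m n" "base Y pt m n" "loop_tri X v m n" by (rule triangles_loop[OF X v])
  note r = homotopy_rel_loop_tri[OF X v, of m n]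
  have sub: "loop_tri X v m n a1 (base Y pt m n) a2" if "P \<in> loop_cells X v m n // rel" "a1 \<in> P" "a2 \<in> P" for P a1 a2
    using quotient_eq_iff[OF equiv_rel that(1) that(1) that(2,3)] unfolding rel_def by simp
  have inL: "x \<in> loop_cells X v m n" if "P \<in> loop_cells X v m n // rel" "x \<in> P" for P x
    using in_quotient_imp_subset[OF equiv_rel that(1)] that(2) by blast
  let ?f = "\<lambda>\<theta>. face1 Y (m + 1) n m (face2 Y (m + 1) (n + 1) n \<theta>)"
  have C: "rel `` {?f \<theta>} = rel `` {c}" if "\<alpha> \<in> P" "\<beta> \<in> Q" "is_BC_filler Y pt m n \<alpha> \<beta> \<theta>" for \<alpha> \<beta> \<theta>
  proof -
    have "\<alpha> \<in> loop_cells X v m n" "\<beta> \<in> loop_cells X v m n" using inL P Q that unfolding r by blast+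
    from loop_tri_BC_filler(1)[OF this that(3) HOL.refl] show ?thesis
      using tri_cong[OF _ _ _ tri] sub[OF P[unfolded r] that(1) ab(1)] sub[OF Q[unfolded r] that(2) ab(2)] by blast
  qed
  show ?thesis
    unfolding BC_mult_def class_BC_def r
  proof (rule the_equality)
    obtain \<theta> where "is_BC_filler Y pt m n a b \<theta>" using BC_filler_ex[of a b] tri_in[OF tri] by blast
    then show "\<exists>\<alpha>\<in>P. \<exists>\<beta>\<in>Q. \<exists>\<theta>. is_BC_filler Y pt m n \<alpha> \<beta> \<theta> \<and> rel `` {c} = rel `` {?f \<theta>}"
      using C[OF ab] ab by metis
  qed (use C in metis)
qed

text \<open>Both groups are quotients by the same relation with products computed by the same
  triangles, so \<open>comm_group_quotient\<close> serves for each.\<close>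

theorem comm_group_loop_group: "comm_group (loop_group X v m n)"
  and comm_group_BC_group: "comm_group (BC_group Y pt m n)"
proof -
  interpret triangles "loop_cells X v m n" "base Y pt m n" "loop_tri X v m n" by (rule triangles_loop[OF X v])
  note r = homotopy_rel_loop_tri[OF X v, of m n]
  show "comm_group (loop_group X v m n)"
    unfolding loop_group_def pi_BC_def class_BC_def loop_cells_def[symmetric] r
    by (rule comm_group_quotient) (rule loop_mult_eq[OF X v, of _ m n, unfolded r], assumption+, rule loop_tri_comm)
  show "comm_group (BC_group Y pt m n)"
    unfolding BC_group_def pi_BC_def class_BC_def loop_cells_def[symmetric] r
    by (rule comm_group_quotient) (rule BC_mult_eq[unfolded r], assumption+, rule loop_tri_comm)
qed

end

theorem corollary3p26:
  fixes X :: "'a bisset" and v :: 'a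
  assumes "v \<in> cells X 0 0"
    and "fibrant TYPE('u::infinite) X"
  shows "(\<forall>m n. group (loop_group X v m n)) \<and>
         (\<forall>m n. 1 \<le> m \<and> 1 \<le> n \<longrightarrow>
            comm_group (loop_group X v m n) \<and>
            comm_group (BC_group (loops X v) (loops_pt X v) m n))"
proof -
  have X: "kan X" by (rule fibrant_imp_kan[OF assms(2)])
  show ?thesis
    using group_loop_group[OF X assms(1)] comm_group_loop_group[OF X assms(1)] comm_group_BC_group[OF X assms(1)]
    by blast
qed

end
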